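(* Let $\Omega\subset\mathbb{R}^n$ be a bounded strictly Lipschitz domain and let $s\in(1,\frac32)$. If $u\in\widetilde H^s(\Omega)$ is sign-changing, then $$Q^{\mathrm{DSp}}_s[u]<Q^{\mathrm{DSp}}_s[|u|].$$
   Context: A domain is a connected open set. All functions are real-valued. Let $\lambda_j$, $j\in\mathbb{N}=\{1,2,\dots\}$, be the nondecreasing sequence of eigenvalues of the Dirichlet Laplacian $-\Delta$ in $\Omega$ (form domain $H^1_0(\Omega)$), counted with multiplicity, and let $\varphi_j$ be corresponding eigenfunctions forming a complete orthonormal system in $L_2(\Omega)$. The quadratic form of the spectral fractional Dirichlet Laplacian of order $s>0$ is $$Q^{\mathrm{DSp}}_s[v]=\sum_{j\ge1}\lambda_j^{s}\,(v,\varphi_j)_{L_2(\Omega)}^2,\qquad \mathrm{Dom}(Q^{\mathrm{DSp}}_s)=\{v\in L_2(\Omega):Q^{\mathrm{DSp}}_s[v]<\infty\}.$$ With $\mathcal F$ the Fourier transform on $\mathbb{R}^n$, $H^s(\mathbb{R}^n)=\{u\in\mathcal S'(\mathbb{R}^n):(1+|\xi|^2)^{s/2}\mathcal Fu(\xi)\in L_2(\mathbb{R}^n)\}$ and $\widetilde H^s(\Omega)=\{u\in H^s(\mathbb{R}^n):\operatorname{supp}(u)\subset\overline\Omega\}$; elements of $\widetilde H^s(\Omega)$ are identified with functions on $\Omega$ extended by zero to $\mathbb{R}^n$. It is known that for $s\in(1,\frac32)$ one has $\widetilde H^s(\Omega)=\mathrm{Dom}(Q^{\mathrm{DSp}}_s)$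 and $|u|\in\widetilde H^s(\Omega)$ whenever $u\in\widetilde H^s(\Omega)$, so both sides of the inequality are finite. A function $u$ is sign-changing if both $u^+\neq0$ and $u^-\ne0$ in $L_2(\Omega)$, where $u^\pm=\frac12(|u|\pm u)$. *)

theory Defs
  imports "HOL-Analysis.Analysis"
begin

section \<open>Domains\<close>

definition bounded_domain :: "'a::euclidean_space set \<Rightarrow> bool" where
  "bounded_domain \<Omega> \<longleftrightarrow> open \<Omega> \<and> connected \<Omega> \<and> bounded \<Omega>"

text \<open>
  Near each boundary point, the set is the strict epigraph of a Lipschitz function in some
  orthogonal coordinate system. The coordinates are a unit vector \<open>e\<close> and its orthogonal
  hyperplane: \<open>x\<close> has height \<open>x \<bullet> e\<close> over the base point \<open>x - (x \<bullet> e) *\<^sub>R e\<close>. In particular the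
  set lies locally on one side of its boundary, which is locally the graph of \<open>\<gamma>\<close>.
\<close>

definition strictly_lipschitz :: "'a::euclidean_space set \<Rightarrow> bool" where
  "strictly_lipschitz \<Omega> \<longleftrightarrow>
     (\<forall>z\<in>frontier \<Omega>. \<exists>e U \<gamma> L. norm e = 1 \<and> open U \<and> z \<in> U \<and>
        L-lipschitz_on {y. y \<bullet> e = 0} \<gamma> \<and>
        \<Omega> \<inter> U = {x \<in> U. \<gamma> (x - (x \<bullet> e) *\<^sub>R e) < x \<bullet> e})"

section \<open>Smooth functions and square-integrable functions\<close>

fun iter_partial :: "'a list \<Rightarrow> ('a::euclidean_space \<Rightarrow> 'b::real_normed_vector) \<Rightarrow> 'a \<Rightarrow> 'b" where
  "iter_partial [] f = f"
| "iter_partial (b # bs) f = (\<lambda>x. frechet_derivative (iter_partial bs f) (at x) b)"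

text \<open>The lists over \<open>Basis\<close> play the role of multi-indices.\<close>

definition smooth :: "('a::euclidean_space \<Rightarrow> 'b::real_normed_vector) \<Rightarrow> bool" where
  "smooth f \<longleftrightarrow> (\<forall>bs\<in>lists Basis. \<forall>x. iter_partial bs f differentiable (at x))"

definition test_functions :: "'a::euclidean_space set \<Rightarrow> ('a \<Rightarrow> 'b::real_normed_vector) set" where
  "test_functions \<Omega> =
     {f. smooth f \<and> compact (closure {x. f x \<noteq> 0}) \<and> closure {x. f x \<noteq> 0} \<subseteq> \<Omega>}"

definition grad :: "('a::euclidean_space \<Rightarrow> real) \<Rightarrow> 'a \<Rightarrow> 'a" where
  "grad f x = (\<Sum>b\<in>Basis. frechet_derivative f (at x) b *\<^sub>R b)"

definition L2 :: "'a measure \<Rightarrow> ('a \<Rightarrow> 'b::euclidean_space) set" where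
  "L2 M = {f \<in> borel_measurable M. integrable M (\<lambda>x. (norm (f x))\<^sup>2)}"

definition L2_inner :: "'a measure \<Rightarrow> ('a \<Rightarrow> real) \<Rightarrow> ('a \<Rightarrow> real) \<Rightarrow> real" where
  "L2_inner M f g = (LINT x|M. f x * g x)"

section \<open>The Dirichlet Laplacian\<close>

definition has_weak_gradient ::
    "'a::euclidean_space set \<Rightarrow> ('a \<Rightarrow> real) \<Rightarrow> ('a \<Rightarrow> 'a) \<Rightarrow> bool" where
  "has_weak_gradient \<Omega> v G \<longleftrightarrow>
     v \<in> L2 (lebesgue_on \<Omega>) \<and> G \<in> L2 (lebesgue_on \<Omega>) \<and>
     (\<forall>f\<in>test_functions \<Omega>.
        (LINT x|lebesgue_on \<Omega>. v x *\<^sub>R grad f x) = - (LINT x|lebesgue_on \<Omega>. f x *\<^sub>R G x))"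

definition weak_gradient :: "'a::euclidean_space set \<Rightarrow> ('a \<Rightarrow> real) \<Rightarrow> 'a \<Rightarrow> 'a" where
  "weak_gradient \<Omega> v = (SOME G. has_weak_gradient \<Omega> v G)"

definition H1_0 :: "'a::euclidean_space set \<Rightarrow> ('a \<Rightarrow> real) set" where
  "H1_0 \<Omega> =
     {v. \<exists>G. has_weak_gradient \<Omega> v G \<and>
        (\<exists>f :: nat \<Rightarrow> 'a \<Rightarrow> real. (\<forall>k. f k \<in> test_functions \<Omega>) \<and>
          (\<lambda>k. LINT x|lebesgue_on \<Omega>. (f k x - v x)\<^sup>2 + (norm (grad (f k) x - G x))\<^sup>2)
            \<longlonglongrightarrow> 0)}"

text \<open>
  The self-adjoint operator associated with the form \<open>\<integral>\<^sub>\<Omega> \<nabla>f \<bullet> \<nabla>h\<close> on \<open>H1_0 \<Omega>\<close>, as a relation: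
  \<open>f\<close> lies in its domain and is mapped to \<open>g\<close>.
\<close>

definition dirichlet_laplacian ::
    "'a::euclidean_space set \<Rightarrow> ('a \<Rightarrow> real) \<Rightarrow> ('a \<Rightarrow> real) \<Rightarrow> bool" where
  "dirichlet_laplacian \<Omega> f g \<longleftrightarrow>
     f \<in> H1_0 \<Omega> \<and> g \<in> L2 (lebesgue_on \<Omega>) \<and>
     (\<forall>h\<in>H1_0 \<Omega>. (LINT x|lebesgue_on \<Omega>. weak_gradient \<Omega> f x \<bullet> weak_gradient \<Omega> h x) =
        L2_inner (lebesgue_on \<Omega>) g h)"

definition orthonormal_system :: "'a measure \<Rightarrow> (nat \<Rightarrow> 'a \<Rightarrow> real) \<Rightarrow> bool" where
  "orthonormal_system M \<phi> \<longleftrightarrow>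
     (\<forall>j. \<phi> j \<in> L2 M) \<and> (\<forall>i j. L2_inner M (\<phi> i) (\<phi> j) = (if i = j then 1 else 0))"

definition complete_system :: "'a measure \<Rightarrow> (nat \<Rightarrow> 'a \<Rightarrow> real) \<Rightarrow> bool" where
  "complete_system M \<phi> \<longleftrightarrow>
     (\<forall>v\<in>L2 M. (\<forall>j. L2_inner M v (\<phi> j) = 0) \<longrightarrow> (AE x in M. v x = 0))"

text \<open>
  Indices start at \<open>0\<close>. Completeness and orthonormality force every eigenvalue to occur in
  \<open>ev\<close> exactly as often as its multiplicity.
\<close>

definition dirichlet_eigensystem ::
    "'a::euclidean_space set \<Rightarrow> (nat \<Rightarrow> real) \<Rightarrow> (nat \<Rightarrow> 'a \<Rightarrow> real) \<Rightarrow> bool" where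
  "dirichlet_eigensystem \<Omega> ev \<phi> \<longleftrightarrow>
     incseq ev \<and>
     (\<forall>j. dirichlet_laplacian \<Omega> (\<phi> j) (\<lambda>x. ev j * \<phi> j x)) \<and>
     orthonormal_system (lebesgue_on \<Omega>) \<phi> \<and> complete_system (lebesgue_on \<Omega>) \<phi>"

text \<open>The sum is taken in \<open>[0, \<infinity>]\<close>; the form domain is the set where it is finite.\<close>

definition Q_DSp ::
    "'a::euclidean_space set \<Rightarrow> (nat \<Rightarrow> real) \<Rightarrow> (nat \<Rightarrow> 'a \<Rightarrow> real) \<Rightarrow> real \<Rightarrow>
      ('a \<Rightarrow> real) \<Rightarrow> ennreal" where
  "Q_DSp \<Omega> ev \<phi> s v =
     (\<Sum>j. ennreal (ev j powr s * (L2_inner (lebesgue_on \<Omega>) v (\<phi> j))\<^sup>2))"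

section \<open>Tempered distributions and Sobolev spaces\<close>

definition schwartz :: "('a::euclidean_space \<Rightarrow> complex) set" where
  "schwartz = {f. smooth f \<and>
     (\<forall>k. \<forall>bs\<in>lists Basis. bounded (range (\<lambda>x. norm x ^ k * norm (iter_partial bs f x))))}"

definition schwartz_seminorm :: "nat \<Rightarrow> 'a list \<Rightarrow> ('a::euclidean_space \<Rightarrow> complex) \<Rightarrow> real" where
  "schwartz_seminorm k bs f = (SUP x. norm x ^ k * norm (iter_partial bs f x))"

text \<open>
  A distribution is a total function on \<open>'a \<Rightarrow> complex\<close> of which only the restriction to
  \<open>schwartz\<close> is meaningful.
\<close>

definition tempered :: "(('a::euclidean_space \<Rightarrow> complex) \<Rightarrow> complex) \<Rightarrow> bool" where
  "tempered T \<longleftrightarrow>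
     (\<forall>f\<in>schwartz. \<forall>g\<in>schwartz. T (\<lambda>x. f x + g x) = T f + T g) \<and>
     (\<forall>c. \<forall>f\<in>schwartz. T (\<lambda>x. c * f x) = c * T f) \<and>
     (\<exists>C N. \<forall>f\<in>schwartz. norm (T f) \<le>
        C * (\<Sum>k\<le>N. \<Sum>bs\<in>{bs\<in>lists Basis. length bs \<le> N}. schwartz_seminorm k bs f))"

definition regular_dist ::
    "('a::euclidean_space \<Rightarrow> complex) \<Rightarrow> ('a \<Rightarrow> complex) \<Rightarrow> complex" where
  "regular_dist g f = (LINT x|lebesgue. g x * f x)"

definition fourier :: "('a::euclidean_space \<Rightarrow> complex) \<Rightarrow> 'a \<Rightarrow> complex" where
  "fourier f \<xi> = complex_of_real ((2 * pi) powr (- real DIM('a) / 2)) *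
     (LINT x|lebesgue. cis (- (x \<bullet> \<xi>)) * f x)"

definition dist_fourier ::
    "(('a::euclidean_space \<Rightarrow> complex) \<Rightarrow> complex) \<Rightarrow> ('a \<Rightarrow> complex) \<Rightarrow> complex" where
  "dist_fourier T f = T (fourier f)"

definition dist_mult ::
    "('a::euclidean_space \<Rightarrow> real) \<Rightarrow> (('a \<Rightarrow> complex) \<Rightarrow> complex) \<Rightarrow>
      ('a \<Rightarrow> complex) \<Rightarrow> complex" where
  "dist_mult m T f = T (\<lambda>x. complex_of_real (m x) * f x)"

definition dist_support :: "(('a::euclidean_space \<Rightarrow> complex) \<Rightarrow> complex) \<Rightarrow> 'a set" where
  "dist_support T = - \<Union>{U. open U \<and> (\<forall>f\<in>test_functions U. T f = 0)}"

definition sobolev_space :: "real \<Rightarrow> (('a::euclidean_space \<Rightarrow> complex) \<Rightarrow> complex) set" where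
  "sobolev_space s = {T. tempered T \<and>
     (\<exists>g\<in>L2 lebesgue. \<forall>f\<in>schwartz.
        dist_mult (\<lambda>\<xi>. (1 + (norm \<xi>)\<^sup>2) powr (s / 2)) (dist_fourier T) f = regular_dist g f)}"

text \<open>
  The space as a set of real functions on the whole space. For \<open>s \<ge> 0\<close> every element of
  \<open>sobolev_space s\<close> is the regular distribution of a square-integrable function, so demanding
  \<open>u \<in> L2 lebesgue\<close> loses nothing; it excludes functions whose pairing with Schwartz functions
  is not a convergent integral.
\<close>

definition tilde_sobolev_space :: "real \<Rightarrow> 'a::euclidean_space set \<Rightarrow> ('a \<Rightarrow> real) set" where
  "tilde_sobolev_space s \<Omega> = {u \<in> L2 lebesgue.
     regular_dist (\<lambda>x. complex_of_real (u x)) \<in> sobolev_space s \<and>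
     dist_support (regular_dist (\<lambda>x. complex_of_real (u x))) \<subseteq> closure \<Omega>}"

section \<open>Sign-changing functions\<close>

definition pos_part :: "('a \<Rightarrow> real) \<Rightarrow> 'a \<Rightarrow> real" where
  "pos_part u x = (\<bar>u x\<bar> + u x) / 2"

definition neg_part :: "('a \<Rightarrow> real) \<Rightarrow> 'a \<Rightarrow> real" where
  "neg_part u x = (\<bar>u x\<bar> - u x) / 2"

definition sign_changing :: "'a::euclidean_space set \<Rightarrow> ('a \<Rightarrow> real) \<Rightarrow> bool" where
  "sign_changing \<Omega> u \<longleftrightarrow>
     \<not> (AE x in lebesgue_on \<Omega>. pos_part u x = 0) \<and> \<not> (AE x in lebesgue_on \<Omega>. neg_part u x = 0)"

end

theory Submission
  imports Defs "HOL-Probability.Probability"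
begin

text \<open>
  For \<open>1 < s < 2\<close> one has \<open>\<lambda>\<^sup>s = c \<integral>\<^sub>0\<^sup>\<infinity> t\<^sup>s\<^sup>-\<^sup>2 \<lambda>\<^sup>2 / (\<lambda> + t) dt\<close> with a constant \<open>c > 0\<close>, and
  \<open>\<lambda>\<^sup>2 / (\<lambda> + t) = \<lambda> - t + t\<^sup>2 / (\<lambda> + t)\<close>. Hence the form of order \<open>s\<close> at \<open>u\<close> is a positive
  superposition over \<open>t > 0\<close> of \<open>\<parallel>\<nabla>u\<parallel>\<^sup>2 - t \<parallel>u\<parallel>\<^sup>2 + t\<^sup>2 (u, (-\<Delta> + t)\<^sup>-\<^sup>1 u)\<close>. Replacing \<open>u\<close> by \<open>\<bar>u\<bar>\<close>
  changes neither of the first two terms and adds \<open>4 t\<^sup>2 (u\<^sup>+, (-\<Delta> + t)\<^sup>-\<^sup>1 u\<^sup>-)\<close>, which is positive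
  for sign-changing \<open>u\<close> by the strong maximum principle on the connected set \<open>\<Omega>\<close>. That \<open>u\<close> lies in
  \<open>H1_0 \<Omega>\<close> is where the Lipschitz boundary enters: cut-offs of \<open>u\<close> are translated into \<open>\<Omega>\<close> and
  mollified. The form at \<open>u\<close> is finite because the resolvent form on \<open>\<Omega>\<close> is dominated by
  that on the whole space.
\<close>

section \<open>Smooth functions\<close>

text \<open>The comparison of \<open>u\<close> with its absolute value is made at fixed
  \<open>t\<close>: multiplied by t^(s-2) and integrated over \<open>t\<close>, the three terms of
  the decomposition diverge separately, and only their sum lambda^2 / (lambda + t) converges, at 0
  because 1 < s and at infinity because s < 2. Strictness survives the integration over
  \<open>t\<close> if the smaller integral is finite; this is the purpose of the Fourier estimate,
  and no such bound is asked of the form at the absolute value. Membership in the form domain is not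
  obtained by weak compactness. Functions are recognised by summability of \<open>ev j\<close> times
  the squared coefficient, a bound that passes to limits of coefficients. As \<Omega> is bounded,
  square-integrable functions supported in its closure are integrable, so Fourier transforms are
  ordinary integrals with values at every point.\<close>

lemma smooth_coinduct:
  fixes f :: "'a::euclidean_space \<Rightarrow> 'b::real_normed_vector"
  assumes "f \<in> S"
    and D: "\<And>f x. f \<in> S \<Longrightarrow> f differentiable (at x)"
    and P: "\<And>f b. f \<in> S \<Longrightarrow> b \<in> Basis \<Longrightarrow> (\<lambda>x. frechet_derivative f (at x) b) \<in> S"
  shows "smooth f"
proof -
  \<comment> \<open>The class \<open>S\<close> plays the role of a coinduction hypothesis: each
    differentiation lands in \<open>S\<close> again, so higher derivatives call for no explicit
    formula.\<close>
  have "iter_partial bs f \<in> S" if "bs \<in> lists Basis" for bs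
    using that by induct (auto simp: assms)
  then show ?thesis by (auto simp: smooth_def D)
qed

lemma smooth_differentiable: "smooth f \<Longrightarrow> f differentiable (at x)"
  unfolding smooth_def by (metis iter_partial.simps(1) lists.Nil)

lemma smooth_has_derivative:
  "smooth f \<Longrightarrow> (f has_derivative frechet_derivative f (at x)) (at x)"
  using frechet_derivative_works smooth_differentiable by blast

lemma iter_partial_append: "iter_partial (bs @ cs) f = iter_partial bs (iter_partial cs f)"
  by (induct bs) auto

lemma smooth_partial:
  assumes "smooth f" "b \<in> Basis" shows "smooth (\<lambda>x. frechet_derivative f (at x) b)"
  unfolding smooth_def
proof (intro ballI allI)
  fix bs :: "'a list" and x assume "bs \<in> lists Basis"
  then have "iter_partial (bs @ [b]) f differentiable at x"
    using assms unfolding smooth_def by (metis append_in_lists_conv lists.Cons lists.Nil)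
  then show "iter_partial bs (\<lambda>x. frechet_derivative f (at x) b) differentiable at x"
    by (simp add: iter_partial_append)
qed

lemma smooth_continuous: "smooth f \<Longrightarrow> continuous_on UNIV f"
  by (simp add: continuous_at_imp_continuous_on differentiable_imp_continuous_within smooth_differentiable)

lemma frechet_eqI: "(f has_derivative D) (at x) \<Longrightarrow> frechet_derivative f (at x) b = D b"
  by (metis frechet_derivative_at)

lemma smooth_add:
  fixes f g :: "'a::euclidean_space \<Rightarrow> 'b::real_normed_vector"
  assumes "smooth f" "smooth g" shows "smooth (\<lambda>x. f x + g x)"
proof (rule smooth_coinduct[where S = "{(\<lambda>x. f x + g x) |f g. smooth f \<and> smooth g}"])
  show "(\<lambda>x. f x + g x) \<in> {(\<lambda>x. f x + g x) |f g. smooth f \<and> smooth g}"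
    using assms by auto
next
  fix h :: "'a \<Rightarrow> 'b" and x assume "h \<in> {(\<lambda>x. f x + g x) |f g. smooth f \<and> smooth g}"
  then obtain f g where "h = (\<lambda>x. f x + g x)" "smooth f" "smooth g" by auto
  then show "h differentiable at x" by (simp add: differentiable_add smooth_differentiable)
next
  fix h :: "'a \<Rightarrow> 'b" and b :: 'a assume "h \<in> {(\<lambda>x. f x + g x) |f g. smooth f \<and> smooth g}" and b: "b \<in> Basis"
  then obtain f g where h: "h = (\<lambda>x. f x + g x)" and fg: "smooth f" "smooth g" by auto
  have "frechet_derivative h (at x) b = frechet_derivative f (at x) b + frechet_derivative g (at x) b" for x
    unfolding h by (rule frechet_eqI) (intro has_derivative_add smooth_has_derivative fg)
  then show "(\<lambda>x. frechet_derivative h (at x) b) \<in> {(\<lambda>x. f x + g x) |f g. smooth f \<and> smooth g}"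
    using smooth_partial[OF fg(1) b] smooth_partial[OF fg(2) b] by auto
qed

lemma smooth_inner_add: "smooth (\<lambda>x::'a::euclidean_space. x \<bullet> a + c)"
proof (rule smooth_coinduct[where S = "{(\<lambda>x. x \<bullet> a + c) |a c. True}"], goal_cases)
  case 1 then show ?case by auto
next
  case (2 f x) then show ?case by auto
next
  case (3 f b)
  then obtain a c where f: "f = (\<lambda>x. x \<bullet> a + c)" by auto
  have "frechet_derivative f (at x) b = x \<bullet> 0 + b \<bullet> a" for x
    unfolding f by (rule frechet_eqI) (auto intro!: derivative_eq_intros)
  then show ?case by blast
qed

lemma smooth_const: "smooth (\<lambda>x::'a::euclidean_space. c::real)"
  using smooth_inner_add[of 0 c] by simp

text \<open>The product rule leads out of the class of products, but not out of the sums of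
  products. This class is the invariant handed to \<open>smooth_coinduct\<close>.\<close>

inductive_set mult_span :: "('a::euclidean_space \<Rightarrow> real) set" where
  base: "smooth f \<Longrightarrow> smooth g \<Longrightarrow> (\<lambda>x. f x * g x) \<in> mult_span"
| add: "h \<in> mult_span \<Longrightarrow> k \<in> mult_span \<Longrightarrow> (\<lambda>x. h x + k x) \<in> mult_span"

lemma smooth_mult:
  fixes f g :: "'a::euclidean_space \<Rightarrow> real"
  assumes "smooth f" "smooth g" shows "smooth (\<lambda>x. f x * g x)"
proof -
  have D: "\<forall>x. h differentiable (at x)" if "h \<in> mult_span" for h :: "'a \<Rightarrow> real"
    using that by induct (simp_all add: differentiable_mult differentiable_add smooth_differentiable)
  show ?thesis
  proof (rule smooth_coinduct[where S = mult_span], goal_cases)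
    case 1 show ?case using assms by (rule mult_span.base)
  next
    case 2 then show ?case using D by auto
  next
    case (3 h b)
    from 3(1) show ?case
    proof induct
      case (base f g)
      have "frechet_derivative (\<lambda>x. f x * g x) (at x) b =
          f x * frechet_derivative g (at x) b + frechet_derivative f (at x) b * g x" for x
        by (rule frechet_eqI) (intro has_derivative_mult smooth_has_derivative base)
      then show ?case
        by (simp only:) (intro mult_span.intros base smooth_partial 3(2))
    next
      case (add h k)
      have "frechet_derivative (\<lambda>x. h x + k x) (at x) b =
          frechet_derivative h (at x) b + frechet_derivative k (at x) b" for x
        by (rule frechet_eqI) (intro has_derivative_add; use D add in \<open>metis frechet_derivative_works\<close>)
      then show ?case using mult_span.add[OF add(2,4)] by auto
    qed
  qed
qed

lemma smooth_cmult: "smooth f \<Longrightarrow> smooth (\<lambda>x. c * f x :: real)"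
  using smooth_mult[OF smooth_const[of c]] by blast

lemma smooth_diff:
  fixes f g :: "'a::euclidean_space \<Rightarrow> real"
  shows "smooth f \<Longrightarrow> smooth g \<Longrightarrow> smooth (\<lambda>x. f x - g x)"
  using smooth_add[of f "\<lambda>x. (-1) * g x"] smooth_cmult[of g "-1"] by simp

lemma smooth_sum:
  fixes f :: "'i \<Rightarrow> 'a::euclidean_space \<Rightarrow> real"
  assumes "\<And>i. i \<in> I \<Longrightarrow> smooth (f i)" shows "smooth (\<lambda>x. \<Sum>i\<in>I. f i x)"
  using assms by (induct I rule: infinite_finite_induct) (auto simp: smooth_const intro!: smooth_add)

lemma smooth_prod:
  fixes f :: "'i \<Rightarrow> 'a::euclidean_space \<Rightarrow> real"
  assumes "\<And>i. i \<in> I \<Longrightarrow> smooth (f i)" shows "smooth (\<lambda>x. \<Prod>i\<in>I. f i x)"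
  using assms by (induct I rule: infinite_finite_induct) (auto simp: smooth_const intro!: smooth_mult)

text \<open>The factor \<open>c\<close> in the invariant absorbs the power of \<open>a\<close> that
  the chain rule produces at each differentiation.\<close>

lemma smooth_affine:
  fixes f :: "'a::euclidean_space \<Rightarrow> real"
  assumes "smooth f" shows "smooth (\<lambda>x. f (a *\<^sub>R x + p))"
proof (rule smooth_coinduct[where S = "{(\<lambda>x. c * f (a *\<^sub>R x + p)) |c f. smooth f}"], goal_cases)
  case 1 then show ?case using assms by (intro CollectI exI[of _ 1] exI[of _ f]) auto
next
  have hd: "((\<lambda>x. c * f (a *\<^sub>R x + p)) has_derivative
     (\<lambda>h. c * frechet_derivative f (at (a *\<^sub>R x + p)) (a *\<^sub>R h))) (at x)"
    if "smooth f" for f :: "'a \<Rightarrow> real" and c x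
    by (intro has_derivative_mult_right has_derivative_compose[where f="\<lambda>x. a *\<^sub>R x + p" and g=f, OF _ smooth_has_derivative[OF that]])
      (auto intro!: derivative_eq_intros)
  { case (2 f x) then show ?case using hd unfolding differentiable_def by blast }
  { case (3 g b)
    then obtain c f where g: "g = (\<lambda>x. c * f (a *\<^sub>R x + p))" "smooth f" by auto
    have "frechet_derivative g (at x) b = c * a * frechet_derivative f (at (a *\<^sub>R x + p)) b" for x
      unfolding g using frechet_eqI[OF hd[OF g(2)]]
        linear_cmul[OF has_derivative_linear[OF smooth_has_derivative[OF g(2)]]] by simp
    then show ?case using smooth_partial[OF g(2) 3(2)]
      by (intro CollectI exI[of _ "c * a"] exI[of _ "\<lambda>y. frechet_derivative f (at y) b"]) auto }
qed

subsection \<open>Bump functions\<close>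

text \<open>The case k = 0 is the flat function exp(-1/t). The powers of t in the denominator are
  those that differentiation creates, so the family is closed under differentiation up to linear
  combinations.\<close>

definition bump_kernel :: "nat \<Rightarrow> real \<Rightarrow> real" where
  "bump_kernel k t = (if 0 < t then exp (- (1 / t)) / t ^ k else 0)"

text \<open>One term of the exponential series, that of degree k + 2, beats the denominator with two
  powers of t to spare. Quadratic decay at 0 is what gives derivative 0 there.\<close>

lemma bump_kernel_bound: "0 < t \<Longrightarrow> bump_kernel k t \<le> fact (k + 2) * t\<^sup>2"
proof -
  assume t: "0 < t"
  have "(1 / t) ^ (k + 2) / fact (k + 2) \<le> exp (1 / t)"
  proof -
    have "(1/t) ^ (k+2) /\<^sub>R fact (k+2) \<le> (\<Sum>n. (1 / t) ^ n /\<^sub>R fact n)"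
      using t sum_le_suminf[OF summable_exp_generic[of "1/t"], of "{k+2}"]
      by (auto simp: zero_le_mult_iff)
    then show ?thesis by (simp add: exp_def divide_inverse mult.commute)
  qed
  then have "1 \<le> exp (1 / t) * (fact (k + 2) * t ^ (k + 2))"
    using t by (simp add: field_simps del: fact_Suc power_Suc)
  then have "exp (- (1 / t)) \<le> fact (k + 2) * t ^ (k + 2)"
    by (simp add: exp_minus divide_simps mult.commute del: fact_Suc power_Suc)
  then show ?thesis using t
    by (simp add: bump_kernel_def divide_simps power_add power2_eq_square mult_ac del: fact_Suc)
qed

lemma bump_kernel_deriv:
  "(bump_kernel k has_real_derivative bump_kernel (k + 2) t - k * bump_kernel (k + 1) t) (at t)"
proof (cases t "0::real" rule: linorder_cases)
  case less
  have "((\<lambda>t. 0) has_real_derivative 0) (at t)" by simp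
  moreover have "\<forall>\<^sub>F x in nhds t. bump_kernel k x = 0"
    using less by (intro eventually_nhds_in_open[of "{..<0}", THEN eventually_mono]) (auto simp: bump_kernel_def)
  ultimately have "(bump_kernel k has_real_derivative 0) (at t)"
    by (subst DERIV_cong_ev[OF refl _ refl]) auto
  then show ?thesis using less by (simp add: bump_kernel_def)
next
  case greater
  have "((\<lambda>t. exp (- (1 / t)) / t ^ k) has_real_derivative bump_kernel (k + 2) t - k * bump_kernel (k + 1) t) (at t)"
    using greater
    by (auto intro!: derivative_eq_intros simp: bump_kernel_def field_simps power2_eq_square)
      (cases k; simp add: field_simps)
  moreover have "\<forall>\<^sub>F x in nhds t. bump_kernel k x = exp (- (1 / x)) / x ^ k"
    using greater by (intro eventually_nhds_in_open[of "{0<..}", THEN eventually_mono]) (auto simp: bump_kernel_def)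
  ultimately show ?thesis
    by (subst DERIV_cong_ev[OF refl _ refl]) auto
next
  case equal
  have "((\<lambda>h. (bump_kernel k (0 + h) - bump_kernel k 0) / h) \<longlongrightarrow> 0) (at 0)"
  proof (rule Lim_null_comparison[where g = "\<lambda>h. fact (k+2) * \<bar>h\<bar>"])
    have "norm ((bump_kernel k (0 + h) - bump_kernel k 0) / h) \<le> fact (k + 2) * \<bar>h\<bar>" for h
    proof (cases "h > 0")
      case True
      then show ?thesis using bump_kernel_bound[OF True, of k]
        by (simp add: bump_kernel_def field_simps power2_eq_square)
    qed (simp add: bump_kernel_def mult_nonneg_nonpos)
    then show "\<forall>\<^sub>F h in at 0. norm ((bump_kernel k (0 + h) - bump_kernel k 0) / h) \<le> fact (k + 2) * \<bar>h\<bar>"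
      by (auto simp: eventually_at intro: exI[of _ 1])
    show "((\<lambda>h. fact (k + 2) * \<bar>h\<bar>) \<longlongrightarrow> 0) (at (0::real))"
      by (auto intro!: tendsto_eq_intros)
  qed
  then show ?thesis using equal by (simp add: DERIV_def bump_kernel_def)
qed

text \<open>Differentiation either acts on the smooth factor or raises \<open>k\<close> by one or
  two at the price of another smooth factor; sums of such terms form a class closed under partial
  derivatives.\<close>

inductive_set bump_span :: "('a::euclidean_space \<Rightarrow> real) \<Rightarrow> ('a \<Rightarrow> real) set" for q where
  base: "smooth g \<Longrightarrow> (\<lambda>x. g x * bump_kernel k (q x)) \<in> bump_span q"
| add: "h \<in> bump_span q \<Longrightarrow> k \<in> bump_span q \<Longrightarrow> (\<lambda>x. h x + k x) \<in> bump_span q"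

lemma smooth_bump_kernel:
  fixes q :: "'a::euclidean_space \<Rightarrow> real"
  assumes q: "smooth q" shows "smooth (\<lambda>x. bump_kernel k (q x))"
proof -
  have hd: "((\<lambda>x. g x * bump_kernel k (q x)) has_derivative
     (\<lambda>h. g x * ((bump_kernel (k + 2) (q x) - k * bump_kernel (k + 1) (q x)) * frechet_derivative q (at x) h)
        + frechet_derivative g (at x) h * bump_kernel k (q x))) (at x)" if "smooth g" for g k x
    by (intro has_derivative_mult smooth_has_derivative[OF that]
      has_derivative_compose[OF smooth_has_derivative[OF q] bump_kernel_deriv[unfolded has_field_derivative_def]])
  have D: "\<forall>x. h differentiable (at x)" if "h \<in> bump_span q" for h :: "'a \<Rightarrow> real"
    using that
  proof induct
    case (base g k) then show ?case using hd unfolding differentiable_def by blast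
  qed (auto intro!: derivative_intros)
  show ?thesis
  proof (rule smooth_coinduct[where S = "bump_span q"], goal_cases)
    case 1 show ?case using bump_span.base[OF smooth_const[of 1], of k q] by simp
  next
    case 2 then show ?case using D by auto
  next
    case (3 h b)
    from 3(1) show ?case
    proof induct
      case (base g k)
      have "(\<lambda>x. frechet_derivative (\<lambda>x. g x * bump_kernel k (q x)) (at x) b) =
        (\<lambda>x. (g x * frechet_derivative q (at x) b) * bump_kernel (k + 2) (q x)
         + ((- k) * (g x * frechet_derivative q (at x) b) * bump_kernel (k + 1) (q x)
           + frechet_derivative g (at x) b * bump_kernel k (q x)))"
        by (subst frechet_eqI[OF hd[OF base]]) (simp add: algebra_simps)
      then show ?case
        by (simp only:) (intro bump_span.intros smooth_mult smooth_cmult base smooth_partial q 3(2) smooth_const)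
    next
      case (add h k)
      have "frechet_derivative (\<lambda>x. h x + k x) (at x) b =
          frechet_derivative h (at x) b + frechet_derivative k (at x) b" for x
        by (rule frechet_eqI) (intro has_derivative_add; use D add in \<open>metis frechet_derivative_works\<close>)
      then show ?case using bump_span.add[OF add(2,4)] by auto
    qed
  qed
qed

lemma smooth_norm_sq: "smooth (\<lambda>x::'a::euclidean_space. (norm (x - p))\<^sup>2)"
proof -
  have "(norm (x - p))\<^sup>2 = (\<Sum>b\<in>Basis. (x \<bullet> b + - (p \<bullet> b)) * (x \<bullet> b + - (p \<bullet> b)))" for x :: 'a
    unfolding power2_norm_eq_inner euclidean_inner[of "x - p" "x - p"] by (simp add: inner_diff_left)
  then show ?thesis by (simp only:) (intro smooth_sum smooth_mult smooth_inner_add)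
qed

lemma bump_exists:
  fixes p :: "'a::euclidean_space"
  assumes r: "0 < r"
  obtains \<rho> :: "'a \<Rightarrow> real" where "smooth \<rho>" "\<And>x. 0 \<le> \<rho> x" "\<And>x. x \<notin> ball p r \<Longrightarrow> \<rho> x = 0"
    "integrable lborel \<rho>" "(LINT x|lborel. \<rho> x) = 1"
proof -
  \<comment> \<open>The squared norm is a polynomial in the coordinates, hence smooth also at the
    centre, where the norm is not.\<close>
  define \<beta> where "\<beta> x = bump_kernel 0 (r\<^sup>2 - (norm (x - p))\<^sup>2)" for x
  have sm: "smooth \<beta>" unfolding \<beta>_def
    by (intro smooth_bump_kernel smooth_diff smooth_const smooth_norm_sq)
  have pos: "\<beta> x > 0" if "x \<in> ball p r" for x
    using that r by (simp add: \<beta>_def bump_kernel_def dist_norm norm_minus_commute power_strict_mono)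
  have out: "\<beta> x = 0" if "x \<notin> ball p r" for x
    using that r by (auto dest!: power2_less_imp_less simp: \<beta>_def bump_kernel_def dist_norm norm_minus_commute)
  have nn: "\<beta> x \<ge> 0" for x using pos out by (cases "x \<in> ball p r") force+
  have le1: "\<beta> x \<le> 1" for x by (simp add: \<beta>_def bump_kernel_def)
  have meas: "\<beta> \<in> borel_measurable borel"
    using borel_measurable_continuous_onI[OF smooth_continuous[OF sm]] .
  have int: "integrable lborel \<beta>"
  proof (rule Bochner_Integration.integrable_bound[where f = "\<lambda>x. indicator (ball p r) x :: real"])
    show "integrable lborel (\<lambda>x. indicator (ball p r) x :: real)"
      by (intro integrable_real_indicator) (auto simp: emeasure_lborel_ball_finite[unfolded infinity_ennreal_def])
    show "AE x in lborel. norm (\<beta> x) \<le> norm (indicator (ball p r) x :: real)"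
      using nn le1 out by (intro AE_I2) (auto simp: indicator_def)
  qed (use meas in auto)
  \<comment> \<open>A zero integral would make the ball, on which \<beta> is positive, a null
    set.\<close>
  have "(LINT x|lborel. \<beta> x) \<noteq> 0"
  proof
    assume "(LINT x|lborel. \<beta> x) = 0"
    then have "AE x in lborel. \<beta> x = 0"
      using integral_nonneg_eq_0_iff_AE[OF int] nn by auto
    then have "AE x in lborel. x \<notin> ball p r" by eventually_elim (use pos in force)
    then have "emeasure lborel (ball p r) = 0"
      by (subst (asm) AE_iff_measurable[of "ball p r"]) auto
    then show False using content_ball_pos[OF r, of p] by (simp add: measure_def)
  qed
  then have ne: "(LINT x|lborel. \<beta> x) > 0" using nn by (simp add: order_less_le)
  show ?thesis
  proof (rule that[of "\<lambda>x. (1 / (LINT x|lborel. \<beta> x)) * \<beta> x"], goal_cases)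
    case 1 show ?case by (intro smooth_cmult sm)
  next case 2 show ?case using nn ne by simp
  next case 3 then show ?case using out by simp
  next case 4 show ?case using int by (intro integrable_mult_right) auto
  next case 5 show ?case using ne by simp
  qed
qed

section \<open>Convolution and cutoff functions\<close>

text \<open>The gradient field is named explicitly, so that functions with merely continuous
  derivatives, such as compositions with a continuously differentiable function of one variable, are
  covered along with smooth ones.\<close>

definition c1 :: "('a::euclidean_space \<Rightarrow> real) \<Rightarrow> ('a \<Rightarrow> 'a) \<Rightarrow> bool" where
  "c1 f F \<longleftrightarrow> (\<forall>x. (f has_derivative (\<lambda>h. F x \<bullet> h)) (at x)) \<and> continuous_on UNIV F"

lemma c1_grad: "c1 f F \<Longrightarrow> grad f = F"
proof
  fix x assume "c1 f F"
  then have "frechet_derivative f (at x) b = F x \<bullet> b" for b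
    unfolding c1_def by (intro frechet_eqI) auto
  then show "grad f x = F x" by (simp add: grad_def euclidean_representation)
qed

lemma grad_inner_Basis: "b \<in> Basis \<Longrightarrow> grad f x \<bullet> b = frechet_derivative f (at x) b"
  by (simp add: grad_def inner_sum_left_Basis)

lemma differentiable_has_derivative_grad:
  assumes "f differentiable (at x)" shows "(f has_derivative (\<lambda>h. grad f x \<bullet> h)) (at x)"
proof -
  have d: "(f has_derivative frechet_derivative f (at x)) (at x)"
    using assms frechet_derivative_works by blast
  have "frechet_derivative f (at x) = (\<lambda>h. grad f x \<bullet> h)"
  proof
    fix h
    interpret linear "frechet_derivative f (at x)" using has_derivative_linear[OF d] .
    have "frechet_derivative f (at x) h = frechet_derivative f (at x) (\<Sum>b\<in>Basis. (h \<bullet> b) *\<^sub>R b)"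
      by (simp add: euclidean_representation)
    also have "\<dots> = grad f x \<bullet> h"
      by (simp add: sum scale grad_def inner_sum_left inner_commute[of h] mult.commute)
    finally show "frechet_derivative f (at x) h = grad f x \<bullet> h" .
  qed
  then show ?thesis using d by simp
qed

lemma smooth_c1: assumes "smooth f" shows "c1 f (grad f)"
  unfolding c1_def
proof (intro conjI allI)
  show "(f has_derivative (\<lambda>h. grad f x \<bullet> h)) (at x)" for x
    using assms by (intro differentiable_has_derivative_grad smooth_differentiable)
  show "continuous_on UNIV (grad f)" unfolding grad_def
    using assms by (intro continuous_intros smooth_continuous smooth_partial)
qed

lemma c1_continuous: "c1 f F \<Longrightarrow> continuous_on UNIV f"
  unfolding c1_def by (meson continuous_at_imp_continuous_on has_derivative_continuous)

lemma c1_zero_outside: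
  assumes "c1 f F" "closed K" "\<And>x. x \<notin> K \<Longrightarrow> f x = 0" "x \<notin> K" shows "F x = 0"
proof -
  have "(f has_derivative (\<lambda>h. 0)) (at x)"
    by (rule has_derivative_transform_within_open[of "\<lambda>x. 0" _ _ _ "- K"]) (use assms in auto)
  then have "(\<lambda>h. F x \<bullet> h) = (\<lambda>h. 0)"
    using assms(1) has_derivative_unique unfolding c1_def by blast
  then show ?thesis by (metis inner_eq_zero_iff)
qed

lemma c1_mult:
  assumes "c1 f F" "c1 g G" shows "c1 (\<lambda>x. f x * g x) (\<lambda>x. f x *\<^sub>R G x + g x *\<^sub>R F x)"
  using assms c1_continuous[OF assms(1)] c1_continuous[OF assms(2)] unfolding c1_def
  by (auto intro!: derivative_eq_intros continuous_intros simp: inner_add_left mult.commute)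

lemma c1_compose:
  assumes "c1 f F" "\<And>t. (p has_real_derivative p' t) (at t)" "continuous_on UNIV p'"
  shows "c1 (\<lambda>x. p (f x)) (\<lambda>x. p' (f x) *\<^sub>R F x)"
proof -
  have "((\<lambda>x. p (f x)) has_derivative (\<lambda>h. p' (f x) *\<^sub>R F x \<bullet> h)) (at x)" for x
    using has_derivative_compose[of f "\<lambda>h. F x \<bullet> h" x UNIV p] assms(1,2)
    unfolding c1_def has_field_derivative_def by auto
  moreover have "continuous_on UNIV (\<lambda>x. p' (f x))"
    using continuous_on_compose2[OF assms(3) c1_continuous[OF assms(1)]] by simp
  then have "continuous_on UNIV (\<lambda>x. p' (f x) *\<^sub>R F x)"
    using assms(1) unfolding c1_def by (intro continuous_on_scaleR) auto
  ultimately show ?thesis unfolding c1_def by blast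
qed

text \<open>Heine-Cantor on a ball with one unit of room around \<open>K\<close>: of two points at
  distance below 1, if one is outside the enlarged ball, then both lie outside \<open>K\<close> and
  both values are 0.\<close>

lemma zero_outside_uniformly_continuous:
  fixes g :: "'a::euclidean_space \<Rightarrow> 'b::real_normed_vector"
  assumes g: "continuous_on UNIV g" and K: "compact K" "\<And>x. x \<notin> K \<Longrightarrow> g x = 0"
  shows "uniformly_continuous_on UNIV g" "bounded (range g)"
proof -
  obtain R where R: "K \<subseteq> cball 0 R" using compact_imp_bounded[OF K(1)] unfolding bounded_iff subset_eq by auto
  have uc: "uniformly_continuous_on (cball 0 (R + 1)) g"
    by (intro compact_uniformly_continuous continuous_on_subset[OF g]) auto
  show "uniformly_continuous_on UNIV g" unfolding uniformly_continuous_on_def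
  proof (intro allI impI)
    fix e :: real assume "e > 0"
    then obtain d where d: "d > 0" "\<And>x y. x \<in> cball 0 (R + 1) \<Longrightarrow> y \<in> cball 0 (R + 1) \<Longrightarrow> dist y x < d \<Longrightarrow> dist (g y) (g x) < e"
      using uc unfolding uniformly_continuous_on_def by metis
    have "dist (g y) (g x) < e" if "dist y x < min d 1" for x y
    proof (cases "x \<in> cball 0 (R + 1) \<and> y \<in> cball 0 (R + 1)")
      case True then show ?thesis using d that by auto
    next
      case False
      have "norm x \<le> norm y + dist y x" "norm y \<le> norm x + dist y x"
        by (metis dist_norm norm_triangle_sub norm_minus_commute)+
      then have "norm x > R" "norm y > R" using False that by auto
      then have "x \<notin> K" "y \<notin> K" using R by auto
      then show ?thesis using K \<open>e > 0\<close> by simp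
    qed
    then show "\<exists>d>0. \<forall>x\<in>UNIV. \<forall>y\<in>UNIV. dist y x < d \<longrightarrow> dist (g y) (g x) < e"
      using d(1) by (intro exI[of _ "min d 1"]) auto
  qed
  have "compact (g ` K)" using K g by (meson compact_continuous_image continuous_on_subset top_greatest)
  moreover have "range g \<subseteq> insert 0 (g ` K)" using K by auto
  ultimately show "bounded (range g)" by (meson bounded_insert bounded_subset compact_imp_bounded)
qed

text \<open>The mean value inequality for the remainder, with the oscillation of \<open>F\<close> on
  a ball as constant. The radius \<open>d\<close> is independent of the base point, which is what
  differentiation under a convolution integral requires.\<close>

lemma c1_uniform_derivative:
  assumes f: "c1 f F" and uc: "uniformly_continuous_on UNIV F" and e: "e > 0"
  obtains d where "d > 0" "\<And>x y. norm (y - x) < d \<Longrightarrow> \<bar>f y - f x - F x \<bullet> (y - x)\<bar> \<le> e * norm (y - x)"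
proof -
  obtain d where d: "d > 0" "\<And>x y. dist y x < d \<Longrightarrow> dist (F y) (F x) < e"
    using uc e unfolding uniformly_continuous_on_def by (metis UNIV_I)
  have "\<bar>f y - f x - F x \<bullet> (y - x)\<bar> \<le> e * norm (y - x)" if "norm (y - x) < d" for x y
  proof -
    have "norm (f y - f x - F x \<bullet> (y - x)) \<le> norm (y - x) * e"
    proof (rule differentiable_bound_linearization[where f' = "\<lambda>x h. F x \<bullet> h" and S = "ball x d"])
      show "x + t *\<^sub>R (y - x) \<in> ball x d" if "t \<in> {0..1}" for t
      proof -
        have "norm (t *\<^sub>R (y - x)) \<le> norm (y - x)" using that by (simp add: mult_left_le_one_le)
        then show ?thesis using \<open>norm (y - x) < d\<close> by (simp add: dist_norm)
      qed
      show "(f has_derivative (\<lambda>h. F z \<bullet> h)) (at z within ball x d)" for z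
        using f unfolding c1_def by (meson has_derivative_at_withinI)
      show "onorm ((\<lambda>h. F z \<bullet> h) - (\<lambda>h. F x \<bullet> h)) \<le> e" if "z \<in> ball x d" for z
      proof (rule onorm_le)
        fix h
        have "norm (((\<lambda>h. F z \<bullet> h) - (\<lambda>h. F x \<bullet> h)) h) \<le> norm (F z - F x) * norm h"
          using Cauchy_Schwarz_ineq2[of "F z - F x" h] by (simp add: inner_diff_left)
        also have "\<dots> \<le> e * norm h"
          using d(2)[of z x] that by (intro mult_right_mono) (auto simp: dist_norm norm_minus_commute)
        finally show "norm (((\<lambda>h. F z \<bullet> h) - (\<lambda>h. F x \<bullet> h)) h) \<le> e * norm h" .
      qed
      show "x \<in> ball x d" using d by simp
    qed
    then show ?thesis by (simp add: mult.commute)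
  qed
  then show ?thesis using that d(1) by blast
qed

section \<open>Translation invariance of Lebesgue measure and convolution\<close>

lemma lborel_distr_reflect: "distr lborel borel (\<lambda>y. x - y) = (lborel :: 'a::euclidean_space measure)"
  using lborel_affine[of "-1" x] by (simp add: density_1)

lemma lborel_distr_shift: "distr lborel borel (\<lambda>y. x + y) = (lborel :: 'a::euclidean_space measure)"
  using lborel_affine[of 1 x] by (simp add: density_1)

lemma integral_lborel_reflect:
  fixes f :: "'a::euclidean_space \<Rightarrow> 'b::{banach, second_countable_topology}"
  assumes [measurable]: "f \<in> borel_measurable borel"
  shows "(LINT y|lborel. f (x - y)) = (LINT y|lborel. f y)"
    and "integrable lborel (\<lambda>y. f (x - y)) \<longleftrightarrow> integrable lborel f"
proof -
  show "(LINT y|lborel. f (x - y)) = (LINT y|lborel. f y)"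
    by (subst (2) lborel_distr_reflect[of x, symmetric], subst integral_distr) auto
  show "integrable lborel (\<lambda>y. f (x - y)) \<longleftrightarrow> integrable lborel f"
    by (subst (2) lborel_distr_reflect[of x, symmetric], subst integrable_distr_eq) auto
qed

lemma integral_lborel_shift:
  fixes f :: "'a::euclidean_space \<Rightarrow> 'b::{banach, second_countable_topology}"
  assumes [measurable]: "f \<in> borel_measurable borel"
  shows "(LINT y|lborel. f (x + y)) = (LINT y|lborel. f y)"
    and "integrable lborel (\<lambda>y. f (x + y)) \<longleftrightarrow> integrable lborel f"
proof -
  show "(LINT y|lborel. f (x + y)) = (LINT y|lborel. f y)"
    by (subst (2) lborel_distr_shift[of x, symmetric], subst integral_distr) auto
  show "integrable lborel (\<lambda>y. f (x + y)) \<longleftrightarrow> integrable lborel f"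
    by (subst (2) lborel_distr_shift[of x, symmetric], subst integrable_distr_eq) auto
qed

lemma integrable_scaleR_bounded:
  fixes f :: "'a \<Rightarrow> 'b::{banach, second_countable_topology}"
  assumes u: "integrable M u" and f: "f \<in> borel_measurable M" "\<And>x. norm (f x) \<le> C"
  shows "integrable M (\<lambda>x. u x *\<^sub>R f x)"
proof (rule Bochner_Integration.integrable_bound[where f = "\<lambda>x. C * u x"])
  show "AE x in M. norm (u x *\<^sub>R f x) \<le> norm (C * u x)"
  proof (rule AE_I2)
    fix x
    have "\<bar>u x\<bar> * norm (f x) \<le> \<bar>u x\<bar> * \<bar>C\<bar>" using f(2)[of x] by (intro mult_left_mono) auto
    then show "norm (u x *\<^sub>R f x) \<le> norm (C * u x)" by (simp add: abs_mult mult.commute)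
  qed
qed (use u f in auto)

lemma integrable_bounded_support:
  fixes g :: "'a::euclidean_space \<Rightarrow> 'b::{banach, second_countable_topology}"
  assumes g: "g \<in> borel_measurable borel" "\<And>x. norm (g x) \<le> C" and K: "bounded K" "\<And>x. x \<notin> K \<Longrightarrow> g x = 0"
  shows "integrable lborel g"
proof -
  obtain R where R: "K \<subseteq> cball 0 R" using K(1) unfolding bounded_iff subset_eq by auto
  have "integrable lborel (\<lambda>x. indicator (cball 0 R) x *\<^sub>R g x)"
    using g(1) by (intro integrable_scaleR_bounded[OF _ _ g(2)] integrable_real_indicator)
      (auto simp: emeasure_lborel_cball_finite[unfolded infinity_ennreal_def])
  moreover have "indicator (cball 0 R) x *\<^sub>R g x = g x" for x
    using K(2)[of x] R by (cases "x \<in> K") (auto simp: indicator_def)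
  ultimately show ?thesis by simp
qed

lemma integrable_compact_support:
  fixes g :: "'a::euclidean_space \<Rightarrow> 'b::{banach, second_countable_topology}"
  assumes g: "continuous_on UNIV g" and K: "compact K" "\<And>x. x \<notin> K \<Longrightarrow> g x = 0"
  shows "integrable lborel g"
proof -
  obtain C where "\<And>x. norm (g x) \<le> C"
    using zero_outside_uniformly_continuous(2)[OF g K] unfolding bounded_iff by auto
  then show ?thesis
    by (rule integrable_bounded_support[OF borel_measurable_continuous_onI[OF g] _ compact_imp_bounded[OF K(1)] K(2)])
qed

definition conv :: "('a::euclidean_space \<Rightarrow> real) \<Rightarrow> ('a \<Rightarrow> 'b) \<Rightarrow> 'a \<Rightarrow> 'b::{banach, second_countable_topology}" where
  "conv u f x = (LINT y|lborel. u y *\<^sub>R f (x - y))"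

lemma conv_integrable:
  fixes f :: "'a::euclidean_space \<Rightarrow> 'b::{banach, second_countable_topology}"
  assumes u: "integrable lborel u" and f: "continuous_on UNIV f" "bounded (range f)"
  shows "integrable lborel (\<lambda>y. u y *\<^sub>R f (x - y))"
proof -
  obtain C where C: "\<And>x. norm (f x) \<le> C" using f(2) unfolding bounded_iff by auto
  have "continuous_on UNIV (\<lambda>y. f (x - y))"
    by (rule continuous_on_compose2[OF f(1)]) (auto intro!: continuous_intros)
  then show ?thesis
    using integrable_scaleR_bounded[OF u, where C = C and f = "\<lambda>y. f (x - y)"] C
    by (simp add: borel_measurable_continuous_onI)
qed

lemma conv_uniformly_continuous:
  assumes u: "integrable lborel u" and f: "uniformly_continuous_on UNIV f" "bounded (range f)"
  shows "uniformly_continuous_on UNIV (conv u f)"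
  unfolding uniformly_continuous_on_def
proof (intro allI impI)
  fix e :: real assume e: "e > 0"
  \<comment> \<open>\<open>A + 1\<close> rather than \<open>A\<close> in the denominators allows for
    \<open>A = 0\<close>.\<close>
  define A where "A = (LINT y|lborel. \<bar>u y\<bar>)"
  have A: "A \<ge> 0" by (simp add: A_def)
  obtain d where d: "d > 0" "\<And>x y. dist y x < d \<Longrightarrow> dist (f y) (f x) < e / (A + 1)"
    using f(1) e A unfolding uniformly_continuous_on_def by (metis UNIV_I add_nonneg_pos divide_pos_pos zero_less_one)
  note I = conv_integrable[OF u uniformly_continuous_imp_continuous[OF f(1)] f(2)]
  have "dist (conv u f y) (conv u f x) < e" if "dist y x < d" for x y
  proof -
    have "norm (conv u f y - conv u f x) = norm (LINT z|lborel. u z *\<^sub>R (f (y - z) - f (x - z)))"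
      unfolding conv_def by (subst Bochner_Integration.integral_diff[symmetric]) (auto simp: I scaleR_diff_right)
    also have "\<dots> \<le> (LINT z|lborel. \<bar>u z\<bar> * (e / (A + 1)))"
    proof (rule Bochner_Integration.integral_norm_bound_integral)
      show "integrable lborel (\<lambda>z. u z *\<^sub>R (f (y - z) - f (x - z)))"
        using Bochner_Integration.integrable_diff[OF I[of y] I[of x]] by (simp add: scaleR_diff_right)
      show "norm (u z *\<^sub>R (f (y - z) - f (x - z))) \<le> \<bar>u z\<bar> * (e / (A + 1))" for z
        using d(2)[of "y - z" "x - z"] that mult_left_mono[of "norm (f (y - z) - f (x - z))" "e / (A + 1)" "\<bar>u z\<bar>"]
        by (simp add: dist_norm)
    qed (use u in auto)
    also have "\<dots> = A * (e / (A + 1))" by (simp add: A_def)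
    also have "\<dots> < e" using e A by (simp add: field_simps)
    finally show ?thesis by (simp add: dist_norm)
  qed
  then show "\<exists>d>0. \<forall>x\<in>UNIV. \<forall>y\<in>UNIV. dist y x < d \<longrightarrow> dist (conv u f y) (conv u f x) < e"
    using d(1) by blast
qed

text \<open>The first-order remainder of \<open>f\<close> is small uniformly in the base point, so
  integrating it against \<open>u\<close> costs only the factor \<open>A\<close>.\<close>

lemma conv_c1:
  assumes u: "integrable lborel u" and f: "c1 f F" "bounded (range f)"
    and F: "uniformly_continuous_on UNIV F" "bounded (range F)"
  shows "c1 (conv u f) (conv u F)"
  unfolding c1_def
proof (intro conjI allI)
  show "continuous_on UNIV (conv u F)"
    using conv_uniformly_continuous[OF u F] uniformly_continuous_imp_continuous by blast
  fix x
  note I = conv_integrable[OF u c1_continuous[OF f(1)] f(2)]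
  note J = conv_integrable[OF u uniformly_continuous_imp_continuous[OF F(1)] F(2)]
  define A where "A = (LINT y|lborel. \<bar>u y\<bar>)"
  have A: "A \<ge> 0" by (simp add: A_def)
  show "(conv u f has_derivative (\<lambda>h. conv u F x \<bullet> h)) (at x)"
    unfolding has_derivative_at_alt
  proof (intro conjI allI impI)
    show "bounded_linear (\<lambda>h. conv u F x \<bullet> h)" by (rule bounded_linear_inner_right)
    fix e :: real assume "e > 0"
    then have e: "e / (A + 1) > 0" using A by simp
    obtain d where d: "d > 0"
      "\<And>x y. norm (y - x) < d \<Longrightarrow> \<bar>f y - f x - F x \<bullet> (y - x)\<bar> \<le> e / (A + 1) * norm (y - x)"
      using c1_uniform_derivative[OF f(1) F(1) e] by metis
    have "norm (conv u f y - conv u f x - conv u F x \<bullet> (y - x)) \<le> e * norm (y - x)" if "norm (y - x) < d" for y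
    proof -
      have i: "conv u F x \<bullet> (y - x) = (LINT z|lborel. u z * (F (x - z) \<bullet> (y - x)))"
        unfolding conv_def by (subst integral_inner_left[symmetric]) (auto simp: J)
      have j: "integrable lborel (\<lambda>z. u z * (F (x - z) \<bullet> (y - x)))"
        using integrable_inner_left[OF J[of x], of "y - x"] by simp
      have I': "integrable lborel (\<lambda>z. u z * f (x - z))" for x using I[of x] by simp
      have eq: "conv u f y - conv u f x - conv u F x \<bullet> (y - x) =
          (LINT z|lborel. u z * (f (y - z) - f (x - z) - F (x - z) \<bullet> (y - x)))"
        unfolding i unfolding conv_def using I' j by (simp add: right_diff_distrib)
      have "norm (LINT z|lborel. u z * (f (y - z) - f (x - z) - F (x - z) \<bullet> (y - x)))
          \<le> (LINT z|lborel. \<bar>u z\<bar> * (e / (A + 1) * norm (y - x)))"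
      proof (rule Bochner_Integration.integral_norm_bound_integral)
        show "integrable lborel (\<lambda>z. u z * (f (y - z) - f (x - z) - F (x - z) \<bullet> (y - x)))"
          using I' j by (simp add: right_diff_distrib)
        show "norm (u z * (f (y - z) - f (x - z) - F (x - z) \<bullet> (y - x)))
            \<le> \<bar>u z\<bar> * (e / (A + 1) * norm (y - x))" for z
          unfolding real_norm_def abs_mult
          using d(2)[of "y - z" "x - z"] that by (intro mult_left_mono) auto
      qed (use u in auto)
      also have "\<dots> = A * (e / (A + 1) * norm (y - x))" by (simp add: A_def)
      also have "\<dots> = (A / (A + 1)) * (e * norm (y - x))" by simp
      also have "\<dots> \<le> 1 * (e * norm (y - x))"
        using A \<open>e > 0\<close> by (intro mult_right_mono) auto
      finally show ?thesis unfolding eq by simp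
    qed
    then show "\<exists>d>0. \<forall>y. norm (y - x) < d \<longrightarrow>
        norm (conv u f y - conv u f x - conv u F x \<bullet> (y - x)) \<le> e * norm (y - x)"
      using d(1) by blast
  qed
qed

text \<open>Partial derivatives fall on the second factor and vanish outside the same
  \<open>K\<close>; for fixed \<open>u\<close> and \<open>K\<close> these convolutions form a class
  closed under differentiation.\<close>

lemma smooth_conv:
  fixes f :: "'a::euclidean_space \<Rightarrow> real"
  assumes u: "integrable lborel u" and f: "smooth f" and K: "compact K" "\<And>x. x \<notin> K \<Longrightarrow> f x = 0"
  shows "smooth (conv u f)"
proof -
  let ?S = "{conv u f |f. smooth f \<and> (\<forall>x. x \<notin> K \<longrightarrow> f x = 0)}"
  have c: "c1 (conv u f) (conv u (grad f))" if "smooth f" "\<forall>x. x \<notin> K \<longrightarrow> f x = 0" for f :: "'a \<Rightarrow> real"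
  proof (rule conv_c1[OF u smooth_c1[OF that(1)]])
    note * = c1_zero_outside[OF smooth_c1[OF that(1)] compact_imp_closed[OF K(1)]]
    have z: "grad f x = 0" if "x \<notin> K" for x using * that \<open>\<forall>x. x \<notin> K \<longrightarrow> f x = 0\<close> by blast
    have gc: "continuous_on UNIV (grad f)" using smooth_c1[OF that(1)] by (simp add: c1_def)
    show "bounded (range f)"
      using zero_outside_uniformly_continuous(2)[OF smooth_continuous[OF that(1)] K(1)] that(2) by blast
    show "uniformly_continuous_on UNIV (grad f)" "bounded (range (grad f))"
      using zero_outside_uniformly_continuous[OF gc K(1) z] by auto
  qed
  show ?thesis
  proof (rule smooth_coinduct[where S = ?S], goal_cases)
    case 1 show ?case using f K(2) by blast
  next
    case (2 h x) then show ?case using c unfolding c1_def differentiable_def by blast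
  next
    case (3 h b)
    then obtain f where h: "h = conv u f" and f: "smooth f" "\<forall>x. x \<notin> K \<longrightarrow> f x = 0" by auto
    have z: "grad f x = 0" if "x \<notin> K" for x
      using c1_zero_outside[OF smooth_c1[OF f(1)] compact_imp_closed[OF K(1)]] that f(2) by blast
    have "continuous_on UNIV (grad f)" using smooth_c1[OF f(1)] by (simp add: c1_def)
    note J = conv_integrable[OF u this zero_outside_uniformly_continuous(2)[OF this K(1) z]]
    have "frechet_derivative h (at x) b = conv u (\<lambda>x. frechet_derivative f (at x) b) x" for x
    proof -
      have "frechet_derivative h (at x) b = conv u (grad f) x \<bullet> b"
        unfolding h using c[OF f] by (intro frechet_eqI) (auto simp: c1_def)
      also have "\<dots> = conv u (\<lambda>x. frechet_derivative f (at x) b) x"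
        unfolding conv_def using 3(2) by (subst integral_inner_left[symmetric]) (auto simp: J grad_inner_Basis)
      finally show ?thesis .
    qed
    then have "(\<lambda>x. frechet_derivative h (at x) b) = conv u (\<lambda>x. frechet_derivative f (at x) b)" by auto
    moreover have "frechet_derivative f (at x) b = 0" if "x \<notin> K" for x
      using z[OF that] grad_inner_Basis[OF 3(2), of f x] by simp
    ultimately show ?case using smooth_partial[OF f(1) 3(2)] by blast
  qed
qed

lemma test_functionsI:
  fixes f :: "'a::euclidean_space \<Rightarrow> 'b::real_normed_vector"
  assumes "smooth f" "compact K" "K \<subseteq> U" "\<And>x. x \<notin> K \<Longrightarrow> f x = 0"
  shows "f \<in> test_functions U"
proof -
  have "closure {x. f x \<noteq> 0} \<subseteq> K" using assms by (intro closure_minimal) (auto simp: compact_imp_closed)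
  moreover from this have "compact (closure {x. f x \<noteq> 0})"
    using assms(2) by (meson closed_closure closed_subset compact_Int_closed compact_imp_closed bounded_subset compact_imp_bounded compact_eq_bounded_closed)
  ultimately show ?thesis using assms unfolding test_functions_def by blast
qed

lemma test_functionsE:
  fixes f :: "'a::euclidean_space \<Rightarrow> 'b::real_normed_vector"
  assumes "f \<in> test_functions U"
  obtains K where "smooth f" "compact K" "K \<subseteq> U" "\<And>x. x \<notin> K \<Longrightarrow> f x = 0"
  using assms closure_subset[of "{x. f x \<noteq> 0}"] unfolding test_functions_def by blast

text \<open>The indicator of the closed e/2-neighbourhood \<open>K1\<close> is mollified by a bump
  of radius e/2. The average is 1 on \<open>K\<close>, where the whole bump sees \<open>K1\<close>,
  and 0 outside the e-neighbourhood \<open>K2\<close>.\<close>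

lemma cutoff_exists:
  fixes K :: "'a::euclidean_space set"
  assumes K: "compact K" and U: "open U" "K \<subseteq> U"
  obtains \<theta> where "\<theta> \<in> test_functions U" "\<And>x. 0 \<le> \<theta> x" "\<And>x. \<theta> x \<le> (1::real)" "\<And>x. x \<in> K \<Longrightarrow> \<theta> x = 1"
proof -
  obtain e where e: "e > 0" "(\<Union>x\<in>K. cball x e) \<subseteq> U"
    using compact_subset_open_imp_cball_epsilon_subset[OF K U] by blast
  define K1 where "K1 = {x + y |x y. x \<in> K \<and> y \<in> cball 0 (e / 2)}"
  define K2 where "K2 = {x + y |x y. x \<in> K \<and> y \<in> cball 0 e}"
  have cK: "compact K1" "compact K2" unfolding K1_def K2_def by (intro compact_sums K compact_cball)+
  have K2U: "K2 \<subseteq> U"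
  proof
    fix z assume "z \<in> K2"
    then obtain x y where "z = x + y" "x \<in> K" "norm y \<le> e" unfolding K2_def by auto
    then have "z \<in> cball x e" by (simp add: dist_norm)
    then show "z \<in> U" using e(2) \<open>x \<in> K\<close> by blast
  qed
  obtain \<rho> :: "'a \<Rightarrow> real" where \<rho>: "smooth \<rho>" "\<And>x. 0 \<le> \<rho> x" "\<And>x. x \<notin> ball 0 (e / 2) \<Longrightarrow> \<rho> x = 0"
    "integrable lborel \<rho>" "(LINT x|lborel. \<rho> x) = 1"
    using bump_exists[of "e / 2" 0] e by auto
  have mK1: "K1 \<in> sets borel" using cK(1) by (simp add: compact_imp_closed)
  have iK1: "integrable lborel (\<lambda>x. indicator K1 x :: real)"
    using emeasure_compact_finite[OF cK(1)] mK1 by (intro integrable_real_indicator) (auto simp: less_top)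
  have m\<rho>[measurable]: "\<rho> \<in> borel_measurable borel" using \<rho>(4) by simp
  have \<rho>0: "\<rho> x = 0" if "x \<notin> cball 0 (e / 2)" for x using \<rho>(3) that by auto
  have bd: "bounded (range \<rho>)"
    by (rule zero_outside_uniformly_continuous(2)[OF smooth_continuous[OF \<rho>(1)] compact_cball \<rho>0])
  let ?\<theta> = "conv (indicator K1) \<rho>"
  have I: "integrable lborel (\<lambda>y. indicator K1 y * \<rho> (x - y))" for x
    using conv_integrable[OF iK1 smooth_continuous[OF \<rho>(1)] bd] by simp
  have R: "integrable lborel (\<lambda>y. \<rho> (x - y))" "(LINT y|lborel. \<rho> (x - y)) = 1" for x
    using integral_lborel_reflect[OF m\<rho>] \<rho>(4,5) by auto
  show ?thesis
  proof (rule that)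
    show "?\<theta> \<in> test_functions U"
    proof (rule test_functionsI[OF smooth_conv[OF iK1 \<rho>(1) compact_cball \<rho>0] cK(2) K2U])
      fix x assume x: "x \<notin> K2"
      have "indicator K1 y *\<^sub>R \<rho> (x - y) = 0" for y
      proof (rule ccontr)
        assume "indicator K1 y *\<^sub>R \<rho> (x - y) \<noteq> 0"
        then have "y \<in> K1" "norm (x - y) < e / 2" using \<rho>(3)[of "x - y"] by (auto simp: indicator_def split: if_splits)
        then obtain a b where ab: "y = a + b" "a \<in> K" "norm b \<le> e / 2" unfolding K1_def by auto
        then have "norm (x - a) \<le> e" using \<open>norm (x - y) < e / 2\<close> norm_triangle_ineq[of "x - y" b] by (simp add: algebra_simps)
        then have "x \<in> K2" unfolding K2_def using ab(2) by (intro CollectI exI[of _ a] exI[of _ "x - a"]) auto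
        then show False using x by simp
      qed
      then show "?\<theta> x = 0" by (simp only: conv_def) simp
    qed
    show "0 \<le> ?\<theta> x" for x unfolding conv_def by (intro integral_nonneg_AE AE_I2) (simp add: \<rho>(2))
    show "?\<theta> x \<le> 1" for x
      unfolding conv_def R(2)[of x, symmetric] using I R(1) \<rho>(2)
      by (intro integral_mono) (auto simp: indicator_def)
    show "?\<theta> x = 1" if "x \<in> K" for x
    proof -
      have "indicator K1 y *\<^sub>R \<rho> (x - y) = \<rho> (x - y)" for y
      proof (cases "\<rho> (x - y) = 0")
        case False
        then have "norm (y - x) < e / 2" using \<rho>(3)[of "x - y"] by (auto simp: norm_minus_commute)
        then have "y \<in> K1" unfolding K1_def using that by (intro CollectI exI[of _ x] exI[of _ "y - x"]) auto
        then show ?thesis by simp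
      qed simp
      then show ?thesis using R(2) by (simp only: conv_def)
    qed
  qed
qed

text \<open>Convolving \<open>f\<close> with the indicator of a ball of radius R + 1 gives a
  function that on the unit ball equals the total integral of \<open>f\<close>, hence has derivative
  0 at the origin. By \<open>conv_c1\<close> this derivative is the integral of \<open>F\<close>.
  Integration by parts rests on this lemma.\<close>

lemma integral_grad_compact_support:
  fixes F :: "'a::euclidean_space \<Rightarrow> 'a"
  assumes f: "c1 f F" and K: "compact K" "\<And>x. x \<notin> K \<Longrightarrow> f x = 0"
  shows "(LINT x|lborel. F x) = 0"
proof -
  have F0: "F x = 0" if "x \<notin> K" for x
    using c1_zero_outside[OF f compact_imp_closed[OF K(1)] K(2) that] .
  have cF: "continuous_on UNIV F" using f by (simp add: c1_def)
  have mF[measurable]: "F \<in> borel_measurable borel" "f \<in> borel_measurable borel"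
    using borel_measurable_continuous_onI cF c1_continuous[OF f] by auto
  obtain R where R: "K \<subseteq> cball 0 R" using compact_imp_bounded[OF K(1)] unfolding bounded_iff subset_eq by auto
  let ?u = "indicator (cball 0 (R + 1)) :: 'a \<Rightarrow> real"
  have iu: "integrable lborel ?u" by (intro integrable_real_indicator) (auto simp: emeasure_lborel_cball_finite[unfolded infinity_ennreal_def])
  have cc: "c1 (conv ?u f) (conv ?u F)"
    using zero_outside_uniformly_continuous[OF c1_continuous[OF f] K]
      zero_outside_uniformly_continuous[OF cF K(1) F0] by (intro conv_c1[OF iu f]) auto
  have u1: "?u y = 1" if "x - y \<in> K" "x \<in> ball 0 1" for x y
  proof -
    have "norm (x - y) \<le> R" using R that(1) by auto
    then have "norm y \<le> R + 1" using that(2) norm_triangle_ineq4[of x "x - y"] by simp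
    then show ?thesis by simp
  qed
  have eqf: "?u y *\<^sub>R f (x - y) = f (x - y)" if "x \<in> ball 0 1" for x y
    using u1[OF _ that] K(2) by (cases "x - y \<in> K") auto
  have eqF: "?u y *\<^sub>R F (0 - y) = F (0 - y)" for y
    using u1[of 0 y] F0 by (cases "0 - y \<in> K") auto
  have cv: "conv ?u f x = (LINT y|lborel. f y)" if "x \<in> ball 0 1" for x
    using integral_lborel_reflect(1)[OF mF(2), of x] unfolding conv_def
    by (simp only: eqf[OF that])
  have "(conv ?u f has_derivative (\<lambda>h. 0)) (at 0)"
    by (rule has_derivative_transform_within_open[OF has_derivative_const open_ball centre_in_ball[THEN iffD2] cv[symmetric]]) auto
  then have "(\<lambda>h. conv ?u F 0 \<bullet> h) = (\<lambda>h. 0)"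
    using cc has_derivative_unique unfolding c1_def by blast
  then have "conv ?u F 0 = 0" by (metis inner_eq_zero_iff)
  moreover have "conv ?u F 0 = (LINT y|lborel. F y)"
    using integral_lborel_reflect(1)[OF mF(1), of 0] unfolding conv_def
    by (simp only: eqF)
  ultimately show ?thesis by simp
qed

section \<open>Square-integrable functions\<close>

text \<open>Borel measurability on the whole space takes the place of Lebesgue measurability on
  \<Omega>: it is stable under composition and product measures. Lebesgue measurable data enter
  through \<open>borel_rep\<close>.\<close>

definition sq_int :: "('a::euclidean_space \<Rightarrow> 'b::euclidean_space) \<Rightarrow> bool" where
  "sq_int f \<longleftrightarrow> f \<in> borel_measurable borel \<and> integrable lborel (\<lambda>x. (norm (f x))\<^sup>2)"

definition nsq :: "('a::euclidean_space \<Rightarrow> 'b::euclidean_space) \<Rightarrow> real" where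
  "nsq f = (LINT x|lborel. (norm (f x))\<^sup>2)"

lemma sq_int_measurable[measurable_dest]: "sq_int f \<Longrightarrow> f \<in> borel_measurable borel"
  by (simp add: sq_int_def)

lemma sq_int_integrable[simp]: "sq_int f \<Longrightarrow> integrable lborel (\<lambda>x. (norm (f x))\<^sup>2)"
  by (simp add: sq_int_def)

lemma nsq_nonneg[simp]: "0 \<le> nsq f"
  by (simp add: nsq_def)

lemma norm_add_sq_le: "(norm (a + b))\<^sup>2 \<le> 2 * (norm a)\<^sup>2 + 2 * (norm (b::'b::real_normed_vector))\<^sup>2"
proof -
  have "(norm (a + b))\<^sup>2 \<le> (norm a + norm b)\<^sup>2" by (intro power_mono norm_triangle_ineq) auto
  also have "\<dots> \<le> 2 * (norm a)\<^sup>2 + 2 * (norm b)\<^sup>2"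
    using sum_squares_bound[of "norm a" "norm b"] by (simp add: power2_sum)
  finally show ?thesis .
qed

lemma norm_mult_le_sq: "2 * (norm a * norm b) \<le> (norm (a::'b::real_normed_vector))\<^sup>2 + (norm (b::'c::real_normed_vector))\<^sup>2"
  using sum_squares_bound[of "norm a" "norm b"] by simp

lemma sq_int_bound:
  fixes g :: "'a::euclidean_space \<Rightarrow> 'b::euclidean_space"
  assumes [measurable]: "g \<in> borel_measurable borel" and w: "integrable lborel w"
    and "AE x in lborel. (norm (g x))\<^sup>2 \<le> w x"
  shows "sq_int g"
  unfolding sq_int_def
proof
  show "integrable lborel (\<lambda>x. (norm (g x))\<^sup>2)"
    using assms(3) by (intro Bochner_Integration.integrable_bound[OF w]) auto
qed fact

lemma sq_int_dominated:
  fixes g :: "'a::euclidean_space \<Rightarrow> 'b::euclidean_space" and w :: "'a \<Rightarrow> 'c::euclidean_space"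
  assumes "g \<in> borel_measurable borel" "sq_int w" "\<And>x. norm (g x) \<le> C * norm (w x)"
  shows "sq_int g"
proof (rule sq_int_bound[OF assms(1), of "\<lambda>x. C\<^sup>2 * (norm (w x))\<^sup>2"])
  show "integrable lborel (\<lambda>x. C\<^sup>2 * (norm (w x))\<^sup>2)" using sq_int_integrable[OF assms(2)] by simp
  show "AE x in lborel. (norm (g x))\<^sup>2 \<le> C\<^sup>2 * (norm (w x))\<^sup>2"
    using assms(3) by (intro AE_I2) (auto simp: power_mult_distrib[symmetric] intro: power_mono)
qed

lemma sq_int_add: assumes "sq_int f" "sq_int g" shows "sq_int (\<lambda>x. f x + g x)"
proof (rule sq_int_bound[of _ "\<lambda>x. 2 * (norm (f x))\<^sup>2 + 2 * (norm (g x))\<^sup>2"])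
  show "integrable lborel (\<lambda>x. 2 * (norm (f x))\<^sup>2 + 2 * (norm (g x))\<^sup>2)"
    using assms by simp
qed (use assms in \<open>auto simp: norm_add_sq_le sq_int_def\<close>)

lemma sq_int_scaleR: assumes "sq_int f" shows "sq_int (\<lambda>x. c *\<^sub>R f x)"
  by (rule sq_int_dominated[OF _ assms, of _ "\<bar>c\<bar>"]) (use assms in \<open>auto simp: sq_int_def\<close>)

lemma sq_int_uminus: assumes "sq_int f" shows "sq_int (\<lambda>x. - f x)"
  using sq_int_scaleR[OF assms, of "-1"] by simp

lemma sq_int_diff: assumes "sq_int f" "sq_int g" shows "sq_int (\<lambda>x. f x - g x)"
  using sq_int_add[OF assms(1) sq_int_uminus[OF assms(2)]] by simp

lemma sq_int_zero: "sq_int (\<lambda>x. 0)"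
  by (simp add: sq_int_def)

lemma sq_int_sum: "(\<And>i. i \<in> I \<Longrightarrow> sq_int (f i)) \<Longrightarrow> sq_int (\<lambda>x. \<Sum>i\<in>I. f i x)"
  by (induct I rule: infinite_finite_induct) (auto intro: sq_int_zero sq_int_add)

lemma sq_int_norm_mult:
  assumes f: "sq_int f" and g: "sq_int g"
  shows "integrable lborel (\<lambda>x. norm (f x) * norm (g x))"
proof (rule Bochner_Integration.integrable_bound[where f = "\<lambda>x. (norm (f x))\<^sup>2 + (norm (g x))\<^sup>2"])
  show "integrable lborel (\<lambda>x. (norm (f x))\<^sup>2 + (norm (g x))\<^sup>2)"
    using assms by simp
  show "AE x in lborel. norm (norm (f x) * norm (g x)) \<le> norm ((norm (f x))\<^sup>2 + (norm (g x))\<^sup>2)"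
  proof (rule AE_I2)
    fix x
    have "0 \<le> norm (f x) * norm (g x)" by simp
    then show "norm (norm (f x) * norm (g x)) \<le> norm ((norm (f x))\<^sup>2 + (norm (g x))\<^sup>2)"
      using norm_mult_le_sq[of "f x" "g x"] unfolding real_norm_def by linarith
  qed
qed (use assms in \<open>auto simp: sq_int_def\<close>)

lemma sq_int_inner:
  assumes f: "sq_int f" and g: "sq_int g"
  shows "integrable lborel (\<lambda>x. f x \<bullet> g x)"
  by (rule Bochner_Integration.integrable_bound[OF sq_int_norm_mult[OF assms]])
    (use assms in \<open>auto simp: sq_int_def Cauchy_Schwarz_ineq2\<close>)

lemma sq_int_mult:
  fixes f g :: "_ \<Rightarrow> real"
  assumes "sq_int f" "sq_int g" shows "integrable lborel (\<lambda>x. f x * g x)"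
  using sq_int_inner[OF assms] by (simp add: inner_real_def)

lemma nsq_add_le: assumes "sq_int f" "sq_int g" shows "nsq (\<lambda>x. f x + g x) \<le> 2 * nsq f + 2 * nsq g"
proof -
  have "nsq (\<lambda>x. f x + g x) \<le> (LINT x|lborel. 2 * (norm (f x))\<^sup>2 + 2 * (norm (g x))\<^sup>2)"
    unfolding nsq_def using assms sq_int_add[OF assms]
    by (intro integral_mono) (auto simp: norm_add_sq_le)
  then show ?thesis using assms by (simp add: nsq_def)
qed

lemma nsq_scaleR: "nsq (\<lambda>x. c *\<^sub>R f x) = c\<^sup>2 * nsq f"
  by (simp add: nsq_def power_mult_distrib)

lemma nsq_minus_commute: "nsq (\<lambda>x. f x - g x) = nsq (\<lambda>x. g x - f x)"
  by (simp add: nsq_def norm_minus_commute)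

lemma nsq_inner: "nsq f = (LINT x|lborel. f x \<bullet> f x)"
  by (simp add: nsq_def power2_norm_eq_inner)

lemma nsq_expand:
  assumes "sq_int f" "sq_int g"
  shows "nsq (\<lambda>x. f x + c *\<^sub>R g x) = nsq f + 2 * c * (LINT x|lborel. f x \<bullet> g x) + c\<^sup>2 * nsq g"
proof -
  have *: "(norm (f x + c *\<^sub>R g x))\<^sup>2 = (norm (f x))\<^sup>2 + 2 * c * (f x \<bullet> g x) + c\<^sup>2 * (norm (g x))\<^sup>2" for x
    unfolding power2_norm_eq_inner by (simp add: inner_add_left inner_add_right inner_commute power2_eq_square algebra_simps)
  show ?thesis unfolding nsq_def * using assms sq_int_inner[OF assms] by simp
qed

text \<open>Nonnegativity of a quadratic polynomial in \<open>c\<close>, the squared norm of f + c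
  g.\<close>

lemma Cauchy_Schwarz_L2:
  assumes "sq_int f" "sq_int g"
  shows "\<bar>LINT x|lborel. f x \<bullet> g x\<bar> \<le> sqrt (nsq f) * sqrt (nsq g)"
proof -
  define B where "B = (LINT x|lborel. f x \<bullet> g x)"
  have *: "0 \<le> nsq f + 2 * c * B + c\<^sup>2 * nsq g" for c
    using nsq_expand[OF assms, of c] nsq_nonneg[of "\<lambda>x. f x + c *\<^sub>R g x"] by (simp add: B_def)
  have "B\<^sup>2 \<le> nsq f * nsq g"
  proof (cases "nsq g = 0")
    case True
    have "B = 0"
    proof (rule ccontr)
      assume "B \<noteq> 0"
      \<comment> \<open>For \<open>nsq g = 0\<close> the polynomial is affine, and at this
        \<open>c\<close> it takes the value -1.\<close>
      then show False using *[of "- (nsq f + 1) / (2 * B)"] True by (simp add: field_simps)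
    qed
    then show ?thesis by simp
  next
    case False
    then have g: "nsq g > 0" using nsq_nonneg[of g] by linarith
    then have "0 \<le> nsq f - B\<^sup>2 / nsq g"
      using *[of "- B / nsq g"] by (simp add: field_simps power2_eq_square)
    then show ?thesis using g by (simp add: field_simps)
  qed
  then have "\<bar>B\<bar> \<le> sqrt (nsq f * nsq g)" by (simp add: real_le_rsqrt)
  then show ?thesis by (simp add: B_def real_sqrt_mult)
qed

definition l2lim :: "(nat \<Rightarrow> 'a::euclidean_space \<Rightarrow> 'b::euclidean_space) \<Rightarrow> ('a \<Rightarrow> 'b) \<Rightarrow> bool" where
  "l2lim F f \<longleftrightarrow> (\<forall>k. sq_int (F k)) \<and> sq_int f \<and> (\<lambda>k. nsq (\<lambda>x. F k x - f x)) \<longlonglongrightarrow> 0"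

lemma l2limD: "l2lim F f \<Longrightarrow> sq_int (F k)" "l2lim F f \<Longrightarrow> sq_int f"
  "l2lim F f \<Longrightarrow> (\<lambda>k. nsq (\<lambda>x. F k x - f x)) \<longlonglongrightarrow> 0"
  by (auto simp: l2lim_def)

lemma l2lim_const: "sq_int f \<Longrightarrow> l2lim (\<lambda>_. f) f"
  by (simp add: l2lim_def nsq_def)

lemma l2lim_bounded:
  assumes "l2lim F f" obtains B where "\<And>k. sqrt (nsq (F k)) \<le> B" "B \<ge> 0"
proof -
  have "Bseq (\<lambda>k. nsq (\<lambda>x. F k x - f x))" using l2limD(3)[OF assms] by (intro convergent_imp_Bseq convergentI)
  then obtain C where C: "\<And>k. norm (nsq (\<lambda>x. F k x - f x)) \<le> C" unfolding Bseq_def by auto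
  have "nsq (F k) \<le> 2 * C + 2 * nsq f" for k
    using nsq_add_le[OF sq_int_diff[OF l2limD(1)[OF assms, of k] l2limD(2)[OF assms]] l2limD(2)[OF assms]] C[of k] by auto
  then show ?thesis using that[of "sqrt (2 * C + 2 * nsq f)"]
    by (smt (verit) nsq_nonneg real_sqrt_ge_zero real_sqrt_le_iff C norm_ge_zero)
qed

lemma l2lim_inner:
  assumes F: "l2lim F f" and G: "l2lim G g"
  shows "(\<lambda>k. LINT x|lborel. F k x \<bullet> G k x) \<longlonglongrightarrow> (LINT x|lborel. f x \<bullet> g x)"
proof -
  note [simp] = l2limD(1,2)[OF F] l2limD(1,2)[OF G]
  obtain B where B: "\<And>k. sqrt (nsq (F k)) \<le> B" "B \<ge> 0" using l2lim_bounded[OF F] by blast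
  have "norm ((LINT x|lborel. F k x \<bullet> G k x) - (LINT x|lborel. f x \<bullet> g x)) \<le>
      B * sqrt (nsq (\<lambda>x. G k x - g x)) + sqrt (nsq (\<lambda>x. F k x - f x)) * sqrt (nsq g)" for k
  proof -
    have eq: "(LINT x|lborel. F k x \<bullet> G k x) - (LINT x|lborel. f x \<bullet> g x) =
        (LINT x|lborel. F k x \<bullet> (G k x - g x)) + (LINT x|lborel. (F k x - f x) \<bullet> g x)"
      by (subst Bochner_Integration.integral_diff[symmetric] Bochner_Integration.integral_add[symmetric];
          (intro sq_int_inner sq_int_diff)?; (simp add: inner_diff_left inner_diff_right)?)+
    have b1: "\<bar>LINT x|lborel. F k x \<bullet> (G k x - g x)\<bar> \<le> B * sqrt (nsq (\<lambda>x. G k x - g x))"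
      using Cauchy_Schwarz_L2[of "F k" "\<lambda>x. G k x - g x"] mult_right_mono[OF B(1), of "sqrt (nsq (\<lambda>x. G k x - g x))" k]
      by (simp add: sq_int_diff)
    have b2: "\<bar>LINT x|lborel. (F k x - f x) \<bullet> g x\<bar> \<le> sqrt (nsq (\<lambda>x. F k x - f x)) * sqrt (nsq g)"
      using Cauchy_Schwarz_L2[of "\<lambda>x. F k x - f x" g] by (simp add: sq_int_diff)
    show ?thesis unfolding eq real_norm_def by (rule order_trans[OF abs_triangle_ineq add_mono[OF b1 b2]])
  qed
  then have ev: "\<forall>\<^sub>F k in sequentially. norm ((LINT x|lborel. F k x \<bullet> G k x) - (LINT x|lborel. f x \<bullet> g x)) \<le>
      B * sqrt (nsq (\<lambda>x. G k x - g x)) + sqrt (nsq (\<lambda>x. F k x - f x)) * sqrt (nsq g)" by auto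
  have "(\<lambda>k. B * sqrt (nsq (\<lambda>x. G k x - g x)) + sqrt (nsq (\<lambda>x. F k x - f x)) * sqrt (nsq g)) \<longlonglongrightarrow>
      B * sqrt 0 + sqrt 0 * sqrt (nsq g)"
    by (intro tendsto_intros l2limD(3)[OF F] l2limD(3)[OF G])
  then show ?thesis by (intro LIM_zero_cancel[OF Lim_null_comparison[OF ev]]) (simp only: real_sqrt_zero mult_zero_left mult_zero_right add_0_left)
qed

lemma l2lim_nsq: "l2lim F f \<Longrightarrow> (\<lambda>k. nsq (F k)) \<longlonglongrightarrow> nsq f"
  unfolding nsq_inner by (rule l2lim_inner)

lemma l2lim_add:
  assumes F: "l2lim F f" and G: "l2lim G g"
  shows "l2lim (\<lambda>k x. F k x + G k x) (\<lambda>x. f x + g x)"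
  unfolding l2lim_def
proof (intro conjI allI)
  note [simp] = l2limD(1,2)[OF F] l2limD(1,2)[OF G]
  show "(\<lambda>k. nsq (\<lambda>x. F k x + G k x - (f x + g x))) \<longlonglongrightarrow> 0"
  proof (rule tendsto_sandwich[of "\<lambda>_. 0" _ _ "\<lambda>k. 2 * nsq (\<lambda>x. F k x - f x) + 2 * nsq (\<lambda>x. G k x - g x)"])
    have "nsq (\<lambda>x. F k x + G k x - (f x + g x)) \<le> 2 * nsq (\<lambda>x. F k x - f x) + 2 * nsq (\<lambda>x. G k x - g x)" for k
      using nsq_add_le[of "\<lambda>x. F k x - f x" "\<lambda>x. G k x - g x"] by (simp add: sq_int_diff algebra_simps)
    then show "\<forall>\<^sub>F k in sequentially. nsq (\<lambda>x. F k x + G k x - (f x + g x)) \<le> 2 * nsq (\<lambda>x. F k x - f x) + 2 * nsq (\<lambda>x. G k x - g x)"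
      by simp
    have "(\<lambda>k. 2 * nsq (\<lambda>x. F k x - f x) + 2 * nsq (\<lambda>x. G k x - g x)) \<longlonglongrightarrow> 2 * 0 + 2 * 0"
      by (intro tendsto_intros l2limD(3)[OF F] l2limD(3)[OF G])
    then show "(\<lambda>k. 2 * nsq (\<lambda>x. F k x - f x) + 2 * nsq (\<lambda>x. G k x - g x)) \<longlonglongrightarrow> 0" by simp
  qed auto
qed (auto intro!: sq_int_add l2limD[OF F] l2limD[OF G])

lemma l2lim_scaleR: assumes F: "l2lim F f" shows "l2lim (\<lambda>k x. c *\<^sub>R F k x) (\<lambda>x. c *\<^sub>R f x)"
  unfolding l2lim_def
proof (intro conjI allI)
  have "nsq (\<lambda>x. c *\<^sub>R F k x - c *\<^sub>R f x) = c\<^sup>2 * nsq (\<lambda>x. F k x - f x)" for k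
    by (simp add: scaleR_diff_right[symmetric] nsq_scaleR)
  then show "(\<lambda>k. nsq (\<lambda>x. c *\<^sub>R F k x - c *\<^sub>R f x)) \<longlonglongrightarrow> 0"
    using tendsto_mult_left[OF l2limD(3)[OF F], of "c\<^sup>2"] by simp
qed (auto intro!: sq_int_scaleR l2limD[OF F])

lemma nsq_zero_iff: assumes "sq_int f" shows "nsq f = 0 \<longleftrightarrow> (AE x in lborel. f x = 0)"
  unfolding nsq_def using integral_nonneg_eq_0_iff_AE[OF sq_int_integrable[OF assms]] by auto

lemma l2lim_subseq: assumes "l2lim F f" "strict_mono r" shows "l2lim (\<lambda>k. F (r k)) f"
  using assms LIMSEQ_subseq_LIMSEQ[OF l2limD(3)[OF assms(1)] assms(2)] by (auto simp: l2lim_def o_def)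

lemma l2lim_AE_subseq:
  assumes F: "l2lim F f"
  obtains r :: "nat \<Rightarrow> nat" where "strict_mono r" "AE x in lborel. (\<lambda>k. F (r k) x) \<longlonglongrightarrow> f x"
proof -
  have "\<exists>r::nat\<Rightarrow>nat. strict_mono r \<and> (AE x in lborel. (\<lambda>n. (norm (F (r n) x - f x))\<^sup>2) \<longlonglongrightarrow> 0)"
    using l2limD(3)[OF F] sq_int_integrable[OF sq_int_diff[OF l2limD(1,2)[OF F]]]
    by (intro tendsto_L1_AE_subseq) (auto simp: nsq_def)
  then obtain r :: "nat \<Rightarrow> nat" where r: "strict_mono r" "AE x in lborel. (\<lambda>n. (norm (F (r n) x - f x))\<^sup>2) \<longlonglongrightarrow> 0"
    by blast
  from r(2) have "AE x in lborel. (\<lambda>k. F (r k) x) \<longlonglongrightarrow> f x"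
  proof eventually_elim
    case (elim x)
    from tendsto_real_sqrt[OF this] show ?case
      by (simp add: tendsto_norm_zero_iff LIM_zero_iff)
  qed
  with r(1) show ?thesis by (rule that)
qed

lemma l2lim_dominated:
  fixes F :: "nat \<Rightarrow> 'a::euclidean_space \<Rightarrow> 'b::euclidean_space" and w :: "'a \<Rightarrow> real"
  assumes [measurable]: "\<And>k. F k \<in> borel_measurable borel" "f \<in> borel_measurable borel"
    and w: "sq_int w" and lim: "AE x in lborel. (\<lambda>k. F k x) \<longlonglongrightarrow> f x"
    and bd: "\<And>k. AE x in lborel. norm (F k x) \<le> w x"
  shows "l2lim F f"
proof -
  have wi: "integrable lborel (\<lambda>x. (w x)\<^sup>2)" using sq_int_integrable[OF w] by simp
  have F: "sq_int (F k)" for k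
    using bd[of k] by (intro sq_int_bound[OF _ wi]) (auto elim!: eventually_mono intro: power_mono)
  have fb: "AE x in lborel. norm (f x) \<le> w x"
    using lim AE_all_countable[THEN iffD2, rule_format, of "\<lambda>k x. norm (F k x) \<le> w x" lborel, OF bd]
  proof eventually_elim
    case (elim x)
    show ?case by (rule LIMSEQ_le_const2[OF tendsto_norm[OF elim(1)]]) (use elim(2) in auto)
  qed
  then have f: "sq_int f"
    by (intro sq_int_bound[OF _ wi]) (auto elim!: eventually_mono intro: power_mono)
  have "(\<lambda>k. LINT x|lborel. (norm (F k x - f x))\<^sup>2) \<longlonglongrightarrow> (LINT x::'a|lborel. 0)"
  proof (rule integral_dominated_convergence[where w = "\<lambda>x. 4 * (w x)\<^sup>2"])
    show "AE x in lborel. (\<lambda>k. (norm (F k x - f x))\<^sup>2) \<longlonglongrightarrow> 0"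
      using lim by eventually_elim (auto intro!: tendsto_eq_intros simp: LIM_zero)
    show "AE x in lborel. norm ((norm (F k x - f x))\<^sup>2) \<le> 4 * (w x)\<^sup>2" for k
      using bd[of k] fb
    proof eventually_elim
      case (elim x)
      have "norm (F k x - f x) \<le> 2 * w x" using norm_triangle_ineq4[of "F k x" "f x"] elim by linarith
      from power_mono[OF this, of 2] show ?case by (simp add: power_mult_distrib)
    qed
  qed (use wi in auto)
  then show ?thesis using F f by (simp add: l2lim_def nsq_def)
qed

lemma sq_int_indicator_ball: "sq_int (\<lambda>x. C * indicator (cball 0 R) x :: real)"
proof -
  have "integrable lborel (\<lambda>x. indicator (cball 0 R) x * C\<^sup>2 :: real)"
    by (intro integrable_mult_left integrable_real_indicator) (auto simp: emeasure_lborel_cball_finite[unfolded infinity_ennreal_def])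
  moreover have "(norm (C * indicator (cball 0 R) x :: real))\<^sup>2 = indicator (cball 0 R) x * C\<^sup>2" for x :: 'a
    by (simp add: indicator_def)
  moreover have "(\<lambda>x. C * indicator (cball 0 R) x :: real) \<in> borel_measurable borel"
    by (intro borel_measurable_times borel_measurable_const borel_measurable_indicator borel_closed closed_cball)
  ultimately show ?thesis unfolding sq_int_def by (simp only: simp_thms)
qed

lemma sq_int_compact_support:
  fixes g :: "'a::euclidean_space \<Rightarrow> 'b::euclidean_space"
  assumes g: "continuous_on UNIV g" and K: "compact K" "\<And>x. x \<notin> K \<Longrightarrow> g x = 0"
  shows "sq_int g"
proof -
  have "integrable lborel (\<lambda>x. (norm (g x))\<^sup>2)"
    by (rule integrable_compact_support[OF _ K(1)]) (auto intro!: continuous_intros g simp: K)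
  then show ?thesis by (simp add: sq_int_def borel_measurable_continuous_onI g)
qed

text \<open>Riesz-Fischer. Along a fast subsequence the differences are small enough for convergence
  almost everywhere; Fatou then gives mean-square convergence of the whole sequence to that
  limit.\<close>

lemma l2_complete:
  fixes F :: "nat \<Rightarrow> 'a::euclidean_space \<Rightarrow> 'b::euclidean_space"
  assumes F: "\<And>k. sq_int (F k)"
    and cauchy: "\<And>e. e > 0 \<Longrightarrow> \<exists>N. \<forall>m\<ge>N. \<forall>n\<ge>N. nsq (\<lambda>x. F m x - F n x) < e"
  obtains f where "l2lim F f"
proof -
  have [measurable]: "F k \<in> borel_measurable borel" for k using F by (simp add: sq_int_def)
  \<comment> \<open>The rate 1/8 serves two purposes: weighted by 4^k the squared norms of the
    differences are still summable, and finiteness of the weighted sum at a point makes the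
    differences there decay like 2^(-k).\<close>
  have "\<exists>r. \<forall>k. (\<forall>m\<ge>r k. \<forall>n\<ge>r k. nsq (\<lambda>x. F m x - F n x) < (1/8)^k) \<and> r k < r (Suc k)"
  proof (rule dependent_nat_choice)
    show "\<exists>N. \<forall>m\<ge>N. \<forall>n\<ge>N. nsq (\<lambda>x. F m x - F n x) < (1/8)^0" using cauchy[of 1] by simp
    fix N :: nat and k
    obtain N' where "\<forall>m\<ge>N'. \<forall>n\<ge>N'. nsq (\<lambda>x. F m x - F n x) < (1/8)^Suc k"
      using cauchy[of "(1/8)^Suc k"] by auto
    then show "\<exists>y. (\<forall>m\<ge>y. \<forall>n\<ge>y. nsq (\<lambda>x. F m x - F n x) < (1/8)^Suc k) \<and> N < y"
      by (intro exI[of _ "max N' (Suc N)"]) auto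
  qed
  then obtain r where r: "\<And>k m n. m \<ge> r k \<Longrightarrow> n \<ge> r k \<Longrightarrow> nsq (\<lambda>x. F m x - F n x) < (1/8)^k"
      and rs: "\<And>k. r k < r (Suc k)" by blast
  define D where "D = (\<lambda>k x. F (r (Suc k)) x - F (r k) x)"
  have D: "sq_int (D k)" for k unfolding D_def by (intro sq_int_diff F)
  have [measurable]: "D k \<in> borel_measurable borel" for k using D by (simp add: sq_int_def)
  have nnD: "(\<integral>\<^sup>+x. ennreal (4 ^ k * (norm (D k x))\<^sup>2) \<partial>lborel) \<le> ennreal ((1/2)^k)" for k
  proof -
    have "(\<integral>\<^sup>+x. ennreal (4 ^ k * (norm (D k x))\<^sup>2) \<partial>lborel) = ennreal (4 ^ k * nsq (D k))"
      unfolding nsq_def using sq_int_integrable[OF D]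
      by (subst nn_integral_eq_integral) auto
    also have "4 ^ k * nsq (D k) \<le> 4 ^ k * (1/8)^k"
      using r[of k "r (Suc k)" "r k"] rs[of k] by (intro mult_left_mono) (auto simp: D_def)
    also have "4 ^ k * (1/8)^k = (1/2::real)^k" by (simp add: power_mult_distrib[symmetric])
    finally show ?thesis by (simp add: ennreal_leI)
  qed
  have "(\<integral>\<^sup>+x. (\<Sum>k. ennreal (4 ^ k * (norm (D k x))\<^sup>2)) \<partial>lborel) =
      (\<Sum>k. \<integral>\<^sup>+x. ennreal (4 ^ k * (norm (D k x))\<^sup>2) \<partial>lborel)"
    by (rule nn_integral_suminf) auto
  also have "\<dots> \<le> (\<Sum>k. ennreal ((1/2)^k))" using nnD by (intro suminf_le) auto
  also have "\<dots> = ennreal (\<Sum>k. (1/2)^k)" by (intro suminf_ennreal2) (auto intro: summable_geometric)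
  also have "\<dots> < \<infinity>" by simp
  finally have "AE x in lborel. (\<Sum>k. ennreal (4 ^ k * (norm (D k x))\<^sup>2)) \<noteq> \<infinity>"
    by (intro nn_integral_PInf_AE) auto
  then have conv: "AE x in lborel. convergent (\<lambda>k. F (r k) x)"
  proof eventually_elim
    case (elim x)
    define E where "E = (\<Sum>k. ennreal (4 ^ k * (norm (D k x))\<^sup>2))"
    have "E \<noteq> \<infinity>" using elim unfolding E_def .
    then obtain S where "E = ennreal S" and S0: "S \<ge> 0" by (cases E) auto
    then have S: "(\<Sum>k. ennreal (4 ^ k * (norm (D k x))\<^sup>2)) = ennreal S" unfolding E_def by blast
    have "norm (D k x) \<le> sqrt S * (1/2)^k" for k
    proof -
      have "ennreal (4 ^ k * (norm (D k x))\<^sup>2) \<le> ennreal S"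
        using sum_le_suminf[of "\<lambda>k. ennreal (4 ^ k * (norm (D k x))\<^sup>2)" "{k}"] unfolding S by simp
      then have "4 ^ k * (norm (D k x))\<^sup>2 \<le> S" using S0 by (simp only: ennreal_le_iff)
      moreover have "(4::real) ^ k = (2 ^ k)\<^sup>2" by (simp add: power2_eq_square power_mult_distrib[symmetric])
      ultimately have "(2 ^ k * norm (D k x))\<^sup>2 \<le> S" by (simp only: power_mult_distrib)
      then have "2 ^ k * norm (D k x) \<le> sqrt S" by (rule real_le_rsqrt)
      then show ?thesis by (simp add: field_simps power_divide)
    qed
    moreover have "summable (\<lambda>k. sqrt S * (1/2)^k)" by (intro summable_mult summable_geometric) simp
    ultimately have "summable (\<lambda>k. D k x)" by (meson summable_comparison_test')
    then have "convergent (\<lambda>m. F (r 0) x + (\<Sum>k<m. D k x))"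
      by (intro convergent_add convergent_const) (simp add: summable_iff_convergent)
    then show ?case unfolding D_def sum_lessThan_telescope[of "\<lambda>k. F (r k) x"] by simp
  qed
  define f where "f x = lim (\<lambda>k. F (r k) x)" for x
  have fm[measurable]: "f \<in> borel_measurable borel"
    unfolding f_def by (rule borel_measurable_lim_metric) auto
  have flim: "AE x in lborel. (\<lambda>k. F (r k) x) \<longlonglongrightarrow> f x"
    using conv by eventually_elim (simp add: f_def convergent_LIMSEQ_iff)
  have fatou: "(\<integral>\<^sup>+x. ennreal ((norm (F n x - f x))\<^sup>2) \<partial>lborel) \<le> ennreal ((1/8)^j)" if n: "n \<ge> r j" for n j
  proof -
    have "(\<integral>\<^sup>+x. ennreal ((norm (F n x - f x))\<^sup>2) \<partial>lborel) =
        (\<integral>\<^sup>+x. liminf (\<lambda>k. ennreal ((norm (F n x - F (r k) x))\<^sup>2)) \<partial>lborel)"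
    proof (rule nn_integral_cong_AE, use flim in eventually_elim)
      case (elim x)
      have "(\<lambda>k. ennreal ((norm (F n x - F (r k) x))\<^sup>2)) \<longlonglongrightarrow> ennreal ((norm (F n x - f x))\<^sup>2)"
        by (intro tendsto_ennrealI tendsto_intros elim)
      from lim_imp_Liminf[OF trivial_limit_sequentially this] show ?case by (rule sym)
    qed
    also have "\<dots> \<le> liminf (\<lambda>k. \<integral>\<^sup>+x. ennreal ((norm (F n x - F (r k) x))\<^sup>2) \<partial>lborel)"
      by (intro nn_integral_liminf) auto
    also have "\<dots> \<le> ennreal ((1/8)^j)"
    proof (rule Liminf_le)
      show "\<forall>\<^sub>F k in sequentially. (\<integral>\<^sup>+x. ennreal ((norm (F n x - F (r k) x))\<^sup>2) \<partial>lborel) \<le> ennreal ((1/8)^j)"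
        using eventually_ge_at_top[of j]
      proof eventually_elim
        case (elim k)
        have "r j \<le> r k" using elim rs by (simp add: lift_Suc_mono_le less_imp_le)
        then have "nsq (\<lambda>x. F n x - F (r k) x) < (1/8)^j" using r n by blast
        then show ?case using sq_int_integrable[OF sq_int_diff[OF F F]]
          by (subst nn_integral_eq_integral) (auto simp: nsq_def intro: ennreal_leI)
      qed
    qed simp
    finally show ?thesis .
  qed
  \<comment> \<open>Fatou controls only the difference to the limit; \<open>f\<close> itself is
    recovered as a difference of square-integrable functions.\<close>
  have d: "sq_int (\<lambda>x. F (r 0) x - f x)"
    unfolding sq_int_def using fatou[of 0 "r 0"]
    by (auto intro!: integrableI_bounded simp: less_top[symmetric] top_unique)
  have f: "sq_int f" using sq_int_diff[OF F[of "r 0"] d] by simp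
  have le: "nsq (\<lambda>x. F n x - f x) \<le> (1/8)^j" if "n \<ge> r j" for n j
    using fatou[OF that] sq_int_integrable[OF sq_int_diff[OF F f]]
    by (subst (asm) nn_integral_eq_integral) (auto simp: nsq_def)
  have "(\<lambda>n. nsq (\<lambda>x. F n x - f x)) \<longlonglongrightarrow> 0"
  proof (rule LIMSEQ_I)
    fix e :: real assume "e > 0"
    then obtain j where "(1/8::real)^j < e" using real_arch_pow_inv[of e "1/8"] by auto
    then have "\<forall>n\<ge>r j. norm (nsq (\<lambda>x. F n x - f x) - 0) < e" using le[of j]
      by (auto simp only: diff_zero real_norm_def abs_of_nonneg[OF nsq_nonneg] intro: le_less_trans)
    then show "\<exists>no. \<forall>n\<ge>no. norm (nsq (\<lambda>x. F n x - f x) - 0) < e" by blast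
  qed
  then show ?thesis using that F f unfolding l2lim_def by blast
qed

section \<open>The fundamental lemma of the calculus of variations\<close>

text \<open>Cutoffs supported in shrinking neighbourhoods of \<open>K\<close> converge pointwise to
  its indicator. They are dominated by the indicator of one compact neighbourhood \<open>K1\<close>,
  on which \<open>v\<close> is integrable.\<close>

lemma integral_compact_eq_0:
  fixes v :: "'a::euclidean_space \<Rightarrow> real"
  assumes U: "open U" and v[measurable]: "v \<in> borel_measurable borel"
    and loc: "\<And>K. compact K \<Longrightarrow> K \<subseteq> U \<Longrightarrow> set_integrable lborel K v"
    and test: "\<And>f. f \<in> test_functions U \<Longrightarrow> (LINT x|lborel. v x * f x) = 0"
    and K: "compact K" "K \<subseteq> U"
  shows "(LINT x:K|lborel. v x) = 0"
proof -
  obtain e where e: "e > 0" "(\<Union>x\<in>K. cball x e) \<subseteq> U"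
    using compact_subset_open_imp_cball_epsilon_subset[OF K(1) U K(2)] by blast
  define K1 where "K1 = {x + y |x y. x \<in> K \<and> y \<in> cball 0 e}"
  have cK1: "compact K1" unfolding K1_def by (intro compact_sums K compact_cball)
  have K1U: "K1 \<subseteq> U"
  proof
    fix z assume "z \<in> K1"
    then obtain x y where "z = x + y" "x \<in> K" "norm y \<le> e" unfolding K1_def by auto
    then have "z \<in> cball x e" by (simp add: dist_norm)
    then show "z \<in> U" using e(2) \<open>x \<in> K\<close> by blast
  qed
  define V where "V n = (\<Union>x\<in>K. ball x (e / real (Suc n)))" for n
  have V: "open (V n)" "K \<subseteq> V n" for n using e(1) by (auto simp: V_def)
  have VK1: "V n \<subseteq> K1" for n
  proof
    fix z assume "z \<in> V n"
    then obtain x where x: "x \<in> K" "dist x z < e / real (Suc n)" unfolding V_def by auto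
    have "e / real (Suc n) \<le> e" using e(1) by (simp add: divide_le_eq)
    then have "norm (z - x) \<le> e" using x(2) by (simp add: dist_norm norm_minus_commute)
    then show "z \<in> K1" unfolding K1_def using x(1) by (intro CollectI exI[of _ x] exI[of _ "z - x"]) auto
  qed
  have "\<exists>\<theta>. \<theta> \<in> test_functions (V n) \<and> (\<forall>x. 0 \<le> \<theta> x \<and> \<theta> x \<le> (1::real)) \<and> (\<forall>x\<in>K. \<theta> x = 1)" for n
    using cutoff_exists[OF K(1) V] by metis
  then obtain \<theta> where \<theta>: "\<And>n. \<theta> n \<in> test_functions (V n)" "\<And>n x. 0 \<le> \<theta> n x" "\<And>n x. \<theta> n x \<le> (1::real)" "\<And>n x. x \<in> K \<Longrightarrow> \<theta> n x = 1"
    by metis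
  have \<theta>0: "\<theta> n x = 0" if "x \<notin> V n" for n x
    using \<theta>(1)[of n] that by (auto elim!: test_functionsE)
  have m[measurable]: "\<theta> n \<in> borel_measurable borel" for n
    using \<theta>(1)[of n] by (auto elim!: test_functionsE intro: borel_measurable_continuous_onI smooth_continuous)
  have mK[measurable]: "K \<in> sets borel" "K1 \<in> sets borel" using K(1) cK1 by (auto simp: compact_imp_closed)
  have "(\<lambda>n. LINT x|lborel. v x * \<theta> n x) \<longlonglongrightarrow> (LINT x|lborel. indicator K x *\<^sub>R v x)"
  proof (rule integral_dominated_convergence[where w = "\<lambda>x. norm (indicator K1 x *\<^sub>R v x)"])
    show "integrable lborel (\<lambda>x. norm (indicator K1 x *\<^sub>R v x))"
      using loc[OF cK1 K1U] unfolding set_integrable_def by (rule integrable_norm)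
    show "AE x in lborel. norm (v x * \<theta> n x) \<le> norm (indicator K1 x *\<^sub>R v x)" for n
    proof (rule AE_I2)
      fix x
      show "norm (v x * \<theta> n x) \<le> norm (indicator K1 x *\<^sub>R v x)"
        using \<theta>0[of x n] \<theta>(2,3)[where n=n and x=x] VK1[of n] mult_left_mono[of "\<theta> n x" 1 "\<bar>v x\<bar>"]
        by (cases "x \<in> V n") (auto simp: abs_mult indicator_def)
    qed
    show "AE x in lborel. (\<lambda>n. v x * \<theta> n x) \<longlonglongrightarrow> indicator K x *\<^sub>R v x"
    proof (rule AE_I2)
      fix x
      show "(\<lambda>n. v x * \<theta> n x) \<longlonglongrightarrow> indicator K x *\<^sub>R v x"
      proof (cases "x \<in> K")
        case False
        have "open (- K)" using K(1) by (simp add: compact_imp_closed open_Compl)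
        then obtain d where d: "d > 0" "ball x d \<subseteq> - K" using False by (metis ComplI openE)
        obtain N where N: "e / real (Suc N) < d" using nat_approx_posE[of "d / e"] d e by (auto simp: field_simps)
        have "\<theta> n x = 0" if "n \<ge> N" for n
        proof (rule \<theta>0, rule notI)
          assume "x \<in> V n"
          then obtain y where y: "y \<in> K" "dist y x < e / real (Suc n)" unfolding V_def by auto
          have "e / real (Suc n) \<le> e / real (Suc N)" using that e(1) by (intro divide_left_mono) auto
          then have "y \<in> ball x d" using y(2) N by (simp add: dist_commute)
          then show False using d(2) y(1) by auto
        qed
        then have "(\<lambda>n. v x * \<theta> n x) \<longlonglongrightarrow> 0"
          by (intro tendsto_eventually) (auto simp: eventually_sequentially)
        then show ?thesis using False by simp
      qed (simp add: \<theta>(4))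
    qed
  qed auto
  moreover have "(LINT x|lborel. v x * \<theta> n x) = 0" for n
  proof (rule test)
    obtain K' where "smooth (\<theta> n)" "compact K'" "K' \<subseteq> V n" "\<And>x. x \<notin> K' \<Longrightarrow> \<theta> n x = 0"
      using \<theta>(1)[of n] by (rule test_functionsE) blast
    then show "\<theta> n \<in> test_functions U" using VK1[of n] K1U by (intro test_functionsI[of _ K']) auto
  qed
  ultimately show ?thesis by (simp add: set_lebesgue_integral_def LIMSEQ_const_iff)
qed

text \<open>Inner regularity: the part of \<open>U\<close> where \<open>v\<close> is positive is
  exhausted up to small measure by closed sets. Each of these is null, being a countable union of
  compact sets over which a positive function integrates to 0.\<close>

lemma AE_nonpos_if_integral_compact_eq_0:
  fixes v :: "'a::euclidean_space \<Rightarrow> real"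
  assumes U: "open U" and v[measurable]: "v \<in> borel_measurable borel"
    and loc: "\<And>K. compact K \<Longrightarrow> K \<subseteq> U \<Longrightarrow> set_integrable lborel K v"
    and int0: "\<And>K. compact K \<Longrightarrow> K \<subseteq> U \<Longrightarrow> (LINT x:K|lborel. v x) = 0"
  shows "AE x in lborel. x \<in> U \<longrightarrow> v x \<le> 0"
proof -
  define A where "A = {x. v x > 0} \<inter> U"
  have Am[measurable]: "A \<in> sets borel" unfolding A_def using U by measurable
  have null: "emeasure lborel T = 0" if T: "closed T" "T \<subseteq> A" for T
  proof -
    have "emeasure lborel (T \<inter> cball 0 (real n)) = 0" for n
    proof -
      let ?K = "T \<inter> cball 0 (real n)"
      have cK: "compact ?K" using T(1) by (intro closed_Int_compact) auto
      have KU: "?K \<subseteq> U" using T(2) A_def by auto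
      have [measurable]: "?K \<in> sets borel" using cK by (simp add: compact_imp_closed)
      have "AE x in lborel. indicator ?K x *\<^sub>R v x = 0"
        using int0[OF cK KU] loc[OF cK KU] T(2)
        unfolding set_lebesgue_integral_def set_integrable_def A_def
        by (subst integral_nonneg_eq_0_iff_AE[symmetric]) (auto simp: indicator_def subset_eq less_imp_le)
      then have "AE x in lborel. x \<notin> ?K"
        by eventually_elim (use T(2) in \<open>auto simp: A_def indicator_def\<close>)
      then show ?thesis by (subst (asm) AE_iff_measurable[of ?K]) auto
    qed
    then have "emeasure lborel (\<Union>n. T \<inter> cball 0 (real n)) = 0"
      using T(1) by (intro emeasure_UN_eq_0) auto
    moreover have "(\<Union>n. T \<inter> cball 0 (real n)) = T" using real_arch_simple by (auto simp: mem_cball)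
    ultimately show ?thesis by simp
  qed
  have le: "emeasure lborel A \<le> ennreal e" if e: "e > 0" for e
  proof -
    have "A \<in> sets lebesgue" by simp
    then obtain T where T: "closed T" "T \<subseteq> A" "emeasure lebesgue (A - T) < ennreal e"
      using sets_lebesgue_inner_closed[OF _ e] by metis
    have "emeasure lborel A \<le> emeasure lborel T + emeasure lborel (A - T)"
      using T(1) emeasure_subadditive[of T lborel "A - T"] T(2) by (simp add: Un_absorb1)
    also have "\<dots> \<le> ennreal e" using null[OF T(1,2)] T(1,3) by (simp add: emeasure_completion less_imp_le)
    finally show ?thesis .
  qed
  have "emeasure lborel A \<le> 0" by (rule ennreal_le_epsilon) (simp add: le)
  then have "AE x in lborel. x \<notin> A" by (subst AE_iff_measurable[of A]) auto
  then show ?thesis by eventually_elim (auto simp: A_def)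
qed

lemma fundamental_lemma:
  fixes v :: "'a::euclidean_space \<Rightarrow> real"
  assumes U: "open U" and v[measurable]: "v \<in> borel_measurable borel"
    and loc: "\<And>K. compact K \<Longrightarrow> K \<subseteq> U \<Longrightarrow> set_integrable lborel K v"
    and test: "\<And>f. f \<in> test_functions U \<Longrightarrow> (LINT x|lborel. v x * f x) = 0"
  shows "AE x in lborel. x \<in> U \<longrightarrow> v x = 0"
proof -
  note 0 = integral_compact_eq_0[OF assms]
  have "AE x in lborel. x \<in> U \<longrightarrow> v x \<le> 0"
    by (rule AE_nonpos_if_integral_compact_eq_0[OF U v loc 0])
  moreover have "AE x in lborel. x \<in> U \<longrightarrow> - v x \<le> 0"
    by (rule AE_nonpos_if_integral_compact_eq_0[OF U]) (use loc 0 in \<open>auto simp: set_integrable_def set_lebesgue_integral_def\<close>)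
  ultimately show ?thesis by eventually_elim auto
qed

lemma sq_int_set_integrable:
  fixes f :: "'a::euclidean_space \<Rightarrow> real"
  assumes "sq_int f" "compact K" shows "set_integrable lborel K f"
proof -
  obtain R where R: "K \<subseteq> cball 0 R" using compact_imp_bounded[OF assms(2)] unfolding bounded_iff subset_eq by auto
  have "integrable lborel (\<lambda>x. f x * (1 * indicator (cball 0 R) x))"
    by (rule sq_int_mult[OF assms(1) sq_int_indicator_ball])
  then have "set_integrable lborel (cball 0 R) f" by (simp add: set_integrable_def mult.commute)
  then show ?thesis by (rule set_integrable_subset) (use R assms(2) in \<open>auto simp: compact_imp_closed\<close>)
qed

section \<open>Gaussians and the Fourier transform\<close>

lemma lborel_integral_prod:
  fixes f :: "'a::euclidean_space \<Rightarrow> real \<Rightarrow> complex"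
  assumes "\<And>b. b \<in> Basis \<Longrightarrow> integrable lborel (f b)"
  shows "(LINT x|lborel. (\<Prod>b\<in>Basis. f b (x \<bullet> b))) = (\<Prod>b\<in>Basis. (LINT t|lborel. f b t))"
    and "integrable lborel (\<lambda>x::'a. \<Prod>b\<in>Basis. f b (x \<bullet> b))"
proof -
  interpret product_sigma_finite "\<lambda>_::'a. lborel :: real measure" ..
  have fm: "f b \<in> borel_measurable borel" if "b \<in> Basis" for b
    using borel_measurable_integrable[OF assms[OF that]] by simp
  have "(\<lambda>x::'a. f b (x \<bullet> b)) \<in> borel_measurable borel" if "b \<in> Basis" for b
    by (rule measurable_compose[OF borel_measurable_continuous_onI fm[OF that]]) (intro continuous_intros)
  then have m: "(\<lambda>x::'a. \<Prod>b\<in>Basis. f b (x \<bullet> b)) \<in> borel_measurable borel"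
    by (rule borel_measurable_prod)
  have e: "(\<Prod>b\<in>Basis. f b ((\<Sum>b\<in>Basis. g b *\<^sub>R b) \<bullet> b)) = (\<Prod>b\<in>Basis. f b (g b))" for g :: "'a \<Rightarrow> real"
    by (intro prod.cong refl) (simp add: inner_sum_left_Basis)
  show "(LINT x|lborel. (\<Prod>b\<in>Basis. f b (x \<bullet> b))) = (\<Prod>b\<in>Basis. (LINT t|lborel. f b t))"
    by (subst lborel_eq, subst integral_distr[OF _ m], simp, subst e)
      (intro product_integral_prod finite_Basis assms)
  show "integrable lborel (\<lambda>x::'a. \<Prod>b\<in>Basis. f b (x \<bullet> b))"
    by (subst lborel_eq, subst integrable_distr_eq[OF _ m], simp, subst e)
      (intro product_integrable_prod finite_Basis assms)
qed

text \<open>The characteristic function of the standard normal law at the point t / c, after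
  rescaling by \<open>c\<close>.\<close>

lemma gauss_1d:
  assumes c: "c > 0"
  shows "(LINT x|lborel. exp (- (c\<^sup>2 * x\<^sup>2) / 2) *\<^sub>R cis (t * x)) = of_real (sqrt (2 * pi) / c * exp (- (t\<^sup>2 / (2 * c\<^sup>2))))"
    and "integrable lborel (\<lambda>x. exp (- (c\<^sup>2 * x\<^sup>2) / 2) *\<^sub>R cis (t * x))"
proof -
  have i: "integrable lborel (\<lambda>x. std_normal_density (0 + c * x))"
    using c by (intro lborel_integrable_real_affine integrable_normal_density) auto
  have e: "exp (- (c\<^sup>2 * x\<^sup>2) / 2) = sqrt (2 * pi) * std_normal_density (0 + c * x)" for x
    by (simp add: std_normal_density_def power_mult_distrib)
  have ie: "integrable lborel (\<lambda>x. exp (- (c\<^sup>2 * x\<^sup>2) / 2))"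
    unfolding e using i by (intro integrable_mult_right)
  have [measurable]: "cis \<in> borel_measurable borel"
    by (intro borel_measurable_continuous_onI continuous_intros)
  show "integrable lborel (\<lambda>x. exp (- (c\<^sup>2 * x\<^sup>2) / 2) *\<^sub>R cis (t * x))"
    by (rule integrable_scaleR_bounded[OF ie, of _ 1]) (auto intro!: measurable_compose[OF _ \<open>cis \<in> _\<close>])
  have "of_real (exp (- ((t / c)\<^sup>2) / 2)) = char std_normal_distribution (t / c)"
    by (simp add: char_std_normal_distribution)
  also have "\<dots> = (LINT x|lborel. std_normal_density x *\<^sub>R iexp (t / c * x))"
    unfolding char_def by (subst integral_density) (auto simp: mult.assoc)
  also have "\<dots> = \<bar>c\<bar> *\<^sub>R (LINT x|lborel. std_normal_density (0 + c * x) *\<^sub>R iexp (t / c * (0 + c * x)))"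
    using c by (intro lborel_integral_real_affine) auto
  also have "(LINT x|lborel. std_normal_density (0 + c * x) *\<^sub>R iexp (t / c * (0 + c * x))) =
      (LINT x|lborel. (1 / sqrt (2 * pi)) *\<^sub>R (exp (- (c\<^sup>2 * x\<^sup>2) / 2) *\<^sub>R cis (t * x)))"
    unfolding e using c by (intro Bochner_Integration.integral_cong refl) (simp add: cis_conv_exp)
  also have "\<bar>c\<bar> *\<^sub>R \<dots> = (c / sqrt (2 * pi)) *\<^sub>R (LINT x|lborel. exp (- (c\<^sup>2 * x\<^sup>2) / 2) *\<^sub>R cis (t * x))"
    unfolding integral_scaleR_right using c by simp
  finally have "of_real (exp (- ((t / c)\<^sup>2) / 2)) = (c / sqrt (2 * pi)) *\<^sub>R (LINT x|lborel. exp (- (c\<^sup>2 * x\<^sup>2) / 2) *\<^sub>R cis (t * x))" .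
  then have "(sqrt (2 * pi) / c) *\<^sub>R (of_real (exp (- ((t / c)\<^sup>2) / 2)) :: complex) = (LINT x|lborel. exp (- (c\<^sup>2 * x\<^sup>2) / 2) *\<^sub>R cis (t * x))"
    using c by simp
  then show "(LINT x|lborel. exp (- (c\<^sup>2 * x\<^sup>2) / 2) *\<^sub>R cis (t * x)) = of_real (sqrt (2 * pi) / c * exp (- (t\<^sup>2 / (2 * c\<^sup>2))))"
    by (simp add: power_divide scaleR_conv_of_real mult.commute)
qed

text \<open>The density of the centred normal law with covariance c^2 times the identity. It is an
  approximate identity as c tends to 0 and, up to the factor (2 pi)^n, the Fourier integral of
  exp(-c^2 |x|^2 / 2).\<close>

definition gauss :: "real \<Rightarrow> 'a::euclidean_space \<Rightarrow> real" where
  "gauss c z = (1 / (c * sqrt (2 * pi))) ^ DIM('a) * exp (- ((norm z)\<^sup>2 / (2 * c\<^sup>2)))"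

lemma norm_sq_sum_Basis: "(norm (x::'a::euclidean_space))\<^sup>2 = (\<Sum>b\<in>Basis. (x \<bullet> b)\<^sup>2)"
  unfolding power2_norm_eq_inner by (subst euclidean_inner) (simp add: power2_eq_square)

text \<open>The integrand is a product over the coordinates, and the one-dimensional formula applies
  in each.\<close>

lemma gauss_fourier:
  fixes z :: "'a::euclidean_space"
  assumes c: "c > 0"
  shows "(LINT x|lborel. exp (- (c\<^sup>2 * (norm x)\<^sup>2) / 2) *\<^sub>R cis (z \<bullet> x)) = of_real ((2 * pi) ^ DIM('a) * gauss c z)"
    and "integrable lborel (\<lambda>x::'a. exp (- (c\<^sup>2 * (norm x)\<^sup>2) / 2) *\<^sub>R cis (z \<bullet> x))"
proof -
  let ?f = "\<lambda>b t. exp (- (c\<^sup>2 * t\<^sup>2) / 2) *\<^sub>R cis ((z \<bullet> b) * t)"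
  have polar: "exp a *\<^sub>R cis t = exp (of_real a + \<i> * of_real t)" for a t :: real
    by (simp add: exp_eq_polar scaleR_conv_of_real)
  have e: "exp (- (c\<^sup>2 * (norm x)\<^sup>2) / 2) *\<^sub>R cis (z \<bullet> x) = (\<Prod>b\<in>Basis. ?f b (x \<bullet> b))" for x :: 'a
  proof -
    have "(\<Prod>b\<in>Basis. ?f b (x \<bullet> b)) = (\<Prod>b\<in>Basis. exp (of_real (- (c\<^sup>2 * (x \<bullet> b)\<^sup>2) / 2) + \<i> * of_real ((z \<bullet> b) * (x \<bullet> b))))"
      by (simp only: polar)
    also have "\<dots> = exp (\<Sum>b\<in>Basis. of_real (- (c\<^sup>2 * (x \<bullet> b)\<^sup>2) / 2) + \<i> * of_real ((z \<bullet> b) * (x \<bullet> b)))"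
      by (simp add: exp_sum)
    also have "(\<Sum>b\<in>Basis. of_real (- (c\<^sup>2 * (x \<bullet> b)\<^sup>2) / 2) + \<i> * of_real ((z \<bullet> b) * (x \<bullet> b))) =
        of_real (- (c\<^sup>2 * (norm x)\<^sup>2) / 2) + \<i> * of_real (z \<bullet> x)"
      unfolding norm_sq_sum_Basis euclidean_inner[of z x]
      by (simp add: sum.distrib sum_distrib_left sum_divide_distrib sum_negf sum_subtractf)
    finally show ?thesis by (simp only: polar)
  qed
  show "integrable lborel (\<lambda>x::'a. exp (- (c\<^sup>2 * (norm x)\<^sup>2) / 2) *\<^sub>R cis (z \<bullet> x))"
    unfolding e by (rule lborel_integral_prod(2)) (rule gauss_1d(2)[OF c])
  have "(LINT x|lborel. exp (- (c\<^sup>2 * (norm x)\<^sup>2) / 2) *\<^sub>R cis (z \<bullet> x)) =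
      (\<Prod>b\<in>Basis. of_real (sqrt (2 * pi) / c * exp (- ((z \<bullet> b)\<^sup>2 / (2 * c\<^sup>2)))))"
    unfolding e by (subst lborel_integral_prod(1)) (auto simp only: gauss_1d[OF c])
  also have "\<dots> = of_real ((sqrt (2 * pi) / c) ^ DIM('a) * exp (\<Sum>b\<in>Basis. - ((z \<bullet> b)\<^sup>2 / (2 * c\<^sup>2))))"
    by (simp add: prod.distrib exp_sum del: times_divide_eq_left)
  also have "(\<Sum>b\<in>Basis. - ((z \<bullet> b)\<^sup>2 / (2 * c\<^sup>2))) = - ((norm z)\<^sup>2 / (2 * c\<^sup>2))"
    unfolding norm_sq_sum_Basis by (simp add: sum_negf sum_divide_distrib)
  also have "(sqrt (2 * pi) / c) ^ DIM('a) = (2 * pi) ^ DIM('a) * (1 / (c * sqrt (2 * pi))) ^ DIM('a)"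
    unfolding power_mult_distrib[symmetric] using c
    by (intro arg_cong[where f = "\<lambda>x. x ^ _"]) (simp add: field_simps)
  finally show "(LINT x|lborel. exp (- (c\<^sup>2 * (norm x)\<^sup>2) / 2) *\<^sub>R cis (z \<bullet> x)) = of_real ((2 * pi) ^ DIM('a) * gauss c z)"
    by (simp add: gauss_def mult.assoc)
qed

lemma gauss_fourier_cos:
  fixes z :: "'a::euclidean_space"
  assumes c: "c > 0"
  shows "(LINT x|lborel. exp (- (c\<^sup>2 * (norm x)\<^sup>2) / 2) * cos (z \<bullet> x)) = (2 * pi) ^ DIM('a) * gauss c z"
    and "integrable lborel (\<lambda>x::'a. exp (- (c\<^sup>2 * (norm x)\<^sup>2) / 2))"
proof -
  have "Re (LINT x|lborel. exp (- (c\<^sup>2 * (norm x)\<^sup>2) / 2) *\<^sub>R cis (z \<bullet> x)) = (2 * pi) ^ DIM('a) * gauss c z"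
    unfolding gauss_fourier(1)[OF c] by simp
  then show "(LINT x|lborel. exp (- (c\<^sup>2 * (norm x)\<^sup>2) / 2) * cos (z \<bullet> x)) = (2 * pi) ^ DIM('a) * gauss c z"
    by (subst (asm) integral_Re[OF gauss_fourier(2)[OF c], symmetric]) simp
  show "integrable lborel (\<lambda>x::'a. exp (- (c\<^sup>2 * (norm x)\<^sup>2) / 2))"
    using integrable_Re[OF gauss_fourier(2)[OF c, of 0]] by simp
qed

lemma gauss_measurable[measurable]: "gauss c \<in> borel_measurable borel"
  unfolding gauss_def by measurable

lemma gauss_nonneg: "c > 0 \<Longrightarrow> 0 \<le> gauss c z"
  by (simp add: gauss_def)

lemma gauss_integral:
  assumes c: "c > 0"
  shows "integrable lborel (gauss c :: 'a::euclidean_space \<Rightarrow> real)" "(LINT x|lborel. gauss c (x::'a)) = 1"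
proof -
  have e: "gauss c z = (1 / (c * sqrt (2 * pi))) ^ DIM('a) * exp (- ((1 / c)\<^sup>2 * (norm z)\<^sup>2) / 2)" for z :: 'a
    by (simp add: gauss_def power_divide)
  show "integrable lborel (gauss c :: 'a \<Rightarrow> real)"
    unfolding e using gauss_fourier_cos(2)[of "1 / c"] c by (intro integrable_mult_right) auto
  have "(LINT x|lborel. gauss c (x::'a)) = (1 / (c * sqrt (2 * pi))) ^ DIM('a) * ((2 * pi) ^ DIM('a) * gauss (1 / c) (0::'a))"
    unfolding e using gauss_fourier_cos(1)[of "1 / c" "0::'a"] c by simp
  also have "\<dots> = (1 / (c * sqrt (2 * pi)) * (2 * pi) * (1 / (1 / c * sqrt (2 * pi)))) ^ DIM('a)"
    by (simp add: gauss_def power_mult_distrib power_divide)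
  also have "1 / (c * sqrt (2 * pi)) * (2 * pi) * (1 / (1 / c * sqrt (2 * pi))) = 1"
    using c by (simp add: field_simps)
  finally show "(LINT x|lborel. gauss c (x::'a)) = 1" by simp
qed

lemma gauss_scale:
  assumes c: "c > 0" shows "c ^ DIM('a) * gauss c (c *\<^sub>R w) = gauss 1 (w::'a::euclidean_space)"
  using c by (simp add: gauss_def power_mult_distrib power_divide)

lemma integral_lborel_scale:
  fixes f :: "'a::euclidean_space \<Rightarrow> real"
  assumes [measurable]: "f \<in> borel_measurable borel" and c: "c > 0"
  shows "(LINT y|lborel. f y) = (LINT y|lborel. c ^ DIM('a) * f (c *\<^sub>R y))"
proof -
  have "(LINT y|lborel. f y) = (LINT y|density (distr lborel borel (\<lambda>x::'a. 0 + c *\<^sub>R x)) (\<lambda>_. ennreal (\<bar>c\<bar> ^ DIM('a))). f y)"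
    using lborel_affine[of c "0::'a"] c by simp
  also have "\<dots> = (LINT y|lborel. c ^ DIM('a) * f (c *\<^sub>R y))"
    using c by (subst integral_density) (auto simp: integral_distr)
  finally show ?thesis .
qed

text \<open>The substitution y = x - c w turns the kernel into the fixed density
  \<open>gauss 1\<close>; only the argument of \<open>g\<close> then depends on
  \<open>c\<close>.\<close>

lemma gauss_approximates:
  fixes g :: "'a::euclidean_space \<Rightarrow> real"
  assumes g: "continuous_on UNIV g" "\<And>x. \<bar>g x\<bar> \<le> C"
  shows "(\<lambda>m. LINT y|lborel. g y * gauss (1 / real (Suc m)) (x - y)) \<longlonglongrightarrow> g x"
proof -
  have [measurable]: "g \<in> borel_measurable borel" using g(1) by (rule borel_measurable_continuous_onI)
  have eq: "(LINT y|lborel. g y * gauss c (x - y)) = (LINT w|lborel. g (x - c *\<^sub>R w) * gauss 1 w)" if c: "c > 0" for c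
  proof -
    have "(LINT y|lborel. g y * gauss c (x - y)) = (LINT y|lborel. g (x - y) * gauss c y)"
      using integral_lborel_reflect(1)[of "\<lambda>y. g (x - y) * gauss c y" x] by simp
    also have "\<dots> = (LINT w|lborel. c ^ DIM('a) * (g (x - c *\<^sub>R w) * gauss c (c *\<^sub>R w)))"
      by (rule integral_lborel_scale) (use c in auto)
    also have "\<dots> = (LINT w|lborel. g (x - c *\<^sub>R w) * (c ^ DIM('a) * gauss c (c *\<^sub>R w)))"
      by (simp add: mult.left_commute)
    finally show ?thesis by (simp only: gauss_scale[OF c])
  qed
  have "(\<lambda>m. LINT w|lborel. g (x - (1 / real (Suc m)) *\<^sub>R w) * gauss 1 w) \<longlonglongrightarrow> (LINT w|lborel. g x * gauss 1 (w::'a))"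
  proof (rule integral_dominated_convergence[where w = "\<lambda>w. C * gauss 1 w"])
    show "integrable lborel (\<lambda>w::'a. C * gauss 1 w)" using gauss_integral(1)[of 1, where 'a='a] by simp
    show "AE w in lborel. (\<lambda>m. g (x - (1 / real (Suc m)) *\<^sub>R w) * gauss 1 w) \<longlonglongrightarrow> g x * gauss 1 w"
    proof (rule AE_I2)
      fix w :: 'a
      have "(\<lambda>m. x - (1 / real (Suc m)) *\<^sub>R w) \<longlonglongrightarrow> x - 0 *\<^sub>R w"
        by (intro tendsto_intros LIMSEQ_Suc lim_1_over_n)
      then have "(\<lambda>m. g (x - (1 / real (Suc m)) *\<^sub>R w)) \<longlonglongrightarrow> g x"
        using continuous_on_tendsto_compose[OF g(1)] by simp
      then show "(\<lambda>m. g (x - (1 / real (Suc m)) *\<^sub>R w) * gauss 1 w) \<longlonglongrightarrow> g x * gauss 1 w"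
        by (intro tendsto_intros)
    qed
    show "AE w in lborel. norm (g (x - (1 / real (Suc m)) *\<^sub>R w) * gauss 1 w) \<le> C * gauss 1 w" for m
      using g(2) gauss_nonneg[of 1, where 'a='a] by (intro AE_I2) (auto simp: abs_mult intro!: mult_right_mono)
  qed auto
  then show ?thesis using gauss_integral(2)[of 1, where 'a='a] by (simp add: eq del: of_nat_Suc)
qed

section \<open>The Fourier transform of integrable functions\<close>

lemma integrable_pair_mult:
  fixes a b :: "'a::euclidean_space \<Rightarrow> real"
  assumes a: "integrable lborel a" and b: "integrable lborel b"
  shows "integrable (lborel \<Otimes>\<^sub>M lborel) (\<lambda>(x, y). a x * b y)"
proof (rule lborel_pair.Fubini_integrable)
  have [measurable]: "a \<in> borel_measurable borel" "b \<in> borel_measurable borel"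
    using borel_measurable_integrable[OF a] borel_measurable_integrable[OF b] by auto
  show "(\<lambda>(x, y). a x * b y) \<in> borel_measurable (lborel \<Otimes>\<^sub>M lborel)" by measurable
  show "integrable lborel (\<lambda>x. LINT y|lborel. norm (case (x, y) of (x, y) \<Rightarrow> a x * b y))"
    using a by (simp add: abs_mult)
  show "AE x in lborel. integrable lborel (\<lambda>y. case (x, y) of (x, y) \<Rightarrow> a x * b y)"
    using b by simp
qed

lemma integrable_pair_conv:
  fixes a b :: "'a::euclidean_space \<Rightarrow> real"
  assumes a: "integrable lborel a" and b: "integrable lborel b"
  shows "integrable (lborel \<Otimes>\<^sub>M lborel) (\<lambda>(y, x). a y * b (x - y))"
proof (rule lborel_pair.Fubini_integrable)
  have m[measurable]: "a \<in> borel_measurable borel" "b \<in> borel_measurable borel"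
    using borel_measurable_integrable[OF a] borel_measurable_integrable[OF b] by auto
  show "(\<lambda>(y, x). a y * b (x - y)) \<in> borel_measurable (lborel \<Otimes>\<^sub>M lborel)" by measurable
  have s: "(LINT x|lborel. \<bar>b (x - y)\<bar>) = (LINT x|lborel. \<bar>b x\<bar>)" "integrable lborel (\<lambda>x. b (x - y))" for y
    using integral_lborel_shift[of "\<lambda>x. \<bar>b x\<bar>" "-y"] integral_lborel_shift[of b "-y"] b by (simp_all add: algebra_simps)
  show "integrable lborel (\<lambda>y. LINT x|lborel. norm (case (y, x) of (y, x) \<Rightarrow> a y * b (x - y)))"
    using a by (simp add: abs_mult s)
  show "AE y in lborel. integrable lborel (\<lambda>x. case (y, x) of (y, x) \<Rightarrow> a y * b (x - y))"
    using s by simp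
qed

text \<open>The normalisation is the unitary one of \<open>fourier\<close>, so that Parseval holds
  without a constant. Values are paired by the real inner product of the complex plane, that is, the
  real part of the Hermitian product.\<close>

definition ft :: "('a::euclidean_space \<Rightarrow> real) \<Rightarrow> 'a \<Rightarrow> complex" where
  "ft u \<xi> = ((2 * pi) powr (- real DIM('a) / 2)) *\<^sub>R (LINT x|lborel. u x *\<^sub>R cis (- (x \<bullet> \<xi>)))"

lemma cis_measurable[measurable]: "cis \<in> borel_measurable borel"
  by (intro borel_measurable_continuous_onI continuous_intros)

lemma ft_measurable[measurable]:
  assumes [measurable]: "u \<in> borel_measurable borel" shows "ft u \<in> borel_measurable borel"
  unfolding ft_def by measurable

lemma ft_integrable: "integrable lborel u \<Longrightarrow> integrable lborel (\<lambda>x. u x *\<^sub>R cis (- (x \<bullet> \<xi>)))"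
  by (rule integrable_scaleR_bounded[of _ _ _ 1]) auto

lemma ft_const_sq: "((2 * pi) powr (- real DIM('a::euclidean_space) / 2))\<^sup>2 * (2 * pi) ^ DIM('a) = 1"
proof -
  have "((2 * pi) powr (- real DIM('a) / 2))\<^sup>2 * (2 * pi) powr (real DIM('a)) = 1"
    unfolding power2_eq_square powr_add[symmetric] by simp
  then show ?thesis by (simp add: powr_realpow)
qed

lemma ft_bound:
  assumes u: "integrable lborel u"
  shows "norm (ft u \<xi>) \<le> (2 * pi) powr (- real DIM('a) / 2) * (LINT x|lborel. \<bar>u (x::'a::euclidean_space)\<bar>)"
  unfolding ft_def norm_scaleR using integral_norm_bound[of lborel "\<lambda>x. u x *\<^sub>R cis (- (x \<bullet> \<xi>))"]
  by (intro mult_mono) auto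

lemma ft_add: "integrable lborel u \<Longrightarrow> integrable lborel v \<Longrightarrow> ft (\<lambda>x. u x + v x) \<xi> = ft u \<xi> + ft v \<xi>"
  by (simp add: ft_def scaleR_add_left ft_integrable scaleR_add_right)

lemma ft_cmult: "ft (\<lambda>x. c * u x) \<xi> = c *\<^sub>R ft u \<xi>"
  by (simp only: ft_def scaleR_scaleR[symmetric] integral_scaleR_right scaleR_left_commute)

text \<open>The Gaussian weight makes all integrals absolutely convergent, so the frequency integral
  may be done first and produces the Gaussian kernel. Only cosines occur because the real inner
  product keeps the real part of the oscillating factor.\<close>

lemma ft_gauss_pairing:
  fixes f g :: "'a::euclidean_space \<Rightarrow> real"
  assumes f: "integrable lborel f" and g: "integrable lborel g" and c: "c > 0"
  shows "(LINT \<xi>|lborel. exp (- (c\<^sup>2 * (norm \<xi>)\<^sup>2) / 2) * (ft f \<xi> \<bullet> ft g \<xi>)) =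
    (LINT x|lborel. f x * (LINT y|lborel. g y * gauss c (x - y)))"
proof -
  have [measurable]: "f \<in> borel_measurable borel" "g \<in> borel_measurable borel"
    using borel_measurable_integrable[OF f] borel_measurable_integrable[OF g] by auto
  define E where "E \<xi> = exp (- (c\<^sup>2 * (norm \<xi>)\<^sup>2) / 2)" for \<xi> :: 'a
  have E: "integrable lborel E" unfolding E_def by (rule gauss_fourier_cos(2)[OF c])
  have [measurable]: "E \<in> borel_measurable borel" using borel_measurable_integrable[OF E] by simp
  define k where "k = ((2 * pi) powr (- real DIM('a) / 2))\<^sup>2"
  define I where "I x \<xi> = (LINT y|lborel. g y * cos ((x - y) \<bullet> \<xi>))" for x \<xi> :: 'a
  have gi: "integrable lborel (\<lambda>y. g y * cos ((x - y) \<bullet> \<xi>))" for x \<xi>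
    using integrable_scaleR_bounded[OF g, of "\<lambda>y. cos ((x - y) \<bullet> \<xi>)" 1] by simp
  have mI[measurable]: "(\<lambda>(x, \<xi>). I x \<xi>) \<in> borel_measurable (lborel \<Otimes>\<^sub>M lborel)" unfolding I_def by measurable
  have mI2[measurable]: "(\<lambda>x. I x \<xi>) \<in> borel_measurable borel" "(\<lambda>\<xi>. I x \<xi>) \<in> borel_measurable borel" for x \<xi>
    unfolding I_def by measurable
  have Ib: "\<bar>I x \<xi>\<bar> \<le> (LINT y|lborel. \<bar>g y\<bar>)" for x \<xi>
  proof -
    have "\<bar>I x \<xi>\<bar> \<le> (LINT y|lborel. \<bar>g y * cos ((x - y) \<bullet> \<xi>)\<bar>)" unfolding I_def by (rule integral_abs_bound)
    also have "\<dots> \<le> (LINT y|lborel. \<bar>g y\<bar>)"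
    proof (rule integral_mono)
      show "\<bar>g y * cos ((x - y) \<bullet> \<xi>)\<bar> \<le> \<bar>g y\<bar>" for y
        using mult_left_mono[OF abs_cos_le_one, of "\<bar>g y\<bar>" "(x - y) \<bullet> \<xi>"] by (simp add: abs_mult)
    qed (use g gi in auto)
    finally show ?thesis .
  qed
  have ip: "ft f \<xi> \<bullet> ft g \<xi> = k * (LINT x|lborel. f x * I x \<xi>)" for \<xi>
  proof -
    have "(LINT x|lborel. f x *\<^sub>R cis (- (x \<bullet> \<xi>))) \<bullet> (LINT y|lborel. g y *\<^sub>R cis (- (y \<bullet> \<xi>))) =
        (LINT x|lborel. (f x *\<^sub>R cis (- (x \<bullet> \<xi>))) \<bullet> (LINT y|lborel. g y *\<^sub>R cis (- (y \<bullet> \<xi>))))"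
      by (subst integral_inner_left) (auto intro: ft_integrable f)
    also have "\<dots> = (LINT x|lborel. f x * I x \<xi>)"
    proof (rule Bochner_Integration.integral_cong[OF refl])
      fix x
      have "(f x *\<^sub>R cis (- (x \<bullet> \<xi>))) \<bullet> (LINT y|lborel. g y *\<^sub>R cis (- (y \<bullet> \<xi>))) =
          (LINT y|lborel. (f x *\<^sub>R cis (- (x \<bullet> \<xi>))) \<bullet> (g y *\<^sub>R cis (- (y \<bullet> \<xi>))))"
        by (subst integral_inner_right) (auto intro: ft_integrable g)
      also have "\<dots> = (LINT y|lborel. f x * (g y * cos ((x - y) \<bullet> \<xi>)))"
        by (intro Bochner_Integration.integral_cong refl) (simp add: inner_complex_def cos_diff inner_diff_left algebra_simps)
      finally show "(f x *\<^sub>R cis (- (x \<bullet> \<xi>))) \<bullet> (LINT y|lborel. g y *\<^sub>R cis (- (y \<bullet> \<xi>))) = f x * I x \<xi>"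
        by (simp add: I_def)
    qed
    finally show ?thesis by (simp add: ft_def k_def power2_eq_square mult.assoc)
  qed
  have "(LINT \<xi>|lborel. E \<xi> * (ft f \<xi> \<bullet> ft g \<xi>)) = k * (LINT \<xi>|lborel. LINT x|lborel. E \<xi> * f x * I x \<xi>)"
    unfolding ip by (simp add: mult.assoc mult.left_commute[of _ k])
  also have "(LINT \<xi>|lborel. LINT x|lborel. E \<xi> * f x * I x \<xi>) = (LINT x|lborel. LINT \<xi>|lborel. E \<xi> * f x * I x \<xi>)"
  proof (rule lborel_pair.Fubini_integral)
    show "integrable (lborel \<Otimes>\<^sub>M lborel) (\<lambda>(x, \<xi>). E \<xi> * f x * I x \<xi>)"
    proof (rule Bochner_Integration.integrable_bound)
      show "integrable (lborel \<Otimes>\<^sub>M lborel) (\<lambda>p. (LINT y|lborel. \<bar>g y\<bar>) * (case p of (x, \<xi>) \<Rightarrow> f x * E \<xi>))"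
        using integrable_pair_mult[OF f E] by (rule integrable_mult_right)
      have "\<bar>E \<xi> * f x * I x \<xi>\<bar> \<le> \<bar>(LINT y|lborel. \<bar>g y\<bar>) * (f x * E \<xi>)\<bar>" for x \<xi>
      proof -
        have "\<bar>E \<xi> * f x\<bar> * \<bar>I x \<xi>\<bar> \<le> \<bar>E \<xi> * f x\<bar> * \<bar>LINT y|lborel. \<bar>g y\<bar>\<bar>"
          using Ib[of x \<xi>] by (intro mult_left_mono) auto
        then show ?thesis by (simp only: abs_mult mult_ac)
      qed
      then show "AE p in lborel \<Otimes>\<^sub>M lborel. norm (case p of (x, \<xi>) \<Rightarrow> E \<xi> * f x * I x \<xi>)
          \<le> norm ((LINT y|lborel. \<bar>g y\<bar>) * (case p of (x, \<xi>) \<Rightarrow> f x * E \<xi>))"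
        by (intro AE_I2) (auto split: prod.split)
    qed measurable
  qed
  also have "\<dots> = (LINT x|lborel. f x * ((2 * pi) ^ DIM('a) * (LINT y|lborel. g y * gauss c (x - y))))"
  proof (rule Bochner_Integration.integral_cong[OF refl])
    fix x
    have "(LINT \<xi>|lborel. E \<xi> * I x \<xi>) = (LINT \<xi>|lborel. LINT y|lborel. E \<xi> * (g y * cos ((x - y) \<bullet> \<xi>)))"
      by (simp add: I_def)
    also have "\<dots> = (LINT y|lborel. LINT \<xi>|lborel. E \<xi> * (g y * cos ((x - y) \<bullet> \<xi>)))"
    proof (rule lborel_pair.Fubini_integral)
      show "integrable (lborel \<Otimes>\<^sub>M lborel) (\<lambda>(y, \<xi>). E \<xi> * (g y * cos ((x - y) \<bullet> \<xi>)))"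
      proof (rule Bochner_Integration.integrable_bound[OF integrable_pair_mult[OF g E]])
        have "\<bar>E \<xi> * (g y * cos ((x - y) \<bullet> \<xi>))\<bar> \<le> \<bar>g y * E \<xi>\<bar>" for y \<xi>
          using mult_left_mono[OF abs_cos_le_one, of "\<bar>E \<xi> * g y\<bar>" "(x - y) \<bullet> \<xi>"] by (simp add: abs_mult mult_ac)
        then show "AE p in lborel \<Otimes>\<^sub>M lborel. norm (case p of (y, \<xi>) \<Rightarrow> E \<xi> * (g y * cos ((x - y) \<bullet> \<xi>)))
            \<le> norm (case p of (y, \<xi>) \<Rightarrow> g y * E \<xi>)"
          by (intro AE_I2) (auto split: prod.split)
      qed measurable
    qed
    also have "\<dots> = (LINT y|lborel. g y * ((2 * pi) ^ DIM('a) * gauss c (x - y)))"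
      unfolding gauss_fourier_cos(1)[OF c, symmetric] E_def
      by (simp only: mult.left_commute[of "exp _"] integral_mult_right_zero)
    also have "\<dots> = (2 * pi) ^ DIM('a) * (LINT y|lborel. g y * gauss c (x - y))"
      by (simp only: mult.left_commute[of "g _"] integral_mult_right_zero)
    finally have "(LINT \<xi>|lborel. E \<xi> * I x \<xi>) = (2 * pi) ^ DIM('a) * (LINT y|lborel. g y * gauss c (x - y))" .
    then show "(LINT \<xi>|lborel. E \<xi> * f x * I x \<xi>) = f x * ((2 * pi) ^ DIM('a) * (LINT y|lborel. g y * gauss c (x - y)))"
      by (simp only: mult.commute[of "E _" "f x"] mult.assoc integral_mult_right_zero)
  qed
  also have "\<dots> = (2 * pi) ^ DIM('a) * (LINT x|lborel. f x * (LINT y|lborel. g y * gauss c (x - y)))"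
    by (simp only: mult.left_commute[of "f _"] integral_mult_right_zero)
  finally show ?thesis using ft_const_sq[where 'a='a] by (simp add: E_def k_def mult.assoc[symmetric])
qed

text \<open>With a Gaussian weight, the squared norm of the transform is a quadratic form in
  \<open>f\<close> with a symmetric kernel of total mass 1, at most \<open>nsq f\<close> by 2 a b
  \<le> a^2 + b^2. The weight is removed by Fatou.\<close>

lemma ft_Bessel:
  fixes f :: "'a::euclidean_space \<Rightarrow> real"
  assumes f: "integrable lborel f" "sq_int f"
  shows "sq_int (ft f)" "nsq (ft f) \<le> nsq f"
proof -
  have [measurable]: "f \<in> borel_measurable borel" using f(2) by simp
  have f2: "integrable lborel (\<lambda>x. (f x)\<^sup>2)" using sq_int_integrable[OF f(2)] by simp
  have bound: "(LINT \<xi>|lborel. exp (- (c\<^sup>2 * (norm \<xi>)\<^sup>2) / 2) * (norm (ft f \<xi>))\<^sup>2) \<le> nsq f" if c: "c > 0" for c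
  proof -
    let ?G = "\<lambda>z::'a. gauss c z"
    have G: "integrable lborel ?G" "(LINT x|lborel. ?G x) = 1" using gauss_integral[OF c] by auto
    have sy: "?G (x - y) = ?G (y - x)" for x y by (simp add: gauss_def norm_minus_commute)
    have sh: "(LINT x|lborel. ?G (x - y)) = 1" "integrable lborel (\<lambda>x. ?G (x - y))" for y
      using integral_lborel_shift[of ?G "-y"] G by (simp_all add: algebra_simps)
    have i1: "integrable (lborel \<Otimes>\<^sub>M lborel) (\<lambda>(y, x). (f y)\<^sup>2 * ?G (x - y))"
      by (rule integrable_pair_conv[OF f2 G(1)])
    have i2: "integrable (lborel \<Otimes>\<^sub>M lborel) (\<lambda>(x, y). (f y)\<^sup>2 * ?G (x - y))"
      using i1 by (subst (asm) lborel_pair.integrable_product_swap_iff[symmetric]) simp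
    have e1: "(LINT x|lborel. LINT y|lborel. (f x)\<^sup>2 * ?G (x - y)) = nsq f"
      using sh(1) by (simp add: nsq_def sy)
    have e2: "(LINT x|lborel. LINT y|lborel. (f y)\<^sup>2 * ?G (x - y)) = nsq f"
    proof -
      have "(LINT x|lborel. LINT y|lborel. (f y)\<^sup>2 * ?G (x - y)) = (LINT y|lborel. LINT x|lborel. (f y)\<^sup>2 * ?G (x - y))"
        by (rule lborel_pair.Fubini_integral[OF i1])
      then show ?thesis using sh(1) by (simp add: nsq_def)
    qed
    have j1: "integrable (lborel \<Otimes>\<^sub>M lborel) (\<lambda>(x, y). (f x)\<^sup>2 * ?G (x - y))" using i1 by (simp add: sy split_def)
    have ij: "integrable (lborel \<Otimes>\<^sub>M lborel) (\<lambda>p. (case p of (x, y) \<Rightarrow> (f x)\<^sup>2 * ?G (x - y)) + (case p of (x, y) \<Rightarrow> (f y)\<^sup>2 * ?G (x - y)))"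
      by (rule Bochner_Integration.integrable_add[OF j1 i2])
    have pw: "2 * \<bar>f x * (f y * ?G (x - y))\<bar> \<le> (f x)\<^sup>2 * ?G (x - y) + (f y)\<^sup>2 * ?G (x - y)" for x y
    proof -
      have "2 * (\<bar>f x\<bar> * \<bar>f y\<bar>) * ?G (x - y) \<le> ((f x)\<^sup>2 + (f y)\<^sup>2) * ?G (x - y)"
        using norm_mult_le_sq[of "f x" "f y"] gauss_nonneg[OF c] by (intro mult_right_mono) auto
      then show ?thesis using gauss_nonneg[OF c, of "x - y"] by (simp add: abs_mult algebra_simps)
    qed
    have k: "integrable (lborel \<Otimes>\<^sub>M lborel) (\<lambda>(x, y). f x * (f y * ?G (x - y)))"
    proof (rule Bochner_Integration.integrable_bound[OF ij])
      have "\<bar>f x * (f y * ?G (x - y))\<bar> \<le> \<bar>(f x)\<^sup>2 * ?G (x - y) + (f y)\<^sup>2 * ?G (x - y)\<bar>" for x y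
        using pw[of x y] by linarith
      then show "AE p in lborel \<Otimes>\<^sub>M lborel. norm (case p of (x, y) \<Rightarrow> f x * (f y * ?G (x - y))) \<le>
          norm ((case p of (x, y) \<Rightarrow> (f x)\<^sup>2 * ?G (x - y)) + (case p of (x, y) \<Rightarrow> (f y)\<^sup>2 * ?G (x - y)))"
        by (intro AE_I2) (auto split: prod.split)
    qed measurable
    have "(LINT \<xi>|lborel. exp (- (c\<^sup>2 * (norm \<xi>)\<^sup>2) / 2) * (norm (ft f \<xi>))\<^sup>2) =
        (LINT x|lborel. LINT y|lborel. f x * (f y * ?G (x - y)))"
      using ft_gauss_pairing[OF f(1) f(1) c] by (simp add: power2_norm_eq_inner)
    also have "\<dots> = integral\<^sup>L (lborel \<Otimes>\<^sub>M lborel) (\<lambda>(x, y). f x * (f y * ?G (x - y)))"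
      by (rule lborel_pair.integral_fst[OF k])
    also have "2 * \<dots> \<le> integral\<^sup>L (lborel \<Otimes>\<^sub>M lborel) (\<lambda>p. (case p of (x, y) \<Rightarrow> (f x)\<^sup>2 * ?G (x - y)) + (case p of (x, y) \<Rightarrow> (f y)\<^sup>2 * ?G (x - y)))"
      unfolding integral_mult_right_zero[symmetric]
    proof (rule integral_mono[OF integrable_mult_right[OF k] ij])
      fix p :: "'a \<times> 'a"
      show "2 * (case p of (x, y) \<Rightarrow> f x * (f y * ?G (x - y))) \<le> (case p of (x, y) \<Rightarrow> (f x)\<^sup>2 * ?G (x - y)) + (case p of (x, y) \<Rightarrow> (f y)\<^sup>2 * ?G (x - y))"
        using pw[of "fst p" "snd p"] by (simp add: split_def)
    qed
    also have "\<dots> = nsq f + nsq f"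
      unfolding Bochner_Integration.integral_add[OF j1 i2] lborel_pair.integral_fst[OF j1, symmetric]
        lborel_pair.integral_fst[OF i2, symmetric] e1 e2 ..
    finally show ?thesis by simp
  qed
  define C where "C = (2 * pi) powr (- real DIM('a) / 2) * (LINT x|lborel. \<bar>f x\<bar>)"
  have C: "norm (ft f \<xi>) \<le> C" for \<xi> unfolding C_def by (rule ft_bound[OF f(1)])
  have int: "integrable lborel (\<lambda>\<xi>. exp (- (c\<^sup>2 * (norm \<xi>)\<^sup>2) / 2) * (norm (ft f \<xi>))\<^sup>2)" if c: "c > 0" for c
    using integrable_scaleR_bounded[OF gauss_fourier_cos(2)[OF c], of "\<lambda>\<xi>. (norm (ft f \<xi>))\<^sup>2" "C\<^sup>2"] C
    by (simp add: power_mono)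
  define c where "c m = 1 / real (Suc m)" for m
  have cpos: "c m > 0" for m by (simp add: c_def)
  have "(\<integral>\<^sup>+\<xi>. ennreal ((norm (ft f \<xi>))\<^sup>2) \<partial>lborel) =
      (\<integral>\<^sup>+\<xi>. liminf (\<lambda>m. ennreal (exp (- ((c m)\<^sup>2 * (norm \<xi>)\<^sup>2) / 2) * (norm (ft f \<xi>))\<^sup>2)) \<partial>lborel)"
  proof (rule nn_integral_cong)
    fix \<xi> :: 'a
    have "(\<lambda>m. exp (- ((c m)\<^sup>2 * (norm \<xi>)\<^sup>2) / 2) * (norm (ft f \<xi>))\<^sup>2) \<longlonglongrightarrow> exp (- (0\<^sup>2 * (norm \<xi>)\<^sup>2) / 2) * (norm (ft f \<xi>))\<^sup>2"
      unfolding c_def by (intro tendsto_intros LIMSEQ_Suc lim_1_over_n) auto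
    then have "(\<lambda>m. ennreal (exp (- ((c m)\<^sup>2 * (norm \<xi>)\<^sup>2) / 2) * (norm (ft f \<xi>))\<^sup>2)) \<longlonglongrightarrow> ennreal ((norm (ft f \<xi>))\<^sup>2)"
      by (intro tendsto_ennrealI) simp
    from lim_imp_Liminf[OF trivial_limit_sequentially this]
    show "ennreal ((norm (ft f \<xi>))\<^sup>2) = liminf (\<lambda>m. ennreal (exp (- ((c m)\<^sup>2 * (norm \<xi>)\<^sup>2) / 2) * (norm (ft f \<xi>))\<^sup>2))" by (rule sym)
  qed
  also have "\<dots> \<le> liminf (\<lambda>m. \<integral>\<^sup>+\<xi>. ennreal (exp (- ((c m)\<^sup>2 * (norm \<xi>)\<^sup>2) / 2) * (norm (ft f \<xi>))\<^sup>2) \<partial>lborel)"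
    by (intro nn_integral_liminf) measurable
  also have "\<dots> \<le> ennreal (nsq f)"
  proof (rule Liminf_le)
    have "(\<integral>\<^sup>+\<xi>. ennreal (exp (- ((c m)\<^sup>2 * (norm \<xi>)\<^sup>2) / 2) * (norm (ft f \<xi>))\<^sup>2) \<partial>lborel) \<le> ennreal (nsq f)" for m
      using bound[OF cpos] by (subst nn_integral_eq_integral[OF int[OF cpos]]) (auto intro: ennreal_leI)
    then show "\<forall>\<^sub>F m in sequentially. (\<integral>\<^sup>+\<xi>. ennreal (exp (- ((c m)\<^sup>2 * (norm \<xi>)\<^sup>2) / 2) * (norm (ft f \<xi>))\<^sup>2) \<partial>lborel) \<le> ennreal (nsq f)"
      by simp
  qed simp
  finally have le: "(\<integral>\<^sup>+\<xi>. ennreal ((norm (ft f \<xi>))\<^sup>2) \<partial>lborel) \<le> ennreal (nsq f)" .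
  show sq: "sq_int (ft f)" unfolding sq_int_def
    using le by (auto intro!: integrableI_bounded simp: less_top[symmetric] top_unique)
  show "nsq (ft f) \<le> nsq f"
    using le sq_int_integrable[OF sq] by (subst (asm) nn_integral_eq_integral) (auto simp: nsq_def)
qed

text \<open>Both sides of the Gaussian pairing converge as c tends to 0: the frequency side because
  the product of the transforms is integrable by \<open>ft_Bessel\<close>, the other side because
  \<open>g\<close> is bounded and continuous.\<close>

lemma ft_Parseval:
  fixes f g :: "'a::euclidean_space \<Rightarrow> real"
  assumes f: "integrable lborel f" "sq_int f"
    and g: "continuous_on UNIV g" and K: "compact K" "\<And>x. x \<notin> K \<Longrightarrow> g x = 0"
  shows "(LINT \<xi>|lborel. ft f \<xi> \<bullet> ft g \<xi>) = (LINT x|lborel. f x * g x)"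
proof -
  have gi: "integrable lborel g" "sq_int g"
    using integrable_compact_support[OF g K] sq_int_compact_support[OF g K] by auto
  obtain C where C: "\<And>x. \<bar>g x\<bar> \<le> C"
    using zero_outside_uniformly_continuous(2)[OF g K] unfolding bounded_iff by auto
  have [measurable]: "f \<in> borel_measurable borel" "g \<in> borel_measurable borel" using f(2) gi(2) by auto
  note ff = ft_Bessel(1)[OF f] and fg = ft_Bessel(1)[OF gi]
  define c where "c m = 1 / real (Suc m)" for m
  have cpos: "c m > 0" for m by (simp add: c_def)
  have "(\<lambda>m. LINT \<xi>|lborel. exp (- ((c m)\<^sup>2 * (norm \<xi>)\<^sup>2) / 2) * (ft f \<xi> \<bullet> ft g \<xi>)) \<longlonglongrightarrow> (LINT \<xi>|lborel. ft f \<xi> \<bullet> ft g \<xi>)"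
  proof (rule integral_dominated_convergence[where w = "\<lambda>\<xi>. \<bar>ft f \<xi> \<bullet> ft g \<xi>\<bar>"])
    show "integrable lborel (\<lambda>\<xi>. \<bar>ft f \<xi> \<bullet> ft g \<xi>\<bar>)" using sq_int_inner[OF ff fg] by simp
    show "AE \<xi> in lborel. (\<lambda>m. exp (- ((c m)\<^sup>2 * (norm \<xi>)\<^sup>2) / 2) * (ft f \<xi> \<bullet> ft g \<xi>)) \<longlonglongrightarrow> ft f \<xi> \<bullet> ft g \<xi>"
    proof (rule AE_I2)
      fix \<xi> :: 'a
      have "(\<lambda>m. exp (- ((c m)\<^sup>2 * (norm \<xi>)\<^sup>2) / 2) * (ft f \<xi> \<bullet> ft g \<xi>)) \<longlonglongrightarrow> exp (- (0\<^sup>2 * (norm \<xi>)\<^sup>2) / 2) * (ft f \<xi> \<bullet> ft g \<xi>)"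
        unfolding c_def by (intro tendsto_intros LIMSEQ_Suc lim_1_over_n) auto
      then show "(\<lambda>m. exp (- ((c m)\<^sup>2 * (norm \<xi>)\<^sup>2) / 2) * (ft f \<xi> \<bullet> ft g \<xi>)) \<longlonglongrightarrow> ft f \<xi> \<bullet> ft g \<xi>" by simp
    qed
    show "AE \<xi> in lborel. norm (exp (- ((c m)\<^sup>2 * (norm \<xi>)\<^sup>2) / 2) * (ft f \<xi> \<bullet> ft g \<xi>)) \<le> \<bar>ft f \<xi> \<bullet> ft g \<xi>\<bar>" for m
      by (intro AE_I2) (simp add: abs_mult mult_left_le_one_le)
  qed auto
  moreover have "(\<lambda>m. LINT x|lborel. f x * (LINT y|lborel. g y * gauss (c m) (x - y))) \<longlonglongrightarrow> (LINT x|lborel. f x * g x)"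
  proof (rule integral_dominated_convergence[where w = "\<lambda>x. \<bar>f x\<bar> * C"])
    show "integrable lborel (\<lambda>x. \<bar>f x\<bar> * C)" using f(1) by simp
    show "AE x in lborel. (\<lambda>m. f x * (LINT y|lborel. g y * gauss (c m) (x - y))) \<longlonglongrightarrow> f x * g x"
      unfolding c_def by (intro AE_I2 tendsto_intros gauss_approximates[OF g C])
    show "AE x in lborel. norm (f x * (LINT y|lborel. g y * gauss (c m) (x - y))) \<le> \<bar>f x\<bar> * C" for m
    proof (rule AE_I2)
      fix x
      have G: "integrable lborel (\<lambda>y::'a. gauss (c m) (x - y))" "(LINT y|lborel. gauss (c m) (x - y :: 'a)) = 1"
        using integral_lborel_reflect[of "gauss (c m)" x] gauss_integral[OF cpos, of m, where 'a='a] by auto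
      have "\<bar>LINT y|lborel. g y * gauss (c m) (x - y)\<bar> \<le> (LINT y|lborel. C * gauss (c m) (x - y))"
      proof (rule Bochner_Integration.integral_norm_bound_integral[where 'b=real, unfolded real_norm_def])
        show "integrable lborel (\<lambda>y. g y * gauss (c m) (x - y))"
          using integrable_scaleR_bounded[OF G(1), of g C] C by (simp add: mult.commute)
        show "\<bar>g y * gauss (c m) (x - y)\<bar> \<le> C * gauss (c m) (x - y)" for y
          using C[of y] gauss_nonneg[OF cpos, of m "x - y"] by (simp add: abs_mult mult_right_mono)
      qed (use G in auto)
      also have "\<dots> = C" using G by simp
      finally show "norm (f x * (LINT y|lborel. g y * gauss (c m) (x - y))) \<le> \<bar>f x\<bar> * C"
        by (simp add: abs_mult mult_left_mono)
    qed
  qed auto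
  ultimately show ?thesis
    unfolding ft_gauss_pairing[OF f(1) gi(1) cpos] by (rule LIMSEQ_unique)
qed

text \<open>The transform of \<rho> is left without the normalising constant, since for a bump of
  mass 1 this factor has modulus at most 1.\<close>

lemma ft_conv:
  fixes u \<rho> :: "'a::euclidean_space \<Rightarrow> real"
  assumes u: "integrable lborel u" and \<rho>: "integrable lborel \<rho>"
    and c: "continuous_on UNIV \<rho>" "bounded (range \<rho>)"
  shows "ft (conv u \<rho>) \<xi> = ft u \<xi> * (LINT y|lborel. \<rho> y *\<^sub>R cis (- (y \<bullet> \<xi>)))"
proof -
  have [measurable]: "u \<in> borel_measurable borel" "\<rho> \<in> borel_measurable borel"
    using borel_measurable_integrable[OF u] borel_measurable_integrable[OF \<rho>] by auto
  have "(LINT x|lborel. conv u \<rho> x *\<^sub>R cis (- (x \<bullet> \<xi>))) = (LINT x|lborel. LINT y|lborel. (u y * \<rho> (x - y)) *\<^sub>R cis (- (x \<bullet> \<xi>)))"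
    unfolding conv_def
    by (intro Bochner_Integration.integral_cong refl)
      (subst integral_scaleR_left[OF conv_integrable[OF u c], symmetric], simp)
  also have "\<dots> = (LINT y|lborel. LINT x|lborel. (u y * \<rho> (x - y)) *\<^sub>R cis (- (x \<bullet> \<xi>)))"
  proof (rule lborel_pair.Fubini_integral)
    show "integrable (lborel \<Otimes>\<^sub>M lborel) (\<lambda>(y, x). (u y * \<rho> (x - y)) *\<^sub>R cis (- (x \<bullet> \<xi>)))"
      by (rule Bochner_Integration.integrable_bound[OF integrable_pair_conv[OF u \<rho>]]) (measurable, auto)
  qed
  also have "\<dots> = (LINT y|lborel. (u y *\<^sub>R cis (- (y \<bullet> \<xi>))) * (LINT z|lborel. \<rho> z *\<^sub>R cis (- (z \<bullet> \<xi>))))"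
  proof (rule Bochner_Integration.integral_cong[OF refl])
    fix y
    have "(LINT x|lborel. (u y * \<rho> (x - y)) *\<^sub>R cis (- (x \<bullet> \<xi>))) =
        (LINT z|lborel. (u y * \<rho> z) *\<^sub>R cis (- ((y + z) \<bullet> \<xi>)))"
      by (subst integral_lborel_shift(1)[of "\<lambda>x. (u y * \<rho> (x - y)) *\<^sub>R cis (- (x \<bullet> \<xi>))" y, symmetric]) simp_all
    also have "\<dots> = (LINT z|lborel. (u y *\<^sub>R cis (- (y \<bullet> \<xi>))) * (\<rho> z *\<^sub>R cis (- (z \<bullet> \<xi>))))"
      by (intro Bochner_Integration.integral_cong refl) (simp only: inner_add_left minus_add_distrib cis_mult[symmetric] mult_scaleR_left mult_scaleR_right scaleR_scaleR mult.commute)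
    finally show "(LINT x|lborel. (u y * \<rho> (x - y)) *\<^sub>R cis (- (x \<bullet> \<xi>))) =
        (u y *\<^sub>R cis (- (y \<bullet> \<xi>))) * (LINT z|lborel. \<rho> z *\<^sub>R cis (- (z \<bullet> \<xi>)))"
      by (simp only: integral_mult_right_zero)
  qed
  also have "\<dots> = (LINT y|lborel. u y *\<^sub>R cis (- (y \<bullet> \<xi>))) * (LINT z|lborel. \<rho> z *\<^sub>R cis (- (z \<bullet> \<xi>)))"
    by (rule integral_mult_left_zero)
  finally show ?thesis by (simp add: ft_def)
qed

text \<open>The gradients of f cos and f sin integrate to 0, which expresses the cosine and sine
  integrals of \<open>F\<close> through those of \<open>f\<close>.\<close>

lemma ft_partial:
  fixes f :: "'a::euclidean_space \<Rightarrow> real"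
  assumes f: "c1 f F" and K: "compact K" "\<And>x. x \<notin> K \<Longrightarrow> f x = 0"
  shows "ft (\<lambda>x. F x \<bullet> b) \<xi> = (\<i> * of_real (\<xi> \<bullet> b)) * ft f \<xi>"
proof -
  have cf: "continuous_on UNIV f" "continuous_on UNIV F" using c1_continuous[OF f] f by (auto simp: c1_def)
  have F0: "x \<notin> K \<Longrightarrow> F x = 0" for x using c1_zero_outside[OF f compact_imp_closed[OF K(1)] K(2)] .
  have lin: "c1 (\<lambda>x. x \<bullet> \<xi>) (\<lambda>x. \<xi>)" by (auto simp: c1_def inner_commute intro!: derivative_eq_intros)
  have C: "c1 (\<lambda>x. cos (x \<bullet> \<xi>)) (\<lambda>x. - sin (x \<bullet> \<xi>) *\<^sub>R \<xi>)" and S: "c1 (\<lambda>x. sin (x \<bullet> \<xi>)) (\<lambda>x. cos (x \<bullet> \<xi>) *\<^sub>R \<xi>)"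
    by (rule c1_compose[OF lin]; auto intro!: derivative_eq_intros continuous_intros)+
  have i: "integrable lborel (\<lambda>x. f x * cos (x \<bullet> \<xi>))" "integrable lborel (\<lambda>x. f x * sin (x \<bullet> \<xi>))"
    "integrable lborel (\<lambda>x. cos (x \<bullet> \<xi>) *\<^sub>R F x)" "integrable lborel (\<lambda>x. sin (x \<bullet> \<xi>) *\<^sub>R F x)"
    by (rule integrable_compact_support[OF _ K(1)]; auto intro!: continuous_intros cf simp: K F0)+
  have "0 = (LINT x|lborel. f x *\<^sub>R (- sin (x \<bullet> \<xi>) *\<^sub>R \<xi>) + cos (x \<bullet> \<xi>) *\<^sub>R F x)"
    using integral_grad_compact_support[OF c1_mult[OF f C] K(1)] K(2) by simp
  also have "\<dots> = (LINT x|lborel. cos (x \<bullet> \<xi>) *\<^sub>R F x - (f x * sin (x \<bullet> \<xi>)) *\<^sub>R \<xi>)"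
    by (intro Bochner_Integration.integral_cong) (auto simp: algebra_simps)
  also have "\<dots> = (LINT x|lborel. cos (x \<bullet> \<xi>) *\<^sub>R F x) - (LINT x|lborel. f x * sin (x \<bullet> \<xi>)) *\<^sub>R \<xi>"
    using i by simp
  finally have c: "(LINT x|lborel. cos (x \<bullet> \<xi>) *\<^sub>R F x) = (LINT x|lborel. f x * sin (x \<bullet> \<xi>)) *\<^sub>R \<xi>" by simp
  have "0 = (LINT x|lborel. f x *\<^sub>R (cos (x \<bullet> \<xi>) *\<^sub>R \<xi>) + sin (x \<bullet> \<xi>) *\<^sub>R F x)"
    using integral_grad_compact_support[OF c1_mult[OF f S] K(1)] K(2) by simp
  also have "\<dots> = (LINT x|lborel. sin (x \<bullet> \<xi>) *\<^sub>R F x + (f x * cos (x \<bullet> \<xi>)) *\<^sub>R \<xi>)"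
    by (intro Bochner_Integration.integral_cong) (auto simp: algebra_simps)
  also have "\<dots> = (LINT x|lborel. sin (x \<bullet> \<xi>) *\<^sub>R F x) + (LINT x|lborel. f x * cos (x \<bullet> \<xi>)) *\<^sub>R \<xi>"
    using i by simp
  finally have s: "(LINT x|lborel. sin (x \<bullet> \<xi>) *\<^sub>R F x) = - (LINT x|lborel. f x * cos (x \<bullet> \<xi>)) *\<^sub>R \<xi>"
    by (simp add: eq_neg_iff_add_eq_0)
  have split: "(LINT x|lborel. h x *\<^sub>R cis (- (x \<bullet> \<xi>))) =
      Complex (LINT x|lborel. h x * cos (x \<bullet> \<xi>)) (- (LINT x|lborel. h x * sin (x \<bullet> \<xi>)))"
    if "integrable lborel h" for h :: "'a \<Rightarrow> real"
    by (rule complex_eqI) (subst integral_Re[symmetric] integral_Im[symmetric]; auto intro!: ft_integrable that)+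
  have fi: "integrable lborel f" "integrable lborel (\<lambda>x. F x \<bullet> b)"
    by (rule integrable_compact_support[OF _ K(1)]; auto intro!: continuous_intros cf simp: K F0)+
  have cb: "(LINT x|lborel. (F x \<bullet> b) * cos (x \<bullet> \<xi>)) = (LINT x|lborel. f x * sin (x \<bullet> \<xi>)) * (\<xi> \<bullet> b)"
    using arg_cong[OF c, of "\<lambda>v. v \<bullet> b"] integral_inner_left[of b lborel, OF i(3)] by (simp add: mult.commute)
  have sb: "(LINT x|lborel. (F x \<bullet> b) * sin (x \<bullet> \<xi>)) = - (LINT x|lborel. f x * cos (x \<bullet> \<xi>)) * (\<xi> \<bullet> b)"
    using arg_cong[OF s, of "\<lambda>v. v \<bullet> b"] integral_inner_left[of b lborel, OF i(4)] by (simp add: mult.commute)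
  show ?thesis unfolding ft_def split[OF fi(1)] split[OF fi(2)] cb sb
    by (simp add: complex_eq_iff)
qed

section \<open>The space of functions with zero boundary values\<close>

text \<open>
  The counterpart of \<open>H1_0\<close> for Borel functions on the whole space. Carrying the gradient \<open>V\<close>
  as an argument avoids the choice of a weak gradient.
\<close>

definition h10 :: "'a::euclidean_space set \<Rightarrow> ('a \<Rightarrow> real) \<Rightarrow> ('a \<Rightarrow> 'a) \<Rightarrow> bool" where
  "h10 \<Omega> v V \<longleftrightarrow>
    (\<exists>f. (\<forall>k. f k \<in> test_functions \<Omega>) \<and> l2lim f v \<and> l2lim (\<lambda>k. grad (f k)) V)"

lemma test_function_c1:
  assumes "f \<in> test_functions \<Omega>"
  obtains K where "compact K" "K \<subseteq> \<Omega>" "c1 f (grad f)" "\<And>x. x \<notin> K \<Longrightarrow> f x = 0" "\<And>x. x \<notin> K \<Longrightarrow> grad f x = 0"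
proof -
  obtain K where K: "smooth f" "compact K" "K \<subseteq> \<Omega>" "\<And>x. x \<notin> K \<Longrightarrow> f x = 0"
    using assms by (rule test_functionsE) blast
  show ?thesis
    using that[OF K(2,3) smooth_c1[OF K(1)] K(4)]
      c1_zero_outside[OF smooth_c1[OF K(1)] compact_imp_closed[OF K(2)] K(4)] by blast
qed

lemma c1_sq_int:
  assumes f: "c1 f F" and K: "compact K" "\<And>x. x \<notin> K \<Longrightarrow> f x = 0"
  shows "sq_int f" "sq_int F"
proof -
  have "continuous_on UNIV F" using f by (simp add: c1_def)
  from sq_int_compact_support[OF this K(1)] c1_zero_outside[OF f compact_imp_closed[OF K(1)] K(2)]
  show "sq_int F" by blast
qed (rule sq_int_compact_support[OF c1_continuous[OF f] K])

lemma test_function_sq_int: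
  fixes f :: "'a::euclidean_space \<Rightarrow> real"
  assumes "f \<in> test_functions \<Omega>" shows "sq_int f" "sq_int (grad f)"
  using assms by (auto elim!: test_function_c1 intro: c1_sq_int)

lemma test_functions_mono: "\<Omega> \<subseteq> \<Omega>' \<Longrightarrow> test_functions \<Omega> \<subseteq> test_functions \<Omega>'"
  by (auto simp: test_functions_def)

lemma test_functions_smooth: "f \<in> test_functions \<Omega> \<Longrightarrow> smooth f"
  by (simp add: test_functions_def)

lemma h10_test: "f \<in> test_functions \<Omega> \<Longrightarrow> h10 \<Omega> f (grad f)"
  unfolding h10_def by (intro exI[of _ "\<lambda>_. f"]) (auto intro: l2lim_const test_function_sq_int)

lemma h10_sq_int: "h10 \<Omega> v V \<Longrightarrow> sq_int v" "h10 \<Omega> v V \<Longrightarrow> sq_int V"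
  by (auto simp: h10_def dest: l2limD)

lemma grad_add:
  assumes "smooth f" "smooth g" shows "grad (\<lambda>x. f x + g x) = (\<lambda>x. grad f x + grad g x)"
proof (rule c1_grad)
  show "c1 (\<lambda>x. f x + g x) (\<lambda>x. grad f x + grad g x)"
    using smooth_c1[OF assms(1)] smooth_c1[OF assms(2)] unfolding c1_def
    by (auto intro!: continuous_intros derivative_eq_intros simp: inner_add_left)
qed

lemma grad_cmult: assumes "smooth f" shows "grad (\<lambda>x. c * f x) = (\<lambda>x. c *\<^sub>R grad f x)"
proof (rule c1_grad)
  show "c1 (\<lambda>x. c * f x) (\<lambda>x. c *\<^sub>R grad f x)"
    using smooth_c1[OF assms] unfolding c1_def
    by (auto intro!: continuous_intros derivative_eq_intros)
qed

lemma grad_mult: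
  assumes "smooth f" "smooth g" shows "grad (\<lambda>x. f x * g x) = (\<lambda>x. f x *\<^sub>R grad g x + g x *\<^sub>R grad f x)"
  by (rule c1_grad[OF c1_mult[OF smooth_c1[OF assms(1)] smooth_c1[OF assms(2)]]])

lemma test_functions_add:
  fixes f g :: "'a::euclidean_space \<Rightarrow> real"
  assumes "f \<in> test_functions \<Omega>" "g \<in> test_functions \<Omega>" shows "(\<lambda>x. f x + g x) \<in> test_functions \<Omega>"
proof -
  obtain K where K: "smooth f" "compact K" "K \<subseteq> \<Omega>" "\<And>x. x \<notin> K \<Longrightarrow> f x = 0" using assms(1) by (rule test_functionsE) blast
  obtain L where L: "smooth g" "compact L" "L \<subseteq> \<Omega>" "\<And>x. x \<notin> L \<Longrightarrow> g x = 0" using assms(2) by (rule test_functionsE) blast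
  show ?thesis
    by (rule test_functionsI[of _ "K \<union> L"]) (use K L in \<open>auto intro: smooth_add compact_Un\<close>)
qed

lemma test_functions_mult:
  fixes f g :: "'a::euclidean_space \<Rightarrow> real"
  assumes "smooth g" "f \<in> test_functions \<Omega>" shows "(\<lambda>x. g x * f x) \<in> test_functions \<Omega>"
proof -
  obtain K where K: "smooth f" "compact K" "K \<subseteq> \<Omega>" "\<And>x. x \<notin> K \<Longrightarrow> f x = 0" using assms(2) by (rule test_functionsE) blast
  show ?thesis by (rule test_functionsI[of _ K]) (use K assms in \<open>auto intro: smooth_mult\<close>)
qed

lemma h10_add: assumes "h10 \<Omega> v V" "h10 \<Omega> w W" shows "h10 \<Omega> (\<lambda>x. v x + w x) (\<lambda>x. V x + W x)"
proof -
  obtain f where f: "\<forall>k. f k \<in> test_functions \<Omega>" "l2lim f v" "l2lim (\<lambda>k. grad (f k)) V" using assms(1) h10_def by blast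
  obtain g where g: "\<forall>k. g k \<in> test_functions \<Omega>" "l2lim g w" "l2lim (\<lambda>k. grad (g k)) W" using assms(2) h10_def by blast
  have "grad (\<lambda>x. f k x + g k x) = (\<lambda>x. grad (f k) x + grad (g k) x)" for k
    using f(1) g(1) by (intro grad_add test_functions_smooth) auto
  then show ?thesis unfolding h10_def
    using l2lim_add[OF f(2) g(2)] l2lim_add[OF f(3) g(3)] f(1) g(1)
    by (intro exI[of _ "\<lambda>k x. f k x + g k x"]) (auto intro: test_functions_add)
qed

lemma h10_cmult: assumes "h10 \<Omega> v V" shows "h10 \<Omega> (\<lambda>x. c * v x) (\<lambda>x. c *\<^sub>R V x)"
proof -
  obtain f where f: "\<forall>k. f k \<in> test_functions \<Omega>" "l2lim f v" "l2lim (\<lambda>k. grad (f k)) V" using assms(1) h10_def by blast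
  have "grad (\<lambda>x. c * f k x) = (\<lambda>x. c *\<^sub>R grad (f k) x)" for k
    using f(1) by (intro grad_cmult test_functions_smooth) auto
  then show ?thesis unfolding h10_def
    using l2lim_scaleR[OF f(2), of c] l2lim_scaleR[OF f(3), of c] f(1)
    by (intro exI[of _ "\<lambda>k x. c * f k x"]) (auto intro: test_functions_mult[OF smooth_const])
qed

lemma h10_diff: "h10 \<Omega> v V \<Longrightarrow> h10 \<Omega> w W \<Longrightarrow> h10 \<Omega> (\<lambda>x. v x - w x) (\<lambda>x. V x - W x)"
  using h10_add[OF _ h10_cmult[of \<Omega> w W "-1"]] by auto

lemma h10_zero: "h10 \<Omega> (\<lambda>x. 0) (\<lambda>x. 0)"
proof -
  have "(\<lambda>x. 0::real) \<in> test_functions \<Omega>" by (rule test_functionsI[of _ "{}"]) (auto simp: smooth_const)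
  from h10_cmult[OF h10_test[OF this], of 0] show ?thesis by simp
qed

lemma h10_sum: "(\<And>i. i \<in> I \<Longrightarrow> h10 \<Omega> (v i) (V i)) \<Longrightarrow> h10 \<Omega> (\<lambda>x. \<Sum>i\<in>I. v i x) (\<lambda>x. \<Sum>i\<in>I. V i x)"
  by (induct I rule: infinite_finite_induct) (auto intro: h10_zero h10_add)

lemma l2lim_perturb:
  assumes v: "l2lim v w" and f: "\<And>k. sq_int (f k)" and d: "(\<lambda>k. nsq (\<lambda>x. f k x - v k x)) \<longlonglongrightarrow> 0"
  shows "l2lim f w"
proof -
  have "l2lim (\<lambda>k x. f k x - v k x) (\<lambda>x. 0)"
    using d f l2limD(1)[OF v] by (simp add: l2lim_def sq_int_diff sq_int_zero)
  from l2lim_add[OF v this] show ?thesis by simp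
qed

text \<open>A diagonal choice: test functions within 1/(k + 1) of the k-th pair in both components
  approximate the limit pair.\<close>

lemma h10_closed:
  assumes h: "\<And>k. h10 \<Omega> (v k) (V k)" and lim: "l2lim v w" "l2lim V W"
  shows "h10 \<Omega> w W"
proof -
  have "\<exists>f. f \<in> test_functions \<Omega> \<and> nsq (\<lambda>x. f x - v k x) < 1 / real (Suc k) \<and> nsq (\<lambda>x. grad f x - V k x) < 1 / real (Suc k)" for k
  proof -
    obtain f where f: "\<forall>j. f j \<in> test_functions \<Omega>" "l2lim f (v k)" "l2lim (\<lambda>j. grad (f j)) (V k)" using h[of k] h10_def by blast
    have "\<forall>\<^sub>F j in sequentially. nsq (\<lambda>x. f j x - v k x) < 1 / real (Suc k) \<and> nsq (\<lambda>x. grad (f j) x - V k x) < 1 / real (Suc k)"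
      by (intro eventually_conj order_tendstoD(2)[OF l2limD(3)[OF f(2)]] order_tendstoD(2)[OF l2limD(3)[OF f(3)]]) auto
    then obtain j where "nsq (\<lambda>x. f j x - v k x) < 1 / real (Suc k) \<and> nsq (\<lambda>x. grad (f j) x - V k x) < 1 / real (Suc k)"
      using eventually_happens'[OF sequentially_bot] by blast
    then show ?thesis using f(1) by blast
  qed
  then obtain f where f: "\<And>k. f k \<in> test_functions \<Omega>" "\<And>k. nsq (\<lambda>x. f k x - v k x) < 1 / real (Suc k)"
    "\<And>k. nsq (\<lambda>x. grad (f k) x - V k x) < 1 / real (Suc k)" by metis
  have z: "(\<lambda>k. 1 / real (Suc k)) \<longlonglongrightarrow> 0" by (rule LIMSEQ_Suc[OF lim_1_over_n])
  have sq: "a \<longlonglongrightarrow> 0" if "\<And>k. 0 \<le> a k" "\<And>k. a k < 1 / real (Suc k)" for a :: "nat \<Rightarrow> real"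
    by (rule tendsto_sandwich[OF _ _ tendsto_const z]) (intro always_eventually allI that less_imp_le[OF that(2)])+
  have "(\<lambda>k. nsq (\<lambda>x. f k x - v k x)) \<longlonglongrightarrow> 0" "(\<lambda>k. nsq (\<lambda>x. grad (f k) x - V k x)) \<longlonglongrightarrow> 0"
    by (rule sq[OF nsq_nonneg f(2)] sq[OF nsq_nonneg f(3)])+
  then have "l2lim f w" "l2lim (\<lambda>k. grad (f k)) W"
    using l2lim_perturb[OF lim(1)] l2lim_perturb[OF lim(2)] test_function_sq_int[OF f(1)] by auto
  then show ?thesis using f(1) unfolding h10_def by blast
qed

lemma l2lim_inner_const:
  assumes "l2lim F f" shows "l2lim (\<lambda>k x. F k x \<bullet> b) (\<lambda>x. f x \<bullet> b)"
proof -
  have s: "sq_int (\<lambda>x. g x \<bullet> b)" if "sq_int g" for g :: "'a \<Rightarrow> 'b"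
  proof (rule sq_int_dominated[OF _ that])
    show "norm (g x \<bullet> b) \<le> norm b * norm (g x)" for x
      using Cauchy_Schwarz_ineq2[of "g x" b] by (simp add: mult.commute)
  qed (use that in \<open>auto simp: sq_int_def\<close>)
  have "(\<lambda>k. nsq (\<lambda>x. F k x \<bullet> b - f x \<bullet> b)) \<longlonglongrightarrow> 0"
  proof (rule tendsto_sandwich[OF _ _ tendsto_const])
    show "(\<lambda>k. (norm b)\<^sup>2 * nsq (\<lambda>x. F k x - f x)) \<longlonglongrightarrow> 0"
      using tendsto_mult_left[OF l2limD(3)[OF assms], of "(norm b)\<^sup>2"] by simp
    have "nsq (\<lambda>x. F k x \<bullet> b - f x \<bullet> b) \<le> (norm b)\<^sup>2 * nsq (\<lambda>x. F k x - f x)" for k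
    proof -
      have d: "sq_int (\<lambda>x. F k x - f x)" by (intro sq_int_diff l2limD[OF assms])
      have "nsq (\<lambda>x. (F k x - f x) \<bullet> b) \<le> (LINT x|lborel. (norm b)\<^sup>2 * (norm (F k x - f x))\<^sup>2)"
        unfolding nsq_def
      proof (rule integral_mono)
        show "(norm ((F k x - f x) \<bullet> b))\<^sup>2 \<le> (norm b)\<^sup>2 * (norm (F k x - f x))\<^sup>2" for x
          using power_mono[OF Cauchy_Schwarz_ineq2[of "F k x - f x" b], of 2] by (simp add: power_mult_distrib mult.commute)
      qed (use s[OF d] d in \<open>auto intro!: integrable_mult_right dest!: sq_int_integrable\<close>)
      then show ?thesis by (simp add: nsq_def inner_diff_left)
    qed
    then show "\<forall>\<^sub>F k in sequentially. nsq (\<lambda>x. F k x \<bullet> b - f x \<bullet> b) \<le> (norm b)\<^sup>2 * nsq (\<lambda>x. F k x - f x)" by simp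
  qed auto
  then show ?thesis using s l2limD(1,2)[OF assms] by (simp add: l2lim_def)
qed

lemma sq_int_inner_const: "sq_int f \<Longrightarrow> sq_int (\<lambda>x. f x \<bullet> b)"
  using l2limD(2)[OF l2lim_inner_const[OF l2lim_const]] .

section \<open>Weak gradients and their uniqueness\<close>

lemma integral_by_parts:
  fixes f g :: "'a::euclidean_space \<Rightarrow> real"
  assumes f: "c1 f F" and K: "compact K" "\<And>x. x \<notin> K \<Longrightarrow> f x = 0" and g: "c1 g G"
  shows "(LINT x|lborel. f x * (G x \<bullet> b)) = - (LINT x|lborel. g x * (F x \<bullet> b))"
proof -
  have cf: "continuous_on UNIV f" "continuous_on UNIV F" "continuous_on UNIV g" "continuous_on UNIV G"
    using c1_continuous[OF f] c1_continuous[OF g] f g by (auto simp: c1_def)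
  have F0: "x \<notin> K \<Longrightarrow> F x = 0" for x using c1_zero_outside[OF f compact_imp_closed[OF K(1)] K(2)] .
  have i: "integrable lborel (\<lambda>x. f x * (G x \<bullet> b))" "integrable lborel (\<lambda>x. g x * (F x \<bullet> b))"
    "integrable lborel (\<lambda>x. f x *\<^sub>R G x + g x *\<^sub>R F x)"
    by (rule integrable_compact_support[OF _ K(1)]; auto intro!: continuous_intros cf simp: K F0)+
  have "(LINT x|lborel. f x *\<^sub>R G x + g x *\<^sub>R F x) \<bullet> b = 0"
    using integral_grad_compact_support[OF c1_mult[OF f g] K(1)] K(2) by simp
  moreover have "(LINT x|lborel. (f x *\<^sub>R G x + g x *\<^sub>R F x) \<bullet> b) = (LINT x|lborel. f x *\<^sub>R G x + g x *\<^sub>R F x) \<bullet> b"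
    by (rule integral_inner_left) (rule i(3))
  ultimately have "(LINT x|lborel. (f x *\<^sub>R G x + g x *\<^sub>R F x) \<bullet> b) = 0" by (rule trans[rotated])
  then have "(LINT x|lborel. f x * (G x \<bullet> b) + g x * (F x \<bullet> b)) = 0" by (simp add: inner_add_left)
  then show ?thesis using i by simp
qed

text \<open>The test function may cross the boundary of \<Omega>: with zero boundary values,
  extension by zero creates no boundary term. The identity is inherited from the approximating test
  functions.\<close>

lemma h10_weak:
  assumes h: "h10 \<Omega> v V" and \<psi>: "\<psi> \<in> test_functions UNIV"
  shows "(LINT x|lborel. v x * (grad \<psi> x \<bullet> b)) = - (LINT x|lborel. \<psi> x * (V x \<bullet> b))"
proof -
  obtain f where f: "\<And>k. f k \<in> test_functions \<Omega>" "l2lim f v" "l2lim (\<lambda>k. grad (f k)) V" using h h10_def by blast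
  have eq: "(LINT x|lborel. f k x * (grad \<psi> x \<bullet> b)) = - (LINT x|lborel. \<psi> x * (grad (f k) x \<bullet> b))" for k
  proof -
    obtain K where K: "compact K" "c1 (f k) (grad (f k))" "\<And>x. x \<notin> K \<Longrightarrow> f k x = 0"
      using f(1)[of k] by (rule test_function_c1) blast
    show ?thesis by (rule integral_by_parts[OF K(2,1,3) smooth_c1[OF test_functions_smooth[OF \<psi>]]])
  qed
  have A: "(\<lambda>k. LINT x|lborel. f k x * (grad \<psi> x \<bullet> b)) \<longlonglongrightarrow> (LINT x|lborel. v x * (grad \<psi> x \<bullet> b))"
    using l2lim_inner[OF f(2) l2lim_const[OF sq_int_inner_const[OF test_function_sq_int(2)[OF \<psi>], of b]]] by simp
  have B: "(\<lambda>k. LINT x|lborel. \<psi> x * (grad (f k) x \<bullet> b)) \<longlonglongrightarrow> (LINT x|lborel. \<psi> x * (V x \<bullet> b))"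
    using l2lim_inner[OF l2lim_const[OF test_function_sq_int(1)[OF \<psi>]] l2lim_inner_const[OF f(3), of b]] by simp
  show ?thesis by (rule LIMSEQ_unique[OF A[unfolded eq] tendsto_minus[OF B]])
qed

lemma AE_eq_inner_Basis:
  fixes V W :: "'a \<Rightarrow> 'b::euclidean_space"
  assumes "\<And>b. b \<in> Basis \<Longrightarrow> AE x in M. V x \<bullet> b = W x \<bullet> b" shows "AE x in M. V x = W x"
proof -
  have "AE x in M. \<forall>b\<in>Basis. V x \<bullet> b = W x \<bullet> b"
    using assms by (intro AE_finite_allI) auto
  then show ?thesis by eventually_elim (auto intro: euclidean_eqI)
qed

text \<open>Both gradients have the same pairings with test functions by \<open>h10_weak\<close>,
  and the fundamental lemma separates them. Hence carrying \<open>V\<close> as an argument of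
  \<open>h10\<close> leaves no freedom beyond null sets.\<close>

lemma h10_unique:
  assumes v: "h10 \<Omega> v V" and w: "h10 \<Omega> w W" and eq: "AE x in lborel. v x = w x"
  shows "AE x in lborel. V x = W x"
proof (rule AE_eq_inner_Basis)
  fix b :: 'a assume "b \<in> Basis"
  have s: "sq_int (\<lambda>x. V x \<bullet> b)" "sq_int (\<lambda>x. W x \<bullet> b)" using h10_sq_int v w sq_int_inner_const by blast+
  have "AE x in lborel. x \<in> UNIV \<longrightarrow> V x \<bullet> b - W x \<bullet> b = 0"
  proof (rule fundamental_lemma)
    show "(\<lambda>x. V x \<bullet> b - W x \<bullet> b) \<in> borel_measurable borel" using sq_int_diff[OF s] by (rule sq_int_measurable)
    show "set_integrable lborel K (\<lambda>x. V x \<bullet> b - W x \<bullet> b)" if "compact K" for K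
      by (rule sq_int_set_integrable[OF sq_int_diff[OF s] that])
    fix \<psi> :: "'a \<Rightarrow> real" assume \<psi>: "\<psi> \<in> test_functions UNIV"
    have "(LINT x|lborel. v x * (grad \<psi> x \<bullet> b)) = (LINT x|lborel. w x * (grad \<psi> x \<bullet> b))"
      using h10_sq_int[OF v] h10_sq_int[OF w] test_function_sq_int[OF \<psi>] sq_int_inner_const
      by (intro integral_cong_AE) (auto dest!: sq_int_measurable intro: eventually_mono[OF eq])
    then have "(LINT x|lborel. \<psi> x * (V x \<bullet> b)) = (LINT x|lborel. \<psi> x * (W x \<bullet> b))"
      using h10_weak[OF v \<psi>, of b] h10_weak[OF w \<psi>, of b] by simp
    then have "(LINT x|lborel. \<psi> x * (V x \<bullet> b) - \<psi> x * (W x \<bullet> b)) = 0"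
      using sq_int_mult[OF test_function_sq_int(1)[OF \<psi>] s(1)] sq_int_mult[OF test_function_sq_int(1)[OF \<psi>] s(2)] by simp
    then show "(LINT x|lborel. (V x \<bullet> b - W x \<bullet> b) * \<psi> x) = 0" by (simp add: algebra_simps)
  qed auto
  then show "AE x in lborel. V x \<bullet> b = W x \<bullet> b" by eventually_elim auto
qed

lemma l2lim_zero_outside:
  assumes "l2lim F f" "\<And>k x. x \<notin> S \<Longrightarrow> F k x = 0" shows "AE x in lborel. x \<notin> S \<longrightarrow> f x = 0"
proof -
  obtain r :: "nat \<Rightarrow> nat" where "AE x in lborel. (\<lambda>k. F (r k) x) \<longlonglongrightarrow> f x" using l2lim_AE_subseq[OF assms(1)] by metis
  then show ?thesis by eventually_elim (use assms(2) in \<open>auto simp: LIMSEQ_const_iff\<close>)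
qed

lemma h10_zero_outside:
  assumes "h10 \<Omega> v V" shows "AE x in lborel. x \<notin> \<Omega> \<longrightarrow> v x = 0" "AE x in lborel. x \<notin> \<Omega> \<longrightarrow> V x = 0"
proof -
  obtain f where f: "\<And>k. f k \<in> test_functions \<Omega>" "l2lim f v" "l2lim (\<lambda>k. grad (f k)) V" using assms h10_def by blast
  have "f k x = 0" "grad (f k) x = 0" if "x \<notin> \<Omega>" for k x
    using f(1)[of k] by (rule test_function_c1; use that in blast)+
  then show "AE x in lborel. x \<notin> \<Omega> \<longrightarrow> v x = 0" "AE x in lborel. x \<notin> \<Omega> \<longrightarrow> V x = 0"
    using l2lim_zero_outside[OF f(2)] l2lim_zero_outside[OF f(3)] by auto
qed

text \<open>The centre is a parameter because a bump with centre \<open>p\<close> translates by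
  \<open>p\<close> while it smooths; off-centre bumps push functions into the domain at its
  boundary.\<close>

definition bump_at :: "'a::euclidean_space \<Rightarrow> real \<Rightarrow> ('a \<Rightarrow> real) \<Rightarrow> bool" where
  "bump_at p r \<rho> \<longleftrightarrow> smooth \<rho> \<and> (\<forall>x. 0 \<le> \<rho> x) \<and> (\<forall>x. x \<notin> ball p r \<longrightarrow> \<rho> x = 0) \<and>
     integrable lborel \<rho> \<and> (LINT x|lborel. \<rho> x) = 1"

lemma bump_at_exists: "0 < r \<Longrightarrow> \<exists>\<rho>. bump_at p r \<rho>"
  unfolding bump_at_def by (rule bump_exists[of r p]) blast+

lemma bump_atD:
  assumes "bump_at p r \<rho>"
  shows "smooth \<rho>" "0 \<le> \<rho> x" "x \<notin> ball p r \<Longrightarrow> \<rho> x = 0" "integrable lborel \<rho>" "(LINT x|lborel. \<rho> x) = 1"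
    "continuous_on UNIV \<rho>" "\<rho> \<in> borel_measurable borel" "bounded (range \<rho>)" "x \<notin> cball p r \<Longrightarrow> \<rho> x = 0"
proof -
  show *: "smooth \<rho>" "0 \<le> \<rho> x" "x \<notin> ball p r \<Longrightarrow> \<rho> x = 0" "integrable lborel \<rho>" "(LINT x|lborel. \<rho> x) = 1" for x
    using assms by (auto simp: bump_at_def)
  show "continuous_on UNIV \<rho>" "\<rho> \<in> borel_measurable borel"
    using smooth_continuous[OF *(1)] borel_measurable_continuous_onI by auto
  show z: "x \<notin> cball p r \<Longrightarrow> \<rho> x = 0" for x using *(3)[of x] by auto
  show "bounded (range \<rho>)" by (rule zero_outside_uniformly_continuous(2)[OF smooth_continuous[OF *(1)] compact_cball z])
qed

lemma conv_bump_bound: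
  fixes g :: "'a::euclidean_space \<Rightarrow> 'b::{banach, second_countable_topology}"
  assumes \<rho>: "bump_at p r \<rho>"
    and g: "continuous_on UNIV g" "bounded (range g)" and e: "\<And>y. y \<in> ball p r \<Longrightarrow> norm (g (x - y) - a) \<le> e"
  shows "norm (conv \<rho> g x - a) \<le> e"
proof -
  note I = conv_integrable[OF bump_atD(4)[OF \<rho>] g, of x]
  have ia: "integrable lborel (\<lambda>y. \<rho> y *\<^sub>R a)" using bump_atD(4)[OF \<rho>] by simp
  have "conv \<rho> g x - a = (LINT y|lborel. \<rho> y *\<^sub>R g (x - y)) - (LINT y|lborel. \<rho> y *\<^sub>R a)"
    using bump_atD(4,5)[OF \<rho>] by (simp add: conv_def)
  also have "\<dots> = (LINT y|lborel. \<rho> y *\<^sub>R (g (x - y) - a))"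
    using I ia by (simp add: scaleR_diff_right)
  also have "norm \<dots> \<le> (LINT y|lborel. \<rho> y * e)"
  proof (rule Bochner_Integration.integral_norm_bound_integral)
    show "integrable lborel (\<lambda>y. \<rho> y *\<^sub>R (g (x - y) - a))"
      using Bochner_Integration.integrable_diff[OF I ia] by (simp add: scaleR_diff_right)
    show "norm (\<rho> y *\<^sub>R (g (x - y) - a)) \<le> \<rho> y * e" for y
      using bump_atD(2)[OF \<rho>, of y] bump_atD(3)[OF \<rho>, of y] e[of y]
      by (cases "y \<in> ball p r") (auto intro: mult_left_mono)
  qed (use bump_atD(4)[OF \<rho>] in simp)
  also have "\<dots> = e" using bump_atD(5)[OF \<rho>] by simp
  finally show ?thesis .
qed

lemma conv_commute:
  fixes u f :: "'a::euclidean_space \<Rightarrow> real"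
  assumes [measurable]: "u \<in> borel_measurable borel" "f \<in> borel_measurable borel"
  shows "conv u f = conv f u"
  unfolding conv_def using integral_lborel_reflect(1)[of "\<lambda>y. u y * f (x - y)" x for x]
  by (auto simp: mult.commute fun_eq_iff)

lemma conv_bump_tendsto:
  fixes h :: "'a::euclidean_space \<Rightarrow> 'b::{banach, second_countable_topology}"
  assumes h: "uniformly_continuous_on UNIV h" "bounded (range h)"
    and \<rho>: "\<And>k. bump_at (p k) (r k) (\<rho> k)" and lim: "p \<longlonglongrightarrow> 0" "r \<longlonglongrightarrow> 0"
  shows "(\<lambda>k. conv (\<rho> k) h x) \<longlonglongrightarrow> h x"
proof (rule LIMSEQ_I)
  fix \<epsilon> :: real assume \<epsilon>: "\<epsilon> > 0"
  obtain d where d: "d > 0" "\<And>x y. dist y x < d \<Longrightarrow> dist (h y) (h x) < \<epsilon> / 2"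
    using h(1) \<epsilon> unfolding uniformly_continuous_on_def by (metis UNIV_I half_gt_zero)
  have "(\<lambda>k. norm (p k) + r k) \<longlonglongrightarrow> norm (0::'a) + 0" by (intro tendsto_intros lim)
  then have "\<forall>\<^sub>F k in sequentially. norm (p k) + r k < d" using order_tendstoD(2)[of _ "0::real" sequentially d] d(1) by simp
  then obtain N where N: "\<And>k. k \<ge> N \<Longrightarrow> norm (p k) + r k < d" by (auto simp: eventually_sequentially)
  have "norm (conv (\<rho> k) h x - h x) \<le> \<epsilon> / 2" if "k \<ge> N" for k
  proof (rule conv_bump_bound[OF \<rho> uniformly_continuous_imp_continuous[OF h(1)] h(2)])
    show "norm (h (x - y) - h x) \<le> \<epsilon> / 2" if "y \<in> ball (p k) (r k)" for y
    proof -
      have "norm y < d" using N[OF \<open>k \<ge> N\<close>] that norm_triangle_sub[of y "p k"] by (simp add: dist_norm norm_minus_commute)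
      then show ?thesis using d(2)[of "x - y" x] by (simp add: dist_norm)
    qed
  qed
  then show "\<exists>N. \<forall>k\<ge>N. norm (conv (\<rho> k) h x - h x) < \<epsilon>" using \<epsilon> by (intro exI[of _ N]) force
qed

lemma conv_bump_l2lim:
  fixes h :: "'a::euclidean_space \<Rightarrow> 'b::euclidean_space"
  assumes h: "uniformly_continuous_on UNIV h" "bounded (range h)"
    and \<rho>: "\<And>k. bump_at (p k) (r k) (\<rho> k)" and lim: "p \<longlonglongrightarrow> 0" "r \<longlonglongrightarrow> 0"
    and K: "bounded K" "\<And>k x. x \<notin> K \<Longrightarrow> conv (\<rho> k) h x = 0"
  shows "l2lim (\<lambda>k. conv (\<rho> k) h) h"
proof -
  obtain C where C: "\<And>x. norm (h x) \<le> C" using h(2) unfolding bounded_iff by auto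
  obtain R where R: "K \<subseteq> cball 0 R" using K(1) unfolding bounded_iff subset_eq by auto
  show ?thesis
  proof (rule l2lim_dominated[OF _ _ sq_int_indicator_ball[of C R]])
    show "conv (\<rho> k) h \<in> borel_measurable borel" for k
      using conv_uniformly_continuous[OF bump_atD(4)[OF \<rho>] h] by (intro borel_measurable_continuous_onI uniformly_continuous_imp_continuous)
    show "h \<in> borel_measurable borel" using h(1) by (intro borel_measurable_continuous_onI uniformly_continuous_imp_continuous)
    show "AE x in lborel. (\<lambda>k. conv (\<rho> k) h x) \<longlonglongrightarrow> h x" by (intro AE_I2 conv_bump_tendsto[OF h \<rho> lim])
    have le: "norm (conv (\<rho> k) h x - 0) \<le> C" for k x
      by (rule conv_bump_bound[OF \<rho> uniformly_continuous_imp_continuous[OF h(1)] h(2)]) (simp add: C)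
    have "norm (conv (\<rho> k) h x) \<le> C * indicator (cball 0 R) x" for k x
      using le[of k x] K(2)[of x k] R by (cases "x \<in> K") (auto simp: indicator_def)
    then show "AE x in lborel. norm (conv (\<rho> k) h x) \<le> C * indicator (cball 0 R) x" for k by simp
  qed
qed

text \<open>Mollification with centred bumps of radius at most \<open>e\<close> keeps the support in
  the compact neighbourhood \<open>K1\<close> of \<open>K\<close>. The lemma serves compositions of
  test functions with functions that are only once continuously differentiable.\<close>

lemma h10_c1:
  assumes \<Omega>: "open \<Omega>" and g: "c1 g G" and K: "compact K" "K \<subseteq> \<Omega>" "\<And>x. x \<notin> K \<Longrightarrow> g x = 0"
  shows "h10 \<Omega> g G"
proof -
  have G0: "G x = 0" if "x \<notin> K" for x using c1_zero_outside[OF g compact_imp_closed[OF K(1)] K(3) that] .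
  have cg: "continuous_on UNIV g" "continuous_on UNIV G" using c1_continuous[OF g] g by (auto simp: c1_def)
  note ug = zero_outside_uniformly_continuous[OF cg(1) K(1,3)] and uG = zero_outside_uniformly_continuous[OF cg(2) K(1) G0]
  obtain e where e: "e > 0" "(\<Union>x\<in>K. cball x e) \<subseteq> \<Omega>"
    using compact_subset_open_imp_cball_epsilon_subset[OF K(1) \<Omega> K(2)] by blast
  define K1 where "K1 = {x + y |x y. x \<in> K \<and> y \<in> cball 0 e}"
  have cK1: "compact K1" unfolding K1_def by (intro compact_sums K compact_cball)
  have K1: "K1 \<subseteq> \<Omega>"
  proof
    fix z assume "z \<in> K1"
    then obtain x y where "z = x + y" "x \<in> K" "norm y \<le> e" unfolding K1_def by auto
    then have "z \<in> cball x e" by (simp add: dist_norm)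
    then show "z \<in> \<Omega>" using e(2) \<open>x \<in> K\<close> by blast
  qed
  define r where "r k = e / real (Suc k)" for k
  have r: "r k > 0" "r k \<le> e" for k using e(1) by (auto simp: r_def divide_le_eq)
  have rlim: "r \<longlonglongrightarrow> 0" unfolding r_def using tendsto_mult_left[OF LIMSEQ_Suc[OF lim_1_over_n], of e] by simp
  have "\<forall>k. \<exists>\<rho>. bump_at (0::'a) (r k) \<rho>" using bump_at_exists[OF r(1)] by blast
  then obtain \<rho> where \<rho>: "\<And>k. bump_at (0::'a) (r k) (\<rho> k)" by metis
  define f where "f k = conv (\<rho> k) g" for k
  have fc1: "c1 (f k) (conv (\<rho> k) G)" for k
    unfolding f_def by (rule conv_c1[OF bump_atD(4)[OF \<rho>] g ug(2) uG])
  have gradf: "grad (f k) = conv (\<rho> k) G" for k by (rule c1_grad[OF fc1])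
  have f0: "f k x = 0" if "x \<notin> K1" for k x
  proof -
    have "\<rho> k y *\<^sub>R g (x - y) = 0" for y
    proof (rule ccontr)
      assume "\<rho> k y *\<^sub>R g (x - y) \<noteq> 0"
      then have "y \<in> ball 0 (r k)" "x - y \<in> K" using bump_atD(3)[OF \<rho>, of y k] K(3)[of "x - y"] by auto
      then have "x \<in> K1" unfolding K1_def using r(2)[of k] by (intro CollectI exI[of _ "x - y"] exI[of _ y]) auto
      then show False using that by simp
    qed
    then show ?thesis by (simp only: f_def conv_def) simp
  qed
  have test: "f k \<in> test_functions \<Omega>" for k
  proof (rule test_functionsI[OF _ cK1 K1 f0])
    have "f k = conv g (\<rho> k)" unfolding f_def
      by (rule conv_commute[OF bump_atD(7)[OF \<rho>] borel_measurable_continuous_onI[OF cg(1)]])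
    moreover have "smooth (conv g (\<rho> k))"
      by (rule smooth_conv[OF integrable_compact_support[OF cg(1) K(1,3)] bump_atD(1)[OF \<rho>] compact_cball bump_atD(9)[OF \<rho>]])
    ultimately show "smooth (f k)" by simp
  qed
  have "l2lim f g" unfolding f_def
    by (rule conv_bump_l2lim[OF ug \<rho> tendsto_const rlim compact_imp_bounded[OF cK1]]) (assumption | rule f0[unfolded f_def])+
  moreover have "l2lim (\<lambda>k. grad (f k)) G" unfolding gradf
    by (rule conv_bump_l2lim[OF uG \<rho> tendsto_const rlim compact_imp_bounded[OF cK1]])
      (assumption | rule c1_zero_outside[OF fc1 compact_imp_closed[OF cK1] f0])+
  ultimately show ?thesis unfolding h10_def using test by blast
qed

section \<open>Chain rules\<close>

lemma tendsto_zero_le: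
  fixes a b :: "nat \<Rightarrow> real"
  assumes "\<And>k. 0 \<le> a k" "\<And>k. a k \<le> c * b k" "b \<longlonglongrightarrow> 0" shows "a \<longlonglongrightarrow> 0"
proof (rule tendsto_sandwich[OF _ _ tendsto_const])
  show "(\<lambda>k. c * b k) \<longlonglongrightarrow> 0" using tendsto_mult_left[OF assms(3), of c] by simp
qed (use assms in auto)

lemma h10_mult:
  assumes h: "h10 \<Omega> v V" and \<psi>: "smooth \<psi>" and C: "\<And>x. \<bar>\<psi> x\<bar> \<le> C" "\<And>x. norm (grad \<psi> x) \<le> C"
  shows "h10 \<Omega> (\<lambda>x. \<psi> x * v x) (\<lambda>x. \<psi> x *\<^sub>R V x + v x *\<^sub>R grad \<psi> x)"
proof -
  obtain f where f: "\<And>k. f k \<in> test_functions \<Omega>" "l2lim f v" "l2lim (\<lambda>k. grad (f k)) V" using h h10_def by blast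
  have [measurable]: "\<psi> \<in> borel_measurable borel" "grad \<psi> \<in> borel_measurable borel"
    using smooth_c1[OF \<psi>] c1_continuous[OF smooth_c1[OF \<psi>]] by (auto simp: c1_def intro: borel_measurable_continuous_onI)
  have nle: "nsq (\<lambda>x. \<psi> x *\<^sub>R g x) \<le> C\<^sup>2 * nsq g" "sq_int (\<lambda>x. \<psi> x *\<^sub>R g x)" if g: "sq_int g" for g :: "'a \<Rightarrow> 'a"
  proof -
    have [measurable]: "g \<in> borel_measurable borel" using g by (simp add: sq_int_def)
    show s: "sq_int (\<lambda>x. \<psi> x *\<^sub>R g x)"
      by (rule sq_int_dominated[OF _ g, of _ C]) (auto intro: mult_right_mono C)
    have "(norm (\<psi> x *\<^sub>R g x))\<^sup>2 \<le> C\<^sup>2 * (norm (g x))\<^sup>2" for x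
      using power_mono[OF mult_right_mono[OF C(1)[of x], of "norm (g x)"], of 2] by (simp add: power_mult_distrib)
    then have "nsq (\<lambda>x. \<psi> x *\<^sub>R g x) \<le> (LINT x|lborel. C\<^sup>2 * (norm (g x))\<^sup>2)"
      unfolding nsq_def using s g by (intro integral_mono) (auto simp del: norm_scaleR)
    then show "nsq (\<lambda>x. \<psi> x *\<^sub>R g x) \<le> C\<^sup>2 * nsq g" by (simp add: nsq_def)
  qed
  have nle1: "nsq (\<lambda>x. \<psi> x * g x) \<le> C\<^sup>2 * nsq g" "sq_int (\<lambda>x. \<psi> x * g x)"
    and nle2: "nsq (\<lambda>x. g x *\<^sub>R grad \<psi> x) \<le> C\<^sup>2 * nsq g" "sq_int (\<lambda>x. g x *\<^sub>R grad \<psi> x)" if g: "sq_int g" for g :: "'a \<Rightarrow> real"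
  proof -
    have [measurable]: "g \<in> borel_measurable borel" using g by (simp add: sq_int_def)
    have p: "(norm (\<psi> x * g x))\<^sup>2 \<le> C\<^sup>2 * (norm (g x))\<^sup>2" "(norm (g x *\<^sub>R grad \<psi> x))\<^sup>2 \<le> C\<^sup>2 * (norm (g x))\<^sup>2" for x
      using power_mono[OF mult_right_mono[OF C(1)[of x], of "norm (g x)"], of 2]
        power_mono[OF mult_right_mono[OF C(2)[of x], of "norm (g x)"], of 2] by (simp_all add: power_mult_distrib mult.commute)
    show s: "sq_int (\<lambda>x. \<psi> x * g x)"
      by (rule sq_int_bound[of _ "\<lambda>x. C\<^sup>2 * (norm (g x))\<^sup>2"]) (use p g in \<open>auto intro!: integrable_mult_right sq_int_integrable simp del: real_norm_def\<close>)
    show s': "sq_int (\<lambda>x. g x *\<^sub>R grad \<psi> x)"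
      by (rule sq_int_bound[of _ "\<lambda>x. C\<^sup>2 * (norm (g x))\<^sup>2"]) (use p g in \<open>auto intro!: integrable_mult_right sq_int_integrable simp del: real_norm_def norm_scaleR\<close>)
    have "nsq (\<lambda>x. \<psi> x * g x) \<le> (LINT x|lborel. C\<^sup>2 * (norm (g x))\<^sup>2)"
      unfolding nsq_def using s g p by (intro integral_mono) (auto simp del: real_norm_def intro!: integrable_mult_right sq_int_integrable)
    then show "nsq (\<lambda>x. \<psi> x * g x) \<le> C\<^sup>2 * nsq g" by (simp add: nsq_def)
    have "nsq (\<lambda>x. g x *\<^sub>R grad \<psi> x) \<le> (LINT x|lborel. C\<^sup>2 * (norm (g x))\<^sup>2)"
      unfolding nsq_def using s' g p by (intro integral_mono) (auto simp del: real_norm_def norm_scaleR intro!: integrable_mult_right sq_int_integrable)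
    then show "nsq (\<lambda>x. g x *\<^sub>R grad \<psi> x) \<le> C\<^sup>2 * nsq g" by (simp add: nsq_def)
  qed
  have null: "a \<longlonglongrightarrow> 0" if "\<And>k. 0 \<le> a k" "\<And>k. a k \<le> C\<^sup>2 * b k" "b \<longlonglongrightarrow> 0" for a b :: "nat \<Rightarrow> real"
    by (rule tendsto_zero_le[OF that])
  have 1: "l2lim (\<lambda>k x. \<psi> x * f k x) (\<lambda>x. \<psi> x * v x)"
    unfolding l2lim_def
  proof (intro conjI allI nle1 l2limD[OF f(2)])
    show "(\<lambda>k. nsq (\<lambda>x. \<psi> x * f k x - \<psi> x * v x)) \<longlonglongrightarrow> 0"
      using nle1(1)[OF sq_int_diff[OF l2limD(1)[OF f(2)] l2limD(2)[OF f(2)]]]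
      by (intro null[OF nsq_nonneg _ l2limD(3)[OF f(2)]]) (simp add: right_diff_distrib)
  qed
  have 2: "l2lim (\<lambda>k x. \<psi> x *\<^sub>R grad (f k) x) (\<lambda>x. \<psi> x *\<^sub>R V x)"
    unfolding l2lim_def
  proof (intro conjI allI nle l2limD[OF f(3)])
    show "(\<lambda>k. nsq (\<lambda>x. \<psi> x *\<^sub>R grad (f k) x - \<psi> x *\<^sub>R V x)) \<longlonglongrightarrow> 0"
      using nle(1)[OF sq_int_diff[OF l2limD(1)[OF f(3)] l2limD(2)[OF f(3)]]]
      by (intro null[OF nsq_nonneg _ l2limD(3)[OF f(3)]]) (simp add: scaleR_diff_right)
  qed
  have 3: "l2lim (\<lambda>k x. f k x *\<^sub>R grad \<psi> x) (\<lambda>x. v x *\<^sub>R grad \<psi> x)"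
    unfolding l2lim_def
  proof (intro conjI allI nle2 l2limD[OF f(2)])
    show "(\<lambda>k. nsq (\<lambda>x. f k x *\<^sub>R grad \<psi> x - v x *\<^sub>R grad \<psi> x)) \<longlonglongrightarrow> 0"
      using nle2(1)[OF sq_int_diff[OF l2limD(1)[OF f(2)] l2limD(2)[OF f(2)]]]
      by (intro null[OF nsq_nonneg _ l2limD(3)[OF f(2)]]) (simp add: scaleR_diff_left)
  qed
  have "grad (\<lambda>x. \<psi> x * f k x) = (\<lambda>x. \<psi> x *\<^sub>R grad (f k) x + f k x *\<^sub>R grad \<psi> x)" for k
    by (rule grad_mult[OF \<psi> test_functions_smooth[OF f(1)]])
  then show ?thesis unfolding h10_def
    using 1 l2lim_add[OF 2 3] test_functions_mult[OF \<psi> f(1)] by (intro exI[of _ "\<lambda>k x. \<psi> x * f k x"]) auto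
qed

lemma lipschitz_if_deriv_bounded:
  fixes p p' :: "real \<Rightarrow> real"
  assumes "\<And>t. (p has_real_derivative p' t) (at t)" "\<And>t. \<bar>p' t\<bar> \<le> L"
  shows "\<bar>p a - p b\<bar> \<le> L * \<bar>a - b\<bar>"
  using field_differentiable_bound[of UNIV p p' L a b] assms by auto

text \<open>As p' is only continuous, the gradients are compared in two steps: p'(f k) V converges
  by domination along an almost everywhere convergent subsequence, and replacing V by the gradient
  of f k costs at most \<open>L\<close> times a null sequence.\<close>

lemma h10_compose:
  assumes \<Omega>: "open \<Omega>" and h: "h10 \<Omega> v V"
    and p: "\<And>t. (p has_real_derivative p' t) (at t)" "continuous_on UNIV p'" "\<And>t. \<bar>p' t\<bar> \<le> L" "p 0 = 0"
  shows "h10 \<Omega> (\<lambda>x. p (v x)) (\<lambda>x. p' (v x) *\<^sub>R V x)"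
proof -
  obtain f0 where f0: "\<And>k. f0 k \<in> test_functions \<Omega>" "l2lim f0 v" "l2lim (\<lambda>k. grad (f0 k)) V" using h h10_def by blast
  obtain r :: "nat \<Rightarrow> nat" where r: "strict_mono r" "AE x in lborel. (\<lambda>k. f0 (r k) x) \<longlonglongrightarrow> v x"
    using l2lim_AE_subseq[OF f0(2)] by blast
  define f where "f k = f0 (r k)" for k
  have f: "\<And>k. f k \<in> test_functions \<Omega>" "l2lim f v" "l2lim (\<lambda>k. grad (f k)) V"
    using f0(1) l2lim_subseq[OF f0(2) r(1)] l2lim_subseq[OF f0(3) r(1)] by (auto simp: f_def[abs_def])
  have AEf: "AE x in lborel. (\<lambda>k. f k x) \<longlonglongrightarrow> v x" using r(2) by (simp add: f_def)
  have lip: "\<bar>p a - p b\<bar> \<le> L * \<bar>a - b\<bar>" for a b by (rule lipschitz_if_deriv_bounded[OF p(1,3)])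
  have cp: "continuous_on UNIV p" using p(1) by (meson DERIV_isCont continuous_at_imp_continuous_on)
  note [measurable] = borel_measurable_continuous_onI[OF cp] borel_measurable_continuous_onI[OF p(2)]
  have mv[measurable]: "v \<in> borel_measurable borel" "V \<in> borel_measurable borel"
    using h10_sq_int[OF h] by (auto simp: sq_int_def)
  have mf[measurable]: "f k \<in> borel_measurable borel" "grad (f k) \<in> borel_measurable borel" for k
    using test_function_sq_int[OF f(1)] by (auto simp: sq_int_def)
  have sc: "nsq (\<lambda>x. a x *\<^sub>R g x) \<le> L\<^sup>2 * nsq g" "sq_int (\<lambda>x. a x *\<^sub>R g x)"
    if g: "sq_int g" and [measurable]: "a \<in> borel_measurable borel" and a: "\<And>x. \<bar>a x\<bar> \<le> L" for a and g :: "'a \<Rightarrow> 'a"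
  proof -
    have [measurable]: "g \<in> borel_measurable borel" using g by (simp add: sq_int_def)
    show s: "sq_int (\<lambda>x. a x *\<^sub>R g x)"
      by (rule sq_int_dominated[OF _ g, of _ L]) (auto intro: mult_right_mono a)
    have "(norm (a x *\<^sub>R g x))\<^sup>2 \<le> L\<^sup>2 * (norm (g x))\<^sup>2" for x
      using power_mono[OF mult_right_mono[OF a[of x], of "norm (g x)"], of 2] by (simp add: power_mult_distrib)
    then have "nsq (\<lambda>x. a x *\<^sub>R g x) \<le> (LINT x|lborel. L\<^sup>2 * (norm (g x))\<^sup>2)"
      unfolding nsq_def using s g by (intro integral_mono) (auto simp del: norm_scaleR)
    then show "nsq (\<lambda>x. a x *\<^sub>R g x) \<le> L\<^sup>2 * nsq g" by (simp add: nsq_def)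
  qed
  have spf: "sq_int (\<lambda>x. p (w x))" if w: "sq_int w" for w :: "'a \<Rightarrow> real"
  proof (rule sq_int_dominated[OF _ w, of _ L])
    show "(\<lambda>x. p (w x)) \<in> borel_measurable borel" using w by (auto simp: sq_int_def)
    show "norm (p (w x)) \<le> L * norm (w x)" for x using lip[of "w x" 0] p(4) by simp
  qed
  have null: "a \<longlonglongrightarrow> 0" if "\<And>k. 0 \<le> a k" "\<And>k. a k \<le> L\<^sup>2 * b k" "b \<longlonglongrightarrow> 0" for a b :: "nat \<Rightarrow> real"
    by (rule tendsto_zero_le[OF that])
  have 1: "l2lim (\<lambda>k x. p (f k x)) (\<lambda>x. p (v x))"
    unfolding l2lim_def
  proof (intro conjI allI spf l2limD[OF f(2)])
    have "nsq (\<lambda>x. p (f k x) - p (v x)) \<le> L\<^sup>2 * nsq (\<lambda>x. f k x - v x)" for k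
    proof -
      have d: "sq_int (\<lambda>x. f k x - v x)" by (intro sq_int_diff l2limD[OF f(2)])
      have d': "sq_int (\<lambda>x. p (f k x) - p (v x))" by (intro sq_int_diff spf l2limD[OF f(2)])
      have "(norm (p (f k x) - p (v x)))\<^sup>2 \<le> L\<^sup>2 * (norm (f k x - v x))\<^sup>2" for x
        using power_mono[OF lip[of "f k x" "v x"], of 2] by (simp add: power_mult_distrib)
      then have "nsq (\<lambda>x. p (f k x) - p (v x)) \<le> (LINT x|lborel. L\<^sup>2 * (norm (f k x - v x))\<^sup>2)"
        unfolding nsq_def using d d' by (intro integral_mono) (auto simp del: real_norm_def intro!: integrable_mult_right sq_int_integrable)
      then show ?thesis by (simp add: nsq_def)
    qed
    then show "(\<lambda>k. nsq (\<lambda>x. p (f k x) - p (v x))) \<longlonglongrightarrow> 0"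
      by (intro null[OF nsq_nonneg _ l2limD(3)[OF f(2)]])
  qed
  have 2: "l2lim (\<lambda>k x. p' (f k x) *\<^sub>R V x) (\<lambda>x. p' (v x) *\<^sub>R V x)"
  proof (rule l2lim_dominated[where w = "\<lambda>x. L * norm (V x)"])
    show "sq_int (\<lambda>x. L * norm (V x))"
      by (rule sq_int_dominated[OF _ h10_sq_int(2)[OF h], of _ "\<bar>L\<bar>"]) (auto simp: abs_mult)
    show "AE x in lborel. (\<lambda>k. p' (f k x) *\<^sub>R V x) \<longlonglongrightarrow> p' (v x) *\<^sub>R V x"
      using AEf by eventually_elim (intro tendsto_intros continuous_on_tendsto_compose[OF p(2)]; simp)
    show "AE x in lborel. norm (p' (f k x) *\<^sub>R V x) \<le> L * norm (V x)" for k
      by (intro AE_I2) (simp add: mult_right_mono p(3))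
  qed measurable
  have 3: "l2lim (\<lambda>k x. p' (f k x) *\<^sub>R grad (f k) x) (\<lambda>x. p' (v x) *\<^sub>R V x)"
  proof (rule l2lim_perturb[OF 2])
    show "sq_int (\<lambda>x. p' (f k x) *\<^sub>R grad (f k) x)" for k
      by (rule sc(2)[OF l2limD(1)[OF f(3)]]) (auto intro: p(3))
    have "nsq (\<lambda>x. p' (f k x) *\<^sub>R (grad (f k) x - V x)) \<le> L\<^sup>2 * nsq (\<lambda>x. grad (f k) x - V x)" for k
      by (rule sc(1)[OF sq_int_diff[OF l2limD(1)[OF f(3)] l2limD(2)[OF f(3)]]]) (auto intro: p(3))
    then show "(\<lambda>k. nsq (\<lambda>x. p' (f k x) *\<^sub>R grad (f k) x - p' (f k x) *\<^sub>R V x)) \<longlonglongrightarrow> 0"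
      by (intro null[OF nsq_nonneg _ l2limD(3)[OF f(3)]]) (simp add: scaleR_diff_right)
  qed
  have "h10 \<Omega> (\<lambda>x. p (f k x)) (\<lambda>x. p' (f k x) *\<^sub>R grad (f k) x)" for k
  proof -
    obtain K where K: "compact K" "K \<subseteq> \<Omega>" "c1 (f k) (grad (f k))" "\<And>x. x \<notin> K \<Longrightarrow> f k x = 0"
      using f(1)[of k] by (rule test_function_c1) blast
    show ?thesis by (rule h10_c1[OF \<Omega> c1_compose[OF K(3) p(1,2)] K(1,2)]) (simp add: K(4) p(4))
  qed
  from h10_closed[OF this 1 3] show ?thesis .
qed

text \<open>The functions e arctan(v / e) tend to 0 while their gradients tend to V restricted to
  the zero set of v. Closedness of \<open>h10\<close> and uniqueness of the gradient make this limit
  0.\<close>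

lemma h10_grad_zero:
  assumes \<Omega>: "open \<Omega>" and h: "h10 \<Omega> v V"
  shows "AE x in lborel. v x = 0 \<longrightarrow> V x = 0"
proof -
  define e where "e k = 1 / real (Suc k)" for k
  have e: "e k > 0" for k by (simp add: e_def)
  have elim: "e \<longlonglongrightarrow> 0" unfolding e_def by (rule LIMSEQ_Suc[OF lim_1_over_n])
  have [measurable]: "v \<in> borel_measurable borel" "V \<in> borel_measurable borel" using h10_sq_int[OF h] by (auto simp: sq_int_def)
  have d: "((\<lambda>t. e k * arctan (t / e k)) has_real_derivative 1 / (1 + (t / e k)\<^sup>2)) (at t)" for k t
  proof -
    have "((\<lambda>t. e k * arctan (t / e k)) has_real_derivative e k * (inverse (1 + (t / e k)\<^sup>2) * (1 / e k))) (at t)"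
      by (intro DERIV_cmult DERIV_chain2[OF DERIV_arctan] DERIV_cdivide DERIV_ident)
    then show ?thesis using e[of k] by (simp add: inverse_eq_divide)
  qed
  have pos: "1 + s\<^sup>2 > 0" for s :: real by (simp add: add_pos_nonneg)
  have b1: "\<bar>1 / (1 + s\<^sup>2)\<bar> \<le> 1" for s :: real using pos[of s] by simp
  have hk: "h10 \<Omega> (\<lambda>x. e k * arctan (v x / e k)) (\<lambda>x. (1 / (1 + (v x / e k)\<^sup>2)) *\<^sub>R V x)" for k
  proof (rule h10_compose[OF \<Omega> h d])
    show "continuous_on UNIV (\<lambda>t. 1 / (1 + (t / e k)\<^sup>2))"
      using e[of k] pos by (intro continuous_intros) (auto simp: less_imp_neq[symmetric])
  qed (use b1 in auto)
  have 1: "l2lim (\<lambda>k x. e k * arctan (v x / e k)) (\<lambda>x. 0)"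
  proof (rule l2lim_dominated[where w = "\<lambda>x. \<bar>v x\<bar>"])
    show "sq_int (\<lambda>x. \<bar>v x\<bar>)" by (rule sq_int_dominated[OF _ h10_sq_int(1)[OF h], of _ 1]) auto
    have le: "norm (e k * arctan t) \<le> e k * (pi / 2)" for t k
      using arctan_lbound[of t] arctan_ubound[of t] e[of k] by (simp add: abs_mult abs_le_iff less_imp_le)
    have lim: "(\<lambda>k. e k * (pi / 2)) \<longlonglongrightarrow> 0" using tendsto_mult_right[OF elim, of "pi / 2"] by simp
    show "AE x in lborel. (\<lambda>k. e k * arctan (v x / e k)) \<longlonglongrightarrow> 0"
      by (intro AE_I2 Lim_null_comparison[OF always_eventually lim] allI le)
    have "\<bar>e k * arctan (t / e k) - e k * arctan (0 / e k)\<bar> \<le> 1 * \<bar>t - 0\<bar>" for k t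
      by (rule lipschitz_if_deriv_bounded[OF d b1])
    then show "AE x in lborel. norm (e k * arctan (v x / e k)) \<le> \<bar>v x\<bar>" for k by (intro AE_I2) simp
  qed measurable
  have 2: "l2lim (\<lambda>k x. (1 / (1 + (v x / e k)\<^sup>2)) *\<^sub>R V x) (\<lambda>x. if v x = 0 then V x else 0)"
  proof (rule l2lim_dominated[where w = "\<lambda>x. norm (V x)"])
    show "sq_int (\<lambda>x. norm (V x))" by (rule sq_int_dominated[OF _ h10_sq_int(2)[OF h], of _ 1]) auto
    show "AE x in lborel. (\<lambda>k. (1 / (1 + (v x / e k)\<^sup>2)) *\<^sub>R V x) \<longlonglongrightarrow> (if v x = 0 then V x else 0)"
    proof (rule AE_I2)
      fix x
      show "(\<lambda>k. (1 / (1 + (v x / e k)\<^sup>2)) *\<^sub>R V x) \<longlonglongrightarrow> (if v x = 0 then V x else 0)"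
      proof (cases "v x = 0")
        case False
        have eq: "1 / (1 + (v x / e k)\<^sup>2) = (e k)\<^sup>2 / ((e k)\<^sup>2 + (v x)\<^sup>2)" for k
          using e[of k] by (simp add: field_simps power2_eq_square)
        have "(\<lambda>k. (e k)\<^sup>2 / ((e k)\<^sup>2 + (v x)\<^sup>2)) \<longlonglongrightarrow> 0\<^sup>2 / (0\<^sup>2 + (v x)\<^sup>2)"
          using False by (intro tendsto_intros elim) auto
        then have "(\<lambda>k. (1 / (1 + (v x / e k)\<^sup>2)) *\<^sub>R V x) \<longlonglongrightarrow> 0 *\<^sub>R V x"
          unfolding eq by (intro tendsto_intros) simp
        then show ?thesis using False by simp
      qed simp
    qed
    show "AE x in lborel. norm ((1 / (1 + (v x / e k)\<^sup>2)) *\<^sub>R V x) \<le> norm (V x)" for k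
      using mult_right_mono[OF b1] unfolding norm_scaleR by (intro AE_I2) (metis mult_1 norm_ge_zero)
  qed measurable
  have "AE x in lborel. (if v x = 0 then V x else 0) = 0"
    by (rule h10_unique[OF h10_closed[OF hk 1 2] h10_zero]) auto
  then show ?thesis by eventually_elim auto
qed

text \<open>The absolute value is approximated by sqrt(v^2 + e^2) - e; subtracting e makes the
  approximations vanish where v does.\<close>

lemma h10_abs:
  assumes \<Omega>: "open \<Omega>" and h: "h10 \<Omega> v V"
  shows "h10 \<Omega> (\<lambda>x. \<bar>v x\<bar>) (\<lambda>x. sgn (v x) *\<^sub>R V x)"
proof -
  define e where "e k = 1 / real (Suc k)" for k
  have e: "e k > 0" for k by (simp add: e_def)
  have elim: "e \<longlonglongrightarrow> 0" unfolding e_def by (rule LIMSEQ_Suc[OF lim_1_over_n])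
  have [measurable]: "v \<in> borel_measurable borel" "V \<in> borel_measurable borel" using h10_sq_int[OF h] by (auto simp: sq_int_def)
  have pos: "t\<^sup>2 + (e k)\<^sup>2 > 0" for t k using e[of k] by (simp add: add_nonneg_pos)
  have d: "((\<lambda>t. sqrt (t\<^sup>2 + (e k)\<^sup>2) - e k) has_real_derivative t / sqrt (t\<^sup>2 + (e k)\<^sup>2)) (at t)" for k t
    using pos[of t k] by (auto intro!: derivative_eq_intros simp: field_simps)
  have b1: "\<bar>t / sqrt (t\<^sup>2 + (e k)\<^sup>2)\<bar> \<le> 1" for k t
  proof -
    have "\<bar>t\<bar> \<le> sqrt (t\<^sup>2 + (e k)\<^sup>2)" by (rule real_le_rsqrt) simp
    then show ?thesis using pos[of t k] by (simp add: abs_divide)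
  qed
  have hk: "h10 \<Omega> (\<lambda>x. sqrt ((v x)\<^sup>2 + (e k)\<^sup>2) - e k) (\<lambda>x. (v x / sqrt ((v x)\<^sup>2 + (e k)\<^sup>2)) *\<^sub>R V x)" for k
  proof (rule h10_compose[OF \<Omega> h d _ b1])
    show "continuous_on UNIV (\<lambda>t. t / sqrt (t\<^sup>2 + (e k)\<^sup>2))"
      using e[of k] by (intro continuous_intros) auto
  qed (use e[of k] in simp)
  have 1: "l2lim (\<lambda>k x. sqrt ((v x)\<^sup>2 + (e k)\<^sup>2) - e k) (\<lambda>x. \<bar>v x\<bar>)"
  proof (rule l2lim_dominated[where w = "\<lambda>x. \<bar>v x\<bar>"])
    show "sq_int (\<lambda>x. \<bar>v x\<bar>)" by (rule sq_int_dominated[OF _ h10_sq_int(1)[OF h], of _ 1]) auto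
    have "(\<lambda>k. sqrt (t\<^sup>2 + (e k)\<^sup>2) - e k) \<longlonglongrightarrow> sqrt (t\<^sup>2 + 0\<^sup>2) - 0" for t by (intro tendsto_intros elim)
    then show "AE x in lborel. (\<lambda>k. sqrt ((v x)\<^sup>2 + (e k)\<^sup>2) - e k) \<longlonglongrightarrow> \<bar>v x\<bar>" by simp
    have "\<bar>(sqrt (t\<^sup>2 + (e k)\<^sup>2) - e k) - (sqrt (0\<^sup>2 + (e k)\<^sup>2) - e k)\<bar> \<le> 1 * \<bar>t - 0\<bar>" for k t
      by (rule lipschitz_if_deriv_bounded[OF d b1])
    moreover have "\<bar>e k\<bar> = e k" for k using e[of k] by simp
    ultimately show "AE x in lborel. norm (sqrt ((v x)\<^sup>2 + (e k)\<^sup>2) - e k) \<le> \<bar>v x\<bar>" for k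
      by (intro AE_I2) simp
  qed measurable
  have 2: "l2lim (\<lambda>k x. (v x / sqrt ((v x)\<^sup>2 + (e k)\<^sup>2)) *\<^sub>R V x) (\<lambda>x. sgn (v x) *\<^sub>R V x)"
  proof (rule l2lim_dominated[where w = "\<lambda>x. norm (V x)"])
    show "sq_int (\<lambda>x. norm (V x))" by (rule sq_int_dominated[OF _ h10_sq_int(2)[OF h], of _ 1]) auto
    have "(\<lambda>k. t / sqrt (t\<^sup>2 + (e k)\<^sup>2)) \<longlonglongrightarrow> sgn t" for t
    proof (cases "t = 0")
      case False
      have "(\<lambda>k. t / sqrt (t\<^sup>2 + (e k)\<^sup>2)) \<longlonglongrightarrow> t / sqrt (t\<^sup>2 + 0\<^sup>2)"
        using False by (intro tendsto_intros elim) auto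
      then show ?thesis by (simp add: real_sgn_eq)
    qed simp
    then show "AE x in lborel. (\<lambda>k. (v x / sqrt ((v x)\<^sup>2 + (e k)\<^sup>2)) *\<^sub>R V x) \<longlonglongrightarrow> sgn (v x) *\<^sub>R V x"
      by (intro AE_I2 tendsto_intros)
    show "AE x in lborel. norm ((v x / sqrt ((v x)\<^sup>2 + (e k)\<^sup>2)) *\<^sub>R V x) \<le> norm (V x)" for k
      using mult_right_mono[OF b1] unfolding norm_scaleR by (intro AE_I2) (metis mult_1 norm_ge_zero)
  qed measurable
  show ?thesis by (rule h10_closed[OF hk 1 2])
qed

text \<open>The factor \<open>sgn (v x)\<close> has modulus 1 except on the zero set of
  \<open>v\<close>, where \<open>V\<close> vanishes by \<open>h10_grad_zero\<close>.\<close>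

lemma h10_abs_nsq:
  assumes \<Omega>: "open \<Omega>" and h: "h10 \<Omega> v V"
  shows "nsq (\<lambda>x. sgn (v x) *\<^sub>R V x) = nsq V"
  unfolding nsq_def
proof (rule integral_cong_AE)
  show "AE x in lborel. (norm (sgn (v x) *\<^sub>R V x))\<^sup>2 = (norm (V x))\<^sup>2"
    using h10_grad_zero[OF \<Omega> h] by eventually_elim (auto simp: abs_sgn_eq)
qed (use h10_sq_int[OF h10_abs[OF \<Omega> h]] h10_sq_int[OF h] in \<open>auto simp: sq_int_def\<close>)

text \<open>For t \<ge> 0 this is the function t / (t + e). The modulus extends it to an odd,
  continuously differentiable function on the whole line, as \<open>h10_compose\<close>
  requires.\<close>

lemma ratio_deriv:
  assumes e: "e > 0"
  shows "((\<lambda>t. t / (\<bar>t\<bar> + e)) has_real_derivative e / (\<bar>t\<bar> + e)\<^sup>2) (at t)"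
proof (cases t "0::real" rule: linorder_cases)
  case less
  have "((\<lambda>t. t / (- t + e)) has_real_derivative e / (\<bar>t\<bar> + e)\<^sup>2) (at t)"
    using less e by (auto intro!: derivative_eq_intros simp: field_simps power2_eq_square)
  then show ?thesis
    by (rule DERIV_cong_ev[OF refl _ refl, THEN iffD1, rotated])
      (use less in \<open>intro eventually_nhds_in_open[of "{..<0}", THEN eventually_mono]; auto\<close>)
next
  case greater
  have "((\<lambda>t. t / (t + e)) has_real_derivative e / (\<bar>t\<bar> + e)\<^sup>2) (at t)"
    using greater e by (auto intro!: derivative_eq_intros simp: field_simps power2_eq_square)
  then show ?thesis
    by (rule DERIV_cong_ev[OF refl _ refl, THEN iffD1, rotated])
      (use greater in \<open>intro eventually_nhds_in_open[of "{0<..}", THEN eventually_mono]; auto\<close>)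
next
  case equal
  have "((\<lambda>h. 1 / (\<bar>h\<bar> + e)) \<longlongrightarrow> 1 / (\<bar>0::real\<bar> + e)) (at 0)"
    using e by (intro tendsto_intros) auto
  moreover have "((\<lambda>h. ((0 + h) / (\<bar>0 + h\<bar> + e) - 0 / (\<bar>0\<bar> + e)) / h) \<longlongrightarrow> 1 / e) (at 0) \<longleftrightarrow>
      ((\<lambda>h. 1 / (\<bar>h\<bar> + e)) \<longlongrightarrow> 1 / e) (at 0)"
    by (rule LIM_cong) auto
  ultimately have "((\<lambda>h. ((0 + h) / (\<bar>0 + h\<bar> + e) - 0 / (\<bar>0\<bar> + e)) / h) \<longlongrightarrow> 1 / e) (at 0)" by simp
  then show ?thesis using equal e by (simp add: DERIV_def power2_eq_square)
qed

section \<open>Functions with vanishing weak gradient\<close>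

lemma AE_lborel_shift:
  assumes "AE y in lborel. Q (x + y)" "{x. Q x} \<in> sets borel"
  shows "AE y in lborel. Q (y :: 'a::euclidean_space)"
proof -
  have "AE y in distr lborel borel (\<lambda>y. x + y). Q y"
    using assms by (subst AE_distr_iff) auto
  then show ?thesis unfolding lborel_distr_shift .
qed

text \<open>The correlation of the indicator of \<open>E\<close> with a test function has zero
  gradient in the shift, hence is constant for small shifts, so the indicator agrees almost
  everywhere with its small translates. Exchanging the two almost-everywhere quantifiers fixes one
  point whose membership decides for almost all nearby points.\<close>

lemma indicator_locally_const:
  fixes E :: "'a::euclidean_space set"
  assumes E: "E \<in> sets borel" "bounded E" and r: "r > 0"
    and weak: "\<And>\<psi>. \<psi> \<in> test_functions (ball z (2 * r)) \<Longrightarrow> (LINT x|lborel. indicator E x *\<^sub>R grad \<psi> x) = 0"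
  shows "(AE x in lborel. x \<in> ball z (r / 2) \<longrightarrow> x \<in> E) \<or> (AE x in lborel. x \<in> ball z (r / 2) \<longrightarrow> x \<notin> E)"
proof -
  let ?E = "indicator E :: 'a \<Rightarrow> real"
  have Em[measurable]: "E \<in> sets borel" by fact
  have shift: "AE x in lborel. x \<in> ball z r \<longrightarrow> ?E (x + y) - ?E x = 0" if y: "norm y < r" for y
  proof (rule fundamental_lemma)
    have m: "(\<lambda>x. ?E (x + y) - ?E x) \<in> borel_measurable borel" by measurable
    then show "(\<lambda>x. ?E (x + y) - ?E x) \<in> borel_measurable borel" .
    show "set_integrable lborel K (\<lambda>x. ?E (x + y) - ?E x)" if K: "compact K" for K
    proof -
      have [measurable]: "K \<in> sets borel" using K by (simp add: compact_imp_closed)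
      show ?thesis unfolding set_integrable_def
        by (rule integrable_bounded_support[OF _ _ compact_imp_bounded[OF K], of _ 1]) (auto simp: indicator_def)
    qed
    fix \<psi> :: "'a \<Rightarrow> real" assume \<psi>: "\<psi> \<in> test_functions (ball z r)"
    obtain K where K: "compact K" "K \<subseteq> ball z r" "c1 \<psi> (grad \<psi>)" "\<And>x. x \<notin> K \<Longrightarrow> \<psi> x = 0" "\<And>x. x \<notin> K \<Longrightarrow> grad \<psi> x = 0"
      using \<psi> by (rule test_function_c1) blast
    have cg: "continuous_on UNIV (grad \<psi>)" "continuous_on UNIV \<psi>" using K(3) c1_continuous[OF K(3)] by (auto simp: c1_def)
    note u1 = zero_outside_uniformly_continuous[OF cg(2) K(1,4)] and u2 = zero_outside_uniformly_continuous[OF cg(1) K(1,5)]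
    have m\<psi>[measurable]: "\<psi> \<in> borel_measurable borel" "grad \<psi> \<in> borel_measurable borel"
      using cg by (auto intro: borel_measurable_continuous_onI)
    have iE: "integrable lborel ?E"
      by (rule integrable_bounded_support[OF _ _ E(2), of _ 1]) (auto simp: indicator_def)
    \<comment> \<open>Reflection turns convolution into correlation: \<open>conv ?u \<psi> q\<close>
      is the integral over \<open>E\<close> of \<psi>(x + q).\<close>
    let ?u = "\<lambda>w. ?E (0 - w)"
    have iu: "integrable lborel ?u" using integral_lborel_reflect(2)[of ?E 0] iE by simp
    have c: "c1 (conv ?u \<psi>) (conv ?u (grad \<psi>))" by (rule conv_c1[OF iu K(3) u1(2) u2])
    have conv1: "conv ?u \<psi> q = (LINT x|lborel. ?E x * \<psi> (x + q))" for q
      using integral_lborel_reflect(1)[of "\<lambda>x. ?E x *\<^sub>R \<psi> (x + q)" 0] by (simp add: conv_def)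
    have conv2: "conv ?u (grad \<psi>) q = (LINT x|lborel. ?E x *\<^sub>R grad \<psi> (x + q))" for q
      using integral_lborel_reflect(1)[of "\<lambda>x. ?E x *\<^sub>R grad \<psi> (x + q)" 0] by (simp add: conv_def)
    have gsm: "smooth (\<lambda>x. \<psi> (x + q))" for q using smooth_affine[OF test_functions_smooth[OF \<psi>], of 1 q] by simp
    have g_shift: "grad (\<lambda>x. \<psi> (x + q)) = (\<lambda>x. grad \<psi> (x + q))" for q
    proof (rule c1_grad)
      show "c1 (\<lambda>x. \<psi> (x + q)) (\<lambda>x. grad \<psi> (x + q))"
        unfolding c1_def
      proof (intro conjI allI)
        fix x
        have "((\<lambda>x. x + q) has_derivative (\<lambda>h. h)) (at x)" by (auto intro!: derivative_eq_intros)
        from has_derivative_compose[OF this, of \<psi> "\<lambda>h. grad \<psi> (x + q) \<bullet> h"]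
        show "((\<lambda>x. \<psi> (x + q)) has_derivative (\<lambda>h. grad \<psi> (x + q) \<bullet> h)) (at x)" using K(3) by (auto simp: c1_def)
        show "continuous_on UNIV (\<lambda>x. grad \<psi> (x + q))"
          by (rule continuous_on_compose2[OF cg(1)]) (auto intro!: continuous_intros)
      qed
    qed
    \<comment> \<open>The doubled radius in \<open>weak\<close> leaves room for shifts of length
      below \<open>r\<close>.\<close>
    have tst: "(\<lambda>x. \<psi> (x + q)) \<in> test_functions (ball z (2 * r))" if q: "norm q < r" for q
    proof (rule test_functionsI[OF gsm, of "(\<lambda>x. x + (- q)) ` K"])
      show "compact ((\<lambda>x. x + (- q)) ` K)" using K(1) by (intro compact_continuous_image continuous_intros)
      show "(\<lambda>x. x + (- q)) ` K \<subseteq> ball z (2 * r)"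
      proof
        fix x assume "x \<in> (\<lambda>x. x + (- q)) ` K"
        then obtain k where k: "k \<in> K" "x = k - q" by auto
        then have "norm (z - k) < r" using K(2) by (auto simp: dist_norm)
        moreover have "z - x = (z - k) + q" using k(2) by simp
        ultimately have "norm (z - x) < 2 * r" using q norm_triangle_ineq[of "z - k" q] unfolding \<open>z - x = (z - k) + q\<close> by linarith
        then show "x \<in> ball z (2 * r)" by (simp add: dist_norm)
      qed
      show "\<psi> (x + q) = 0" if "x \<notin> (\<lambda>x. x + (- q)) ` K" for x
      proof (rule K(4), rule notI)
        assume "x + q \<in> K"
        then have "x \<in> (\<lambda>x. x + (- q)) ` K" by (intro image_eqI[of _ _ "x + q"]) auto
        with that show False by simp
      qed
    qed
    have z: "conv ?u (grad \<psi>) q = 0" if "q \<in> ball 0 r" for q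
      using weak[OF tst[of q]] that unfolding conv2 g_shift by simp
    have "(conv ?u \<psi> has_derivative (\<lambda>h. 0)) (at q within ball 0 r)" if "q \<in> ball 0 r" for q
    proof -
      have "(conv ?u \<psi> has_derivative (\<lambda>h. conv ?u (grad \<psi>) q \<bullet> h)) (at q)" using c unfolding c1_def by blast
      then show ?thesis unfolding z[OF that] inner_zero_left by (rule has_derivative_at_withinI)
    qed
    from has_derivative_zero_unique[OF convex_ball this, of "- y" 0]
    have "(LINT x|lborel. ?E x * \<psi> (x + - y)) = (LINT x|lborel. ?E x * \<psi> (x + 0))"
      using y r unfolding conv1 by simp
    moreover have "(LINT x|lborel. ?E (y + x) * \<psi> x) = (LINT x|lborel. ?E x * \<psi> (x + - y))"
      using integral_lborel_shift(1)[of "\<lambda>x. ?E x * \<psi> (x + - y)" y] by simp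
    ultimately have eq: "(LINT x|lborel. ?E (y + x) * \<psi> x) = (LINT x|lborel. ?E x * \<psi> x)" by simp
    have i\<psi>: "integrable lborel \<psi>" by (rule integrable_compact_support[OF cg(2) K(1,4)])
    have i: "integrable lborel (\<lambda>x. \<psi> x *\<^sub>R ?E (y + x))" "integrable lborel (\<lambda>x. \<psi> x *\<^sub>R ?E x)"
      by (rule integrable_scaleR_bounded[OF i\<psi>, of _ 1]; auto simp: indicator_def)+
    have "(LINT x|lborel. (?E (x + y) - ?E x) * \<psi> x) = (LINT x|lborel. \<psi> x *\<^sub>R ?E (y + x) - \<psi> x *\<^sub>R ?E x)"
      by (intro Bochner_Integration.integral_cong refl) (simp add: algebra_simps)
    also have "\<dots> = (LINT x|lborel. \<psi> x *\<^sub>R ?E (y + x)) - (LINT x|lborel. \<psi> x *\<^sub>R ?E x)"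
      by (rule Bochner_Integration.integral_diff[OF i])
    also have "\<dots> = 0" using eq by (simp add: mult.commute)
    finally show "(LINT x|lborel. (?E (x + y) - ?E x) * \<psi> x) = 0" .
  qed auto
  have "AE y in lborel. AE x in lborel. norm y < r \<longrightarrow> x \<in> ball z r \<longrightarrow> ?E (x + y) - ?E x = 0"
  proof (rule AE_I2)
    fix y :: 'a
    show "AE x in lborel. norm y < r \<longrightarrow> x \<in> ball z r \<longrightarrow> ?E (x + y) - ?E x = 0"
      using shift[of y] by (cases "norm y < r") simp_all
  qed
  \<comment> \<open>So far the exceptional set of x depends on the shift y; by Tonelli, almost every
    x works for almost every y.\<close>
  then have "AE x in lborel. AE y in lborel. norm y < r \<longrightarrow> x \<in> ball z r \<longrightarrow> ?E (x + y) - ?E x = 0"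
  proof (subst (asm) lborel_pair.AE_commute)
    have [measurable]: "ball z r \<in> sets borel" by simp
    have "(\<lambda>p. ?E (snd p + fst p) - ?E (snd p)) \<in> borel_measurable (borel \<Otimes>\<^sub>M borel)" by measurable
    then have [measurable]: "Measurable.pred (borel \<Otimes>\<^sub>M borel) (\<lambda>p. ?E (snd p + fst p) - ?E (snd p) = 0)" by measurable
    have "Measurable.pred (borel \<Otimes>\<^sub>M borel) (\<lambda>p. norm (fst p) < r \<longrightarrow> snd p \<in> ball z r \<longrightarrow> ?E (snd p + fst p) - ?E (snd p) = 0)"
      by measurable
    then show "{p \<in> space (lborel \<Otimes>\<^sub>M lborel). norm (fst p) < r \<longrightarrow> snd p \<in> ball z r \<longrightarrow> ?E (snd p + fst p) - ?E (snd p) = 0} \<in> sets (lborel \<Otimes>\<^sub>M lborel)"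
      by (simp add: pred_def space_pair_measure cong: sets_pair_measure_cong)
  qed
  \<comment> \<open>Such a point exists in the ball because the ball is not a null set.\<close>
  then have "\<exists>x\<in>ball z (r / 2). AE y in lborel. norm y < r \<longrightarrow> x \<in> ball z r \<longrightarrow> ?E (x + y) - ?E x = 0"
  proof (rule contrapos_pp)
    assume "\<not> (\<exists>x\<in>ball z (r / 2). AE y in lborel. norm y < r \<longrightarrow> x \<in> ball z r \<longrightarrow> ?E (x + y) - ?E x = 0)"
    then have *: "\<And>x. (AE y in lborel. norm y < r \<longrightarrow> x \<in> ball z r \<longrightarrow> ?E (x + y) - ?E x = 0) \<Longrightarrow> x \<notin> ball z (r / 2)" by blast
    show "\<not> (AE x in lborel. AE y in lborel. norm y < r \<longrightarrow> x \<in> ball z r \<longrightarrow> ?E (x + y) - ?E x = 0)"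
    proof
      assume "AE x in lborel. AE y in lborel. norm y < r \<longrightarrow> x \<in> ball z r \<longrightarrow> ?E (x + y) - ?E x = 0"
      then have "AE x in lborel. x \<notin> ball z (r / 2)" by (rule eventually_mono) (rule *)
      then have "emeasure lborel (ball z (r / 2)) = 0" by (subst (asm) AE_iff_measurable[of "ball z (r / 2)"]) auto
      then show False using content_ball_pos[of "r / 2" z] r by (simp add: measure_def)
    qed
  qed
  then obtain x where x: "x \<in> ball z (r / 2)"
    and ae: "AE y in lborel. norm y < r \<longrightarrow> x \<in> ball z r \<longrightarrow> ?E (x + y) - ?E x = 0" by blast
  from ae have "AE y in lborel. x + y \<in> ball z (r / 2) \<longrightarrow> (x + y \<in> E \<longleftrightarrow> x \<in> E)"
  proof eventually_elim
    case (elim y)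
    show ?case
    proof
      assume "x + y \<in> ball z (r / 2)"
      then have "norm ((z - x) - (z - (x + y))) < r / 2 + r / 2"
        using x norm_triangle_ineq4[of "z - x" "z - (x + y)"] by (auto simp: dist_norm)
      then have "norm y < r" by simp
      moreover have "x \<in> ball z r" using x r by auto
      ultimately show "x + y \<in> E \<longleftrightarrow> x \<in> E" using elim by (auto simp: indicator_def split: if_splits)
    qed
  qed
  then have "AE y in lborel. y \<in> ball z (r / 2) \<longrightarrow> (y \<in> E \<longleftrightarrow> x \<in> E)"
  proof (rule AE_lborel_shift)
    have "{y. y \<in> ball z (r / 2) \<longrightarrow> (y \<in> E \<longleftrightarrow> x \<in> E)} = - ball z (r / 2) \<union> (if x \<in> E then E else - E)" by auto
    then show "{y. y \<in> ball z (r / 2) \<longrightarrow> (y \<in> E \<longleftrightarrow> x \<in> E)} \<in> sets borel" by (auto intro: borel_comp)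
  qed
  then show ?thesis by (cases "x \<in> E") auto
qed

text \<open>The points near which \<open>E\<close> has full measure and those near which it is null
  form two disjoint open sets covering \<Omega>, so one of them is empty. A countable subcover turns
  the local statements into a global one.\<close>

lemma zero_weak_gradient_connected:
  fixes E :: "'a::euclidean_space set"
  assumes \<Omega>: "open \<Omega>" "connected \<Omega>" and E: "E \<in> sets borel" "bounded E"
    and weak: "\<And>\<psi>. \<psi> \<in> test_functions \<Omega> \<Longrightarrow> (LINT x|lborel. indicator E x *\<^sub>R grad \<psi> x) = 0"
  shows "(AE x in lborel. x \<in> \<Omega> \<longrightarrow> x \<in> E) \<or> (AE x in lborel. x \<in> \<Omega> \<longrightarrow> x \<notin> E)"
proof -
  define A where "A = {z \<in> \<Omega>. \<exists>r>0. AE x in lborel. x \<in> ball z r \<longrightarrow> x \<in> E}"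
  define B where "B = {z \<in> \<Omega>. \<exists>r>0. AE x in lborel. x \<in> ball z r \<longrightarrow> x \<notin> E}"
  have AB: "\<Omega> \<subseteq> A \<union> B"
  proof
    fix z assume z: "z \<in> \<Omega>"
    then obtain e where e: "e > 0" "ball z e \<subseteq> \<Omega>" using \<Omega>(1) openE by blast
    have "(AE x in lborel. x \<in> ball z (e / 2 / 2) \<longrightarrow> x \<in> E) \<or> (AE x in lborel. x \<in> ball z (e / 2 / 2) \<longrightarrow> x \<notin> E)"
    proof (rule indicator_locally_const[OF E])
      show "(LINT x|lborel. indicator E x *\<^sub>R grad \<psi> x) = 0" if "\<psi> \<in> test_functions (ball z (2 * (e / 2)))" for \<psi>
        using weak test_functions_mono[OF e(2)] that by auto
    qed (use e in auto)
    then show "z \<in> A \<union> B" using z e(1) unfolding A_def B_def by (auto intro: exI[of _ "e / 2 / 2"])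
  qed
  have op: "open {z \<in> \<Omega>. \<exists>r>0. AE x in lborel. x \<in> ball z r \<longrightarrow> P x}" for P
  proof (rule openI)
    fix z assume "z \<in> {z \<in> \<Omega>. \<exists>r>0. AE x in lborel. x \<in> ball z r \<longrightarrow> P x}"
    then obtain r where r: "z \<in> \<Omega>" "r > 0" "AE x in lborel. x \<in> ball z r \<longrightarrow> P x" by auto
    obtain e where e: "e > 0" "ball z e \<subseteq> \<Omega>" using r(1) \<Omega>(1) openE by blast
    have "ball z (min e (r / 2)) \<subseteq> {z \<in> \<Omega>. \<exists>r>0. AE x in lborel. x \<in> ball z r \<longrightarrow> P x}"
    proof
      fix y assume y: "y \<in> ball z (min e (r / 2))"
      have "AE x in lborel. x \<in> ball y (r / 2) \<longrightarrow> P x"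
        using r(3)
      proof eventually_elim
        case (elim x)
        have "dist z x \<le> dist z y + dist y x" by (rule dist_triangle)
        then show ?case using elim y by auto
      qed
      then show "y \<in> {z \<in> \<Omega>. \<exists>r>0. AE x in lborel. x \<in> ball z r \<longrightarrow> P x}"
        using y e r(2) by (auto intro!: exI[of _ "r / 2"])
    qed
    then show "\<exists>e>0. ball z e \<subseteq> {z \<in> \<Omega>. \<exists>r>0. AE x in lborel. x \<in> ball z r \<longrightarrow> P x}"
      using e(1) r(2) by (intro exI[of _ "min e (r / 2)"]) auto
  qed
  have oAB: "open A" "open B" unfolding A_def B_def by (rule op)+
  have disj: "A \<inter> B = {}"
  proof (rule ccontr)
    assume "A \<inter> B \<noteq> {}"
    then obtain z r r' where r: "r > 0" "AE x in lborel. x \<in> ball z r \<longrightarrow> x \<in> E" "r' > 0" "AE x in lborel. x \<in> ball z r' \<longrightarrow> x \<notin> E"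
      unfolding A_def B_def by auto
    from r(2,4) have "AE x in lborel. x \<notin> ball z (min r r')" by eventually_elim auto
    then have "emeasure lborel (ball z (min r r')) = 0" by (subst (asm) AE_iff_measurable[of "ball z (min r r')"]) auto
    then show False using content_ball_pos[of "min r r'" z] r(1,3) by (simp add: measure_def)
  qed
  have glue: "AE x in lborel. x \<in> \<Omega> \<longrightarrow> P x" if P: "\<Omega> \<subseteq> {z \<in> \<Omega>. \<exists>r>0. AE x in lborel. x \<in> ball z r \<longrightarrow> P x}" for P
  proof -
    have "\<forall>z\<in>\<Omega>. \<exists>r>0. AE x in lborel. x \<in> ball z r \<longrightarrow> P x" using P by auto
    then obtain r where r: "\<And>z. z \<in> \<Omega> \<Longrightarrow> r z > 0 \<and> (AE x in lborel. x \<in> ball z (r z) \<longrightarrow> P x)" by metis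
    obtain D where D: "D \<subseteq> (\<lambda>z. ball z (r z)) ` \<Omega>" "countable D" "\<Union>D = \<Union>((\<lambda>z. ball z (r z)) ` \<Omega>)"
      using Lindelof[of "(\<lambda>z. ball z (r z)) ` \<Omega>"] by auto
    have "AE x in lborel. \<forall>S\<in>D. x \<in> S \<longrightarrow> P x"
      using D(1,2) r by (subst AE_ball_countable) auto
    then show ?thesis
    proof eventually_elim
      case (elim x)
      show ?case
      proof
        assume "x \<in> \<Omega>"
        then have "x \<in> \<Union>D" unfolding D(3) using r by (intro UnionI[of "ball x (r x)"]) auto
        then show "P x" using elim by auto
      qed
    qed
  qed
  have "A = {} \<or> B = {}"
    using connectedD[OF \<Omega>(2) oAB _ AB] disj unfolding A_def B_def by blast
  then show ?thesis
  proof
    assume "A = {}" then show ?thesis using AB glue[of "\<lambda>x. x \<notin> E"] unfolding B_def by auto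
  next
    assume "B = {}" then show ?thesis using AB glue[of "\<lambda>x. x \<in> E"] unfolding A_def by auto
  qed
qed

section \<open>Orthogonal expansions\<close>

text \<open>Orthogonal but not normalised: \<open>w j\<close> is the squared norm of the j-th member
  and may be 0. The instances are the eigenfunctions, with w = 1, and their gradients, with the
  eigenvalues as w.\<close>

locale orthogonal_system =
  fixes \<psi> :: "nat \<Rightarrow> 'a::euclidean_space \<Rightarrow> 'b::euclidean_space" and w :: "nat \<Rightarrow> real"
  assumes \<psi>: "sq_int (\<psi> j)"
    and orth: "(LINT x|lborel. \<psi> i x \<bullet> \<psi> j x) = (if i = j then w j else 0)"
begin

definition partial :: "(nat \<Rightarrow> real) \<Rightarrow> nat set \<Rightarrow> 'a \<Rightarrow> 'b" where
  "partial a I x = (\<Sum>j\<in>I. a j *\<^sub>R \<psi> j x)"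

lemma w_nonneg: "0 \<le> w j"
  using orth[of j j] nsq_nonneg[of "\<psi> j"] by (simp add: nsq_inner)

lemma partial_sq_int: "sq_int (partial a I)"
  unfolding partial_def by (intro sq_int_sum sq_int_scaleR \<psi>)

lemma inner_partial:
  assumes v: "sq_int v"
  shows "(LINT x|lborel. v x \<bullet> partial a I x) = (\<Sum>j\<in>I. a j * (LINT x|lborel. v x \<bullet> \<psi> j x))"
proof -
  have "(LINT x|lborel. v x \<bullet> partial a I x) = (LINT x|lborel. (\<Sum>j\<in>I. a j * (v x \<bullet> \<psi> j x)))"
    by (simp add: partial_def inner_sum_right)
  also have "\<dots> = (\<Sum>j\<in>I. a j * (LINT x|lborel. v x \<bullet> \<psi> j x))"
    using sq_int_inner[OF v \<psi>] by (subst Bochner_Integration.integral_sum) auto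
  finally show ?thesis .
qed

lemma partial_coeff:
  assumes "finite I" shows "(LINT x|lborel. partial a I x \<bullet> \<psi> i x) = (if i \<in> I then w i * a i else 0)"
proof -
  have "(LINT x|lborel. partial a I x \<bullet> \<psi> i x) = (\<Sum>j\<in>I. a j * (LINT x|lborel. \<psi> i x \<bullet> \<psi> j x))"
    using inner_partial[OF \<psi>[of i], of a I] by (simp add: inner_commute)
  also have "\<dots> = (\<Sum>j\<in>I. if i = j then w i * a i else 0)"
    by (intro sum.cong) (auto simp: orth)
  finally show ?thesis using assms by simp
qed

lemma inner_partial_partial:
  "finite I \<Longrightarrow> (LINT x|lborel. partial a I x \<bullet> partial b I x) = (\<Sum>j\<in>I. w j * a j * b j)"
  unfolding inner_partial[OF partial_sq_int] by (intro sum.cong) (auto simp: partial_coeff)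

lemma nsq_partial: "finite I \<Longrightarrow> nsq (partial a I) = (\<Sum>j\<in>I. w j * (a j)\<^sup>2)"
  unfolding nsq_inner inner_partial_partial by (simp add: power2_eq_square mult.assoc)

text \<open>The coefficients enter as \<open>w j * c j\<close>, without a division, which also
  covers members of norm 0.\<close>

lemma Bessel:
  assumes v: "sq_int v" and c: "\<And>j. (LINT x|lborel. v x \<bullet> \<psi> j x) = w j * c j" and I: "finite I"
  shows "(\<Sum>j\<in>I. w j * (c j)\<^sup>2) \<le> nsq v"
proof -
  have ip: "(LINT x|lborel. v x \<bullet> partial c I x) = (\<Sum>j\<in>I. w j * (c j)\<^sup>2)"
    unfolding inner_partial[OF v] c by (intro sum.cong) (auto simp: power2_eq_square)
  have "0 \<le> nsq (\<lambda>x. v x + (-1) *\<^sub>R partial c I x)" by simp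
  also have "\<dots> = nsq v - 2 * (\<Sum>j\<in>I. w j * (c j)\<^sup>2) + (\<Sum>j\<in>I. w j * (c j)\<^sup>2)"
    using nsq_expand[OF v partial_sq_int, of "-1" c I] ip nsq_partial[OF I, of c] by simp
  finally show ?thesis by simp
qed

lemma partial_converges:
  assumes "summable (\<lambda>j. w j * (a j)\<^sup>2)"
  obtains v where "l2lim (\<lambda>N. partial a {..<N}) v"
proof (rule l2_complete[OF partial_sq_int])
  fix e :: real assume "e > 0"
  then obtain N where N: "\<And>m n. m \<ge> N \<Longrightarrow> norm (sum (\<lambda>j. w j * (a j)\<^sup>2) {m..<n}) < e"
    using assms unfolding summable_Cauchy by blast
  have le: "nsq (\<lambda>x. partial a {..<n} x - partial a {..<m} x) < e" if "m \<ge> N" "m \<le> n" for m n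
  proof -
    have "partial a {..<n} x - partial a {..<m} x = partial a {m..<n} x" for x
      unfolding partial_def using sum_diff_nat_ivl[of 0 m n] that(2) by (simp add: atLeast0LessThan)
    then show ?thesis using nsq_partial[of "{m..<n}" a] N[OF that(1), of n] by simp
  qed
  have "nsq (\<lambda>x. partial a {..<m} x - partial a {..<n} x) < e" if "m \<ge> N" "n \<ge> N" for m n
  proof (cases "m \<le> n")
    case True then show ?thesis using le[OF that(1) True] by (subst nsq_minus_commute) simp
  next
    case False then show ?thesis using le[OF that(2), of m] by simp
  qed
  then show "\<exists>N. \<forall>m\<ge>N. \<forall>n\<ge>N. nsq (\<lambda>x. partial a {..<m} x - partial a {..<n} x) < e" by blast
qed

lemma l2lim_partial_coeff:
  assumes "l2lim (\<lambda>N. partial a {..<N}) v" shows "(LINT x|lborel. v x \<bullet> \<psi> j x) = w j * a j"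
proof -
  have "(\<lambda>N. LINT x|lborel. partial a {..<N} x \<bullet> \<psi> j x) \<longlonglongrightarrow> (LINT x|lborel. v x \<bullet> \<psi> j x)"
    by (rule l2lim_inner[OF assms l2lim_const[OF \<psi>]])
  moreover have "(\<lambda>N. LINT x|lborel. partial a {..<N} x \<bullet> \<psi> j x) \<longlonglongrightarrow> w j * a j"
    by (rule tendsto_eventually) (auto simp: partial_coeff eventually_sequentially intro: exI[of _ "Suc j"])
  ultimately show ?thesis by (rule LIMSEQ_unique)
qed

lemma l2lim_partial_sums:
  assumes "l2lim (\<lambda>N. partial a {..<N}) v" "l2lim (\<lambda>N. partial b {..<N}) v'"
  shows "(\<lambda>j. w j * a j * b j) sums (LINT x|lborel. v x \<bullet> v' x)"
  using l2lim_inner[OF assms] unfolding sums_def by (simp add: inner_partial_partial)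

end

section \<open>The Dirichlet form\<close>

text \<open>The eigenvalue equation is asked only against test functions; \<open>eigen_h10\<close>
  extends it by density.\<close>

locale dirichlet_form =
  fixes \<Omega> :: "'a::euclidean_space set" and ev :: "nat \<Rightarrow> real"
    and \<phi> :: "nat \<Rightarrow> 'a \<Rightarrow> real" and G :: "nat \<Rightarrow> 'a \<Rightarrow> 'a"
  assumes \<Omega>: "open \<Omega>" "connected \<Omega>" "bounded \<Omega>"
    and h10_\<phi>: "h10 \<Omega> (\<phi> j) (G j)"
    and eigen: "f \<in> test_functions \<Omega> \<Longrightarrow> (LINT x|lborel. G j x \<bullet> grad f x) = ev j * (LINT x|lborel. \<phi> j x * f x)"
    and orthonormal: "(LINT x|lborel. \<phi> i x * \<phi> j x) = (if i = j then 1 else 0)"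
    and complete: "sq_int v \<Longrightarrow> (\<And>j. (LINT x|lborel. v x * \<phi> j x) = 0) \<Longrightarrow> AE x in lborel. x \<in> \<Omega> \<longrightarrow> v x = 0"
begin

definition coef :: "('a \<Rightarrow> real) \<Rightarrow> nat \<Rightarrow> real" where
  "coef v j = (LINT x|lborel. v x * \<phi> j x)"

text \<open>Stands for the Hilbert space L2(\<Omega>), in which the eigenfunctions are
  complete.\<close>

definition supported :: "('a \<Rightarrow> real) \<Rightarrow> bool" where
  "supported v \<longleftrightarrow> sq_int v \<and> (AE x in lborel. x \<notin> \<Omega> \<longrightarrow> v x = 0)"

lemma h10_supported: "h10 \<Omega> v V \<Longrightarrow> supported v"
  using h10_sq_int(1) h10_zero_outside(1) unfolding supported_def by blast

lemma eigen_h10: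
  assumes "h10 \<Omega> v V" shows "(LINT x|lborel. V x \<bullet> G j x) = ev j * coef v j"
proof -
  obtain f where f: "\<And>k. f k \<in> test_functions \<Omega>" "l2lim f v" "l2lim (\<lambda>k. grad (f k)) V" using assms h10_def by blast
  have A: "(\<lambda>k. LINT x|lborel. grad (f k) x \<bullet> G j x) \<longlonglongrightarrow> (LINT x|lborel. V x \<bullet> G j x)"
    by (rule l2lim_inner[OF f(3) l2lim_const[OF h10_sq_int(2)[OF h10_\<phi>]]])
  have B: "(\<lambda>k. LINT x|lborel. f k x \<bullet> \<phi> j x) \<longlonglongrightarrow> (LINT x|lborel. v x \<bullet> \<phi> j x)"
    by (rule l2lim_inner[OF f(2) l2lim_const[OF h10_sq_int(1)[OF h10_\<phi>]]])
  have eq: "(LINT x|lborel. grad (f k) x \<bullet> G j x) = ev j * (LINT x|lborel. f k x \<bullet> \<phi> j x)" for k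
    using eigen[OF f(1), of j k] by (simp add: inner_commute mult.commute)
  show ?thesis using LIMSEQ_unique[OF A[unfolded eq] tendsto_mult_left[OF B]] by (simp add: coef_def)
qed

sublocale L2: orthogonal_system \<phi> "\<lambda>_. 1"
  by unfold_locales (use h10_sq_int(1)[OF h10_\<phi>] orthonormal in auto)

text \<open>The eigenvalue equation tested with another eigenfunction makes the gradients
  orthogonal, with squared norms \<open>ev j\<close>. Nonnegativity of the eigenvalues is thereby
  available as \<open>H1.w_nonneg\<close>.\<close>

sublocale H1: orthogonal_system G ev
proof
  show "sq_int (G j)" for j by (rule h10_sq_int(2)[OF h10_\<phi>])
  show "(LINT x|lborel. G i x \<bullet> G j x) = (if i = j then ev j else 0)" for i j
    unfolding eigen_h10[OF h10_\<phi>] by (simp add: coef_def orthonormal)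
qed

lemma h10_partial: "h10 \<Omega> (L2.partial a I) (H1.partial a I)"
proof -
  have "h10 \<Omega> (\<lambda>x. \<Sum>j\<in>I. a j * \<phi> j x) (\<lambda>x. \<Sum>j\<in>I. a j *\<^sub>R G j x)"
    by (intro h10_sum h10_cmult h10_\<phi>)
  then show ?thesis by (simp add: L2.partial_def[abs_def] H1.partial_def[abs_def])
qed

lemma partial_converges_supported:
  assumes "l2lim (\<lambda>N. L2.partial a {..<N}) v" shows "supported v" "coef v j = a j"
proof -
  have "AE x in lborel. \<forall>j. x \<notin> \<Omega> \<longrightarrow> \<phi> j x = 0"
    using h10_zero_outside(1)[OF h10_\<phi>] by (intro AE_all_countable[THEN iffD2] allI)
  moreover obtain r :: "nat \<Rightarrow> nat" where "AE x in lborel. (\<lambda>k. L2.partial a {..<r k} x) \<longlonglongrightarrow> v x"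
    using l2lim_AE_subseq[OF assms] by blast
  ultimately have "AE x in lborel. x \<notin> \<Omega> \<longrightarrow> v x = 0"
    by eventually_elim (auto simp: L2.partial_def LIMSEQ_const_iff)
  then show "supported v" using l2limD(2)[OF assms] by (simp add: supported_def)
  show "coef v j = a j" using L2.l2lim_partial_coeff[OF assms, of j] by (simp add: coef_def)
qed

lemma supported_eqI:
  assumes "supported v" "supported v'" "\<And>j. coef v j = coef v' j" shows "AE x in lborel. v x = v' x"
proof -
  have s: "sq_int v" "sq_int v'" using assms by (auto simp: supported_def)
  have "(LINT x|lborel. (v x - v' x) * \<phi> j x) = 0" for j
    using assms(3)[of j] sq_int_mult[OF s(1) L2.\<psi>[of j]] sq_int_mult[OF s(2) L2.\<psi>[of j]]
    by (simp add: coef_def left_diff_distrib)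
  from complete[OF sq_int_diff[OF s] this] have "AE x in lborel. x \<in> \<Omega> \<longrightarrow> v x - v' x = 0" .
  moreover have "AE x in lborel. x \<notin> \<Omega> \<longrightarrow> v x = 0" "AE x in lborel. x \<notin> \<Omega> \<longrightarrow> v' x = 0"
    using assms by (auto simp: supported_def)
  ultimately show ?thesis by eventually_elim auto
qed

lemma l2lim_AE_cong:
  assumes "l2lim F f" "AE x in lborel. f x = g x" "g \<in> borel_measurable borel" shows "l2lim F g"
proof -
  have [measurable]: "f \<in> borel_measurable borel" "F k \<in> borel_measurable borel" for k
    using l2limD(1,2)[OF assms(1)] by (auto simp: sq_int_def)
  note [measurable] = assms(3)
  have g: "sq_int g"
    by (rule sq_int_bound[OF assms(3) sq_int_integrable[OF l2limD(2)[OF assms(1)]]])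
      (use assms(2) in \<open>auto elim: eventually_mono\<close>)
  have "nsq (\<lambda>x. F k x - g x) = nsq (\<lambda>x. F k x - f x)" for k
    unfolding nsq_def by (rule integral_cong_AE) (use assms(2) in \<open>auto elim: eventually_mono\<close>)
  then show ?thesis using assms(1) g by (simp add: l2lim_def)
qed

text \<open>Bessel's inequality gives a limit of the partial sums; it has the coefficients of
  \<open>v\<close>, and completeness identifies the two.\<close>

lemma expansion:
  assumes "supported v" shows "l2lim (\<lambda>N. L2.partial (coef v) {..<N}) v"
proof -
  have v: "sq_int v" using assms by (simp add: supported_def)
  have "summable (\<lambda>j. 1 * (coef v j)\<^sup>2)"
    by (rule bounded_imp_summable[of _ "nsq v"])
      (use L2.Bessel[OF v, of "coef v" "{.._}"] in \<open>auto simp: coef_def\<close>)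
  then obtain v' where v': "l2lim (\<lambda>N. L2.partial (coef v) {..<N}) v'" using L2.partial_converges by blast
  have "AE x in lborel. v' x = v x"
    by (rule supported_eqI[OF partial_converges_supported(1)[OF v'] assms partial_converges_supported(2)[OF v']])
  from l2lim_AE_cong[OF v' this] show ?thesis using v by (simp add: sq_int_def)
qed

lemma inner_sums:
  assumes "supported v" "supported v'" shows "(\<lambda>j. coef v j * coef v' j) sums (LINT x|lborel. v x * v' x)"
  using L2.l2lim_partial_sums[OF expansion[OF assms(1)] expansion[OF assms(2)]] by simp

lemma nsq_sums: "supported v \<Longrightarrow> (\<lambda>j. (coef v j)\<^sup>2) sums nsq v"
  using inner_sums[of v v] by (simp add: nsq_inner power2_eq_square)

text \<open>The spectral criterion for the form domain: summability makes the gradients of the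
  partial sums converge, and \<open>h10\<close> is closed.\<close>

lemma h10_if_summable:
  assumes v: "l2lim (\<lambda>N. L2.partial a {..<N}) v" and "summable (\<lambda>j. ev j * (a j)\<^sup>2)"
  obtains V where "h10 \<Omega> v V" "l2lim (\<lambda>N. H1.partial a {..<N}) V"
proof -
  obtain V where V: "l2lim (\<lambda>N. H1.partial a {..<N}) V" using H1.partial_converges[OF assms(2)] by blast
  show ?thesis by (rule that[OF h10_closed[OF h10_partial v V] V])
qed

text \<open>Bessel for the gradients makes the gradients of the partial sums converge; the limit is
  \<open>V\<close> because gradients are unique.\<close>

lemma energy_expansion:
  assumes h: "h10 \<Omega> v V" shows "l2lim (\<lambda>N. H1.partial (coef v) {..<N}) V"
proof -
  have V: "sq_int V" by (rule h10_sq_int(2)[OF h])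
  have "summable (\<lambda>j. ev j * (coef v j)\<^sup>2)"
    by (rule bounded_imp_summable[of _ "nsq V"])
      (use H1.Bessel[OF V eigen_h10[OF h], of "{.._}"] H1.w_nonneg in auto)
  then obtain V' where V': "h10 \<Omega> v V'" "l2lim (\<lambda>N. H1.partial (coef v) {..<N}) V'"
    using h10_if_summable[OF expansion[OF h10_supported[OF h]]] by blast
  have "AE x in lborel. V' x = V x" by (rule h10_unique[OF V'(1) h]) simp
  from l2lim_AE_cong[OF V'(2) this] show ?thesis using V by (simp add: sq_int_def)
qed

lemma energy_inner_sums:
  assumes "h10 \<Omega> v V" "h10 \<Omega> v' V'"
  shows "(\<lambda>j. ev j * coef v j * coef v' j) sums (LINT x|lborel. V x \<bullet> V' x)"
  by (rule H1.l2lim_partial_sums[OF energy_expansion[OF assms(1)] energy_expansion[OF assms(2)]])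

lemma energy_sums: "h10 \<Omega> v V \<Longrightarrow> (\<lambda>j. ev j * (coef v j)\<^sup>2) sums nsq V"
  using energy_inner_sums[of v V v V] by (simp add: nsq_inner power2_eq_square mult.assoc)

subsection \<open>The resolvent\<close>

text \<open>Dividing the coefficients by \<open>ev j + \<mu>\<close> defines the resolvent
  (-\<Delta> + \<mu>)^(-1) f; the two summability estimates place it in the form domain.\<close>

lemma resolvent_exists:
  assumes f: "supported f" and \<mu>: "\<mu> > 0"
  obtains w W where "h10 \<Omega> w W" "\<And>j. coef w j = coef f j / (ev j + \<mu>)"
    "\<And>h H. h10 \<Omega> h H \<Longrightarrow> (LINT x|lborel. W x \<bullet> H x) + \<mu> * (LINT x|lborel. w x * h x) = (LINT x|lborel. f x * h x)"
proof -
  define a where "a j = coef f j / (ev j + \<mu>)" for j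
  have pos: "ev j + \<mu> > 0" for j using H1.w_nonneg[of j] \<mu> by simp
  have sf: "summable (\<lambda>j. (coef f j)\<^sup>2)" using nsq_sums[OF f] by (rule sums_summable)
  have "(a j)\<^sup>2 \<le> (1 / \<mu>\<^sup>2) * (coef f j)\<^sup>2" for j
  proof -
    have "\<mu>\<^sup>2 \<le> (ev j + \<mu>)\<^sup>2" using H1.w_nonneg[of j] \<mu> by (intro power_mono) auto
    then have "(coef f j)\<^sup>2 / (ev j + \<mu>)\<^sup>2 \<le> (coef f j)\<^sup>2 / \<mu>\<^sup>2" using \<mu> pos[of j] by (intro divide_left_mono) auto
    then show ?thesis by (simp add: a_def power_divide)
  qed
  then have "summable (\<lambda>j. 1 * (a j)\<^sup>2)"
    by (intro summable_comparison_test'[OF summable_mult[OF sf, of "1 / \<mu>\<^sup>2"]]) auto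
  then obtain w where w: "l2lim (\<lambda>N. L2.partial a {..<N}) w" using L2.partial_converges by blast
  have "ev j * (a j)\<^sup>2 \<le> (1 / \<mu>) * (coef f j)\<^sup>2" for j
  proof -
    have "ev j * \<mu> \<le> (ev j + \<mu>)\<^sup>2"
      using H1.w_nonneg[of j] \<mu> by (simp add: power2_eq_square algebra_simps mult_nonneg_nonneg)
    then have "ev j / (ev j + \<mu>)\<^sup>2 \<le> 1 / \<mu>" using \<mu> pos[of j] by (simp add: field_simps)
    from mult_right_mono[OF this, of "(coef f j)\<^sup>2"] show ?thesis by (simp add: a_def power_divide)
  qed
  then have "summable (\<lambda>j. ev j * (a j)\<^sup>2)"
    by (intro summable_comparison_test'[OF summable_mult[OF sf, of "1 / \<mu>"]]) (auto simp: H1.w_nonneg)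
  then obtain W where W: "h10 \<Omega> w W" using h10_if_summable[OF w] by blast
  have cw: "coef w j = a j" for j by (rule partial_converges_supported(2)[OF w])
  show ?thesis
  proof (rule that[OF W])
    show "coef w j = coef f j / (ev j + \<mu>)" for j by (simp add: cw a_def)
    fix h H assume h: "h10 \<Omega> h H"
    have "(\<lambda>j. ev j * coef w j * coef h j + \<mu> * (coef w j * coef h j)) sums
        ((LINT x|lborel. W x \<bullet> H x) + \<mu> * (LINT x|lborel. w x * h x))"
      by (intro sums_add energy_inner_sums[OF W h] sums_mult inner_sums h10_supported[OF W] h10_supported[OF h])
    moreover have "ev j * coef w j * coef h j + \<mu> * (coef w j * coef h j) = coef f j * coef h j" for j
    proof -
      have "ev j * coef w j * coef h j + \<mu> * (coef w j * coef h j) = ((ev j + \<mu>) * a j) * coef h j"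
        by (simp add: cw algebra_simps)
      also have "(ev j + \<mu>) * a j = coef f j" using pos[of j] by (simp add: a_def)
      finally show ?thesis .
    qed
    ultimately have "(\<lambda>j. coef f j * coef h j) sums ((LINT x|lborel. W x \<bullet> H x) + \<mu> * (LINT x|lborel. w x * h x))" by simp
    then show "(LINT x|lborel. W x \<bullet> H x) + \<mu> * (LINT x|lborel. w x * h x) = (LINT x|lborel. f x * h x)"
      using inner_sums[OF f h10_supported[OF h]] by (rule sums_unique2)
  qed
qed

text \<open>Tested with the negative part of \<open>w\<close>, the left side of the equation is
  nonpositive and the right side nonnegative, so the negative part has norm 0.\<close>

lemma weak_maximum_principle:
  assumes f: "sq_int f" "AE x in lborel. 0 \<le> f x" and \<mu>: "\<mu> > 0" and w: "h10 \<Omega> w W"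
    and eq: "\<And>h H. h10 \<Omega> h H \<Longrightarrow> (LINT x|lborel. W x \<bullet> H x) + \<mu> * (LINT x|lborel. w x * h x) = (LINT x|lborel. f x * h x)"
  shows "AE x in lborel. 0 \<le> w x"
proof -
  define h where "h x = (1/2) * (\<bar>w x\<bar> - w x)" for x
  define H where "H x = (1/2) *\<^sub>R (sgn (w x) *\<^sub>R W x - W x)" for x
  have h: "h10 \<Omega> h H" unfolding h_def H_def by (intro h10_cmult h10_diff h10_abs \<Omega> w)
  have h0: "0 \<le> h x" for x by (simp add: h_def)
  have "0 \<le> (LINT x|lborel. f x * h x)"
    using f(2) by (intro integral_nonneg_AE) (auto elim!: eventually_mono simp: h0)
  also have "\<dots> = (LINT x|lborel. W x \<bullet> H x) + \<mu> * (LINT x|lborel. w x * h x)" by (rule eq[OF h, symmetric])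
  also have "(LINT x|lborel. W x \<bullet> H x) \<le> 0"
  proof -
    have "W x \<bullet> H x \<le> 0" for x
    proof -
      have "W x \<bullet> H x = ((sgn (w x) - 1) / 2) * (W x \<bullet> W x)" by (simp add: H_def inner_diff_right algebra_simps)
      also have "\<dots> \<le> 0" by (intro mult_nonpos_nonneg) (auto simp: sgn_if)
      finally show ?thesis .
    qed
    then have "(LINT x|lborel. - (W x \<bullet> H x)) \<ge> 0" by (intro integral_nonneg_AE) auto
    then show ?thesis by simp
  qed
  also have "(LINT x|lborel. w x * h x) = - nsq h"
  proof -
    have "w x * h x = - (norm (h x))\<^sup>2" for x by (cases "w x \<ge> 0") (auto simp: h_def power2_eq_square)
    then show ?thesis by (simp add: nsq_def)
  qed
  finally have "nsq h \<le> 0" using \<mu> by (simp add: mult_le_0_iff)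
  then have "nsq h = 0" using nsq_nonneg[of h] by linarith
  then have "AE x in lborel. h x = 0" using nsq_zero_iff[OF h10_sq_int(1)[OF h]] by simp
  then show ?thesis by eventually_elim (auto simp: h_def)
qed

lemma h10_ratio:
  assumes w: "h10 \<Omega> w W" and \<epsilon>: "\<epsilon> > 0"
  shows "h10 \<Omega> (\<lambda>x. w x / (\<bar>w x\<bar> + \<epsilon>)) (\<lambda>x. (\<epsilon> / (\<bar>w x\<bar> + \<epsilon>)\<^sup>2) *\<^sub>R W x)"
proof (rule h10_compose[OF \<Omega>(1) w ratio_deriv[OF \<epsilon>], of "1 / \<epsilon>"])
  show "continuous_on UNIV (\<lambda>t. \<epsilon> / (\<bar>t\<bar> + \<epsilon>)\<^sup>2)"
    using \<epsilon> by (intro continuous_intros) (auto simp: add_nonneg_eq_0_iff)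
  show "\<bar>\<epsilon> / (\<bar>t\<bar> + \<epsilon>)\<^sup>2\<bar> \<le> 1 / \<epsilon>" for t
  proof -
    have "\<epsilon>\<^sup>2 \<le> (\<bar>t\<bar> + \<epsilon>)\<^sup>2" using \<epsilon> by (intro power_mono) auto
    moreover have "(\<bar>t\<bar> + \<epsilon>)\<^sup>2 > 0" using \<epsilon> by (simp add: add_nonneg_pos)
    ultimately show ?thesis using \<epsilon> by (simp add: abs_divide divide_simps power2_eq_square)
  qed
qed simp

text \<open>
  Testing the equation with \<open>\<psi>\<^sup>2 / (w + \<epsilon>)\<close> bounds \<open>\<psi> \<nabla>w / (w + \<epsilon>)\<close> in the mean square,
  uniformly in \<open>\<epsilon>\<close>. As \<open>\<nabla>w\<close> vanishes where \<open>w\<close> does, the gradient \<open>\<epsilon> \<nabla>w / (w + \<epsilon>)\<^sup>2\<close> of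
  \<open>w / (w + \<epsilon>)\<close> tends to \<open>0\<close> locally, so the indicator of \<open>w > 0\<close> has zero weak gradient.
\<close>

lemma supersolution_log_bound:
  assumes f: "sq_int f" "AE x in lborel. 0 \<le> f x" and \<mu>: "\<mu> > 0" and w: "h10 \<Omega> w W" "AE x in lborel. 0 \<le> w x"
    and eq: "\<And>h H. h10 \<Omega> h H \<Longrightarrow> (LINT x|lborel. W x \<bullet> H x) + \<mu> * (LINT x|lborel. w x * h x) = (LINT x|lborel. f x * h x)"
    and \<psi>: "\<psi> \<in> test_functions \<Omega>" and \<epsilon>: "\<epsilon> > 0"
  shows "sq_int (\<lambda>x. (\<psi> x / (\<bar>w x\<bar> + \<epsilon>)) *\<^sub>R W x)"
    "nsq (\<lambda>x. (\<psi> x / (\<bar>w x\<bar> + \<epsilon>)) *\<^sub>R W x) \<le> 4 * nsq (grad \<psi>) + 2 * \<mu> * nsq \<psi>"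
proof -
  define g where "g x = (\<psi> x / (\<bar>w x\<bar> + \<epsilon>)) *\<^sub>R W x" for x
  obtain K where K: "compact K" "c1 \<psi> (grad \<psi>)" "\<And>x. x \<notin> K \<Longrightarrow> \<psi> x = 0" "\<And>x. x \<notin> K \<Longrightarrow> grad \<psi> x = 0"
    using \<psi> by (rule test_function_c1) blast
  have cg: "continuous_on UNIV (grad \<psi>)" "continuous_on UNIV \<psi>" using K(2) c1_continuous[OF K(2)] by (auto simp: c1_def)
  obtain C where C: "\<And>x. \<bar>\<psi> x\<bar> \<le> C"
    using zero_outside_uniformly_continuous(2)[OF cg(2) K(1,3)] unfolding bounded_iff by auto
  have [measurable]: "w \<in> borel_measurable borel" "W \<in> borel_measurable borel" "f \<in> borel_measurable borel"
    using h10_sq_int[OF w(1)] f by (auto simp: sq_int_def)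
  have [measurable]: "\<psi> \<in> borel_measurable borel" "grad \<psi> \<in> borel_measurable borel"
    using cg by (auto intro: borel_measurable_continuous_onI)
  have g: "sq_int g"
  proof (rule sq_int_dominated[OF _ h10_sq_int(2)[OF w(1)], of _ "C / \<epsilon>"])
    show "g \<in> borel_measurable borel" unfolding g_def by measurable
    show "norm (g x) \<le> C / \<epsilon> * norm (W x)" for x
    proof -
      have "\<bar>\<psi> x\<bar> / (\<bar>w x\<bar> + \<epsilon>) \<le> C / \<epsilon>" using C[of x] \<epsilon> by (intro frac_le) auto
      moreover have "norm (g x) = \<bar>\<psi> x\<bar> / (\<bar>w x\<bar> + \<epsilon>) * norm (W x)"
        unfolding g_def norm_scaleR using \<epsilon> by (simp add: abs_divide)
      ultimately show ?thesis by (metis mult_right_mono norm_ge_zero)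
    qed
  qed
  then show "sq_int (\<lambda>x. (\<psi> x / (\<bar>w x\<bar> + \<epsilon>)) *\<^sub>R W x)" by (simp add: g_def[abs_def])
  have sm: "smooth \<psi>" by (rule test_functions_smooth[OF \<psi>])
  have \<psi>2: "(\<lambda>x. \<psi> x * \<psi> x) \<in> test_functions \<Omega>" by (rule test_functions_mult[OF sm \<psi>])
  have g2: "grad (\<lambda>x. \<psi> x * \<psi> x) = (\<lambda>x. (2 * \<psi> x) *\<^sub>R grad \<psi> x)"
    unfolding grad_mult[OF sm sm] by (simp add: scaleR_2[symmetric] scaleR_add_left[symmetric])
  have cg2: "continuous_on UNIV (\<lambda>x. \<psi> x * \<psi> x)" "continuous_on UNIV (grad (\<lambda>x. \<psi> x * \<psi> x))"
    unfolding g2 by (intro continuous_intros cg)+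
  obtain C1 where C1: "\<And>x. \<bar>\<psi> x * \<psi> x\<bar> \<le> C1"
    using zero_outside_uniformly_continuous(2)[OF cg2(1) K(1)] K(3) unfolding bounded_iff by auto
  obtain C2 where C2: "\<And>x. norm (grad (\<lambda>x. \<psi> x * \<psi> x) x) \<le> C2"
    using zero_outside_uniformly_continuous(2)[OF cg2(2) K(1)] K(3) unfolding bounded_iff g2 by auto
  define p where "p x = w x / (\<bar>w x\<bar> + \<epsilon>)" for x
  define P where "P x = (\<epsilon> / (\<bar>w x\<bar> + \<epsilon>)\<^sup>2) *\<^sub>R W x" for x
  have hp: "h10 \<Omega> p P" unfolding p_def P_def by (rule h10_ratio[OF w(1) \<epsilon>])
  \<comment> \<open>Where w \<ge> 0, one has 1 - p = \<epsilon> / (w + \<epsilon>), so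
    \<open>h\<close> is the intended test function \<psi>^2 / (w + \<epsilon>). In this form it is a
    combination of functions known to lie in \<open>h10\<close>, with gradient
    \<open>H\<close>.\<close>
  define h where "h x = (1 / \<epsilon>) * (\<psi> x * \<psi> x - \<psi> x * \<psi> x * p x)" for x
  define H where "H x = (1 / \<epsilon>) *\<^sub>R (grad (\<lambda>x. \<psi> x * \<psi> x) x - ((\<psi> x * \<psi> x) *\<^sub>R P x + p x *\<^sub>R grad (\<lambda>x. \<psi> x * \<psi> x) x))" for x
  have hH: "h10 \<Omega> h H" unfolding h_def H_def
    by (intro h10_cmult h10_diff h10_test[OF \<psi>2] h10_mult[OF hp smooth_mult[OF sm sm], of "max C1 C2"])
      (use C1 C2 in \<open>auto simp: le_max_iff_disj\<close>)
  have h_eq: "AE x in lborel. h x = \<psi> x * \<psi> x / (\<bar>w x\<bar> + \<epsilon>)"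
    using w(2)
  proof eventually_elim
    case (elim x)
    have "1 - p x = \<epsilon> / (\<bar>w x\<bar> + \<epsilon>)" using elim \<epsilon> by (simp add: p_def field_simps)
    moreover have "h x = (1 / \<epsilon>) * (\<psi> x * \<psi> x) * (1 - p x)" using \<epsilon> by (simp add: h_def field_simps)
    ultimately show ?case using \<epsilon> by simp
  qed
  have WH: "AE x in lborel. W x \<bullet> H x = 2 * (grad \<psi> x \<bullet> g x) - (norm (g x))\<^sup>2"
    using w(2)
  proof eventually_elim
    case (elim x)
    have 1: "1 - p x = \<epsilon> / (\<bar>w x\<bar> + \<epsilon>)" using elim \<epsilon> by (simp add: p_def field_simps)
    have "H x = (1 / \<epsilon>) *\<^sub>R ((1 - p x) *\<^sub>R ((2 * \<psi> x) *\<^sub>R grad \<psi> x) - (\<psi> x * \<psi> x) *\<^sub>R P x)"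
      by (simp add: H_def g2 algebra_simps)
    also have "\<dots> = (2 * \<psi> x / (\<bar>w x\<bar> + \<epsilon>)) *\<^sub>R grad \<psi> x - (\<psi> x / (\<bar>w x\<bar> + \<epsilon>))\<^sup>2 *\<^sub>R W x"
      unfolding 1 P_def using \<epsilon> by (simp add: scaleR_diff_right power_divide power2_eq_square)
    finally have "W x \<bullet> H x = 2 * (\<psi> x / (\<bar>w x\<bar> + \<epsilon>)) * (grad \<psi> x \<bullet> W x) - (\<psi> x / (\<bar>w x\<bar> + \<epsilon>))\<^sup>2 * (W x \<bullet> W x)"
      by (simp add: inner_diff_right inner_commute)
    then show ?case unfolding power2_norm_eq_inner g_def by (simp add: power2_eq_square)
  qed
  have ig: "integrable lborel (\<lambda>x. grad \<psi> x \<bullet> g x)" by (rule sq_int_inner[OF test_function_sq_int(2)[OF \<psi>] g])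
  have "AE x in lborel. 0 \<le> f x * h x"
    using f(2) h_eq
  proof eventually_elim
    case (elim x)
    then show ?case using \<epsilon> by simp
  qed
  then have "0 \<le> (LINT x|lborel. f x * h x)" by (rule integral_nonneg_AE)
  also have "\<dots> = (LINT x|lborel. W x \<bullet> H x) + \<mu> * (LINT x|lborel. w x * h x)" by (rule eq[OF hH, symmetric])
  also have "(LINT x|lborel. W x \<bullet> H x) = (LINT x|lborel. 2 * (grad \<psi> x \<bullet> g x) - (norm (g x))\<^sup>2)"
    using WH g h10_sq_int(2)[OF hH] by (intro integral_cong_AE) (auto simp: sq_int_def)
  also have "\<dots> = 2 * (LINT x|lborel. grad \<psi> x \<bullet> g x) - nsq g"
    using ig g by (simp add: nsq_def)
  also have "(LINT x|lborel. w x * h x) \<le> nsq \<psi>"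
    unfolding nsq_def
  proof (rule integral_mono_AE)
    show "integrable lborel (\<lambda>x. w x * h x)" by (rule sq_int_mult[OF h10_sq_int(1)[OF w(1)] h10_sq_int(1)[OF hH]])
    show "integrable lborel (\<lambda>x. (norm (\<psi> x))\<^sup>2)" by (rule sq_int_integrable[OF test_function_sq_int(1)[OF \<psi>]])
    show "AE x in lborel. w x * h x \<le> (norm (\<psi> x))\<^sup>2"
      using h_eq w(2)
    proof eventually_elim
      case (elim x)
      have "w x * h x = (w x / (\<bar>w x\<bar> + \<epsilon>)) * (\<psi> x)\<^sup>2" using elim by (simp add: power2_eq_square)
      also have "\<dots> \<le> 1 * (\<psi> x)\<^sup>2" using elim \<epsilon> by (intro mult_right_mono) (auto simp: divide_le_eq)
      finally show ?case by simp
    qed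
  qed
  \<comment> \<open>Young's inequality, from the square of g - 2 grad \<psi>: only half of
    \<open>nsq g\<close> appears, and it is absorbed by the other side.\<close>
  also have "2 * (LINT x|lborel. grad \<psi> x \<bullet> g x) \<le> (1/2) * nsq g + 2 * nsq (grad \<psi>)"
  proof -
    have "0 \<le> nsq (\<lambda>x. g x + (-2) *\<^sub>R grad \<psi> x)" by simp
    also have "\<dots> = nsq g - 4 * (LINT x|lborel. g x \<bullet> grad \<psi> x) + 4 * nsq (grad \<psi>)"
      using nsq_expand[OF g test_function_sq_int(2)[OF \<psi>], of "-2"] by simp
    finally show ?thesis by (simp add: inner_commute)
  qed
  finally have "nsq g \<le> 4 * nsq (grad \<psi>) + 2 * \<mu> * nsq \<psi>" using \<mu> by simp
  then show "nsq (\<lambda>x. (\<psi> x / (\<bar>w x\<bar> + \<epsilon>)) *\<^sub>R W x) \<le> 4 * nsq (grad \<psi>) + 2 * \<mu> * nsq \<psi>"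
    by (simp add: g_def[abs_def])
qed

text \<open>By connectedness the set where \<open>w\<close> is positive has full or zero measure in
  \<Omega>. In the second case \<open>w\<close> and its gradient would vanish almost everywhere, and
  the equation would force f = 0 in \<Omega>.\<close>

lemma strong_maximum_principle:
  assumes f: "sq_int f" "AE x in lborel. 0 \<le> f x" "\<not> (AE x in lborel. x \<in> \<Omega> \<longrightarrow> f x = 0)" and \<mu>: "\<mu> > 0"
    and w: "h10 \<Omega> w W"
    and eq: "\<And>h H. h10 \<Omega> h H \<Longrightarrow> (LINT x|lborel. W x \<bullet> H x) + \<mu> * (LINT x|lborel. w x * h x) = (LINT x|lborel. f x * h x)"
  shows "AE x in lborel. x \<in> \<Omega> \<longrightarrow> 0 < w x"
proof -
  have w0: "AE x in lborel. 0 \<le> w x" by (rule weak_maximum_principle[OF f(1,2) \<mu> w eq])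
  have [measurable]: "w \<in> borel_measurable borel" "W \<in> borel_measurable borel" "f \<in> borel_measurable borel"
    using h10_sq_int[OF w] f by (auto simp: sq_int_def)
  have [measurable]: "\<Omega> \<in> sets borel" using \<Omega>(1) by simp
  define E where "E = {x. 0 < w x} \<inter> \<Omega>"
  have Em[measurable]: "E \<in> sets borel" unfolding E_def by measurable
  have Eb: "bounded E" using \<Omega>(3) by (rule bounded_subset) (auto simp: E_def)
  have weak: "(LINT x|lborel. indicator E x *\<^sub>R grad \<psi> x) = 0" if \<psi>: "\<psi> \<in> test_functions \<Omega>" for \<psi>
  proof (rule euclidean_eqI)
    fix b :: 'a assume b: "b \<in> Basis"
    obtain K where K: "compact K" "K \<subseteq> \<Omega>" "c1 \<psi> (grad \<psi>)" "\<And>x. x \<notin> K \<Longrightarrow> \<psi> x = 0" "\<And>x. x \<notin> K \<Longrightarrow> grad \<psi> x = 0"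
      using \<psi> by (rule test_function_c1) blast
    have cg: "continuous_on UNIV (grad \<psi>)" "continuous_on UNIV \<psi>" using K(3) c1_continuous[OF K(3)] by (auto simp: c1_def)
    have [measurable]: "\<psi> \<in> borel_measurable borel" "grad \<psi> \<in> borel_measurable borel" "K \<in> sets borel"
      using cg K(1) by (auto intro: borel_measurable_continuous_onI compact_imp_closed borel_closed)
    obtain R where R: "K \<subseteq> cball 0 R" using compact_imp_bounded[OF K(1)] unfolding bounded_iff subset_eq by auto
    define e where "e k = 1 / real (Suc k)" for k
    have e: "e k > 0" for k by (simp add: e_def)
    have e0: "e \<longlonglongrightarrow> 0" unfolding e_def by (rule LIMSEQ_Suc[OF lim_1_over_n])
    define g where "g k x = (\<psi> x / (\<bar>w x\<bar> + e k)) *\<^sub>R W x" for k x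
    define M where "M = 4 * nsq (grad \<psi>) + 2 * \<mu> * nsq \<psi>"
    have g: "sq_int (g k)" "nsq (g k) \<le> M" for k
      using supersolution_log_bound[OF f(1,2) \<mu> w w0 eq \<psi> e[of k]] by (auto simp: g_def[abs_def] M_def)
    \<comment> \<open>The gradient of w / (w + e) tested against \<psi> is the pairing of \<kappa>
      with \<open>g\<close>. The zero set of w, where the quotient e / (w + e) stays equal to 1, is
      taken out of \<kappa>; this leaves the pairing unchanged because W vanishes there.\<close>
    define \<kappa> where "\<kappa> k x = (if w x = 0 \<or> x \<notin> K then 0 else e k / (\<bar>w x\<bar> + e k)) *\<^sub>R b" for k x
    have \<kappa>: "l2lim \<kappa> (\<lambda>x. 0)"
    proof (rule l2lim_dominated[OF _ _ sq_int_indicator_ball[of 1 R]])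
      show "\<kappa> k \<in> borel_measurable borel" for k unfolding \<kappa>_def by measurable
      have "(\<lambda>k. \<kappa> k x) \<longlonglongrightarrow> 0" for x
      proof (cases "w x = 0 \<or> x \<notin> K")
        case False
        have "(\<lambda>k. (e k / (\<bar>w x\<bar> + e k)) *\<^sub>R b) \<longlonglongrightarrow> (0 / (\<bar>w x\<bar> + 0)) *\<^sub>R b"
          using False by (intro tendsto_intros e0) auto
        then show ?thesis using False by (simp add: \<kappa>_def)
      qed (auto simp: \<kappa>_def)
      then show "AE x in lborel. (\<lambda>k. \<kappa> k x) \<longlonglongrightarrow> 0" by simp
      have "norm (\<kappa> k x) \<le> 1 * indicator (cball 0 R) x" for k x
        using e[of k] R b by (cases "x \<in> K") (auto simp: \<kappa>_def indicator_def divide_le_eq)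
      then show "AE x in lborel. norm (\<kappa> k x) \<le> 1 * indicator (cball 0 R) x" for k by simp
    qed simp
    have parts: "(LINT x|lborel. (w x / (\<bar>w x\<bar> + e k)) * (grad \<psi> x \<bullet> b)) = - (LINT x|lborel. \<kappa> k x \<bullet> g k x)" for k
    proof -
      have "(LINT x|lborel. (w x / (\<bar>w x\<bar> + e k)) * (grad \<psi> x \<bullet> b)) = - (LINT x|lborel. \<psi> x * ((e k / (\<bar>w x\<bar> + e k)\<^sup>2) *\<^sub>R W x \<bullet> b))"
        using test_functions_mono[of \<Omega> UNIV] \<psi> by (intro h10_weak[OF h10_ratio[OF w e]]) auto
      also have "(LINT x|lborel. \<psi> x * ((e k / (\<bar>w x\<bar> + e k)\<^sup>2) *\<^sub>R W x \<bullet> b)) = (LINT x|lborel. \<kappa> k x \<bullet> g k x)"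
      proof (rule integral_cong_AE)
        show "AE x in lborel. \<psi> x * ((e k / (\<bar>w x\<bar> + e k)\<^sup>2) *\<^sub>R W x \<bullet> b) = \<kappa> k x \<bullet> g k x"
          using h10_grad_zero[OF \<Omega>(1) w]
          by eventually_elim (use K(4) in \<open>auto simp: \<kappa>_def g_def power2_eq_square inner_commute\<close>)
      qed (auto simp: \<kappa>_def g_def)
      finally show ?thesis .
    qed
    \<comment> \<open>\<kappa> tends to 0 in the mean square while the squared norms of
      \<open>g\<close> stay below \<open>M\<close>, so their pairings tend to 0.\<close>
    have "(\<lambda>k. LINT x|lborel. (w x / (\<bar>w x\<bar> + e k)) * (grad \<psi> x \<bullet> b)) \<longlonglongrightarrow> 0"
    proof (rule Lim_null_comparison[OF always_eventually])
      have "norm (LINT x|lborel. \<kappa> k x \<bullet> g k x) \<le> sqrt (nsq (\<lambda>x. \<kappa> k x - 0)) * sqrt M" for k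
      proof -
        have "\<bar>LINT x|lborel. \<kappa> k x \<bullet> g k x\<bar> \<le> sqrt (nsq (\<kappa> k)) * sqrt (nsq (g k))"
          by (rule Cauchy_Schwarz_L2[OF l2limD(1)[OF \<kappa>] g(1)])
        also have "\<dots> \<le> sqrt (nsq (\<kappa> k)) * sqrt M" by (intro mult_left_mono real_sqrt_le_mono g) auto
        finally show ?thesis by simp
      qed
      then show "\<forall>k. norm (LINT x|lborel. (w x / (\<bar>w x\<bar> + e k)) * (grad \<psi> x \<bullet> b)) \<le> sqrt (nsq (\<lambda>x. \<kappa> k x - 0)) * sqrt M"
        unfolding parts norm_minus_cancel by blast
      have "(\<lambda>k. sqrt (nsq (\<lambda>x. \<kappa> k x - 0)) * sqrt M) \<longlonglongrightarrow> sqrt 0 * sqrt M" by (intro tendsto_intros l2limD(3)[OF \<kappa>])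
      then show "(\<lambda>k. sqrt (nsq (\<lambda>x. \<kappa> k x - 0)) * sqrt M) \<longlonglongrightarrow> 0" by (simp only: real_sqrt_zero mult_zero_left)
    qed
    moreover have "(\<lambda>k. LINT x|lborel. (w x / (\<bar>w x\<bar> + e k)) * (grad \<psi> x \<bullet> b)) \<longlonglongrightarrow> (LINT x|lborel. indicator E x * (grad \<psi> x \<bullet> b))"
    proof (rule integral_dominated_convergence[where w = "\<lambda>x. \<bar>grad \<psi> x \<bullet> b\<bar>"])
      have "integrable lborel (grad \<psi>)" by (rule integrable_compact_support[OF cg(1) K(1,5)])
      then show "integrable lborel (\<lambda>x. \<bar>grad \<psi> x \<bullet> b\<bar>)" by simp
      show "AE x in lborel. (\<lambda>k. (w x / (\<bar>w x\<bar> + e k)) * (grad \<psi> x \<bullet> b)) \<longlonglongrightarrow> indicator E x * (grad \<psi> x \<bullet> b)"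
        using w0
      proof eventually_elim
        case (elim x)
        show ?case
        proof (cases "x \<in> K")
          case False then show ?thesis by (simp add: K(5))
        next
          case True
          show ?thesis
          proof (cases "w x = 0")
            case False
            have "(\<lambda>k. (w x / (\<bar>w x\<bar> + e k)) * (grad \<psi> x \<bullet> b)) \<longlonglongrightarrow> (w x / (\<bar>w x\<bar> + 0)) * (grad \<psi> x \<bullet> b)"
              using False by (intro tendsto_intros e0) auto
            moreover have "x \<in> E" using False True \<open>0 \<le> w x\<close> K(2) by (auto simp: E_def)
            ultimately show ?thesis using False \<open>0 \<le> w x\<close> by simp
          qed (simp add: E_def)
        qed
      qed
      have le1: "\<bar>w x / (\<bar>w x\<bar> + e k)\<bar> \<le> 1" for x k using e[of k] by (simp add: abs_divide divide_le_eq)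
      show "AE x in lborel. norm ((w x / (\<bar>w x\<bar> + e k)) * (grad \<psi> x \<bullet> b)) \<le> \<bar>grad \<psi> x \<bullet> b\<bar>" for k
        using mult_right_mono[OF le1, of "\<bar>grad \<psi> x \<bullet> b\<bar>" x k for x] by (intro AE_I2) (simp only: real_norm_def abs_mult mult_1 abs_ge_zero)
    qed auto
    ultimately have 0: "(LINT x|lborel. indicator E x * (grad \<psi> x \<bullet> b)) = 0" by (rule LIMSEQ_unique[symmetric])
    have i: "integrable lborel (\<lambda>x. indicator E x *\<^sub>R grad \<psi> x)"
    proof (rule Bochner_Integration.integrable_bound[OF integrable_compact_support[OF cg(1) K(1,5)]])
      show "AE x in lborel. norm (indicator E x *\<^sub>R grad \<psi> x) \<le> norm (grad \<psi> x)" by (intro AE_I2) (simp add: indicator_def)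
    qed auto
    have "(LINT x|lborel. (indicator E x *\<^sub>R grad \<psi> x) \<bullet> b) = (LINT x|lborel. indicator E x *\<^sub>R grad \<psi> x) \<bullet> b"
      by (rule integral_inner_left) (rule i)
    with 0 show "(LINT x|lborel. indicator E x *\<^sub>R grad \<psi> x) \<bullet> b = 0 \<bullet> b" by simp
  qed
  have "(AE x in lborel. x \<in> \<Omega> \<longrightarrow> x \<in> E) \<or> (AE x in lborel. x \<in> \<Omega> \<longrightarrow> x \<notin> E)"
    by (rule zero_weak_gradient_connected[OF \<Omega>(1,2) Em Eb weak])
  then show ?thesis
  proof
    assume "AE x in lborel. x \<in> \<Omega> \<longrightarrow> x \<in> E"
    then show ?thesis by eventually_elim (auto simp: E_def)
  next
    assume "AE x in lborel. x \<in> \<Omega> \<longrightarrow> x \<notin> E"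
    then have wz: "AE x in lborel. w x = 0"
      using w0 h10_zero_outside(1)[OF w] by eventually_elim (force simp: E_def)
    have Wz: "AE x in lborel. W x = 0" by (rule h10_unique[OF w h10_zero wz])
    have "AE x in lborel. x \<in> \<Omega> \<longrightarrow> f x = 0"
    proof (rule fundamental_lemma[OF \<Omega>(1)])
      show "set_integrable lborel K f" if "compact K" for K by (rule sq_int_set_integrable[OF f(1) that])
      fix h :: "'a \<Rightarrow> real" assume h: "h \<in> test_functions \<Omega>"
      have "(LINT x|lborel. W x \<bullet> grad h x) = 0" "(LINT x|lborel. w x * h x) = 0"
        by (rule integral_eq_zero_AE; use wz Wz in \<open>auto elim: eventually_mono\<close>)+
      then show "(LINT x|lborel. f x * h x) = 0" using eq[OF h10_test[OF h]] by simp
    qed simp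
    then show ?thesis using f(3) by blast
  qed
qed

text \<open>The sum is the pairing of \<open>g\<close> with the resolvent of \<open>f\<close>,
  written in coefficients. The resolvent of \<open>f\<close> is positive in \<Omega>, and
  \<open>g\<close> is nonnegative and not zero there.\<close>

lemma resolvent_pairing_pos:
  assumes f: "supported f" "AE x in lborel. 0 \<le> f x" "\<not> (AE x in lborel. f x = 0)"
    and g: "supported g" "AE x in lborel. 0 \<le> g x" "\<not> (AE x in lborel. g x = 0)" and \<mu>: "\<mu> > 0"
  obtains S where "S > 0" "(\<lambda>j. coef f j * coef g j / (ev j + \<mu>)) sums S"
proof -
  have out: "AE x in lborel. x \<notin> \<Omega> \<longrightarrow> f x = 0" "AE x in lborel. x \<notin> \<Omega> \<longrightarrow> g x = 0" and s: "sq_int f" "sq_int g"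
    using f(1) g(1) by (auto simp: supported_def)
  have nf: "\<not> (AE x in lborel. x \<in> \<Omega> \<longrightarrow> f x = 0)"
  proof
    assume "AE x in lborel. x \<in> \<Omega> \<longrightarrow> f x = 0"
    with out(1) have "AE x in lborel. f x = 0" by eventually_elim auto
    then show False using f(3) by blast
  qed
  obtain w W where w: "h10 \<Omega> w W" "\<And>j. coef w j = coef f j / (ev j + \<mu>)"
    and eq: "\<And>h H. h10 \<Omega> h H \<Longrightarrow> (LINT x|lborel. W x \<bullet> H x) + \<mu> * (LINT x|lborel. w x * h x) = (LINT x|lborel. f x * h x)"
    using resolvent_exists[OF f(1) \<mu>] by blast
  have pos: "AE x in lborel. x \<in> \<Omega> \<longrightarrow> 0 < w x" by (rule strong_maximum_principle[OF s(1) f(2) nf \<mu> w(1) eq])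
  have nn: "AE x in lborel. 0 \<le> w x * g x"
    using pos out(2) g(2) by eventually_elim (metis less_imp_le mult_nonneg_nonneg mult_zero_right order_refl)
  have "(LINT x|lborel. w x * g x) \<noteq> 0"
  proof
    assume "(LINT x|lborel. w x * g x) = 0"
    then have "AE x in lborel. w x * g x = 0"
      using integral_nonneg_eq_0_iff_AE[OF sq_int_mult[OF h10_sq_int(1)[OF w(1)] s(2)] nn] by simp
    with pos out(2) have "AE x in lborel. g x = 0" by eventually_elim auto
    then show False using g(3) by blast
  qed
  moreover have "(LINT x|lborel. w x * g x) \<ge> 0" by (rule integral_nonneg_AE[OF nn])
  moreover have "(\<lambda>j. coef f j * coef g j / (ev j + \<mu>)) sums (LINT x|lborel. w x * g x)"
    using inner_sums[OF h10_supported[OF w(1)] g(1)] by (simp add: w(2))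
  ultimately show ?thesis using that by (simp add: less_le)
qed

lemma abs_shifted_energy_less:
  assumes u: "h10 \<Omega> u U" and sc: "\<not> (AE x in lborel. \<bar>u x\<bar> + u x = 0)" "\<not> (AE x in lborel. \<bar>u x\<bar> - u x = 0)"
    and \<mu>: "\<mu> > 0"
  obtains X Y where "X < Y" "(\<lambda>j. (ev j)\<^sup>2 / (ev j + \<mu>) * (coef u j)\<^sup>2) sums X"
    "(\<lambda>j. (ev j)\<^sup>2 / (ev j + \<mu>) * (coef (\<lambda>x. \<bar>u x\<bar>) j)\<^sup>2) sums Y"
proof -
  let ?a = "\<lambda>x. \<bar>u x\<bar>"
  have a: "h10 \<Omega> ?a (\<lambda>x. sgn (u x) *\<^sub>R U x)" by (rule h10_abs[OF \<Omega>(1) u])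
  have pos: "ev j + \<mu> > 0" for j using H1.w_nonneg[of j] \<mu> by simp
  have split: "(ev j)\<^sup>2 / (ev j + \<mu>) * t = ev j * t - \<mu> * t + \<mu>\<^sup>2 * (t / (ev j + \<mu>))" for j t
    using pos[of j] by (simp add: field_simps power2_eq_square)
  have R: "\<exists>R. (\<lambda>j. (coef v j)\<^sup>2 / (ev j + \<mu>)) sums R" if v: "supported v" for v
  proof -
    have "norm ((coef v j)\<^sup>2 / (ev j + \<mu>)) \<le> (1 / \<mu>) * (coef v j)\<^sup>2" for j
      using pos[of j] \<mu> H1.w_nonneg[of j] divide_left_mono[of \<mu> "ev j + \<mu>" "(coef v j)\<^sup>2"] by simp
    then have "summable (\<lambda>j. (coef v j)\<^sup>2 / (ev j + \<mu>))"
      by (intro summable_comparison_test'[OF summable_mult[OF sums_summable[OF nsq_sums[OF v]], of "1 / \<mu>"]])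
    then show ?thesis by (auto simp: summable_def)
  qed
  obtain Rc Rd where Rc: "(\<lambda>j. (coef u j)\<^sup>2 / (ev j + \<mu>)) sums Rc" and Rd: "(\<lambda>j. (coef ?a j)\<^sup>2 / (ev j + \<mu>)) sums Rd"
    using R[OF h10_supported[OF u]] R[OF h10_supported[OF a]] by blast
  define f where "f x = (1/2) * (\<bar>u x\<bar> + u x)" for x
  define g where "g x = (1/2) * (\<bar>u x\<bar> - u x)" for x
  have f: "supported f" unfolding f_def by (rule h10_supported[OF h10_cmult[OF h10_add[OF a u]]])
  have g: "supported g" unfolding g_def by (rule h10_supported[OF h10_cmult[OF h10_diff[OF a u]]])
  have i: "integrable lborel (\<lambda>x. u x * \<phi> j x)" "integrable lborel (\<lambda>x. \<bar>u x\<bar> * \<phi> j x)" for j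
    by (rule sq_int_mult[OF h10_sq_int(1)[OF u] L2.\<psi>] sq_int_mult[OF h10_sq_int(1)[OF a] L2.\<psi>])+
  have cf: "coef f j = (1/2) * (coef ?a j + coef u j)" and cg: "coef g j = (1/2) * (coef ?a j - coef u j)" for j
    using i[of j] by (simp_all add: coef_def f_def g_def mult.assoc distrib_right left_diff_distrib)
  obtain S where S: "S > 0" "(\<lambda>j. coef f j * coef g j / (ev j + \<mu>)) sums S"
  proof (rule resolvent_pairing_pos[OF f _ _ g _ _ \<mu>])
    show "AE x in lborel. 0 \<le> f x" "AE x in lborel. 0 \<le> g x" by (auto simp: f_def g_def)
    show "\<not> (AE x in lborel. f x = 0)" "\<not> (AE x in lborel. g x = 0)" using sc by (auto simp: f_def g_def)
  qed
  \<comment> \<open>With \<open>f\<close> and \<open>g\<close> the positive and negative parts, the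
    product of coefficients is a quarter of a difference of squares. The strict inequality between
    the two resolvent sums is therefore the positivity of \<open>S\<close>.\<close>
  have eq: "coef f j * coef g j / (ev j + \<mu>) = (1/4) * ((coef ?a j)\<^sup>2 / (ev j + \<mu>) - (coef u j)\<^sup>2 / (ev j + \<mu>))" for j
    unfolding cf cg diff_divide_distrib[symmetric] by (simp add: power2_eq_square algebra_simps)
  have "(\<lambda>j. coef f j * coef g j / (ev j + \<mu>)) sums ((1/4) * (Rd - Rc))"
    unfolding eq by (intro sums_mult sums_diff Rd Rc)
  then have "S = (1/4) * (Rd - Rc)" using S(2) sums_unique2 by blast
  then have less: "Rc < Rd" using S(1) by simp
  have na: "nsq ?a = nsq u" by (simp add: nsq_def)
  show ?thesis
  proof (rule that)
    show "nsq U - \<mu> * nsq u + \<mu>\<^sup>2 * Rc < nsq U - \<mu> * nsq u + \<mu>\<^sup>2 * Rd"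
      using less \<mu> by simp
    show "(\<lambda>j. (ev j)\<^sup>2 / (ev j + \<mu>) * (coef u j)\<^sup>2) sums (nsq U - \<mu> * nsq u + \<mu>\<^sup>2 * Rc)"
      unfolding split by (intro sums_add sums_diff sums_mult energy_sums[OF u] nsq_sums[OF h10_supported[OF u]] Rc)
    have "(\<lambda>j. (ev j)\<^sup>2 / (ev j + \<mu>) * (coef ?a j)\<^sup>2) sums (nsq (\<lambda>x. sgn (u x) *\<^sub>R U x) - \<mu> * nsq ?a + \<mu>\<^sup>2 * Rd)"
      unfolding split by (intro sums_add sums_diff sums_mult energy_sums[OF a] nsq_sums[OF h10_supported[OF a]] Rd)
    then show "(\<lambda>j. (ev j)\<^sup>2 / (ev j + \<mu>) * (coef ?a j)\<^sup>2) sums (nsq U - \<mu> * nsq u + \<mu>\<^sup>2 * Rd)"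
      by (simp only: h10_abs_nsq[OF \<Omega>(1) u] na)
  qed
qed

end

section \<open>The Fourier transform of functions with zero boundary values\<close>

text \<open>A scalar substitute for the transform of the gradient: it has the modulus of the vector
  i \<xi> times \<open>ft u\<close>, and only norms and inner products of such vectors
  occur.\<close>

definition ftg :: "('a::euclidean_space \<Rightarrow> real) \<Rightarrow> 'a \<Rightarrow> complex" where
  "ftg u \<xi> = norm \<xi> *\<^sub>R ft u \<xi>"

lemma ftg_measurable[measurable]:
  assumes [measurable]: "u \<in> borel_measurable borel" shows "ftg u \<in> borel_measurable borel"
  unfolding ftg_def by measurable

text \<open>Parseval for \<open>f\<close> and for each partial derivative; by
  \<open>ft_partial\<close> the squared moduli of the latter add up to that of
  \<open>ftg f\<close>.\<close>

lemma c1_Plancherel: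
  assumes f: "c1 f F" and K: "compact K" "\<And>x. x \<notin> K \<Longrightarrow> f x = 0"
  shows "sq_int (ft f)" "nsq (ft f) = nsq f" "sq_int (ftg f)" "nsq (ftg f) = nsq F"
proof -
  have cf: "continuous_on UNIV f" "continuous_on UNIV F" using c1_continuous[OF f] f by (auto simp: c1_def)
  have F0: "x \<notin> K \<Longrightarrow> F x = 0" for x using c1_zero_outside[OF f compact_imp_closed[OF K(1)] K(2)] .
  note fi = integrable_compact_support[OF cf(1) K] sq_int_compact_support[OF cf(1) K]
  show "sq_int (ft f)" by (rule ft_Bessel(1)[OF fi])
  have PS: "nsq (ft g) = nsq g" if "continuous_on UNIV g" "\<And>x. x \<notin> K \<Longrightarrow> g x = 0" for g :: "'a \<Rightarrow> real"
    using ft_Parseval[OF integrable_compact_support[OF that(1) K(1) that(2)] sq_int_compact_support[OF that(1) K(1) that(2)] that(1) K(1) that(2)]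
    by (simp add: nsq_inner)
  show "nsq (ft f) = nsq f" by (rule PS[OF cf(1) K(2)])
  have cb: "continuous_on UNIV (\<lambda>x. F x \<bullet> b)" "\<And>x. x \<notin> K \<Longrightarrow> F x \<bullet> b = 0" for b
    using F0 by (auto intro!: continuous_intros cf)
  note Fb = integrable_compact_support[OF cb(1) K(1) cb(2)] sq_int_compact_support[OF cb(1) K(1) cb(2)]
  have eq: "(norm (ftg f \<xi>))\<^sup>2 = (\<Sum>b\<in>Basis. (norm (ft (\<lambda>x. F x \<bullet> b) \<xi>))\<^sup>2)" for \<xi>
  proof -
    have "ft (\<lambda>x. F x \<bullet> b) \<xi> = (\<i> * of_real (\<xi> \<bullet> b)) * ft f \<xi>" for b by (rule ft_partial[OF f K])
    then show ?thesis unfolding ftg_def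
      by (simp add: norm_mult power_mult_distrib sum_distrib_right[symmetric] norm_sq_sum_Basis[of \<xi>])
  qed
  have i: "integrable lborel (\<lambda>\<xi>. (norm (ft (\<lambda>x. F x \<bullet> b) \<xi>))\<^sup>2)" for b
    by (rule sq_int_integrable[OF ft_Bessel(1)[OF Fb]])
  have [measurable]: "f \<in> borel_measurable borel" by (rule borel_measurable_continuous_onI[OF cf(1)])
  show "sq_int (ftg f)" unfolding sq_int_def eq using i by auto
  have "nsq (ftg f) = (\<Sum>b\<in>Basis. nsq (ft (\<lambda>x. F x \<bullet> b)))"
    unfolding nsq_def eq by (rule Bochner_Integration.integral_sum) (rule i)
  also have "\<dots> = (\<Sum>b\<in>Basis. nsq (\<lambda>x. F x \<bullet> b))" by (intro sum.cong refl PS cb)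
  also have "\<dots> = (LINT x|lborel. (\<Sum>b\<in>Basis. (norm (F x \<bullet> b))\<^sup>2))"
    unfolding nsq_def by (rule Bochner_Integration.integral_sum[symmetric]) (rule sq_int_integrable[OF Fb(2)])
  also have "\<dots> = nsq F" unfolding nsq_def norm_sq_sum_Basis[of "F _"] by simp
  finally show "nsq (ftg f) = nsq F" .
qed

lemma sq_int_integrable_bounded:
  fixes v :: "'a::euclidean_space \<Rightarrow> real"
  assumes v: "sq_int v" and S: "bounded S" "AE x in lborel. x \<notin> S \<longrightarrow> v x = 0"
  shows "integrable lborel v"
proof -
  obtain R where R: "S \<subseteq> cball 0 R" using S(1) unfolding bounded_iff subset_eq by auto
  have [measurable]: "v \<in> borel_measurable borel" using v by (simp add: sq_int_def)
  have "integrable lborel (\<lambda>x. v x * (1 * indicator (cball 0 R) x))"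
    by (rule sq_int_mult[OF v sq_int_indicator_ball])
  moreover have "AE x in lborel. v x * (1 * indicator (cball 0 R) x) = v x"
    using S(2) by eventually_elim (use R in \<open>auto simp: indicator_def\<close>)
  moreover have "(\<lambda>x. v x * (1 * indicator (cball 0 R) x)) \<in> borel_measurable lborel"
    using calculation(1) by (rule borel_measurable_integrable)
  ultimately show ?thesis by (subst integrable_cong_AE[symmetric]) auto
qed

lemma h10_integrable: "bounded \<Omega> \<Longrightarrow> h10 \<Omega> v V \<Longrightarrow> integrable lborel v"
  by (rule sq_int_integrable_bounded[OF h10_sq_int(1) _ h10_zero_outside(1)])

lemma ft_diff: "integrable lborel u \<Longrightarrow> integrable lborel v \<Longrightarrow> ft (\<lambda>x. u x - v x) \<xi> = ft u \<xi> - ft v \<xi>"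
  using ft_add[of u "\<lambda>x. (-1) * v x"] ft_cmult[of "-1" v] by simp

lemma grad_diff:
  assumes "smooth f" "smooth g" shows "grad (\<lambda>x. f x - g x) = (\<lambda>x. grad f x - grad g x)"
  using grad_add[OF assms(1) smooth_cmult[OF assms(2), of "-1"]] grad_cmult[OF assms(2), of "-1"] by simp

text \<open>For test functions this is \<open>c1_Plancherel\<close>. In the limit the transforms
  converge by \<open>ft_Bessel\<close>, the weighted ones form a Cauchy sequence, and an almost
  everywhere convergent subsequence identifies the limit of the latter with
  \<open>ftg v\<close>.\<close>

lemma h10_Plancherel:
  assumes \<Omega>: "bounded \<Omega>" and h: "h10 \<Omega> v V"
  shows "sq_int (ftg v)" "nsq (ftg v) = nsq V"
proof -
  obtain f where f: "\<And>k. f k \<in> test_functions \<Omega>" "l2lim f v" "l2lim (\<lambda>k. grad (f k)) V" using h h10_def by blast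
  have T: "sq_int (ftg g)" "nsq (ftg g) = nsq (grad g)" "integrable lborel g" if g: "g \<in> test_functions \<Omega>" for g
  proof -
    obtain K where K: "compact K" "c1 g (grad g)" "\<And>x. x \<notin> K \<Longrightarrow> g x = 0" using g by (rule test_function_c1) blast
    show "sq_int (ftg g)" "nsq (ftg g) = nsq (grad g)" using c1_Plancherel[OF K(2,1,3)] by auto
    show "integrable lborel g" by (rule integrable_compact_support[OF c1_continuous[OF K(2)] K(1,3)])
  qed
  have iv: "integrable lborel v" by (rule h10_integrable[OF \<Omega> h])
  have "l2lim (\<lambda>k. ft (f k)) (ft v)" unfolding l2lim_def
  proof (intro conjI allI)
    show "sq_int (ft (f k))" for k by (rule ft_Bessel(1)[OF T(3)[OF f(1)] l2limD(1)[OF f(2)]])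
    show "sq_int (ft v)" by (rule ft_Bessel(1)[OF iv l2limD(2)[OF f(2)]])
    have "ft (\<lambda>x. f k x - v x) = (\<lambda>\<xi>. ft (f k) \<xi> - ft v \<xi>)" for k
      by (rule ext) (rule ft_diff[OF T(3)[OF f(1)] iv])
    then have "nsq (\<lambda>\<xi>. ft (f k) \<xi> - ft v \<xi>) \<le> 1 * nsq (\<lambda>x. f k x - v x)" for k
      using ft_Bessel(2)[OF Bochner_Integration.integrable_diff[OF T(3)[OF f(1)] iv] sq_int_diff[OF l2limD(1)[OF f(2)] l2limD(2)[OF f(2)]], of k]
      by simp
    then show "(\<lambda>k. nsq (\<lambda>\<xi>. ft (f k) \<xi> - ft v \<xi>)) \<longlonglongrightarrow> 0"
      by (rule tendsto_zero_le[OF nsq_nonneg _ l2limD(3)[OF f(2)]])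
  qed
  obtain Z where Z: "l2lim (\<lambda>k. ftg (f k)) Z"
  proof (rule l2_complete[of "\<lambda>k. ftg (f k)"])
    show "sq_int (ftg (f k))" for k by (rule T(1)[OF f(1)])
    fix e :: real assume "e > 0"
    then have "\<forall>\<^sub>F k in sequentially. nsq (\<lambda>x. grad (f k) x - V x) < e / 4"
      using order_tendstoD(2)[OF l2limD(3)[OF f(3)], of "e / 4"] by simp
    then obtain N where N: "\<And>k. k \<ge> N \<Longrightarrow> nsq (\<lambda>x. grad (f k) x - V x) < e / 4" by (auto simp: eventually_sequentially)
    have "nsq (\<lambda>\<xi>. ftg (f m) \<xi> - ftg (f n) \<xi>) < e" if "m \<ge> N" "n \<ge> N" for m n
    proof -
      have d: "(\<lambda>x. f m x + (-1) * f n x) \<in> test_functions \<Omega>"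
        by (intro test_functions_add test_functions_mult smooth_const f)
      have "(\<lambda>\<xi>. ftg (f m) \<xi> - ftg (f n) \<xi>) = ftg (\<lambda>x. f m x + (-1) * f n x)"
        using ft_diff[OF T(3)[OF f(1)] T(3)[OF f(1)], of m n] by (simp add: ftg_def fun_eq_iff scaleR_diff_right)
      then have "nsq (\<lambda>\<xi>. ftg (f m) \<xi> - ftg (f n) \<xi>) = nsq (grad (\<lambda>x. f m x - f n x))" using T(2)[OF d] by simp
      also have "\<dots> = nsq (\<lambda>x. (grad (f m) x - V x) + (V x - grad (f n) x))"
        using grad_diff[OF test_functions_smooth[OF f(1)] test_functions_smooth[OF f(1)]] by simp
      also have "\<dots> \<le> 2 * nsq (\<lambda>x. grad (f m) x - V x) + 2 * nsq (\<lambda>x. V x - grad (f n) x)"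
        by (intro nsq_add_le sq_int_diff l2limD[OF f(3)])
      also have "nsq (\<lambda>x. V x - grad (f n) x) = nsq (\<lambda>x. grad (f n) x - V x)" by (rule nsq_minus_commute)
      finally show ?thesis using N[OF that(1)] N[OF that(2)] by simp
    qed
    then show "\<exists>N. \<forall>m\<ge>N. \<forall>n\<ge>N. nsq (\<lambda>\<xi>. ftg (f m) \<xi> - ftg (f n) \<xi>) < e" by blast
  qed
  obtain r :: "nat \<Rightarrow> nat" where r: "strict_mono r" "AE x in lborel. (\<lambda>k. ft (f (r k)) x) \<longlonglongrightarrow> ft v x"
    using l2lim_AE_subseq[OF \<open>l2lim (\<lambda>k. ft (f k)) (ft v)\<close>] by blast
  obtain q :: "nat \<Rightarrow> nat" where q: "strict_mono q" "AE x in lborel. (\<lambda>k. ftg (f (r (q k))) x) \<longlonglongrightarrow> Z x"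
    using l2lim_AE_subseq[OF l2lim_subseq[OF Z r(1)]] by blast
  have eq: "AE \<xi> in lborel. Z \<xi> = ftg v \<xi>"
    using r(2) q(2)
  proof eventually_elim
    case (elim \<xi>)
    have "(\<lambda>k. ftg (f (r (q k))) \<xi>) \<longlonglongrightarrow> ftg v \<xi>"
      unfolding ftg_def using LIMSEQ_subseq_LIMSEQ[OF elim(1) q(1)] by (intro tendsto_intros) (simp add: o_def)
    then show ?case using elim(2) LIMSEQ_unique by blast
  qed
  have [measurable]: "v \<in> borel_measurable borel" using l2limD(2)[OF f(2)] by (simp add: sq_int_def)
  have mv: "ftg v \<in> borel_measurable borel" by measurable
  show sv: "sq_int (ftg v)"
    by (rule sq_int_bound[OF mv sq_int_integrable[OF l2limD(2)[OF Z]]]) (use eq in \<open>auto elim: eventually_mono\<close>)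
  have "nsq (ftg v) = nsq Z" unfolding nsq_def
    by (rule integral_cong_AE) (use eq l2limD(2)[OF Z] in \<open>auto elim: eventually_mono simp: sq_int_def\<close>)
  also have "nsq Z = nsq V"
    using LIMSEQ_unique[OF l2lim_nsq[OF Z]] l2lim_nsq[OF f(3)] by (simp add: T(2)[OF f(1)])
  finally show "nsq (ftg v) = nsq V" .
qed

text \<open>Polarisation of \<open>h10_Plancherel\<close>.\<close>

lemma h10_Parseval:
  assumes \<Omega>: "bounded \<Omega>" and u: "h10 \<Omega> u U" and v: "h10 \<Omega> v V"
  shows "(LINT x|lborel. U x \<bullet> V x) = (LINT \<xi>|lborel. ftg u \<xi> \<bullet> ftg v \<xi>)"
proof -
  note su = h10_Plancherel[OF \<Omega> u] and sv = h10_Plancherel[OF \<Omega> v]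
  have "ftg (\<lambda>x. u x + v x) = (\<lambda>\<xi>. ftg u \<xi> + 1 *\<^sub>R ftg v \<xi>)"
    using ft_add[OF h10_integrable[OF \<Omega> u] h10_integrable[OF \<Omega> v]] by (simp add: ftg_def fun_eq_iff scaleR_add_right)
  then have "nsq (\<lambda>\<xi>. ftg u \<xi> + 1 *\<^sub>R ftg v \<xi>) = nsq (\<lambda>x. U x + 1 *\<^sub>R V x)"
    using h10_Plancherel(2)[OF \<Omega> h10_add[OF u v]] by simp
  then show ?thesis
    unfolding nsq_expand[OF su(1) sv(1)] nsq_expand[OF h10_sq_int(2)[OF u] h10_sq_int(2)[OF v]]
    using su(2) sv(2) by simp
qed

section \<open>Finiteness of the spectral form\<close>

context dirichlet_form
begin

text \<open>
  The right-hand side is the corresponding quantity for the Laplacian on the whole space: the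
  resolvent form on \<open>\<Omega>\<close> is dominated by that of the whole space because the infimum defining
  it is taken over a smaller set of competitors.
\<close>

lemma shifted_energy_le_fourier:
  assumes u: "h10 \<Omega> u U" and \<mu>: "\<mu> > 0"
  shows "(\<Sum>j<N. (ev j)\<^sup>2 / (ev j + \<mu>) * (coef u j)\<^sup>2) \<le>
    (LINT \<xi>|lborel. norm \<xi> ^ 4 / ((norm \<xi>)\<^sup>2 + \<mu>) * (norm (ft u \<xi>))\<^sup>2)"
    and "integrable lborel (\<lambda>\<xi>. norm \<xi> ^ 4 / ((norm \<xi>)\<^sup>2 + \<mu>) * (norm (ft u \<xi>))\<^sup>2)"
proof -
  have pos: "ev j + \<mu> > 0" for j using H1.w_nonneg[of j] \<mu> by simp
  have p: "(norm \<xi>)\<^sup>2 + \<mu> > 0" for \<xi> :: 'a using \<mu> by (simp add: add_nonneg_pos)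
  \<comment> \<open>\<open>g\<close> is the truncated expansion of -\<Delta> (-\<Delta> +
    \<mu>)^(-1) u, the optimal competitor: its energy pairing with \<open>u\<close> and its own
    shifted energy both equal \<open>S\<close>.\<close>
  define a where "a j = ev j / (ev j + \<mu>) * coef u j" for j
  define g where "g = L2.partial a {..<N}"
  define D where "D = H1.partial a {..<N}"
  define S where "S = (\<Sum>j<N. (ev j)\<^sup>2 / (ev j + \<mu>) * (coef u j)\<^sup>2)"
  have S0: "S \<ge> 0" unfolding S_def using pos by (intro sum_nonneg mult_nonneg_nonneg divide_nonneg_pos) auto
  have gD: "h10 \<Omega> g D" unfolding g_def D_def by (rule h10_partial)
  have UD: "(LINT x|lborel. U x \<bullet> D x) = S"
    unfolding D_def H1.inner_partial[OF h10_sq_int(2)[OF u]] eigen_h10[OF u] S_def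
    by (intro sum.cong) (auto simp: a_def power2_eq_square)
  have nS: "nsq D + \<mu> * nsq g = S"
  proof -
    have "nsq D + \<mu> * nsq g = (\<Sum>j<N. (ev j + \<mu>) * (a j)\<^sup>2)"
      unfolding D_def g_def H1.nsq_partial[OF finite_lessThan] L2.nsq_partial[OF finite_lessThan]
      by (simp add: sum_distrib_left sum.distrib[symmetric] algebra_simps)
    also have "\<dots> = S" unfolding S_def
    proof (intro sum.cong refl)
      fix j
      have "(ev j + \<mu>) * (a j)\<^sup>2 = ((ev j + \<mu>) / (ev j + \<mu>)) * ((ev j)\<^sup>2 / (ev j + \<mu>) * (coef u j)\<^sup>2)"
        by (simp add: a_def power_mult_distrib power_divide power2_eq_square)
      then show "(ev j + \<mu>) * (a j)\<^sup>2 = (ev j)\<^sup>2 / (ev j + \<mu>) * (coef u j)\<^sup>2" using pos[of j] by simp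
    qed
    finally show ?thesis .
  qed
  have mu: "u \<in> borel_measurable borel" and mg: "g \<in> borel_measurable borel"
    using h10_sq_int(1)[OF u] h10_sq_int(1)[OF gD] by (auto simp: sq_int_def)
  note [measurable] = mu mg
  \<comment> \<open>The weight |\<xi>|^2 of the energy pairing is split so that |A|^2 is the density
    on the right-hand side of the claim and |B|^2 the shifted energy density of
    \<open>g\<close>.\<close>
  define A where "A \<xi> = (norm \<xi> / sqrt ((norm \<xi>)\<^sup>2 + \<mu>)) *\<^sub>R ftg u \<xi>" for \<xi>
  define B where "B \<xi> = sqrt ((norm \<xi>)\<^sup>2 + \<mu>) *\<^sub>R ft g \<xi>" for \<xi>
  note fu = h10_Plancherel[OF \<Omega>(3) u] and fg = h10_Plancherel[OF \<Omega>(3) gD]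
    and bg = ft_Bessel[OF h10_integrable[OF \<Omega>(3) gD] h10_sq_int(1)[OF gD]]
  have A: "sq_int A"
  proof (rule sq_int_dominated[OF _ fu(1), of _ 1])
    show "A \<in> borel_measurable borel" unfolding A_def by measurable
    show "norm (A \<xi>) \<le> 1 * norm (ftg u \<xi>)" for \<xi>
    proof -
      have "norm \<xi> \<le> sqrt ((norm \<xi>)\<^sup>2 + \<mu>)" using \<mu> by (intro real_le_rsqrt) simp
      then have "norm \<xi> / sqrt ((norm \<xi>)\<^sup>2 + \<mu>) \<le> 1" using p[of \<xi>] by simp
      then have "norm \<xi> / sqrt ((norm \<xi>)\<^sup>2 + \<mu>) * norm (ftg u \<xi>) \<le> 1 * norm (ftg u \<xi>)" by (rule mult_right_mono) simp
      then show ?thesis unfolding A_def norm_scaleR using p[of \<xi>] by (simp add: abs_divide)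
    qed
  qed
  have nB: "(norm (B \<xi>))\<^sup>2 = (norm (ftg g \<xi>))\<^sup>2 + \<mu> * (norm (ft g \<xi>))\<^sup>2" for \<xi>
    unfolding B_def ftg_def norm_scaleR power_mult_distrib using p[of \<xi>] by (simp add: distrib_right)
  have Bm: "B \<in> borel_measurable borel" unfolding B_def by measurable
  have B: "sq_int B" unfolding sq_int_def nB using sq_int_integrable[OF fg(1)] sq_int_integrable[OF bg(1)] Bm by simp
  have nBS: "nsq B \<le> S"
  proof -
    have "nsq B = nsq (ftg g) + \<mu> * nsq (ft g)"
      unfolding nsq_def nB using sq_int_integrable[OF fg(1)] sq_int_integrable[OF bg(1)] by simp
    also have "\<dots> \<le> nsq D + \<mu> * nsq g" using fg(2) bg(2) \<mu> by simp
    finally show ?thesis using nS by simp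
  qed
  have AB: "ftg u \<xi> \<bullet> ftg g \<xi> = A \<xi> \<bullet> B \<xi>" for \<xi>
    unfolding A_def B_def ftg_def using p[of \<xi>] by simp
  \<comment> \<open>Cauchy-Schwarz bounds \<open>S\<close> by a product whose second factor is at
    most sqrt S; dividing by it leaves the bound \<open>nsq A\<close>.\<close>
  have "S = (LINT \<xi>|lborel. A \<xi> \<bullet> B \<xi>)"
    using UD h10_Parseval[OF \<Omega>(3) u gD] by (simp add: AB)
  also have "\<dots> \<le> sqrt (nsq A) * sqrt (nsq B)" using Cauchy_Schwarz_L2[OF A B] by simp
  also have "\<dots> \<le> sqrt (nsq A) * sqrt S" using nBS by (intro mult_left_mono real_sqrt_le_mono) auto
  finally have "S \<le> sqrt (nsq A) * sqrt S" .
  have le: "S \<le> nsq A"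
  proof (cases "S = 0")
    case False
    then have s: "sqrt S > 0" using S0 by simp
    have "sqrt S * sqrt S \<le> sqrt (nsq A) * sqrt S" using \<open>S \<le> sqrt (nsq A) * sqrt S\<close> S0 by simp
    then have "sqrt S \<le> sqrt (nsq A)" by (rule mult_right_le_imp_le) (rule s)
    then show ?thesis by simp
  qed simp
  have nA: "(norm (A \<xi>))\<^sup>2 = norm \<xi> ^ 4 / ((norm \<xi>)\<^sup>2 + \<mu>) * (norm (ft u \<xi>))\<^sup>2" for \<xi>
  proof -
    have "(norm (A \<xi>))\<^sup>2 = (norm \<xi>)\<^sup>2 / ((norm \<xi>)\<^sup>2 + \<mu>) * ((norm \<xi>)\<^sup>2 * (norm (ft u \<xi>))\<^sup>2)"
      unfolding A_def ftg_def norm_scaleR power_mult_distrib using p[of \<xi>] by (simp add: power_divide)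
    then show ?thesis by (simp add: power2_eq_square power4_eq_xxxx mult.assoc)
  qed
  show "(\<Sum>j<N. (ev j)\<^sup>2 / (ev j + \<mu>) * (coef u j)\<^sup>2) \<le>
    (LINT \<xi>|lborel. norm \<xi> ^ 4 / ((norm \<xi>)\<^sup>2 + \<mu>) * (norm (ft u \<xi>))\<^sup>2)"
    using le unfolding nsq_def nA S_def .
  show "integrable lborel (\<lambda>\<xi>. norm \<xi> ^ 4 / ((norm \<xi>)\<^sup>2 + \<mu>) * (norm (ft u \<xi>))\<^sup>2)"
    using sq_int_integrable[OF A] unfolding nA .
qed

end

subsection \<open>An integral representation of powers\<close>

text \<open>The integrand in the representation of a^s, extended by 0 to t \<le> 0 so that the
  integral runs over the whole line.\<close>

definition power_kernel :: "real \<Rightarrow> real \<Rightarrow> real \<Rightarrow> real" where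
  "power_kernel s a t = (if 0 < t then t powr (s - 2) * (a\<^sup>2 / (a + t)) else 0)"

text \<open>The reciprocal of the constant in the representation of the power. For 1 < s < 2 it is
  pi / sin(pi (s - 1)), but only its finiteness matters.\<close>

definition power_const :: "real \<Rightarrow> ennreal" where
  "power_const s = (\<integral>\<^sup>+t. ennreal (power_kernel s 1 t) \<partial>lborel)"

lemma power_kernel_measurable[measurable]:
  assumes [measurable]: "a \<in> borel_measurable M" "t \<in> borel_measurable M"
  shows "(\<lambda>x. power_kernel s (a x) (t x)) \<in> borel_measurable M"
  unfolding power_kernel_def by measurable

lemma power_kernel_nonneg: "0 \<le> a \<Longrightarrow> 0 \<le> power_kernel s a t"
  by (simp add: power_kernel_def)

text \<open>Replacing t by a t pulls out the power of a: one factor a from the measure, a^(s-2) from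
  the weight, and a^2 / a from the fraction.\<close>

lemma power_kernel_integral:
  assumes a: "0 \<le> a"
  shows "(\<integral>\<^sup>+t. ennreal (power_kernel s a t) \<partial>lborel) = ennreal (a powr s) * power_const s"
proof (cases "a = 0")
  case True
  have "power_kernel s 0 t = 0" for t by (simp add: power_kernel_def)
  then show ?thesis using True by simp
next
  case False
  then have a: "a > 0" using a by simp
  have "(\<integral>\<^sup>+t. ennreal (power_kernel s a t) \<partial>lborel) = ennreal a * (\<integral>\<^sup>+t. ennreal (power_kernel s a (0 + a * t)) \<partial>lborel)"
    using a nn_integral_real_affine[of "\<lambda>t. ennreal (power_kernel s a t)" a 0] by simp
  also have "\<dots> = (\<integral>\<^sup>+t. ennreal (a powr s) * ennreal (power_kernel s 1 t) \<partial>lborel)"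
  proof (subst nn_integral_cmult[symmetric], simp, rule nn_integral_cong)
    fix t
    have "a * power_kernel s a (0 + a * t) = a powr s * power_kernel s 1 t"
    proof (cases "t > 0")
      case True
      have "a * power_kernel s a (0 + a * t) = a * (a powr (s - 2) * t powr (s - 2) * (a\<^sup>2 / (a * (1 + t))))"
        using a True by (simp add: power_kernel_def powr_mult distrib_left)
      also have "\<dots> = (a powr (s - 2) * a\<^sup>2) * (t powr (s - 2) / (1 + t))"
        using a by (simp add: power2_eq_square)
      also have "a powr (s - 2) * a\<^sup>2 = a powr s"
        using a by (simp add: powr_diff powr_numeral)
      finally show ?thesis using True by (simp add: power_kernel_def)
    next
      case False
      then have "\<not> 0 < a * t" using a by (simp add: zero_less_mult_iff)
      then show ?thesis using False by (simp add: power_kernel_def)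
    qed
    then show "ennreal a * ennreal (power_kernel s a (0 + a * t)) = ennreal (a powr s) * ennreal (power_kernel s 1 t)"
      using a by (simp add: ennreal_mult'[symmetric] power_kernel_nonneg)
  qed
  also have "\<dots> = ennreal (a powr s) * power_const s"
    unfolding power_const_def by (rule nn_integral_cmult) simp
  finally show ?thesis .
qed

text \<open>Up to 1 the integrand is at most t^(s-2), integrable because s > 1; beyond 1 it is at
  most t^(s-3), integrable because s < 2.\<close>

lemma power_const_finite:
  assumes s: "1 < s" "s < 2" shows "power_const s \<noteq> \<infinity>"
proof -
  have 1: "(\<integral>\<^sup>+t. ennreal (t powr (s - 2)) * indicator {0..1} t \<partial>lborel) = ennreal (1 powr (s - 2 + 1) / (s - 2 + 1))"
    using s by (intro nn_integral_has_integral_lebesgue' has_integral_powr_from_0) auto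
  have 2: "(\<integral>\<^sup>+t. ennreal (t powr (s - 3)) * indicator {1..} t \<partial>lborel) = ennreal (- (1 powr (s - 3 + 1)) / (s - 3 + 1))"
    using s by (intro nn_integral_has_integral_lebesgue' has_integral_powr_to_inf) auto
  have "power_const s \<le> (\<integral>\<^sup>+t. ennreal (t powr (s - 2)) * indicator {0..1} t + ennreal (t powr (s - 3)) * indicator {1..} t \<partial>lborel)"
    unfolding power_const_def
  proof (rule nn_integral_mono)
    fix t :: real
    consider "t \<le> 0" | "0 < t" "t \<le> 1" | "1 < t" by linarith
    then show "ennreal (power_kernel s 1 t) \<le> ennreal (t powr (s - 2)) * indicator {0..1} t + ennreal (t powr (s - 3)) * indicator {1..} t"
    proof cases
      case 1 then show ?thesis by (simp add: power_kernel_def)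
    next
      case 2
      have "t powr (s - 2) * (1\<^sup>2 / (1 + t)) \<le> t powr (s - 2) * 1"
        using 2 by (intro mult_left_mono) auto
      then have "ennreal (power_kernel s 1 t) \<le> ennreal (t powr (s - 2)) * indicator {0..1} t"
        using 2 by (simp add: power_kernel_def ennreal_leI)
      then show ?thesis by (rule order_trans) simp
    next
      case 3
      have "t powr (s - 2) * (1\<^sup>2 / (1 + t)) \<le> t powr (s - 2) * (1 / t)"
        using 3 by (intro mult_left_mono) (auto simp: divide_simps)
      also have "\<dots> = t powr (s - 3)" using 3 powr_diff[of t "s - 2" 1] by simp
      finally have "ennreal (power_kernel s 1 t) \<le> ennreal (t powr (s - 3)) * indicator {1..} t"
        using 3 by (simp add: power_kernel_def ennreal_leI)
      then show ?thesis by (rule order_trans) simp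
    qed
  qed
  also have "\<dots> < \<infinity>" by (subst nn_integral_add) (auto simp: 1 2)
  finally show ?thesis by simp
qed

context dirichlet_form
begin

definition spectral :: "real \<Rightarrow> ('a \<Rightarrow> real) \<Rightarrow> ennreal" where
  "spectral s v = (\<Sum>j. ennreal (ev j powr s * (coef v j)\<^sup>2))"

text \<open>The terms are nonnegative, so sum and integral are exchanged in [0, \<infinity>] before
  anything is known to be finite.\<close>

lemma spectral_representation:
  "power_const s * spectral s v = (\<integral>\<^sup>+t. (\<Sum>j. ennreal (power_kernel s (ev j) t * (coef v j)\<^sup>2)) \<partial>lborel)"
proof -
  have "(\<integral>\<^sup>+t. (\<Sum>j. ennreal (power_kernel s (ev j) t * (coef v j)\<^sup>2)) \<partial>lborel) =
      (\<Sum>j. \<integral>\<^sup>+t. ennreal (power_kernel s (ev j) t * (coef v j)\<^sup>2) \<partial>lborel)"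
    by (rule nn_integral_suminf) simp
  also have "\<dots> = (\<Sum>j. power_const s * ennreal (ev j powr s * (coef v j)\<^sup>2))"
  proof (rule arg_cong[where f = suminf], rule ext)
    fix j
    have "(\<integral>\<^sup>+t. ennreal (power_kernel s (ev j) t * (coef v j)\<^sup>2) \<partial>lborel) =
        (\<integral>\<^sup>+t. ennreal (power_kernel s (ev j) t) * ennreal ((coef v j)\<^sup>2) \<partial>lborel)"
      by (intro nn_integral_cong) (simp add: ennreal_mult'' power_kernel_nonneg H1.w_nonneg)
    also have "\<dots> = (\<integral>\<^sup>+t. ennreal (power_kernel s (ev j) t) \<partial>lborel) * ennreal ((coef v j)\<^sup>2)"
      by (rule nn_integral_multc) simp
    finally show "(\<integral>\<^sup>+t. ennreal (power_kernel s (ev j) t * (coef v j)\<^sup>2) \<partial>lborel) = power_const s * ennreal (ev j powr s * (coef v j)\<^sup>2)"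
      by (simp add: power_kernel_integral[OF H1.w_nonneg] ennreal_mult'' mult_ac)
  qed
  also have "\<dots> = power_const s * spectral s v" unfolding spectral_def by (rule ennreal_suminf_cmult)
  finally show ?thesis by simp
qed

lemma kernel_sum:
  assumes "0 < t" "(\<lambda>j. (ev j)\<^sup>2 / (ev j + t) * (coef v j)\<^sup>2) sums X"
  shows "(\<Sum>j. ennreal (power_kernel s (ev j) t * (coef v j)\<^sup>2)) = ennreal (t powr (s - 2) * X)"
proof -
  have "(\<lambda>j. t powr (s - 2) * ((ev j)\<^sup>2 / (ev j + t) * (coef v j)\<^sup>2)) sums (t powr (s - 2) * X)"
    by (rule sums_mult[OF assms(2)])
  then have *: "(\<lambda>j. power_kernel s (ev j) t * (coef v j)\<^sup>2) sums (t powr (s - 2) * X)"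
    using assms(1) by (simp add: power_kernel_def mult.assoc)
  have "(\<Sum>j. ennreal (power_kernel s (ev j) t * (coef v j)\<^sup>2)) = ennreal (\<Sum>j. power_kernel s (ev j) t * (coef v j)\<^sup>2)"
    using * by (intro suminf_ennreal2) (auto simp: sums_iff power_kernel_nonneg H1.w_nonneg)
  then show ?thesis using * by (simp add: sums_iff)
qed

text \<open>Integrating the whole-space bound over \<open>t\<close> and exchanging the integrals
  reproduces the power representation with |\<xi>|^2 in place of an eigenvalue, which gives the
  weight |\<xi>|^(2 s).\<close>

lemma spectral_finite:
  assumes s: "1 < s" "s < 2" and u: "h10 \<Omega> u U"
    and fin: "(\<integral>\<^sup>+\<xi>. ennreal (norm \<xi> powr (2 * s) * (norm (ft u \<xi>))\<^sup>2) \<partial>lborel) \<noteq> \<infinity>"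
  shows "power_const s * spectral s u \<noteq> \<infinity>"
proof -
  have [measurable]: "u \<in> borel_measurable borel" using h10_sq_int(1)[OF u] by (simp add: sq_int_def)
  let ?F = "\<lambda>t \<xi>::'a. ennreal (power_kernel s ((norm \<xi>)\<^sup>2) t * (norm (ft u \<xi>))\<^sup>2)"
  have le: "(\<Sum>j. ennreal (power_kernel s (ev j) t * (coef u j)\<^sup>2)) \<le> (\<integral>\<^sup>+\<xi>. ?F t \<xi> \<partial>lborel)" for t
  proof (cases "t > 0")
    case True
    note E = shifted_energy_le_fourier[OF u True]
    have e: "power_kernel s ((norm \<xi>)\<^sup>2) t * (norm (ft u \<xi>))\<^sup>2 = t powr (s - 2) * (norm \<xi> ^ 4 / ((norm \<xi>)\<^sup>2 + t) * (norm (ft u \<xi>))\<^sup>2)" for \<xi> :: 'a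
      using True by (simp add: power_kernel_def mult.assoc power_mult[symmetric])
    have R: "(\<integral>\<^sup>+\<xi>. ?F t \<xi> \<partial>lborel) = ennreal (t powr (s - 2) * (LINT \<xi>|lborel. norm \<xi> ^ 4 / ((norm \<xi>)\<^sup>2 + t) * (norm (ft u \<xi>))\<^sup>2))"
    proof -
      have "(\<integral>\<^sup>+\<xi>. ?F t \<xi> \<partial>lborel) = ennreal (LINT \<xi>|lborel. t powr (s - 2) * (norm \<xi> ^ 4 / ((norm \<xi>)\<^sup>2 + t) * (norm (ft u \<xi>))\<^sup>2))"
        unfolding e using True by (intro nn_integral_eq_integral integrable_mult_right E(2)) auto
      then show ?thesis by (simp only: integral_mult_right_zero)
    qed
    show ?thesis unfolding R
    proof (rule suminf_le_const)
      show "(\<Sum>j<n. ennreal (power_kernel s (ev j) t * (coef u j)\<^sup>2)) \<le>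
          ennreal (t powr (s - 2) * (LINT \<xi>|lborel. norm \<xi> ^ 4 / ((norm \<xi>)\<^sup>2 + t) * (norm (ft u \<xi>))\<^sup>2))" for n
      proof -
        have "(\<Sum>j<n. ennreal (power_kernel s (ev j) t * (coef u j)\<^sup>2)) = ennreal (\<Sum>j<n. power_kernel s (ev j) t * (coef u j)\<^sup>2)"
          by (rule sum_ennreal) (simp add: power_kernel_nonneg H1.w_nonneg)
        also have "(\<Sum>j<n. power_kernel s (ev j) t * (coef u j)\<^sup>2) = t powr (s - 2) * (\<Sum>j<n. (ev j)\<^sup>2 / (ev j + t) * (coef u j)\<^sup>2)"
          using True by (simp add: power_kernel_def sum_distrib_left mult.assoc)
        finally show ?thesis using E(1)[of n] by (simp add: ennreal_leI mult_left_mono)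
      qed
    qed simp
  qed (simp add: power_kernel_def)
  have "power_const s * spectral s u \<le> (\<integral>\<^sup>+t. \<integral>\<^sup>+\<xi>. ?F t \<xi> \<partial>lborel \<partial>lborel)"
    unfolding spectral_representation by (intro nn_integral_mono le)
  also have "\<dots> = (\<integral>\<^sup>+\<xi>. \<integral>\<^sup>+t. ?F t \<xi> \<partial>lborel \<partial>lborel)"
    by (rule lborel_pair.Fubini') measurable
  also have "\<dots> = (\<integral>\<^sup>+\<xi>. power_const s * ennreal (norm \<xi> powr (2 * s) * (norm (ft u \<xi>))\<^sup>2) \<partial>lborel)"
  proof (rule nn_integral_cong)
    fix \<xi> :: 'a
    have "(\<integral>\<^sup>+t. ?F t \<xi> \<partial>lborel) = (\<integral>\<^sup>+t. ennreal (power_kernel s ((norm \<xi>)\<^sup>2) t) * ennreal ((norm (ft u \<xi>))\<^sup>2) \<partial>lborel)"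
      by (intro nn_integral_cong) (simp add: ennreal_mult'' power_kernel_nonneg)
    also have "\<dots> = ennreal (((norm \<xi>)\<^sup>2) powr s) * power_const s * ennreal ((norm (ft u \<xi>))\<^sup>2)"
      by (subst nn_integral_multc) (auto simp: power_kernel_integral)
    also have "((norm \<xi>)\<^sup>2) powr s = norm \<xi> powr (2 * s)"
      by (cases "\<xi> = 0") (auto simp: powr_powr[symmetric] powr_numeral)
    finally show "(\<integral>\<^sup>+t. ?F t \<xi> \<partial>lborel) = power_const s * ennreal (norm \<xi> powr (2 * s) * (norm (ft u \<xi>))\<^sup>2)"
      by (simp add: ennreal_mult'' mult_ac)
  qed
  also have "\<dots> = power_const s * (\<integral>\<^sup>+\<xi>. ennreal (norm \<xi> powr (2 * s) * (norm (ft u \<xi>))\<^sup>2) \<partial>lborel)"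
    by (rule nn_integral_cmult) simp
  also have "\<dots> < \<infinity>" using fin power_const_finite[OF s] by (simp add: ennreal_mult_less_top less_top)
  finally show ?thesis by simp
qed

text \<open>The integrands are strictly ordered at every t > 0, and strictness passes to the
  integrals because the one at \<open>u\<close> is finite.\<close>

theorem spectral_abs_less:
  assumes s: "1 < s" "s < 2" and u: "h10 \<Omega> u U"
    and sc: "\<not> (AE x in lborel. \<bar>u x\<bar> + u x = 0)" "\<not> (AE x in lborel. \<bar>u x\<bar> - u x = 0)"
    and fin: "(\<integral>\<^sup>+\<xi>. ennreal (norm \<xi> powr (2 * s) * (norm (ft u \<xi>))\<^sup>2) \<partial>lborel) \<noteq> \<infinity>"
  shows "spectral s u < spectral s (\<lambda>x. \<bar>u x\<bar>)"
proof -
  let ?X = "\<lambda>v t. \<Sum>j. ennreal (power_kernel s (ev j) t * (coef v j)\<^sup>2)"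
  have lt: "?X u t < ?X (\<lambda>x. \<bar>u x\<bar>) t" if t: "t > 0" for t
  proof -
    obtain X Y where XY: "X < Y" "(\<lambda>j. (ev j)\<^sup>2 / (ev j + t) * (coef u j)\<^sup>2) sums X"
      "(\<lambda>j. (ev j)\<^sup>2 / (ev j + t) * (coef (\<lambda>x. \<bar>u x\<bar>) j)\<^sup>2) sums Y"
      using abs_shifted_energy_less[OF u sc t] by blast
    have "0 \<le> X"
      using XY(2) H1.w_nonneg t by (intro sums_le[OF _ sums_zero XY(2)]) (auto intro!: mult_nonneg_nonneg divide_nonneg_nonneg add_nonneg_nonneg)
    then show ?thesis
      unfolding kernel_sum[OF t XY(2)] kernel_sum[OF t XY(3)] using XY(1) t by (intro ennreal_lessI) auto
  qed
  have z: "?X v t = 0" if "\<not> t > 0" for v t using that by (simp add: power_kernel_def)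
  have "(\<integral>\<^sup>+t. ?X u t \<partial>lborel) < (\<integral>\<^sup>+t. ?X (\<lambda>x. \<bar>u x\<bar>) t \<partial>lborel)"
  proof (rule nn_integral_less)
    show "(\<integral>\<^sup>+t. ?X u t \<partial>lborel) \<noteq> \<infinity>" using spectral_finite[OF s u fin] by (simp add: spectral_representation)
    show "AE t in lborel. ?X u t \<le> ?X (\<lambda>x. \<bar>u x\<bar>) t"
    proof (rule AE_I2)
      fix t show "?X u t \<le> ?X (\<lambda>x. \<bar>u x\<bar>) t" using lt[of t] z[of t] by (cases "t > 0") (auto intro: less_imp_le)
    qed
    show "\<not> (AE t in lborel. ?X (\<lambda>x. \<bar>u x\<bar>) t \<le> ?X u t)"
    proof
      assume "AE t in lborel. ?X (\<lambda>x. \<bar>u x\<bar>) t \<le> ?X u t"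
      then have "AE t in lborel. t \<notin> {0<..<1::real}"
        by eventually_elim (use lt in \<open>auto simp: not_less[symmetric]\<close>)
      then have "emeasure lborel {0<..<1::real} = 0" by (subst (asm) AE_iff_measurable[of "{0<..<1}"]) auto
      then show False by simp
    qed
  qed measurable
  then have lt2: "power_const s * spectral s u < power_const s * spectral s (\<lambda>x. \<bar>u x\<bar>)"
    by (simp only: spectral_representation)
  \<comment> \<open>The common factor is cancelled by monotonicity: the reverse inequality would
    survive multiplication by it.\<close>
  show ?thesis
  proof (rule ccontr)
    assume "\<not> ?thesis"
    then have "power_const s * spectral s (\<lambda>x. \<bar>u x\<bar>) \<le> power_const s * spectral s u" by (intro mult_left_mono) auto
    with lt2 show False by simp
  qed
qed

end

section \<open>Functions on the whole space vanishing outside a Lipschitz domain\<close>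

lemma norm_project_le:
  assumes "norm e = 1" shows "norm (x - (x \<bullet> e) *\<^sub>R e) \<le> norm (x :: 'a::euclidean_space)"
proof -
  have "(norm (x - (x \<bullet> e) *\<^sub>R e))\<^sup>2 = (norm x)\<^sup>2 - (x \<bullet> e)\<^sup>2"
    using assms unfolding power2_norm_eq_inner
    by (simp add: inner_diff_left inner_diff_right inner_commute power2_eq_square norm_eq_1)
  then have "(norm (x - (x \<bullet> e) *\<^sub>R e))\<^sup>2 \<le> (norm x)\<^sup>2" by simp
  then show ?thesis by (rule power2_le_imp_le) simp
qed

locale lipschitz_chart =
  fixes \<Omega> U :: "'a::euclidean_space set" and e :: 'a and \<gamma> :: "'a \<Rightarrow> real" and L :: real
  assumes open_\<Omega>: "open \<Omega>" and e: "norm e = 1" and U: "open U"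
    and \<gamma>: "L-lipschitz_on {y. y \<bullet> e = 0} \<gamma>"
    and chart: "\<Omega> \<inter> U = {x \<in> U. \<gamma> (x - (x \<bullet> e) *\<^sub>R e) < x \<bullet> e}"
begin

abbreviation project :: "'a \<Rightarrow> 'a" where "project x \<equiv> x - (x \<bullet> e) *\<^sub>R e"

lemma project_orth: "project x \<bullet> e = 0"
  using e by (simp add: inner_diff_left norm_eq_1)

lemma L_nonneg: "0 \<le> L"
  by (rule lipschitz_on_nonneg[OF \<gamma>])

lemma \<gamma>_lipschitz: "\<gamma> (project x) \<le> \<gamma> (project y) + L * norm (project (x - y))"
proof -
  have "dist (\<gamma> (project x)) (\<gamma> (project y)) \<le> L * dist (project x) (project y)"
    by (rule lipschitz_onD[OF \<gamma>]) (auto simp only: mem_Collect_eq project_orth)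
  moreover have "project x - project y = project (x - y)" by (simp add: inner_diff_left algebra_simps)
  ultimately show ?thesis by (simp add: dist_norm abs_le_iff)
qed

lemma closure_above: assumes "y \<in> closure \<Omega>" "y \<in> U" shows "\<gamma> (project y) \<le> y \<bullet> e"
proof -
  have "continuous_on UNIV (\<lambda>y. \<gamma> (project y))"
    by (rule continuous_on_compose2[OF lipschitz_on_continuous_on[OF \<gamma>]])
      (auto intro!: continuous_intros simp only: mem_Collect_eq project_orth image_subset_iff)
  then have "closed {y. \<gamma> (project y) \<le> y \<bullet> e}" by (intro closed_Collect_le continuous_intros)
  moreover have "\<Omega> \<inter> U \<subseteq> {y. \<gamma> (project y) \<le> y \<bullet> e}" unfolding chart by auto
  ultimately have "closure (\<Omega> \<inter> U) \<subseteq> {y. \<gamma> (project y) \<le> y \<bullet> e}" by (rule closure_minimal[rotated])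
  moreover have "y \<in> closure (\<Omega> \<inter> U)"
    using open_Int_closure_subset[OF U, of \<Omega>] assms by (auto simp: Int_commute)
  ultimately show ?thesis by auto
qed

text \<open>Write p = t e + q. The height grows by at least t - |q| while the graph below rises by
  at most L |q|; as (L + 1) |q| \<le> t / 2, the point ends strictly above the graph.\<close>

lemma inward:
  assumes t: "0 < t" and y: "y \<in> closure \<Omega>" "y \<in> U" and p: "norm (p - t *\<^sub>R e) \<le> t / (2 * (L + 1))" and x: "y + p \<in> U"
  shows "y + p \<in> \<Omega>"
proof -
  have L1: "L + 1 > 0" using L_nonneg by simp
  define q where "q = p - t *\<^sub>R e"
  have pq: "p = q + t *\<^sub>R e" by (simp add: q_def)
  have ee: "e \<bullet> e = 1" using e by (simp add: norm_eq_1)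
  have "project p = project q" unfolding pq by (simp add: inner_add_left ee algebra_simps)
  then have n1: "norm (project p) \<le> norm q" using norm_project_le[OF e, of q] by simp
  have n2: "p \<bullet> e \<ge> t - norm q" unfolding pq using Cauchy_Schwarz_ineq2[of q e] e by (simp add: inner_add_left ee abs_le_iff)
  have "(L + 1) * norm q \<le> (L + 1) * (t / (2 * (L + 1)))" using p L1 by (intro mult_left_mono) (auto simp: q_def)
  also have "\<dots> = t / 2"
  proof -
    have "l * (t / (2 * l)) = t / 2" if "l > 0" for l :: real using that by simp
    from this[OF L1] show ?thesis .
  qed
  also have "\<dots> < t" using t by simp
  finally have k: "L * norm q + norm q < t" by (simp add: algebra_simps)
  have "\<gamma> (project (y + p)) \<le> \<gamma> (project y) + L * norm (project p)"
    using \<gamma>_lipschitz[of "y + p" y] by simp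
  also have "\<dots> \<le> y \<bullet> e + L * norm q"
    using closure_above[OF y] mult_left_mono[OF n1 L_nonneg] by simp
  also have "\<dots> < y \<bullet> e + p \<bullet> e" using k n2 by simp
  also have "\<dots> = (y + p) \<bullet> e" by (simp add: inner_add_left)
  finally have "y + p \<in> \<Omega> \<inter> U" unfolding chart using x by simp
  then show ?thesis by simp
qed

lemma frontier_graph: assumes "x \<in> frontier \<Omega>" "x \<in> U" shows "\<gamma> (project x) = x \<bullet> e"
proof (rule antisym)
  show "\<gamma> (project x) \<le> x \<bullet> e" using assms by (intro closure_above) (auto simp: frontier_def)
  have "x \<notin> \<Omega> \<inter> U" using assms open_\<Omega> by (auto simp: frontier_def interior_open)
  then show "x \<bullet> e \<le> \<gamma> (project x)" unfolding chart using assms(2) by (simp add: not_less)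
qed

text \<open>Infinitely many disjoint translates of the graph fit into a bounded set.\<close>

lemma frontier_locally_null:
  assumes S: "closed S" "bounded S" "S \<subseteq> U" shows "emeasure lborel (frontier \<Omega> \<inter> S) = 0"
proof (rule ccontr)
  let ?F = "frontier \<Omega> \<inter> S"
  assume ne: "emeasure lborel ?F \<noteq> 0"
  have Fm[measurable]: "?F \<in> sets borel" using S(1) by (simp add: closed_Int borel_closed)
  obtain R where R: "S \<subseteq> cball 0 R" using S(2) unfolding bounded_iff subset_eq by auto
  define T where "T n = {x. - ((1 / real (Suc n)) *\<^sub>R e) + x \<in> ?F}" for n
  have Tm: "T n \<in> sets lborel" for n
  proof -
    have "(\<lambda>x. - ((1 / real (Suc n)) *\<^sub>R e) + x) -` ?F \<inter> space borel \<in> sets borel"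
      by (rule measurable_sets[OF _ Fm]) simp
    then show ?thesis by (simp add: T_def vimage_def)
  qed
  have Te: "emeasure lborel (T n) = emeasure lborel ?F" for n
  proof -
    have "emeasure lborel ?F = emeasure (distr lborel borel (\<lambda>x. - ((1 / real (Suc n)) *\<^sub>R e) + x)) ?F"
      unfolding lborel_distr_shift ..
    also have "\<dots> = emeasure lborel (T n)" by (subst emeasure_distr) (auto simp: T_def vimage_def)
    finally show ?thesis by simp
  qed
  have disj: "disjoint_family T"
  \<comment> \<open>A common point of two translates would put the graph over one base point at two
    different heights.\<close>
  proof (unfold disjoint_family_on_def, intro ballI impI, rule ccontr)
    fix m n :: nat assume "m \<noteq> n" "T m \<inter> T n \<noteq> {}"
    then obtain x where x: "x \<in> T m" "x \<in> T n" by auto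
    have g: "\<gamma> (project x) = x \<bullet> e - 1 / real (Suc k)" if "x \<in> T k" for k
    proof -
      have "\<gamma> (project (- ((1 / real (Suc k)) *\<^sub>R e) + x)) = (- ((1 / real (Suc k)) *\<^sub>R e) + x) \<bullet> e"
        using that S(3) by (intro frontier_graph) (auto simp: T_def)
      moreover have "project (- ((1 / real (Suc k)) *\<^sub>R e) + x) = project x"
        using e by (simp add: inner_diff_left norm_eq_1 algebra_simps)
      moreover have "(- ((1 / real (Suc k)) *\<^sub>R e) + x) \<bullet> e = x \<bullet> e - 1 / real (Suc k)"
        using e by (simp add: inner_diff_left norm_eq_1)
      ultimately show ?thesis by metis
    qed
    show False using g[OF x(1)] g[OF x(2)] \<open>m \<noteq> n\<close> by (simp add: field_simps)
  qed
  have sub: "(\<Union>n. T n) \<subseteq> cball 0 (R + 1)"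
  proof
    fix x assume "x \<in> (\<Union>n. T n)"
    then obtain n where "- ((1 / real (Suc n)) *\<^sub>R e) + x \<in> S" by (auto simp: T_def)
    then have "norm (- ((1 / real (Suc n)) *\<^sub>R e) + x) \<le> R" using R by auto
    moreover have "norm x \<le> norm (- ((1 / real (Suc n)) *\<^sub>R e) + x) + norm ((1 / real (Suc n)) *\<^sub>R e)"
      using norm_triangle_ineq[of "- ((1 / real (Suc n)) *\<^sub>R e) + x" "(1 / real (Suc n)) *\<^sub>R e"] by simp
    moreover have "norm ((1 / real (Suc n)) *\<^sub>R e) \<le> 1" using e by simp
    ultimately have "norm x \<le> R + 1" by linarith
    then show "x \<in> cball 0 (R + 1)" by simp
  qed
  have "emeasure lborel (\<Union>n. T n) \<le> emeasure lborel (cball 0 (R + 1) :: 'a set)"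
    by (rule emeasure_mono[OF sub]) simp
  also have "\<dots> < \<infinity>" by (rule emeasure_lborel_cball_finite)
  finally have fin: "(\<Sum>n. emeasure lborel (T n)) < \<infinity>"
    using suminf_emeasure[of T lborel] Tm disj by (simp add: image_subset_iff)
  then obtain C where C: "(\<Sum>n. emeasure lborel (T n)) = ennreal C" "C \<ge> 0" by (cases "\<Sum>n. emeasure lborel (T n)") auto
  have N: "of_nat N * emeasure lborel ?F \<le> ennreal C" for N :: nat
    using sum_le_suminf[of "\<lambda>n. emeasure lborel (T n)" "{..<N}"] C by (simp add: Te)
  then obtain m where m: "emeasure lborel ?F = ennreal m" "m \<ge> 0"
    using N[of 1] by (cases "emeasure lborel ?F") (auto simp: top_unique)
  then have "m > 0" using ne by (cases "m = 0") auto
  then obtain N :: nat where "C < real N * m" using reals_Archimedean3 by metis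
  moreover have "real N * m \<le> C"
    using N[of N] m C(2) by (simp add: ennreal_of_nat_eq_real_of_nat ennreal_mult'[symmetric])
  ultimately show False by simp
qed

end

lemma strictly_lipschitz_chart:
  assumes "open \<Omega>" "strictly_lipschitz \<Omega>" "z \<in> frontier \<Omega>"
  obtains U e \<gamma> L where "lipschitz_chart \<Omega> U e \<gamma> L" "z \<in> U"
  using assms unfolding strictly_lipschitz_def lipschitz_chart_def by blast

text \<open>The compact boundary is covered by finitely many balls inside charts. The support
  condition confines functions only to the closure of \<Omega>; this lemma leads from there to
  vanishing almost everywhere off \<Omega>.\<close>

lemma frontier_null:
  assumes \<Omega>: "open \<Omega>" "bounded \<Omega>" "strictly_lipschitz \<Omega>" shows "AE x in lborel. x \<notin> frontier \<Omega>"
proof -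
  have "\<exists>r>0. emeasure lborel (frontier \<Omega> \<inter> cball z r) = 0" if z: "z \<in> frontier \<Omega>" for z
  proof -
    obtain U e \<gamma> L where c: "lipschitz_chart \<Omega> U e \<gamma> L" "z \<in> U" using strictly_lipschitz_chart[OF \<Omega>(1,3) z] by blast
    interpret lipschitz_chart \<Omega> U e \<gamma> L by fact
    obtain r where "r > 0" "cball z r \<subseteq> U" using U c(2) open_contains_cball by blast
    then show ?thesis using frontier_locally_null[of "cball z r"] by auto
  qed
  then obtain r where r: "\<And>z. z \<in> frontier \<Omega> \<Longrightarrow> r z > 0 \<and> emeasure lborel (frontier \<Omega> \<inter> cball z (r z)) = 0" by metis
  have cpt: "compact (frontier \<Omega>)" using \<Omega>(2) by (simp add: compact_frontier_bounded)
  have cov: "frontier \<Omega> \<subseteq> (\<Union>z\<in>frontier \<Omega>. ball z (r z))" using r by fastforce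
  obtain D where D: "D \<subseteq> frontier \<Omega>" "finite D" "frontier \<Omega> \<subseteq> (\<Union>z\<in>D. ball z (r z))"
    by (rule compactE_image[OF cpt open_ball cov])
  have "AE x in lborel. \<forall>z\<in>D. x \<notin> frontier \<Omega> \<inter> cball z (r z)"
  proof (rule AE_finite_allI[OF D(2)])
    fix z assume "z \<in> D"
    then have "emeasure lborel (frontier \<Omega> \<inter> cball z (r z)) = 0" using r D(1) by auto
    then show "AE x in lborel. x \<notin> frontier \<Omega> \<inter> cball z (r z)"
      by (subst AE_iff_measurable[of "frontier \<Omega> \<inter> cball z (r z)"]) (auto intro: borel_closed closed_Int)
  qed
  then show ?thesis
  proof eventually_elim
    case (elim x)
    show ?case
    proof
      assume x: "x \<in> frontier \<Omega>"
      then obtain z where "z \<in> D" "x \<in> ball z (r z)" using D(3) by blast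
      then show False using elim x by auto
    qed
  qed
qed

text \<open>The cone condition in a form common to interior points, where any displacement ending in
  a small ball will do and e = 0, c = 1 serve, and boundary points, where it comes from
  \<open>inward\<close>.\<close>

lemma local_inward:
  fixes \<Omega> :: "'a::euclidean_space set"
  assumes \<Omega>: "open \<Omega>" "strictly_lipschitz \<Omega>" and z: "z \<in> closure \<Omega>"
  obtains r e c where "r > 0" "c > 0"
    "\<And>t y p. 0 < t \<Longrightarrow> t \<le> r \<Longrightarrow> y \<in> closure \<Omega> \<Longrightarrow> norm (p - t *\<^sub>R e) \<le> c * t \<Longrightarrow> y + p \<in> ball z r \<Longrightarrow> y + p \<in> \<Omega>"
proof (cases "z \<in> \<Omega>")
  case True
  then obtain r where r: "r > 0" "ball z r \<subseteq> \<Omega>" using \<Omega>(1) openE by blast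
  show ?thesis by (rule that[of r 1 0]) (use r in auto)
next
  case False
  then have "z \<in> frontier \<Omega>" using z \<Omega>(1) by (simp add: frontier_def interior_open)
  then obtain U e \<gamma> L where c: "lipschitz_chart \<Omega> U e \<gamma> L" "z \<in> U" using strictly_lipschitz_chart[OF \<Omega>] by blast
  interpret lipschitz_chart \<Omega> U e \<gamma> L by fact
  obtain r where r: "r > 0" "ball z r \<subseteq> U" using U c(2) openE by blast
  have L1: "2 * (L + 1) \<ge> 2" using L_nonneg by simp
  show ?thesis
  \<comment> \<open>With a third of the radius, p has length at most 2 t \<le> 2 r / 3, so the
    starting point y still has distance below r from z and lies in the chart.\<close>
  proof (rule that[of "r / 3" "1 / (2 * (L + 1))" e])
    fix t y p assume t: "0 < t" "t \<le> r / 3" and y: "y \<in> closure \<Omega>" and p: "norm (p - t *\<^sub>R e) \<le> 1 / (2 * (L + 1)) * t"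
      and x: "y + p \<in> ball z (r / 3)"
    have "1 / (2 * (L + 1)) * t \<le> 1 * t" using L1 t by (intro mult_right_mono) auto
    then have "norm (p - t *\<^sub>R e) \<le> t" using p by simp
    moreover have "norm p \<le> norm (p - t *\<^sub>R e) + norm (t *\<^sub>R e)" using norm_triangle_ineq[of "p - t *\<^sub>R e" "t *\<^sub>R e"] by simp
    ultimately have "norm p \<le> 2 * t" using e t by simp
    then have np: "norm p \<le> 2 * (r / 3)" using t by simp
    have "norm (z - (y + p)) < r / 3" using x by (simp add: dist_norm)
    moreover have "norm (z - y) \<le> norm (z - (y + p)) + norm p" using norm_triangle_ineq[of "z - (y + p)" p] by simp
    ultimately have "norm (z - y) < r" using np by simp
    then have "y \<in> U" using r(2) by (auto simp: dist_norm)
    moreover have "y + p \<in> U" using x r by auto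
    ultimately show "y + p \<in> \<Omega>" using p t(1) y by (intro inward) auto
  qed (use r L1 in auto)
qed

section \<open>Membership in the form domain from the Fourier side\<close>

lemma nsq_mono:
  assumes g: "sq_int g" and [measurable]: "f \<in> borel_measurable borel" and le: "\<And>x. norm (f x) \<le> norm (g x)"
  shows "nsq f \<le> nsq g"
proof -
  have "sq_int f" by (rule sq_int_dominated[OF _ g, of _ 1]) (use le in auto)
  then show ?thesis unfolding nsq_def using g le by (intro integral_mono) (auto intro: power_mono)
qed

text \<open>Fubini moves the mollifier onto the continuous \<open>g\<close>; the reflection in
  \<open>h\<close> accounts for the change from convolution to correlation.\<close>

lemma conv_bump_weak_limit:
  fixes u g :: "'a::euclidean_space \<Rightarrow> real"
  assumes u: "integrable lborel u" and g: "continuous_on UNIV g" and K: "compact K" "\<And>x. x \<notin> K \<Longrightarrow> g x = 0"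
    and \<rho>: "\<And>k. bump_at (p k) (r k) (\<rho> k)" and lim: "p \<longlonglongrightarrow> 0" "r \<longlonglongrightarrow> 0"
  shows "(\<lambda>k. LINT x|lborel. conv u (\<rho> k) x * g x) \<longlonglongrightarrow> (LINT x|lborel. u x * g x)"
proof -
  define h where "h x = g (- x)" for x
  have ch: "continuous_on UNIV h" unfolding h_def by (rule continuous_on_compose2[OF g]) (auto intro!: continuous_intros)
  have h0: "h x = 0" if "x \<notin> uminus ` K" for x
  proof -
    have "- x \<notin> K" using that by (metis imageI minus_minus)
    then show ?thesis by (simp add: h_def K)
  qed
  have cK: "compact (uminus ` K)" using K(1) by (rule compact_negations)
  note uh = zero_outside_uniformly_continuous[OF ch cK h0]
  obtain C where C: "\<And>x. \<bar>h x\<bar> \<le> C" using uh(2) unfolding bounded_iff by auto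
  have Cg: "\<bar>g x\<bar> \<le> C" for x using C[of "- x"] by (simp add: h_def)
  have [measurable]: "u \<in> borel_measurable borel" "g \<in> borel_measurable borel" "h \<in> borel_measurable borel"
    using u borel_measurable_continuous_onI[OF g] borel_measurable_continuous_onI[OF ch] by auto
  have \<rho>m[measurable]: "\<rho> k \<in> borel_measurable borel" for k by (rule bump_atD(7)[OF \<rho>])
  have cm[measurable]: "conv (\<rho> k) h \<in> borel_measurable borel" for k
    using conv_uniformly_continuous[OF bump_atD(4)[OF \<rho>] uh] by (intro borel_measurable_continuous_onI uniformly_continuous_imp_continuous)
  have eq: "(LINT x|lborel. conv u (\<rho> k) x * g x) = (LINT y|lborel. u y * conv (\<rho> k) h (- y))" for k
  proof -
    have "(LINT x|lborel. conv u (\<rho> k) x * g x) = (LINT x|lborel. LINT y|lborel. (u y * \<rho> k (x - y)) * g x)"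
      by (simp add: conv_def)
    also have "\<dots> = (LINT y|lborel. LINT x|lborel. (u y * \<rho> k (x - y)) * g x)"
    proof (rule lborel_pair.Fubini_integral)
      show "integrable (lborel \<Otimes>\<^sub>M lborel) (\<lambda>(y, x). (u y * \<rho> k (x - y)) * g x)"
      proof (rule Bochner_Integration.integrable_bound)
        show "integrable (lborel \<Otimes>\<^sub>M lborel) (\<lambda>q. C * (case q of (y, x) \<Rightarrow> u y * \<rho> k (x - y)))"
          by (rule integrable_mult_right[OF integrable_pair_conv[OF u bump_atD(4)[OF \<rho>]]])
        have "\<bar>(u y * \<rho> k (x - y)) * g x\<bar> \<le> \<bar>C * (u y * \<rho> k (x - y))\<bar>" for x y
        proof -
          have "\<bar>u y * \<rho> k (x - y)\<bar> * \<bar>g x\<bar> \<le> \<bar>u y * \<rho> k (x - y)\<bar> * \<bar>C\<bar>" using Cg[of x] by (intro mult_left_mono) auto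
          then show ?thesis by (simp only: abs_mult mult_ac)
        qed
        then show "AE q in lborel \<Otimes>\<^sub>M lborel. norm (case q of (y, x) \<Rightarrow> (u y * \<rho> k (x - y)) * g x) \<le>
            norm (C * (case q of (y, x) \<Rightarrow> u y * \<rho> k (x - y)))"
          by (intro AE_I2) (auto split: prod.split)
      qed measurable
    qed
    also have "\<dots> = (LINT y|lborel. u y * conv (\<rho> k) h (- y))"
    proof (rule Bochner_Integration.integral_cong[OF refl])
      fix y
      have "(LINT x|lborel. (u y * \<rho> k (x - y)) * g x) = (LINT x|lborel. u y * (\<rho> k x * g (y + x)))"
        by (subst integral_lborel_shift(1)[of "\<lambda>x. (u y * \<rho> k (x - y)) * g x" y, symmetric]) (simp_all add: mult.assoc)
      also have "\<dots> = u y * (LINT x|lborel. \<rho> k x * g (y + x))" by (rule integral_mult_right_zero)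
      also have "(LINT x|lborel. \<rho> k x * g (y + x)) = conv (\<rho> k) h (- y)" by (simp add: conv_def h_def add.commute)
      finally show "(LINT x|lborel. (u y * \<rho> k (x - y)) * g x) = u y * conv (\<rho> k) h (- y)" .
    qed
    finally show ?thesis .
  qed
  have "(\<lambda>k. LINT y|lborel. u y * conv (\<rho> k) h (- y)) \<longlonglongrightarrow> (LINT y|lborel. u y * g y)"
  proof (rule integral_dominated_convergence[where w = "\<lambda>y. \<bar>u y\<bar> * C"])
    show "integrable lborel (\<lambda>y. \<bar>u y\<bar> * C)" using u by simp
    have "(\<lambda>k. u y * conv (\<rho> k) h (- y)) \<longlonglongrightarrow> u y * g y" for y
    proof -
      have "h (- y) = g y" by (simp add: h_def)
      then show ?thesis using tendsto_mult_left[OF conv_bump_tendsto[OF uh \<rho> lim, of "- y"], of "u y"] by simp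
    qed
    then show "AE y in lborel. (\<lambda>k. u y * conv (\<rho> k) h (- y)) \<longlonglongrightarrow> u y * g y" by simp
    have "\<bar>conv (\<rho> k) h (- y) - 0\<bar> \<le> C" for k y
      using conv_bump_bound[OF \<rho> ch uh(2), of k "- y" 0 C] C by simp
    then show "AE y in lborel. norm (u y * conv (\<rho> k) h (- y)) \<le> \<bar>u y\<bar> * C" for k
      by (intro AE_I2) (simp add: abs_mult mult_left_mono)
  qed auto
  then show ?thesis unfolding eq .
qed

text \<open>The Fourier integral of a nonnegative bump of mass 1 has modulus at most 1, wherever the
  bump is centred.\<close>

lemma ft_conv_bump_le:
  assumes u: "integrable lborel u" and \<rho>: "bump_at p r \<rho>"
  shows "norm (ft (conv u \<rho>) \<xi>) \<le> norm (ft u \<xi>)"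
proof -
  have "norm (LINT y|lborel. \<rho> y *\<^sub>R cis (- (y \<bullet> \<xi>))) \<le> (LINT y|lborel. norm (\<rho> y *\<^sub>R cis (- (y \<bullet> \<xi>))))"
    by (rule integral_norm_bound)
  also have "\<dots> = (LINT y|lborel. \<rho> y)" using bump_atD(2)[OF \<rho>] by simp
  also have "\<dots> = 1" by (rule bump_atD(5)[OF \<rho>])
  finally show ?thesis
    unfolding ft_conv[OF u bump_atD(4,6,8)[OF \<rho>]] norm_mult by (simp add: mult_left_le)
qed

context dirichlet_form
begin

text \<open>Convergence against test functions extends to the eigenfunctions, which are limits of
  test functions, because the norms of \<open>v k\<close> are bounded.\<close>

lemma coef_weak_limit:
  assumes v: "\<And>k. sq_int (v k)" "\<And>k. nsq (v k) \<le> B" and w: "sq_int w"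
    and lim: "\<And>f. f \<in> test_functions \<Omega> \<Longrightarrow> (\<lambda>k. LINT x|lborel. v k x * f x) \<longlonglongrightarrow> (LINT x|lborel. w x * f x)"
  shows "(\<lambda>k. coef (v k) j) \<longlonglongrightarrow> coef w j"
proof (rule LIMSEQ_I)
  fix \<epsilon> :: real assume \<epsilon>: "\<epsilon> > 0"
  obtain f where f: "\<And>n. f n \<in> test_functions \<Omega>" "l2lim f (\<phi> j)" using h10_\<phi>[of j] h10_def by blast
  define A where "A = sqrt B + sqrt (nsq w)"
  have "B \<ge> 0" using v(2)[of 0] nsq_nonneg[of "v 0"] by linarith
  then have A: "A \<ge> 0" by (simp add: A_def)
  have "(\<lambda>n. A * sqrt (nsq (\<lambda>x. f n x - \<phi> j x))) \<longlonglongrightarrow> A * sqrt 0" by (intro tendsto_intros l2limD(3)[OF f(2)])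
  then have "\<forall>\<^sub>F n in sequentially. A * sqrt (nsq (\<lambda>x. f n x - \<phi> j x)) < \<epsilon> / 2"
    using order_tendstoD(2)[of _ "0::real" sequentially "\<epsilon> / 2"] \<epsilon> by simp
  then obtain n where n: "A * sqrt (nsq (\<lambda>x. f n x - \<phi> j x)) < \<epsilon> / 2"
    using eventually_happens'[OF sequentially_bot] by blast
  obtain N where N: "\<And>k. k \<ge> N \<Longrightarrow> norm ((LINT x|lborel. v k x * f n x) - (LINT x|lborel. w x * f n x)) < \<epsilon> / 2"
    using LIMSEQ_D[OF lim[OF f(1)], of "\<epsilon> / 2" n] \<epsilon> by auto
  define d where "d x = f n x - \<phi> j x" for x
  have d: "sq_int d" unfolding d_def by (intro sq_int_diff l2limD[OF f(2)])
  have c: "coef g j = (LINT x|lborel. g x * f n x) - (LINT x|lborel. g x * d x)" if g: "sq_int g" for g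
  proof -
    have "(LINT x|lborel. g x * f n x) - (LINT x|lborel. g x * d x) = (LINT x|lborel. g x * f n x - g x * d x)"
      by (rule Bochner_Integration.integral_diff[symmetric]) (intro sq_int_mult g d l2limD[OF f(2)])+
    then show ?thesis by (simp add: coef_def d_def algebra_simps)
  qed
  have b: "\<bar>LINT x|lborel. g x * d x\<bar> \<le> sqrt (nsq g) * sqrt (nsq d)" if g: "sq_int g" for g
    using Cauchy_Schwarz_L2[OF g d] by simp
  have "norm (coef (v k) j - coef w j) < \<epsilon>" if "k \<ge> N" for k
  proof -
    have "sqrt (nsq (v k)) * sqrt (nsq d) + sqrt (nsq w) * sqrt (nsq d) \<le> A * sqrt (nsq d)"
      using v(2)[of k] unfolding A_def distrib_right by (intro add_right_mono mult_right_mono real_sqrt_le_mono) auto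
    then have "\<bar>LINT x|lborel. v k x * d x\<bar> + \<bar>LINT x|lborel. w x * d x\<bar> < \<epsilon> / 2"
      using b[OF v(1)[of k]] b[OF w] n unfolding d_def[abs_def, symmetric] by linarith
    then show ?thesis unfolding c[OF v(1)[of k]] c[OF w] using N[OF that] unfolding real_norm_def by linarith
  qed
  then show "\<exists>N. \<forall>k\<ge>N. norm (coef (v k) j - coef w j) < \<epsilon>" by blast
qed

text \<open>Mollifying with a bump of centre t e and radius c t and cutting off with \<eta> gives
  test functions in \<Omega>. Their energies are bounded on the Fourier side and their coefficients
  converge, so the bound on the spectral sums passes to the product of \<eta> and \<open>u\<close>,
  and \<open>h10_if_summable\<close> applies.\<close>

lemma localized_h10:
  assumes lip: "strictly_lipschitz \<Omega>" and u: "sq_int u" "\<And>x. x \<notin> closure \<Omega> \<Longrightarrow> u x = 0" and fu: "sq_int (ftg u)"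
    and r: "r > 0" and c: "c > 0"
    and inward: "\<And>t y p. 0 < t \<Longrightarrow> t \<le> r \<Longrightarrow> y \<in> closure \<Omega> \<Longrightarrow> norm (p - t *\<^sub>R e) \<le> c * t \<Longrightarrow> y + p \<in> ball z r \<Longrightarrow> y + p \<in> \<Omega>"
    and \<eta>: "\<eta> \<in> test_functions (ball z r)"
  obtains V where "h10 \<Omega> (\<lambda>x. \<eta> x * u x) V"
proof -
  have bcl: "bounded (closure \<Omega>)" using \<Omega>(3) by (rule bounded_closure)
  have iu: "integrable lborel u" by (rule sq_int_integrable_bounded[OF u(1) bcl]) (use u(2) in auto)
  have [measurable]: "u \<in> borel_measurable borel" using u(1) by (simp add: sq_int_def)
  obtain K where K: "compact K" "K \<subseteq> ball z r" "c1 \<eta> (grad \<eta>)" "\<And>x. x \<notin> K \<Longrightarrow> \<eta> x = 0" "\<And>x. x \<notin> K \<Longrightarrow> grad \<eta> x = 0"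
    using \<eta> by (rule test_function_c1) blast
  have c\<eta>: "continuous_on UNIV \<eta>" "continuous_on UNIV (grad \<eta>)" using K(3) c1_continuous[OF K(3)] by (auto simp: c1_def)
  have sm\<eta>: "smooth \<eta>" by (rule test_functions_smooth[OF \<eta>])
  have [measurable]: "\<eta> \<in> borel_measurable borel" "grad \<eta> \<in> borel_measurable borel"
    using c\<eta> by (auto intro: borel_measurable_continuous_onI)
  obtain C1 where C1: "\<And>x. \<bar>\<eta> x\<bar> \<le> C1"
    using zero_outside_uniformly_continuous(2)[OF c\<eta>(1) K(1,4)] unfolding bounded_iff by auto
  obtain C2 where C2: "\<And>x. norm (grad \<eta> x) \<le> C2"
    using zero_outside_uniformly_continuous(2)[OF c\<eta>(2) K(1,5)] unfolding bounded_iff by auto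
  define t where "t k = r / real (Suc k)" for k
  have t: "t k > 0" "t k \<le> r" for k using r by (auto simp: t_def divide_le_eq)
  have tlim: "t \<longlonglongrightarrow> 0" unfolding t_def using tendsto_mult_left[OF LIMSEQ_Suc[OF lim_1_over_n], of r] by simp
  define p where "p k = t k *\<^sub>R e" for k
  have plim: "p \<longlonglongrightarrow> 0" unfolding p_def using tendsto_scaleR[OF tlim tendsto_const[of e]] by simp
  have clim: "(\<lambda>k. c * t k) \<longlonglongrightarrow> 0" using tendsto_mult_left[OF tlim, of c] by simp
  have "\<exists>\<rho>. bump_at (p k) (c * t k) \<rho>" for k by (rule bump_at_exists) (use c t(1) in simp)
  then obtain \<rho> where \<rho>: "\<And>k. bump_at (p k) (c * t k) (\<rho> k)" by metis
  define m where "m k = conv u (\<rho> k)" for k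
  \<comment> \<open>The mollified function lives on this set: points of the closure of \<Omega>
    moved by vectors that \<open>inward\<close> admits. Within the ball around \<open>z\<close> they
    fall into \<Omega>.\<close>
  define S where "S k = {y + q |y q. y \<in> closure \<Omega> \<and> q \<in> cball (p k) (c * t k)}" for k
  have cS: "compact (S k)" for k unfolding S_def by (intro compact_sums compact_cball) (simp add: bcl compact_eq_bounded_closed)
  have m0: "m k x = 0" if "x \<notin> S k" for k x
  proof -
    have "u y *\<^sub>R \<rho> k (x - y) = 0" for y
    proof (rule ccontr)
      assume "u y *\<^sub>R \<rho> k (x - y) \<noteq> 0"
      then have "y \<in> closure \<Omega>" "x - y \<in> cball (p k) (c * t k)" using u(2)[of y] bump_atD(9)[OF \<rho>, of "x - y" k] by auto
      then have "x \<in> S k" unfolding S_def by (intro CollectI exI[of _ y] exI[of _ "x - y"]) auto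
      then show False using that by simp
    qed
    then show ?thesis by (simp only: m_def conv_def) simp
  qed
  have smm: "smooth (m k)" for k unfolding m_def
    by (rule smooth_conv[OF iu bump_atD(1)[OF \<rho>] compact_cball bump_atD(9)[OF \<rho>]])
  note mc = smooth_c1[OF smm]
  note mP = c1_Plancherel[OF mc cS m0]
  have msq: "sq_int (m k)" "sq_int (grad (m k))" for k using c1_sq_int[OF mc cS m0] by auto
  have [measurable]: "m k \<in> borel_measurable borel" "grad (m k) \<in> borel_measurable borel" for k
    using msq[of k] by (auto simp: sq_int_def)
  have mn: "nsq (m k) \<le> nsq u" for k
  proof -
    have "nsq (m k) = nsq (ft (m k))" by (rule mP(2)[symmetric])
    also have "\<dots> \<le> nsq (ft u)"
      by (rule nsq_mono[OF ft_Bessel(1)[OF iu u(1)]]) (auto simp: m_def intro: ft_conv_bump_le[OF iu \<rho>] sq_int_measurable[OF mP(1), unfolded m_def])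
    also have "\<dots> \<le> nsq u" by (rule ft_Bessel(2)[OF iu u(1)])
    finally show ?thesis .
  qed
  \<comment> \<open>The mollified function is smooth with compact support, so its energy can be
    computed on the Fourier side, where mollification does not increase moduli. In this way
    \<open>ftg u\<close> bounds gradients before \<open>u\<close> is known to have one.\<close>
  have mg: "nsq (grad (m k)) \<le> nsq (ftg u)" for k
  proof -
    have "nsq (grad (m k)) = nsq (ftg (m k))" by (rule mP(4)[symmetric])
    also have "\<dots> \<le> nsq (ftg u)"
    proof (rule nsq_mono[OF fu sq_int_measurable[OF mP(3)]])
      show "norm (ftg (m k) \<xi>) \<le> norm (ftg u \<xi>)" for \<xi>
        unfolding ftg_def norm_scaleR m_def by (intro mult_left_mono ft_conv_bump_le[OF iu \<rho>]) auto
    qed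
    finally show ?thesis .
  qed
  define v where "v k x = \<eta> x * m k x" for k x
  have vt: "v k \<in> test_functions \<Omega>" for k
  proof (rule test_functionsI[of _ "K \<inter> S k"])
    show "smooth (v k)" unfolding v_def by (intro smooth_mult sm\<eta> smm)
    show "compact (K \<inter> S k)" using K(1) cS[of k] by (intro compact_Int) auto
    show "K \<inter> S k \<subseteq> \<Omega>"
    proof
      fix x assume x: "x \<in> K \<inter> S k"
      then obtain y q where yq: "x = y + q" "y \<in> closure \<Omega>" "q \<in> cball (p k) (c * t k)" unfolding S_def by auto
      have "norm (q - t k *\<^sub>R e) \<le> c * t k" using yq(3) by (simp add: p_def dist_norm norm_minus_commute)
      then show "x \<in> \<Omega>" unfolding yq(1) using inward[OF t(1) t(2) yq(2)] x K(2) yq(1) by blast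
    qed
    show "v k x = 0" if "x \<notin> K \<inter> S k" for x using that K(4) m0 by (auto simp: v_def)
  qed
  have vg: "grad (v k) = (\<lambda>x. \<eta> x *\<^sub>R grad (m k) x + m k x *\<^sub>R grad \<eta> x)" for k
    unfolding v_def by (rule grad_mult[OF sm\<eta> smm])
  have le1: "nsq (\<lambda>x. \<eta> x *\<^sub>R grad (m k) x) \<le> C1\<^sup>2 * nsq (ftg u)" "sq_int (\<lambda>x. \<eta> x *\<^sub>R grad (m k) x)" for k
  proof -
    have n: "norm (\<eta> x *\<^sub>R grad (m k) x) \<le> C1 * norm (grad (m k) x)" for x by (simp add: mult_right_mono C1)
    show s: "sq_int (\<lambda>x. \<eta> x *\<^sub>R grad (m k) x)" by (rule sq_int_dominated[OF _ msq(2)[of k] n]) measurable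
    have C0: "0 \<le> C1" using C1[of 0] abs_ge_zero[of "\<eta> 0"] by linarith
    have "nsq (\<lambda>x. \<eta> x *\<^sub>R grad (m k) x) \<le> nsq (\<lambda>x. C1 *\<^sub>R grad (m k) x)"
      by (rule nsq_mono[OF sq_int_scaleR[OF msq(2)]]) (use n C0 in auto)
    also have "\<dots> = C1\<^sup>2 * nsq (grad (m k))" by (rule nsq_scaleR)
    also have "\<dots> \<le> C1\<^sup>2 * nsq (ftg u)" by (intro mult_left_mono mg) auto
    finally show "nsq (\<lambda>x. \<eta> x *\<^sub>R grad (m k) x) \<le> C1\<^sup>2 * nsq (ftg u)" .
  qed
  have le2: "nsq (\<lambda>x. m k x *\<^sub>R grad \<eta> x) \<le> C2\<^sup>2 * nsq u" "sq_int (\<lambda>x. m k x *\<^sub>R grad \<eta> x)" for k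
  proof -
    have n: "norm (m k x *\<^sub>R grad \<eta> x) \<le> C2 * norm (m k x)" for x
      using mult_left_mono[OF C2[of x], of "\<bar>m k x\<bar>"] by (simp add: mult.commute)
    show s: "sq_int (\<lambda>x. m k x *\<^sub>R grad \<eta> x)" by (rule sq_int_dominated[OF _ msq(1)[of k] n]) measurable
    have C0: "0 \<le> C2" using C2[of 0] norm_ge_zero[of "grad \<eta> 0"] by linarith
    have "nsq (\<lambda>x. m k x *\<^sub>R grad \<eta> x) \<le> nsq (\<lambda>x. C2 *\<^sub>R m k x)"
      by (rule nsq_mono[OF sq_int_scaleR[OF msq(1)]]) (use n C0 in \<open>auto simp: abs_mult\<close>)
    also have "\<dots> = C2\<^sup>2 * nsq (m k)" by (rule nsq_scaleR)
    also have "\<dots> \<le> C2\<^sup>2 * nsq u" by (intro mult_left_mono mn) auto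
    finally show "nsq (\<lambda>x. m k x *\<^sub>R grad \<eta> x) \<le> C2\<^sup>2 * nsq u" .
  qed
  define B where "B = 2 * (C1\<^sup>2 * nsq (ftg u)) + 2 * (C2\<^sup>2 * nsq u)"
  have gB: "nsq (grad (v k)) \<le> B" for k
    unfolding vg B_def using nsq_add_le[OF le1(2) le2(2), of k k] le1(1)[of k] le2(1)[of k] by linarith
  have \<eta>m: "nsq (\<lambda>x. \<eta> x * g x) \<le> C1\<^sup>2 * nsq g" "sq_int (\<lambda>x. \<eta> x * g x)" if g: "sq_int g" for g :: "'a \<Rightarrow> real"
  proof -
    have [measurable]: "g \<in> borel_measurable borel" using g by (simp add: sq_int_def)
    have n: "norm (\<eta> x * g x) \<le> C1 * norm (g x)" for x by (simp add: abs_mult mult_right_mono C1)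
    show s: "sq_int (\<lambda>x. \<eta> x * g x)" by (rule sq_int_dominated[OF _ g n]) measurable
    have C0: "0 \<le> C1" using C1[of 0] abs_ge_zero[of "\<eta> 0"] by linarith
    have "nsq (\<lambda>x. \<eta> x * g x) \<le> nsq (\<lambda>x. C1 *\<^sub>R g x)"
      by (rule nsq_mono[OF sq_int_scaleR[OF g]]) (use n C0 in \<open>auto simp: abs_mult\<close>)
    then show "nsq (\<lambda>x. \<eta> x * g x) \<le> C1\<^sup>2 * nsq g" by (simp only: nsq_scaleR)
  qed
  have vB: "nsq (v k) \<le> C1\<^sup>2 * nsq u" for k
  proof -
    have "nsq (v k) \<le> C1\<^sup>2 * nsq (m k)" unfolding v_def by (rule \<eta>m(1)[OF msq(1)])
    also have "\<dots> \<le> C1\<^sup>2 * nsq u" by (intro mult_left_mono mn) auto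
    finally show ?thesis .
  qed
  let ?w = "\<lambda>x. \<eta> x * u x"
  have wlim: "(\<lambda>k. coef (v k) j) \<longlonglongrightarrow> coef ?w j" for j
  proof (rule coef_weak_limit[OF _ vB \<eta>m(2)[OF u(1)]])
    show "sq_int (v k)" for k by (rule test_function_sq_int(1)[OF vt])
    fix f :: "'a \<Rightarrow> real" assume f: "f \<in> test_functions \<Omega>"
    have "continuous_on UNIV (\<lambda>x. \<eta> x * f x)"
      by (intro continuous_intros c\<eta> smooth_continuous[OF test_functions_smooth[OF f]])
    from conv_bump_weak_limit[OF iu this K(1) _ \<rho> plim clim]
    have "(\<lambda>k. LINT x|lborel. m k x * (\<eta> x * f x)) \<longlonglongrightarrow> (LINT x|lborel. u x * (\<eta> x * f x))"
      using K(4) by (simp add: m_def)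
    then show "(\<lambda>k. LINT x|lborel. v k x * f x) \<longlonglongrightarrow> (LINT x|lborel. ?w x * f x)"
      by (simp add: v_def mult_ac)
  qed
  \<comment> \<open>Weak lower semicontinuity of the energy, in the form of finite sums: Bessel
    bounds them for each k, and finite sums pass to the limit.\<close>
  have part: "(\<Sum>j\<in>I. ev j * (coef ?w j)\<^sup>2) \<le> B" if I: "finite I" for I
  proof (rule LIMSEQ_le_const2)
    show "(\<lambda>k. \<Sum>j\<in>I. ev j * (coef (v k) j)\<^sup>2) \<longlonglongrightarrow> (\<Sum>j\<in>I. ev j * (coef ?w j)\<^sup>2)"
      by (intro tendsto_intros wlim)
    have "(\<Sum>j\<in>I. ev j * (coef (v k) j)\<^sup>2) \<le> B" for k
      using H1.Bessel[OF test_function_sq_int(2)[OF vt] eigen_h10[OF h10_test[OF vt]] I, of k] gB[of k] by linarith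
    then show "\<exists>N. \<forall>k\<ge>N. (\<Sum>j\<in>I. ev j * (coef (v k) j)\<^sup>2) \<le> B" by blast
  qed
  have "summable (\<lambda>j. ev j * (coef ?w j)\<^sup>2)"
    by (rule bounded_imp_summable[of _ B]) (use part H1.w_nonneg in auto)
  moreover have "supported ?w"
    unfolding supported_def
  proof
    show "sq_int ?w" by (rule \<eta>m(2)[OF u(1)])
    show "AE x in lborel. x \<notin> \<Omega> \<longrightarrow> ?w x = 0"
      using frontier_null[OF \<Omega>(1,3) lip]
    proof eventually_elim
      case (elim x)
      then show ?case using u(2)[of x] \<Omega>(1) by (auto simp: frontier_def interior_open)
    qed
  qed
  ultimately obtain V where "h10 \<Omega> ?w V" using h10_if_summable[OF expansion] by blast
  then show ?thesis by (rule that)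
qed

text \<open>The localised pieces are glued with 1 minus the product of the factors 1 - \<theta> z
  over a finite cover, a function equal to 1 on the closure of \<Omega>.\<close>

theorem h10_if_fourier:
  assumes lip: "strictly_lipschitz \<Omega>" and u: "sq_int u" "\<And>x. x \<notin> closure \<Omega> \<Longrightarrow> u x = 0" and fu: "sq_int (ftg u)"
  obtains U where "h10 \<Omega> u U"
proof -
  define good where "good \<eta> \<longleftrightarrow> (\<exists>V. h10 \<Omega> (\<lambda>x. \<eta> x * u x) V)" for \<eta> :: "'a \<Rightarrow> real"
  have "\<forall>z\<in>closure \<Omega>. \<exists>\<rho> \<theta>. \<rho> > 0 \<and> smooth \<theta> \<and> (\<forall>x\<in>ball z \<rho>. \<theta> x = 1) \<and> (\<forall>\<eta>. smooth \<eta> \<longrightarrow> good (\<lambda>x. \<eta> x * \<theta> x))"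
  proof
    fix z assume z: "z \<in> closure \<Omega>"
    obtain r e c where rc: "r > 0" "c > 0"
      "\<And>t y p. 0 < t \<Longrightarrow> t \<le> r \<Longrightarrow> y \<in> closure \<Omega> \<Longrightarrow> norm (p - t *\<^sub>R e) \<le> c * t \<Longrightarrow> y + p \<in> ball z r \<Longrightarrow> y + p \<in> \<Omega>"
      by (rule local_inward[OF \<Omega>(1) lip z]) (rule that)
    have "cball z (r / 2) \<subseteq> ball z r" using rc(1) by (simp add: subset_iff)
    from this obtain \<theta> where \<theta>: "\<theta> \<in> test_functions (ball z r)" "\<And>x. 0 \<le> \<theta> x" "\<And>x. \<theta> x \<le> (1::real)" "\<And>x. x \<in> cball z (r / 2) \<Longrightarrow> \<theta> x = (1::real)"
      by (rule cutoff_exists[OF compact_cball open_ball]) (rule that)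
    have "good (\<lambda>x. \<eta> x * \<theta> x)" if "smooth \<eta>" for \<eta>
      by (rule localized_h10[OF lip u fu rc test_functions_mult[OF that \<theta>(1)]]) (auto simp: good_def)
    then show "\<exists>\<rho> \<theta>. \<rho> > 0 \<and> smooth \<theta> \<and> (\<forall>x\<in>ball z \<rho>. \<theta> x = 1) \<and> (\<forall>\<eta>. smooth \<eta> \<longrightarrow> good (\<lambda>x. \<eta> x * \<theta> x))"
      using rc(1) \<theta>(4) test_functions_smooth[OF \<theta>(1)] \<open>\<And>\<eta>. smooth \<eta> \<Longrightarrow> good (\<lambda>x. \<eta> x * \<theta> x)\<close>
      by (intro exI[of _ "r / 2"] exI[of _ \<theta>]) simp
  qed
  then obtain \<rho> \<theta> where *: "\<And>z. z \<in> closure \<Omega> \<Longrightarrow> \<rho> z > 0 \<and> smooth (\<theta> z) \<and> (\<forall>x\<in>ball z (\<rho> z). \<theta> z x = 1) \<and>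
      (\<forall>\<eta>. smooth \<eta> \<longrightarrow> good (\<lambda>x. \<eta> x * \<theta> z x))"
    unfolding bchoice_iff by blast
  have R: "\<And>z. z \<in> closure \<Omega> \<Longrightarrow> \<rho> z > 0" "\<And>z. z \<in> closure \<Omega> \<Longrightarrow> smooth (\<theta> z)"
    "\<And>z x. z \<in> closure \<Omega> \<Longrightarrow> x \<in> ball z (\<rho> z) \<Longrightarrow> \<theta> z x = (1::real)"
    "\<And>z \<eta>. z \<in> closure \<Omega> \<Longrightarrow> smooth \<eta> \<Longrightarrow> good (\<lambda>x. \<eta> x * \<theta> z x)" using * by auto
  have cpt: "compact (closure \<Omega>)" using \<Omega>(3) by (simp add: compact_eq_bounded_closed bounded_closure)
  have cov: "closure \<Omega> \<subseteq> (\<Union>z\<in>closure \<Omega>. ball z (\<rho> z))" using R(1) by fastforce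
  obtain D where D: "D \<subseteq> closure \<Omega>" "finite D" "closure \<Omega> \<subseteq> (\<Union>z\<in>D. ball z (\<rho> z))"
    by (rule compactE_image[OF cpt open_ball cov])
  \<comment> \<open>An arbitrary smooth factor \<eta> is carried along because the cutoff of a new
    point z comes multiplied by the product over the earlier points.\<close>
  have "smooth \<eta> \<Longrightarrow> good (\<lambda>x. \<eta> x * (1 - (\<Prod>z\<in>D. 1 - \<theta> z x)))" for \<eta>
    using D(2,1)
  proof (induction D arbitrary: \<eta>)
    case empty
    then show ?case using h10_zero[of \<Omega>] by (auto simp: good_def)
  next
    case (insert z D)
    have sp: "smooth (\<lambda>x. \<Prod>z\<in>D. 1 - \<theta> z x)"
      using insert.prems R(2) by (intro smooth_prod smooth_diff smooth_const) auto
    have "good (\<lambda>x. \<eta> x * (1 - (\<Prod>z\<in>D. 1 - \<theta> z x)))" using insert by auto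
    then obtain V1 where V1: "h10 \<Omega> (\<lambda>x. \<eta> x * (1 - (\<Prod>z\<in>D. 1 - \<theta> z x)) * u x) V1" by (auto simp: good_def)
    have "good (\<lambda>x. (\<eta> x * (\<Prod>z\<in>D. 1 - \<theta> z x)) * \<theta> z x)"
      using insert.prems by (intro R(4) smooth_mult sp) auto
    then obtain V2 where V2: "h10 \<Omega> (\<lambda>x. (\<eta> x * (\<Prod>z\<in>D. 1 - \<theta> z x)) * \<theta> z x * u x) V2" by (auto simp: good_def)
    have eq: "\<eta> x * (1 - (\<Prod>z\<in>D. 1 - \<theta> z x)) * u x + (\<eta> x * (\<Prod>z\<in>D. 1 - \<theta> z x)) * \<theta> z x * u x =
        \<eta> x * (1 - (\<Prod>z\<in>insert z D. 1 - \<theta> z x)) * u x" for x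
    proof -
      have "c * (1 - P) * v + (c * P) * b * v = c * (1 - (1 - b) * P) * v" for c P b v :: real
        by (simp add: algebra_simps)
      then show ?thesis unfolding prod.insert[OF insert.hyps(1,2)] .
    qed
    show ?case using h10_add[OF V1 V2] unfolding eq good_def by blast
  qed
  from this[OF smooth_const[of 1]]
  obtain V where V: "h10 \<Omega> (\<lambda>x. 1 * (1 - (\<Prod>z\<in>D. 1 - \<theta> z x)) * u x) V" by (auto simp: good_def)
  have "1 * (1 - (\<Prod>z\<in>D. 1 - \<theta> z x)) * u x = u x" for x
  proof (cases "x \<in> closure \<Omega>")
    case True
    then obtain z where z: "z \<in> D" "x \<in> ball z (\<rho> z)" using D(3) by blast
    then have "1 - \<theta> z x = 0" using R(3)[of z x] D(1) by auto
    then have "(\<Prod>z\<in>D. 1 - \<theta> z x) = 0" using D(2) z(1) by (intro prod_zero) auto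
    then show ?thesis by simp
  qed (simp add: u(2))
  then have "h10 \<Omega> u V" using V by (simp only:)
  then show ?thesis by (rule that)
qed

end

section \<open>Passage from Lebesgue to Borel measurable functions\<close>

text \<open>Vanishing outside \<Omega> turns integrals over \<Omega> into integrals over the whole
  space with respect to \<open>lborel\<close>.\<close>

definition borel_rep :: "'a::euclidean_space set \<Rightarrow> ('a \<Rightarrow> 'b::euclidean_space) \<Rightarrow> ('a \<Rightarrow> 'b) \<Rightarrow> bool" where
  "borel_rep \<Omega> f f' \<longleftrightarrow> f \<in> borel_measurable (lebesgue_on \<Omega>) \<and> f' \<in> borel_measurable borel \<and>
     (\<forall>x. x \<notin> \<Omega> \<longrightarrow> f' x = 0) \<and> (AE x in lebesgue_on \<Omega>. f x = f' x)"

lemma AE_lebesgue_on_iff: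
  assumes "\<Omega> \<in> sets borel" shows "(AE x in lebesgue_on \<Omega>. P x) \<longleftrightarrow> (AE x in lborel. x \<in> \<Omega> \<longrightarrow> P x)"
  using assms by (subst AE_restrict_space_iff) (auto simp: AE_completion_iff)

text \<open>Each coordinate is replaced by a Borel function that agrees with it almost
  everywhere.\<close>

lemma borel_rep_exists:
  fixes f :: "'a::euclidean_space \<Rightarrow> 'b::euclidean_space"
  assumes \<Omega>: "\<Omega> \<in> sets borel" and f: "f \<in> borel_measurable (lebesgue_on \<Omega>)"
  obtains f' where "borel_rep \<Omega> f f'"
proof -
  have m: "(\<lambda>x. indicator \<Omega> x *\<^sub>R f x) \<in> borel_measurable lebesgue"
    using f \<Omega> by (subst (asm) borel_measurable_restrict_space_iff) auto
  have "\<exists>g\<in>borel_measurable lborel. AE x in lborel. (indicator \<Omega> x *\<^sub>R f x) \<bullet> b = g x" for b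
    by (rule completion_ex_borel_measurable_real) (intro borel_measurable_inner m borel_measurable_const)
  then obtain g where g: "\<And>b. g b \<in> borel_measurable lborel" "\<And>b. AE x in lborel. (indicator \<Omega> x *\<^sub>R f x) \<bullet> b = g b x"
    by metis
  define f' where "f' x = indicator \<Omega> x *\<^sub>R (\<Sum>b\<in>Basis. g b x *\<^sub>R b)" for x
  have [measurable]: "g b \<in> borel_measurable borel" for b using g(1)[of b] by simp
  have "f' \<in> borel_measurable borel" unfolding f'_def using \<Omega> by measurable
  moreover have "AE x in lborel. \<forall>b\<in>Basis. (indicator \<Omega> x *\<^sub>R f x) \<bullet> b = g b x"
    using g(2) by (intro AE_finite_allI) auto
  then have "AE x in lborel. x \<in> \<Omega> \<longrightarrow> f x = f' x"
  proof eventually_elim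
    case (elim x)
    show ?case
    proof
      assume "x \<in> \<Omega>"
      then have "(\<Sum>b\<in>Basis. g b x *\<^sub>R b) = (\<Sum>b\<in>Basis. (f x \<bullet> b) *\<^sub>R b)" using elim by (intro sum.cong) auto
      then show "f x = f' x" using \<open>x \<in> \<Omega>\<close> by (simp add: f'_def euclidean_representation)
    qed
  qed
  ultimately show ?thesis using that[of f'] f AE_lebesgue_on_iff[OF \<Omega>] by (simp add: borel_rep_def f'_def)
qed

lemma borel_rep_integral:
  fixes h :: "'a::euclidean_space \<Rightarrow> 'b::euclidean_space"
  assumes \<Omega>: "\<Omega> \<in> sets borel" and h: "borel_rep \<Omega> h h'"
  shows "(LINT x|lebesgue_on \<Omega>. h x) = (LINT x|lborel. h' x)"
    and "integrable (lebesgue_on \<Omega>) h \<longleftrightarrow> integrable lborel h'"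
proof -
  have m: "h' \<in> borel_measurable borel" and m2: "h \<in> borel_measurable (lebesgue_on \<Omega>)"
    and 0: "\<And>x. x \<notin> \<Omega> \<Longrightarrow> h' x = 0" and ae: "AE x in lebesgue_on \<Omega>. h x = h' x"
    using h by (auto simp: borel_rep_def)
  have ml: "h' \<in> borel_measurable lborel" using m by simp
  then have mc: "h' \<in> borel_measurable lebesgue" by (rule measurable_completion)
  then have mo: "h' \<in> borel_measurable (lebesgue_on \<Omega>)" by (rule measurable_restrict_space1)
  have s: "\<Omega> \<inter> space lebesgue \<in> sets lebesgue" using \<Omega> by auto
  have e: "(\<lambda>x. indicator \<Omega> x *\<^sub>R h' x) = h'" using 0 by (auto simp: indicator_def)
  show "(LINT x|lebesgue_on \<Omega>. h x) = (LINT x|lborel. h' x)"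
    using integral_cong_AE[OF m2 mo ae] unfolding integral_restrict_space[OF s] e integral_completion[OF ml] .
  show "integrable (lebesgue_on \<Omega>) h \<longleftrightarrow> integrable lborel h'"
    using integrable_cong_AE[OF m2 mo ae] integrable_restrict_space[OF s, of h'] integrable_completion[OF ml]
    unfolding e by blast
qed

text \<open>\<open>F 0 0 = 0\<close> keeps the combination zero outside \<Omega>. Products, inner
  products and squared distances are instances.\<close>

lemma borel_rep_compose:
  fixes F :: "'b::euclidean_space \<Rightarrow> 'c::euclidean_space \<Rightarrow> 'd::euclidean_space"
  assumes f: "borel_rep \<Omega> f f'" and g: "borel_rep \<Omega> g g'"
    and F: "continuous_on UNIV (\<lambda>z. F (fst z) (snd z))" "F 0 0 = 0"
  shows "borel_rep \<Omega> (\<lambda>x. F (f x) (g x)) (\<lambda>x. F (f' x) (g' x))"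
  using f g F(2) unfolding borel_rep_def
  by (auto intro!: borel_measurable_continuous_Pair[OF _ _ F(1)] elim: eventually_elim2)

lemma borel_rep_continuous:
  fixes f :: "'a::euclidean_space \<Rightarrow> 'b::euclidean_space"
  assumes "continuous_on UNIV f" "\<And>x. x \<notin> \<Omega> \<Longrightarrow> f x = 0" shows "borel_rep \<Omega> f f"
proof -
  have "f \<in> borel_measurable lborel" using borel_measurable_continuous_onI[OF assms(1)] by simp
  then have "f \<in> borel_measurable (lebesgue_on \<Omega>)" by (intro measurable_restrict_space1 measurable_completion)
  then show ?thesis using assms borel_measurable_continuous_onI[OF assms(1)] by (simp add: borel_rep_def)
qed

lemma borel_rep_scaleR: "borel_rep \<Omega> f f' \<Longrightarrow> borel_rep \<Omega> g g' \<Longrightarrow> borel_rep \<Omega> (\<lambda>x. f x *\<^sub>R g x) (\<lambda>x. f' x *\<^sub>R g' x)"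
  by (erule borel_rep_compose) (auto intro!: continuous_intros)

lemma borel_rep_mult:
  fixes f f' g g' :: "'a::euclidean_space \<Rightarrow> real"
  shows "borel_rep \<Omega> f f' \<Longrightarrow> borel_rep \<Omega> g g' \<Longrightarrow> borel_rep \<Omega> (\<lambda>x. f x * g x) (\<lambda>x. f' x * g' x)"
  using borel_rep_scaleR[of \<Omega> f f' g g'] by simp

lemma borel_rep_inner: "borel_rep \<Omega> f f' \<Longrightarrow> borel_rep \<Omega> g g' \<Longrightarrow> borel_rep \<Omega> (\<lambda>x. f x \<bullet> g x) (\<lambda>x. f' x \<bullet> g' x)"
  by (erule borel_rep_compose) (auto intro!: continuous_intros)

lemma borel_rep_norm_diff:
  "borel_rep \<Omega> f f' \<Longrightarrow> borel_rep \<Omega> g g' \<Longrightarrow> borel_rep \<Omega> (\<lambda>x. (norm (f x - g x))\<^sup>2) (\<lambda>x. (norm (f' x - g' x))\<^sup>2)"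
  by (erule borel_rep_compose) (auto intro!: continuous_intros)

lemma borel_rep_L2:
  assumes \<Omega>: "\<Omega> \<in> sets borel" and f: "borel_rep \<Omega> f f'" shows "f \<in> L2 (lebesgue_on \<Omega>) \<longleftrightarrow> sq_int f'"
proof -
  have "borel_rep \<Omega> (\<lambda>x. (norm (f x))\<^sup>2) (\<lambda>x. (norm (f' x))\<^sup>2)"
    by (rule borel_rep_compose[OF f f]) (auto intro!: continuous_intros)
  from borel_rep_integral(2)[OF \<Omega> this] show ?thesis using f by (simp add: L2_def sq_int_def borel_rep_def)
qed

lemma L2_borel_rep:
  assumes \<Omega>: "\<Omega> \<in> sets borel" and f: "f \<in> L2 (lebesgue_on \<Omega>)"
  obtains f' where "borel_rep \<Omega> f f'" "sq_int f'"
proof -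
  have "f \<in> borel_measurable (lebesgue_on \<Omega>)" using f by (simp add: L2_def)
  then obtain f' where "borel_rep \<Omega> f f'" by (rule borel_rep_exists[OF \<Omega>])
  then show ?thesis using that borel_rep_L2[OF \<Omega>] f by blast
qed

lemma borel_rep_cong: "borel_rep \<Omega> f f' \<Longrightarrow> f'' \<in> borel_measurable borel \<Longrightarrow> (\<And>x. x \<notin> \<Omega> \<Longrightarrow> f'' x = 0) \<Longrightarrow>
    \<Omega> \<in> sets borel \<Longrightarrow> AE x in lborel. f' x = f'' x \<Longrightarrow> borel_rep \<Omega> f f''"
  by (auto simp: borel_rep_def AE_lebesgue_on_iff elim: eventually_elim2)

lemma borel_rep_test_function:
  fixes f :: "'a::euclidean_space \<Rightarrow> real"
  assumes "f \<in> test_functions \<Omega>" shows "borel_rep \<Omega> f f" "borel_rep \<Omega> (grad f) (grad f)"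
proof -
  obtain K where K: "K \<subseteq> \<Omega>" "c1 f (grad f)" "\<And>x. x \<notin> K \<Longrightarrow> f x = 0" "\<And>x. x \<notin> K \<Longrightarrow> grad f x = 0"
    using assms by (rule test_function_c1) blast
  have "continuous_on UNIV f" "continuous_on UNIV (grad f)" using K(2) c1_continuous[OF K(2)] by (auto simp: c1_def)
  then show "borel_rep \<Omega> f f" "borel_rep \<Omega> (grad f) (grad f)"
    using K by (auto intro!: borel_rep_continuous)
qed

section \<open>The Dirichlet eigensystem\<close>

text \<open>The fundamental lemma in each coordinate. \<open>weak_gradient\<close> is an arbitrary
  choice, and uniqueness is what gives access to its integrals.\<close>

lemma weak_gradient_unique:
  fixes v :: "'a::euclidean_space \<Rightarrow> real"
  assumes \<Omega>: "open \<Omega>" and G: "has_weak_gradient \<Omega> v G" "borel_rep \<Omega> G G'"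
    and H: "has_weak_gradient \<Omega> v H" "borel_rep \<Omega> H H'"
  shows "AE x in lborel. G' x = H' x"
proof (rule AE_eq_inner_Basis)
  fix b :: 'a assume "b \<in> Basis"
  have \<Omega>b: "\<Omega> \<in> sets borel" using \<Omega> by auto
  have s: "sq_int G'" "sq_int H'"
    using G H borel_rep_L2[OF \<Omega>b] by (auto simp: has_weak_gradient_def)
  note sb = sq_int_inner_const[OF s(1), of b] sq_int_inner_const[OF s(2), of b]
  have "AE x in lborel. x \<in> \<Omega> \<longrightarrow> G' x \<bullet> b - H' x \<bullet> b = 0"
  proof (rule fundamental_lemma[OF \<Omega>])
    show "(\<lambda>x. G' x \<bullet> b - H' x \<bullet> b) \<in> borel_measurable borel" using sq_int_diff[OF sb] by (rule sq_int_measurable)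
    show "set_integrable lborel K (\<lambda>x. G' x \<bullet> b - H' x \<bullet> b)" if "compact K" for K
      by (rule sq_int_set_integrable[OF sq_int_diff[OF sb] that])
    fix f :: "'a \<Rightarrow> real" assume f: "f \<in> test_functions \<Omega>"
    note r = borel_rep_test_function(1)[OF f]
    have fs: "sq_int f" using f by (rule test_function_sq_int)
    have "(LINT x|lborel. f x *\<^sub>R G' x) = (LINT x|lborel. f x *\<^sub>R H' x)"
      using G(1) H(1) f borel_rep_integral(1)[OF \<Omega>b borel_rep_scaleR[OF r G(2)]]
        borel_rep_integral(1)[OF \<Omega>b borel_rep_scaleR[OF r H(2)]] by (simp add: has_weak_gradient_def)
    then have "(LINT x|lborel. f x *\<^sub>R G' x) \<bullet> b = (LINT x|lborel. f x *\<^sub>R H' x) \<bullet> b" by simp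
    moreover have "(LINT x|lborel. f x *\<^sub>R K x) \<bullet> b = (LINT x|lborel. f x * (K x \<bullet> b))" if K: "sq_int K" for K :: "'a \<Rightarrow> 'a"
    proof -
      have "integrable lborel (\<lambda>x. f x *\<^sub>R K x)"
        by (rule Bochner_Integration.integrable_bound[OF sq_int_norm_mult[OF fs K]]) (use fs K in \<open>auto simp: sq_int_def\<close>)
      from integral_inner_left[OF this, of b] show ?thesis by simp
    qed
    ultimately have "(LINT x|lborel. f x * (G' x \<bullet> b)) = (LINT x|lborel. f x * (H' x \<bullet> b))" using s by simp
    then have "(LINT x|lborel. f x * (G' x \<bullet> b) - f x * (H' x \<bullet> b)) = 0"
      using sq_int_mult[OF fs sb(1)] sq_int_mult[OF fs sb(2)] by simp
    then show "(LINT x|lborel. (G' x \<bullet> b - H' x \<bullet> b) * f x) = 0" by (simp add: algebra_simps)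
  qed
  then show "AE x in lborel. G' x \<bullet> b = H' x \<bullet> b"
    using G(2) H(2) by (auto simp: borel_rep_def elim!: eventually_mono)
qed

text \<open>The limit that defines \<open>H1_0\<close> is one of sums of two nonnegative terms, so
  each term tends to 0 and supplies one half of \<open>h10\<close>. Uniqueness replaces the chosen
  weak gradient by that of the approximation.\<close>

lemma H1_0_h10:
  fixes v :: "'a::euclidean_space \<Rightarrow> real"
  assumes \<Omega>: "open \<Omega>" and v: "v \<in> H1_0 \<Omega>" "borel_rep \<Omega> v v'"
  obtains G' where "h10 \<Omega> v' G'" "borel_rep \<Omega> (weak_gradient \<Omega> v) G'"
proof -
  have \<Omega>b: "\<Omega> \<in> sets borel" using \<Omega> by auto
  obtain G f where G: "has_weak_gradient \<Omega> v G" and f: "\<And>k. f k \<in> test_functions \<Omega>"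
    and lim: "(\<lambda>k. LINT x|lebesgue_on \<Omega>. (f k x - v x)\<^sup>2 + (norm (grad (f k) x - G x))\<^sup>2) \<longlonglongrightarrow> 0"
    using v(1) by (auto simp: H1_0_def)
  have W: "has_weak_gradient \<Omega> v (weak_gradient \<Omega> v)" unfolding weak_gradient_def[abs_def] using someI[of "has_weak_gradient \<Omega> v", OF G] by simp
  have "G \<in> L2 (lebesgue_on \<Omega>)" "weak_gradient \<Omega> v \<in> L2 (lebesgue_on \<Omega>)" "v \<in> L2 (lebesgue_on \<Omega>)"
    using G W by (auto simp: has_weak_gradient_def)
  then obtain G' W' where G': "borel_rep \<Omega> G G'" "sq_int G'" and W': "borel_rep \<Omega> (weak_gradient \<Omega> v) W'" "sq_int W'" and v': "sq_int v'"
    using borel_rep_L2[OF \<Omega>b v(2)] by (metis L2_borel_rep[OF \<Omega>b])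
  have sf: "sq_int (f k)" "sq_int (grad (f k))" for k using test_function_sq_int[OF f] by auto
  have eq: "(LINT x|lebesgue_on \<Omega>. (f k x - v x)\<^sup>2 + (norm (grad (f k) x - G x))\<^sup>2) =
      nsq (\<lambda>x. f k x - v' x) + nsq (\<lambda>x. grad (f k) x - G' x)" for k
  proof -
    note r = borel_rep_norm_diff[OF borel_rep_test_function(1)[OF f] v(2), of k] borel_rep_norm_diff[OF borel_rep_test_function(2)[OF f] G'(1), of k]
    have "integrable (lebesgue_on \<Omega>) (\<lambda>x. (norm (f k x - v x))\<^sup>2)" "integrable (lebesgue_on \<Omega>) (\<lambda>x. (norm (grad (f k) x - G x))\<^sup>2)"
      unfolding borel_rep_integral(2)[OF \<Omega>b r(1)] borel_rep_integral(2)[OF \<Omega>b r(2)]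
      by (intro sq_int_integrable sq_int_diff sf v' G'(2))+
    from Bochner_Integration.integral_add[OF this] show ?thesis
      unfolding borel_rep_integral(1)[OF \<Omega>b r(1)] borel_rep_integral(1)[OF \<Omega>b r(2)] nsq_def by simp
  qed
  have lim1: "(\<lambda>k. nsq (\<lambda>x. f k x - v' x)) \<longlonglongrightarrow> 0" "(\<lambda>k. nsq (\<lambda>x. grad (f k) x - G' x)) \<longlonglongrightarrow> 0"
    by (rule tendsto_zero_le[OF _ _ lim, of _ 1]; simp add: eq)+
  have "h10 \<Omega> v' G'"
    unfolding h10_def l2lim_def using f sf v' G'(2) lim1 by blast
  moreover have "borel_rep \<Omega> (weak_gradient \<Omega> v) G'"
    by (rule borel_rep_cong[OF W'(1) _ _ \<Omega>b weak_gradient_unique[OF \<Omega> W W'(1) G G'(1)]])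
      (use G'(1) in \<open>auto simp: borel_rep_def\<close>)
  ultimately show ?thesis by (rule that)
qed

lemma test_function_H1_0:
  fixes f :: "'a::euclidean_space \<Rightarrow> real"
  assumes \<Omega>: "open \<Omega>" and f: "f \<in> test_functions \<Omega>"
  shows "f \<in> H1_0 \<Omega>" "borel_rep \<Omega> (weak_gradient \<Omega> f) (grad f)"
proof -
  have \<Omega>b: "\<Omega> \<in> sets borel" using \<Omega> by auto
  note r = borel_rep_test_function[OF f] and s = test_function_sq_int[OF f]
  have "(LINT x|lebesgue_on \<Omega>. f x *\<^sub>R grad g x) = - (LINT x|lebesgue_on \<Omega>. g x *\<^sub>R grad f x)"
    if g: "g \<in> test_functions \<Omega>" for g
  proof -
    note rg = borel_rep_test_function[OF g] and sg = test_function_sq_int[OF g]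
    have i: "integrable lborel (\<lambda>x. h x *\<^sub>R K x)" if "sq_int h" "sq_int K" for h :: "'a \<Rightarrow> real" and K :: "'a \<Rightarrow> 'a"
      by (rule Bochner_Integration.integrable_bound[OF sq_int_norm_mult[OF that]]) (use that in \<open>auto simp: sq_int_def\<close>)
    have gU: "g \<in> test_functions UNIV" using g test_functions_mono[of \<Omega> UNIV] by auto
    have "(LINT x|lborel. f x *\<^sub>R grad g x) = - (LINT x|lborel. g x *\<^sub>R grad f x)"
    proof (rule euclidean_eqI)
      fix b :: 'a
      show "(LINT x|lborel. f x *\<^sub>R grad g x) \<bullet> b = (- (LINT x|lborel. g x *\<^sub>R grad f x)) \<bullet> b"
        using h10_weak[OF h10_test[OF f] gU, of b] integral_inner_left[OF i[OF s(1) sg(2)], of b] integral_inner_left[OF i[OF sg(1) s(2)], of b]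
        by simp
    qed
    then show ?thesis unfolding borel_rep_integral(1)[OF \<Omega>b borel_rep_scaleR[OF r(1) rg(2)]]
        borel_rep_integral(1)[OF \<Omega>b borel_rep_scaleR[OF rg(1) r(2)]] .
  qed
  then have "has_weak_gradient \<Omega> f (grad f)"
    using borel_rep_L2[OF \<Omega>b r(1)] borel_rep_L2[OF \<Omega>b r(2)] s by (simp add: has_weak_gradient_def)
  then show H: "f \<in> H1_0 \<Omega>" unfolding H1_0_def using f by (intro CollectI exI[of _ "grad f"] exI[of _ "\<lambda>_. f"] conjI) auto
  obtain G where G: "h10 \<Omega> f G" "borel_rep \<Omega> (weak_gradient \<Omega> f) G" by (rule H1_0_h10[OF \<Omega> H r(1)])
  show "borel_rep \<Omega> (weak_gradient \<Omega> f) (grad f)"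
    by (rule borel_rep_cong[OF G(2) _ _ \<Omega>b h10_unique[OF G(1) h10_test[OF f]]]) (use r(2) in \<open>auto simp: borel_rep_def\<close>)
qed

theorem dirichlet_eigensystem_form:
  fixes \<Omega> :: "'a::euclidean_space set" and ev :: "nat \<Rightarrow> real" and \<phi> :: "nat \<Rightarrow> 'a \<Rightarrow> real"
  assumes \<Omega>: "bounded_domain \<Omega>" and E: "dirichlet_eigensystem \<Omega> ev \<phi>"
  obtains \<phi>' G where "\<And>j. borel_rep \<Omega> (\<phi> j) (\<phi>' j)" "dirichlet_form \<Omega> ev \<phi>' G"
proof -
  have o: "open \<Omega>" "connected \<Omega>" "bounded \<Omega>" using \<Omega> by (auto simp: bounded_domain_def)
  have \<Omega>b: "\<Omega> \<in> sets borel" using o by auto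
  have L: "\<And>j. dirichlet_laplacian \<Omega> (\<phi> j) (\<lambda>x. ev j * \<phi> j x)" and ON: "orthonormal_system (lebesgue_on \<Omega>) \<phi>"
    and C: "complete_system (lebesgue_on \<Omega>) \<phi>" using E by (auto simp: dirichlet_eigensystem_def)
  have "\<exists>\<phi>'. borel_rep \<Omega> (\<phi> j) \<phi>' \<and> sq_int \<phi>'" for j
    using ON unfolding orthonormal_system_def by (metis L2_borel_rep[OF \<Omega>b])
  then obtain \<phi>' where \<phi>': "\<And>j. borel_rep \<Omega> (\<phi> j) (\<phi>' j)" "\<And>j. sq_int (\<phi>' j)" by metis
  have "\<phi> j \<in> H1_0 \<Omega>" for j using L by (simp add: dirichlet_laplacian_def)
  then have "\<exists>G. h10 \<Omega> (\<phi>' j) G \<and> borel_rep \<Omega> (weak_gradient \<Omega> (\<phi> j)) G" for j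
    by (metis H1_0_h10[OF o(1) _ \<phi>'(1)])
  then obtain G where G: "\<And>j. h10 \<Omega> (\<phi>' j) (G j)" "\<And>j. borel_rep \<Omega> (weak_gradient \<Omega> (\<phi> j)) (G j)" by metis
  have "dirichlet_form \<Omega> ev \<phi>' G"
  proof
    fix f :: "'a \<Rightarrow> real" and j assume f: "f \<in> test_functions \<Omega>"
    note T = test_function_H1_0[OF o(1) f]
    have "(LINT x|lebesgue_on \<Omega>. weak_gradient \<Omega> (\<phi> j) x \<bullet> weak_gradient \<Omega> f x) = (LINT x|lebesgue_on \<Omega>. (ev j * \<phi> j x) * f x)"
      using L[of j] T(1) unfolding dirichlet_laplacian_def L2_inner_def by blast
    also have "\<dots> = ev j * (LINT x|lebesgue_on \<Omega>. \<phi> j x * f x)" by (simp add: mult.assoc)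
    finally show "(LINT x|lborel. G j x \<bullet> grad f x) = ev j * (LINT x|lborel. \<phi>' j x * f x)"
      unfolding borel_rep_integral(1)[OF \<Omega>b borel_rep_inner[OF G(2) T(2)]]
        borel_rep_integral(1)[OF \<Omega>b borel_rep_mult[OF \<phi>'(1) borel_rep_test_function(1)[OF f]]] .
  next
    fix i j
    show "(LINT x|lborel. \<phi>' i x * \<phi>' j x) = (if i = j then 1 else 0)"
      using ON borel_rep_integral(1)[OF \<Omega>b borel_rep_mult[OF \<phi>'(1)[of i] \<phi>'(1)[of j]]]
      by (simp add: orthonormal_system_def L2_inner_def)
  next
    fix v :: "'a \<Rightarrow> real" assume v: "sq_int v" and 0: "\<And>j. (LINT x|lborel. v x * \<phi>' j x) = 0"
    have [measurable]: "v \<in> borel_measurable borel" using v by (rule sq_int_measurable)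
    \<comment> \<open>Completeness concerns \<Omega> only, so \<open>v\<close> is first cut off
      outside it.\<close>
    have m: "(\<lambda>x. indicator \<Omega> x * v x) \<in> borel_measurable borel" using \<Omega>b by measurable
    have sq: "sq_int (\<lambda>x. indicator \<Omega> x * v x)"
      by (rule sq_int_dominated[OF m v, of 1]) (auto simp: indicator_def)
    have r: "borel_rep \<Omega> v (\<lambda>x. indicator \<Omega> x * v x)"
      unfolding borel_rep_def AE_lebesgue_on_iff[OF \<Omega>b] using m
      by (auto intro!: measurable_restrict_space1 measurable_completion)
    have "v \<in> L2 (lebesgue_on \<Omega>)" using borel_rep_L2[OF \<Omega>b r] sq by simp
    moreover have "L2_inner (lebesgue_on \<Omega>) v (\<phi> j) = 0" for j
    proof -
      have "L2_inner (lebesgue_on \<Omega>) v (\<phi> j) = (LINT x|lborel. indicator \<Omega> x * v x * \<phi>' j x)"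
        unfolding L2_inner_def by (rule borel_rep_integral(1)[OF \<Omega>b borel_rep_mult[OF r \<phi>'(1)]])
      also have "\<dots> = (LINT x|lborel. v x * \<phi>' j x)"
        using \<phi>'(1)[of j] by (intro Bochner_Integration.integral_cong) (auto simp: indicator_def borel_rep_def)
      finally show ?thesis using 0 by simp
    qed
    ultimately have "AE x in lebesgue_on \<Omega>. v x = 0" using C by (simp add: complete_system_def)
    then show "AE x in lborel. x \<in> \<Omega> \<longrightarrow> v x = 0" by (simp add: AE_lebesgue_on_iff[OF \<Omega>b])
  qed (use o G in auto)
  then show ?thesis using that \<phi>'(1) by blast
qed

section \<open>The Sobolev space with support condition\<close>

lemma iter_partial_of_real:
  fixes f :: "'a::euclidean_space \<Rightarrow> real"
  assumes f: "smooth f" and bs: "bs \<in> lists Basis"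
  shows "iter_partial bs (\<lambda>x. complex_of_real (f x)) = (\<lambda>x. complex_of_real (iter_partial bs f x))"
  using bs
proof (induct bs)
  case (Cons b bs)
  have "bs \<in> lists Basis" using Cons(2) by (simp add: in_lists_conv_set)
  then have d: "(iter_partial bs f has_derivative frechet_derivative (iter_partial bs f) (at x)) (at x)" for x
    using f by (auto simp: smooth_def frechet_derivative_works[symmetric])
  have "frechet_derivative (\<lambda>x. complex_of_real (iter_partial bs f x)) (at x) b =
      complex_of_real (frechet_derivative (iter_partial bs f) (at x) b)" for x
    by (rule frechet_eqI[OF has_derivative_of_real[OF d]])
  then show ?case using Cons by simp
qed simp

lemma smooth_of_real:
  fixes f :: "'a::euclidean_space \<Rightarrow> real"
  assumes f: "smooth f" shows "smooth (\<lambda>x. complex_of_real (f x))"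
  unfolding smooth_def
proof (intro ballI allI)
  fix bs :: "'a list" and x assume bs: "bs \<in> lists Basis"
  then have "(iter_partial bs f has_derivative frechet_derivative (iter_partial bs f) (at x)) (at x)"
    using f by (simp add: smooth_def frechet_derivative_works[symmetric])
  from has_derivative_of_real[OF this, where ?'a = complex]
  show "iter_partial bs (\<lambda>x. complex_of_real (f x)) differentiable at x"
    unfolding iter_partial_of_real[OF f bs] by (rule differentiableI)
qed

lemma iter_partial_smooth_zero:
  fixes f :: "'a::euclidean_space \<Rightarrow> real"
  assumes f: "smooth f" and K: "closed K" "\<And>x. x \<notin> K \<Longrightarrow> f x = 0" and bs: "bs \<in> lists Basis"
  shows "smooth (iter_partial bs f) \<and> (\<forall>x. x \<notin> K \<longrightarrow> iter_partial bs f x = 0)"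
  using bs
proof (induction bs)
  case (Cons b bs)
  then have s: "smooth (iter_partial bs f)" and 0: "\<And>x. x \<notin> K \<Longrightarrow> iter_partial bs f x = 0" and b: "b \<in> Basis" by auto
  have "frechet_derivative (iter_partial bs f) (at x) b = 0" if "x \<notin> K" for x
    using c1_zero_outside[OF smooth_c1[OF s] K(1) 0 that] grad_inner_Basis[OF b, of "iter_partial bs f" x] by simp
  then show ?case using smooth_partial[OF s b] by simp
qed (use f K in simp)

lemma test_function_of_real:
  fixes f :: "'a::euclidean_space \<Rightarrow> real"
  assumes "f \<in> test_functions U"
  shows "(\<lambda>x. complex_of_real (f x)) \<in> test_functions U" "(\<lambda>x. complex_of_real (f x)) \<in> schwartz"
proof -
  obtain K where K: "smooth f" "compact K" "K \<subseteq> U" "\<And>x. x \<notin> K \<Longrightarrow> f x = 0"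
    using assms by (rule test_functionsE) blast
  show "(\<lambda>x. complex_of_real (f x)) \<in> test_functions U"
    by (rule test_functionsI[OF smooth_of_real[OF K(1)] K(2,3)]) (simp add: K(4))
  show "(\<lambda>x. complex_of_real (f x)) \<in> schwartz"
    unfolding schwartz_def
  proof (intro CollectI conjI allI ballI smooth_of_real K(1))
    fix k and bs :: "'a list" assume bs: "bs \<in> lists Basis"
    note Z = iter_partial_smooth_zero[OF K(1) compact_imp_closed[OF K(2)] K(4) bs]
    let ?h = "\<lambda>x. norm x ^ k * norm (iter_partial bs f x)"
    have "continuous_on UNIV (iter_partial bs f)" using Z by (intro smooth_continuous) auto
    then have "continuous_on UNIV ?h" by (intro continuous_intros)
    then have "bounded (?h ` K)"
      using K(2) by (intro compact_imp_bounded compact_continuous_image) (auto intro: continuous_on_subset)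
    then have "bounded (insert 0 (?h ` K))" by simp
    moreover have "range ?h \<subseteq> insert 0 (?h ` K)" using Z by auto
    ultimately have "bounded (range ?h)" by (rule bounded_subset)
    then show "bounded (range (\<lambda>x. norm x ^ k * norm (iter_partial bs (\<lambda>x. complex_of_real (f x)) x)))"
      unfolding iter_partial_of_real[OF K(1) bs] by simp
  qed
qed

lemma fourier_of_real:
  fixes h :: "'a::euclidean_space \<Rightarrow> real"
  assumes [measurable]: "h \<in> borel_measurable borel"
  shows "fourier (\<lambda>x. complex_of_real (h x)) = ft h"
proof
  fix \<xi> :: 'a
  have "(LINT x|lebesgue. cis (- (x \<bullet> \<xi>)) * complex_of_real (h x)) = (LINT x|lborel. cis (- (x \<bullet> \<xi>)) * complex_of_real (h x))"
    by (rule integral_completion) measurable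
  also have "\<dots> = (LINT x|lborel. h x *\<^sub>R cis (- (x \<bullet> \<xi>)))"
    by (simp add: scaleR_conv_of_real mult.commute)
  finally show "fourier (\<lambda>x. complex_of_real (h x)) \<xi> = ft h \<xi>"
    by (simp add: fourier_def ft_def scaleR_conv_of_real)
qed

text \<open>Fubini; it takes the transform off the test function in the distributional
  definition.\<close>

lemma ft_swap:
  fixes u h :: "'a::euclidean_space \<Rightarrow> real"
  assumes u: "integrable lborel u" and h: "integrable lborel h"
  shows "(LINT x|lborel. u x *\<^sub>R ft h x) = (LINT \<xi>|lborel. h \<xi> *\<^sub>R ft u \<xi>)"
proof -
  have [measurable]: "u \<in> borel_measurable borel" "h \<in> borel_measurable borel" using u h by auto
  define c where "c = (2 * pi) powr (- real DIM('a) / 2)"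
  have "integrable (lborel \<Otimes>\<^sub>M lborel) (\<lambda>z. (case z of (x, y) \<Rightarrow> u x * h y) *\<^sub>R cis (- (fst z \<bullet> snd z)))"
    by (rule integrable_scaleR_bounded[OF integrable_pair_mult[OF u h], of _ 1]) (auto simp: lborel_prod intro!: borel_measurable_continuous_onI continuous_intros)
  then have i: "integrable (lborel \<Otimes>\<^sub>M lborel) (\<lambda>(x, y). (u x * h y) *\<^sub>R cis (- (x \<bullet> y)))"
    by (simp add: split_beta')
  have "(LINT x|lborel. u x *\<^sub>R ft h x) = c *\<^sub>R (LINT x|lborel. LINT y|lborel. (u x * h y) *\<^sub>R cis (- (x \<bullet> y)))"
    unfolding ft_def c_def[symmetric] integral_scaleR_right[symmetric]
    by (simp add: inner_commute mult_ac)
  also have "(LINT x|lborel. LINT y|lborel. (u x * h y) *\<^sub>R cis (- (x \<bullet> y))) = (LINT y|lborel. LINT x|lborel. (u x * h y) *\<^sub>R cis (- (x \<bullet> y)))"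
    using lborel_pair.Fubini_integral[OF i] by simp
  also have "c *\<^sub>R \<dots> = (LINT \<xi>|lborel. h \<xi> *\<^sub>R ft u \<xi>)"
    unfolding ft_def c_def[symmetric] integral_scaleR_right[symmetric]
    by (simp add: inner_commute mult_ac)
  finally show ?thesis .
qed

text \<open>The complement of the support is a union of possibly uncountably many open sets in which
  \<open>u0\<close> vanishes almost everywhere; by Lindelof, countably many of them suffice.\<close>

lemma dist_support_zero_outside:
  fixes u :: "'a::euclidean_space \<Rightarrow> real"
  assumes u: "borel_rep UNIV u u0" "sq_int u0" and S: "dist_support (regular_dist (\<lambda>x. complex_of_real (u x))) \<subseteq> S"
  shows "AE x in lborel. x \<notin> S \<longrightarrow> u0 x = 0"
proof -
  define \<U> where "\<U> = {U. open U \<and> (\<forall>f\<in>test_functions U. regular_dist (\<lambda>x. complex_of_real (u x)) f = 0)}"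
  have loc: "AE x in lborel. x \<in> U \<longrightarrow> u0 x = 0" if U: "U \<in> \<U>" for U
  proof (rule fundamental_lemma)
    show "open U" using U by (simp add: \<U>_def)
    show "u0 \<in> borel_measurable borel" using u(2) by (rule sq_int_measurable)
    show "set_integrable lborel K u0" if "compact K" for K by (rule sq_int_set_integrable[OF u(2) that])
    fix f :: "'a \<Rightarrow> real" assume f: "f \<in> test_functions U"
    have fU: "f \<in> test_functions UNIV" using f test_functions_mono[of U UNIV] by auto
    have "complex_of_real (LINT x|lebesgue. u x * f x) = regular_dist (\<lambda>x. complex_of_real (u x)) (\<lambda>x. complex_of_real (f x))"
      by (simp add: regular_dist_def flip: of_real_mult integral_complex_of_real)
    also have "\<dots> = 0" using test_function_of_real(1)[OF f] U by (simp add: \<U>_def)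
    finally show "(LINT x|lborel. u0 x * f x) = 0"
      using borel_rep_integral(1)[OF _ borel_rep_mult[OF u(1) borel_rep_test_function(1)[OF fU]]]
      by (simp add: lebesgue_on_UNIV_eq)
  qed
  obtain \<V> where \<V>: "\<V> \<subseteq> \<U>" "countable \<V>" "\<Union>\<V> = \<Union>\<U>"
    using Lindelof[of \<U>] unfolding \<U>_def by blast
  have "AE x in lborel. \<forall>U\<in>\<V>. x \<in> U \<longrightarrow> u0 x = 0"
    using loc \<V>(1,2) by (subst AE_ball_countable) auto
  then show ?thesis
  proof eventually_elim
    case (elim x)
    have "- S \<subseteq> \<Union>\<V>" using S unfolding dist_support_def \<U>_def[symmetric] \<V>(3) by blast
    then show ?case using elim by blast
  qed
qed

text \<open>The Sobolev condition provides the density only in the sense of distributions. As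
  \<open>u1\<close> is integrable, its transform is a bounded function, and testing identifies the
  weighted transform with the density almost everywhere.\<close>

lemma sobolev_fourier_density:
  fixes u :: "'a::euclidean_space \<Rightarrow> real"
  assumes u: "borel_rep UNIV u u1" "integrable lborel u1"
    and T: "regular_dist (\<lambda>x. complex_of_real (u x)) \<in> sobolev_space s"
  obtains g where "sq_int g" "AE \<xi> in lborel. (1 + (norm \<xi>)\<^sup>2) powr (s / 2) *\<^sub>R ft u1 \<xi> = g \<xi>"
proof -
  define m where "m \<xi> = (1 + (norm \<xi>)\<^sup>2) powr (s / 2)" for \<xi> :: 'a
  have pos: "1 + (norm \<xi>)\<^sup>2 \<noteq> 0" for \<xi> :: 'a using zero_le_power2[of "norm \<xi>"] by linarith
  have cm: "continuous_on UNIV m" unfolding m_def by (intro continuous_intros) (simp add: pos)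
  have [measurable]: "m \<in> borel_measurable borel" by (rule borel_measurable_continuous_onI[OF cm])
  have [measurable]: "u1 \<in> borel_measurable borel" using u(1) by (simp add: borel_rep_def)
  obtain G where G: "G \<in> L2 lebesgue" and eqG: "\<And>f. f \<in> schwartz \<Longrightarrow>
      dist_mult m (dist_fourier (regular_dist (\<lambda>x. complex_of_real (u x)))) f = regular_dist G f"
    using T unfolding sobolev_space_def m_def by blast
  have B: "UNIV \<in> sets borel" by simp
  obtain g where g: "borel_rep UNIV G g" "sq_int g" using G by (metis L2_borel_rep[OF B] lebesgue_on_UNIV_eq)
  have test: "(LINT \<xi>|lborel. \<psi> \<xi> *\<^sub>R (m \<xi> *\<^sub>R ft u1 \<xi>)) = (LINT \<xi>|lborel. \<psi> \<xi> *\<^sub>R g \<xi>)" if \<psi>: "\<psi> \<in> test_functions UNIV" for \<psi>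
  proof -
    obtain K where K: "smooth \<psi>" "compact K" "K \<subseteq> UNIV" "\<And>x. x \<notin> K \<Longrightarrow> \<psi> x = 0" using \<psi> by (rule test_functionsE) blast
    \<comment> \<open>Multiplication and transform act on the argument of the distribution, so the
      weight is absorbed into the test function before the transform is taken.\<close>
    let ?h = "\<lambda>x. m x * \<psi> x"
    have ch: "continuous_on UNIV ?h" by (intro continuous_intros cm smooth_continuous K(1))
    have ih: "integrable lborel ?h" by (rule integrable_compact_support[OF ch K(2)]) (simp add: K(4))
    have [measurable]: "?h \<in> borel_measurable borel" by (rule borel_measurable_continuous_onI[OF ch])
    have fh: "ft ?h \<in> borel_measurable borel" by measurable
    have rf: "borel_rep UNIV (ft ?h) (ft ?h)"
      using fh by (simp add: borel_rep_def lebesgue_on_UNIV_eq measurable_completion)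
    have "regular_dist (\<lambda>x. complex_of_real (u x)) (fourier (\<lambda>x. complex_of_real (?h x))) = regular_dist G (\<lambda>x. complex_of_real (\<psi> x))"
      using eqG[OF test_function_of_real(2)[OF \<psi>]] by (simp add: dist_mult_def dist_fourier_def)
    then have "(LINT x|lebesgue_on UNIV. u x *\<^sub>R ft ?h x) = (LINT x|lebesgue_on UNIV. \<psi> x *\<^sub>R G x)"
      unfolding fourier_of_real[OF \<open>?h \<in> borel_measurable borel\<close>] regular_dist_def
      by (simp add: lebesgue_on_UNIV_eq scaleR_conv_of_real mult.commute)
    then have "(LINT x|lborel. u1 x *\<^sub>R ft ?h x) = (LINT x|lborel. \<psi> x *\<^sub>R g x)"
      unfolding borel_rep_integral(1)[OF B borel_rep_scaleR[OF u(1) rf]]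
        borel_rep_integral(1)[OF B borel_rep_scaleR[OF borel_rep_test_function(1)[OF \<psi>] g(1)]] .
    then show ?thesis unfolding ft_swap[OF u(2) ih] by (simp add: mult.commute)
  qed
  have "AE \<xi> in lborel. m \<xi> *\<^sub>R ft u1 \<xi> = g \<xi>"
  proof (rule AE_eq_inner_Basis)
    fix b :: complex assume "b \<in> Basis"
    have gs: "sq_int (\<lambda>\<xi>. g \<xi> \<bullet> b)" by (rule sq_int_inner_const[OF g(2)])
    have [measurable]: "(\<lambda>\<xi>. g \<xi> \<bullet> b) \<in> borel_measurable borel" using gs by (rule sq_int_measurable)
    define M where "M = (2 * pi) powr (- real DIM('a) / 2) * (LINT x|lborel. \<bar>u1 x\<bar>)"
    \<comment> \<open>The weight grows and the transform is merely bounded, so integrability is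
      established only against bounded functions of compact support.\<close>
    have mloc: "integrable lborel (\<lambda>\<xi>. c \<xi> *\<^sub>R (m \<xi> *\<^sub>R ft u1 \<xi>))"
      if c: "c \<in> borel_measurable borel" and K: "compact K" "\<And>x. x \<notin> K \<Longrightarrow> c x = 0" and C: "\<And>x. \<bar>c x\<bar> \<le> C" for c :: "'a \<Rightarrow> real" and K C
    proof -
      have "bounded (m ` K)" using K(1) by (intro compact_imp_bounded compact_continuous_image continuous_on_subset[OF cm]) auto
      then obtain A where A: "\<And>x. x \<in> K \<Longrightarrow> \<bar>m x\<bar> \<le> A" unfolding bounded_iff by auto
      have [measurable]: "c \<in> borel_measurable borel" by fact
      show ?thesis
      proof (rule integrable_bounded_support[OF _ _ compact_imp_bounded[OF K(1)]])
        show "(\<lambda>\<xi>. c \<xi> *\<^sub>R (m \<xi> *\<^sub>R ft u1 \<xi>)) \<in> borel_measurable borel" by measurable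
        show "norm (c x *\<^sub>R (m x *\<^sub>R ft u1 x)) \<le> \<bar>C\<bar> * (\<bar>A\<bar> * \<bar>M\<bar>)" for x
        proof (cases "x \<in> K")
          case True
          have "\<bar>c x\<bar> \<le> \<bar>C\<bar>" "\<bar>m x\<bar> \<le> \<bar>A\<bar>" "norm (ft u1 x) \<le> \<bar>M\<bar>"
            using C[of x] A[OF True] ft_bound[OF u(2), of x] unfolding M_def by linarith+
          then show ?thesis unfolding norm_scaleR by (intro mult_mono) auto
        qed (simp add: K(2))
      qed (simp add: K(2))
    qed
    have "AE \<xi> in lborel. \<xi> \<in> UNIV \<longrightarrow> (m \<xi> *\<^sub>R ft u1 \<xi>) \<bullet> b - g \<xi> \<bullet> b = 0"
    proof (rule fundamental_lemma)
      show "(\<lambda>\<xi>. (m \<xi> *\<^sub>R ft u1 \<xi>) \<bullet> b - g \<xi> \<bullet> b) \<in> borel_measurable borel" by measurable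
      show "set_integrable lborel K (\<lambda>\<xi>. (m \<xi> *\<^sub>R ft u1 \<xi>) \<bullet> b - g \<xi> \<bullet> b)" if K: "compact K" for K
      proof (rule set_integral_diff(1))
        have "integrable lborel (\<lambda>\<xi>. indicator K \<xi> *\<^sub>R (m \<xi> *\<^sub>R ft u1 \<xi>))"
          by (rule mloc[OF borel_measurable_indicator[OF borel_compact[OF K]] K, of 1]) (auto simp: indicator_def)
        then have "integrable lborel (\<lambda>\<xi>. (indicator K \<xi> *\<^sub>R (m \<xi> *\<^sub>R ft u1 \<xi>)) \<bullet> b)" by (rule integrable_inner_left)
        then show "set_integrable lborel K (\<lambda>\<xi>. (m \<xi> *\<^sub>R ft u1 \<xi>) \<bullet> b)" by (simp add: set_integrable_def mult.assoc)
        show "set_integrable lborel K (\<lambda>\<xi>. g \<xi> \<bullet> b)" by (rule sq_int_set_integrable[OF gs K])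
      qed
      fix \<psi> :: "'a \<Rightarrow> real" assume \<psi>: "\<psi> \<in> test_functions UNIV"
      obtain K where K: "smooth \<psi>" "compact K" "K \<subseteq> UNIV" "\<And>x. x \<notin> K \<Longrightarrow> \<psi> x = 0" using \<psi> by (rule test_functionsE) blast
      obtain C where C: "\<And>x. \<bar>\<psi> x\<bar> \<le> C"
        using zero_outside_uniformly_continuous(2)[OF smooth_continuous[OF K(1)] K(2,4)] unfolding bounded_iff by auto
      note \<psi>s = test_function_sq_int(1)[OF \<psi>]
      have i1: "integrable lborel (\<lambda>\<xi>. \<psi> \<xi> *\<^sub>R (m \<xi> *\<^sub>R ft u1 \<xi>))"
        by (rule mloc[OF sq_int_measurable[OF \<psi>s] K(2,4) C])
      have i2: "integrable lborel (\<lambda>\<xi>. \<psi> \<xi> *\<^sub>R g \<xi>)"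
        by (rule Bochner_Integration.integrable_bound[OF sq_int_norm_mult[OF \<psi>s g(2)]]) (use \<psi>s g(2) in \<open>auto simp: sq_int_def\<close>)
      have "(LINT \<xi>|lborel. (\<psi> \<xi> *\<^sub>R (m \<xi> *\<^sub>R ft u1 \<xi>)) \<bullet> b) = (LINT \<xi>|lborel. (\<psi> \<xi> *\<^sub>R g \<xi>) \<bullet> b)"
        unfolding integral_inner_left[OF i1] integral_inner_left[OF i2] test[OF \<psi>] ..
      then have "(LINT \<xi>|lborel. (\<psi> \<xi> *\<^sub>R (m \<xi> *\<^sub>R ft u1 \<xi>)) \<bullet> b - (\<psi> \<xi> *\<^sub>R g \<xi>) \<bullet> b) = 0"
        using integrable_inner_left[OF i1, of b] integrable_inner_left[OF i2, of b] by (simp only: Bochner_Integration.integral_diff diff_self)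
      then show "(LINT \<xi>|lborel. ((m \<xi> *\<^sub>R ft u1 \<xi>) \<bullet> b - g \<xi> \<bullet> b) * \<psi> \<xi>) = 0" by (simp add: algebra_simps)
    qed simp
    then show "AE \<xi> in lborel. (m \<xi> *\<^sub>R ft u1 \<xi>) \<bullet> b = g \<xi> \<bullet> b" by eventually_elim simp
  qed
  then show ?thesis using that[OF g(2)] by (simp add: m_def)
qed

text \<open>Cutting off outside the closure of \<Omega> changes \<open>u\<close> only on a null set.
  The representative is integrable because \<Omega> is bounded, so its transform is an ordinary
  integral to which the density applies.\<close>

theorem tilde_sobolev_fourier:
  fixes u :: "'a::euclidean_space \<Rightarrow> real"
  assumes \<Omega>: "bounded \<Omega>" and s: "1 \<le> s" and u: "u \<in> tilde_sobolev_space s \<Omega>"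
  obtains u1 where "borel_rep UNIV u u1" "sq_int u1" "\<And>x. x \<notin> closure \<Omega> \<Longrightarrow> u1 x = 0"
    "sq_int (ftg u1)" "(\<integral>\<^sup>+\<xi>. ennreal (norm \<xi> powr (2 * s) * (norm (ft u1 \<xi>))\<^sup>2) \<partial>lborel) \<noteq> \<infinity>"
proof -
  have B: "UNIV \<in> sets borel" by simp
  have "u \<in> L2 (lebesgue_on UNIV)" using u by (simp add: tilde_sobolev_space_def lebesgue_on_UNIV_eq)
  then obtain u0 where u0: "borel_rep UNIV u u0" "sq_int u0" by (rule L2_borel_rep[OF B])
  have [measurable]: "u0 \<in> borel_measurable borel" using u0(2) by (rule sq_int_measurable)
  define u1 where "u1 x = indicator (closure \<Omega>) x * u0 x" for x
  have m1[measurable]: "u1 \<in> borel_measurable borel" unfolding u1_def by measurable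
  have s1: "sq_int u1" by (rule sq_int_dominated[OF m1 u0(2), of 1]) (auto simp: u1_def indicator_def)
  have out: "\<And>x. x \<notin> closure \<Omega> \<Longrightarrow> u1 x = 0" by (simp add: u1_def)
  have "AE x in lborel. x \<notin> closure \<Omega> \<longrightarrow> u0 x = 0"
    using u by (intro dist_support_zero_outside[OF u0]) (simp add: tilde_sobolev_space_def)
  then have "AE x in lborel. u0 x = u1 x" by eventually_elim (auto simp: u1_def indicator_def)
  then have r1: "borel_rep UNIV u u1" by (intro borel_rep_cong[OF u0(1) m1 _ B]) auto
  have i1: "integrable lborel u1" by (rule sq_int_integrable_bounded[OF s1 bounded_closure[OF \<Omega>]]) (simp add: out)
  obtain g where g: "sq_int g" "AE \<xi> in lborel. (1 + (norm \<xi>)\<^sup>2) powr (s / 2) *\<^sub>R ft u1 \<xi> = g \<xi>"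
    using sobolev_fourier_density[OF r1 i1] u unfolding tilde_sobolev_space_def by blast
  have eq: "(norm (g \<xi>))\<^sup>2 = (1 + (norm \<xi>)\<^sup>2) powr s * (norm (ft u1 \<xi>))\<^sup>2"
    if "(1 + (norm \<xi>)\<^sup>2) powr (s / 2) *\<^sub>R ft u1 \<xi> = g \<xi>" for \<xi>
  proof -
    have "((1 + (norm \<xi>)\<^sup>2) powr (s / 2))\<^sup>2 = (1 + (norm \<xi>)\<^sup>2) powr s"
      by (simp add: power2_eq_square flip: powr_add)
    then show ?thesis by (simp add: power_mult_distrib flip: that)
  qed
  have "sq_int (ftg u1)"
  proof (rule sq_int_bound[OF _ sq_int_integrable[OF g(1)]])
    show "AE \<xi> in lborel. (norm (ftg u1 \<xi>))\<^sup>2 \<le> (norm (g \<xi>))\<^sup>2"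
      using g(2)
    proof eventually_elim
      case (elim \<xi>)
      have "(norm \<xi>)\<^sup>2 \<le> (1 + (norm \<xi>)\<^sup>2) powr 1" by simp
      also have "\<dots> \<le> (1 + (norm \<xi>)\<^sup>2) powr s" using s by (intro powr_mono) auto
      finally show ?case unfolding eq[OF elim] by (simp add: ftg_def power_mult_distrib mult_right_mono)
    qed
  qed measurable
  moreover have "(\<integral>\<^sup>+\<xi>. ennreal (norm \<xi> powr (2 * s) * (norm (ft u1 \<xi>))\<^sup>2) \<partial>lborel) \<le> (\<integral>\<^sup>+\<xi>. ennreal ((norm (g \<xi>))\<^sup>2) \<partial>lborel)"
  proof (rule nn_integral_mono_AE)
    show "AE \<xi> in lborel. ennreal (norm \<xi> powr (2 * s) * (norm (ft u1 \<xi>))\<^sup>2) \<le> ennreal ((norm (g \<xi>))\<^sup>2)"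
      using g(2)
    proof eventually_elim
      case (elim \<xi>)
      have "norm \<xi> powr (2 * s) = ((norm \<xi>)\<^sup>2) powr s"
        by (simp add: power2_eq_square powr_mult flip: powr_add)
      also have "\<dots> \<le> (1 + (norm \<xi>)\<^sup>2) powr s" using s by (intro powr_mono2) auto
      finally show ?case unfolding eq[OF elim] by (intro ennreal_leI mult_right_mono) auto
    qed
  qed
  moreover have "(\<integral>\<^sup>+\<xi>. ennreal ((norm (g \<xi>))\<^sup>2) \<partial>lborel) < \<infinity>"
    using sq_int_integrable[OF g(1)] by (simp add: integrable_iff_bounded)
  ultimately show ?thesis by (intro that[OF r1 s1 out]) auto
qed

theorem corollary3:
  fixes \<Omega> :: "(real ^ 'n) set"
    and s :: real
    and ev :: "nat \<Rightarrow> real"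
    and \<phi> :: "nat \<Rightarrow> real ^ 'n \<Rightarrow> real"
    and u :: "real ^ 'n \<Rightarrow> real"
  assumes "bounded_domain \<Omega>" and "strictly_lipschitz \<Omega>"
    and "1 < s" and "s < 3 / 2"
    and "dirichlet_eigensystem \<Omega> ev \<phi>"
    and "u \<in> tilde_sobolev_space s \<Omega>"
    and "sign_changing \<Omega> u"
  shows "Q_DSp \<Omega> ev \<phi> s u < Q_DSp \<Omega> ev \<phi> s (\<lambda>x. \<bar>u x\<bar>)"
proof -
  obtain \<phi>' G where \<phi>': "\<And>j. borel_rep \<Omega> (\<phi> j) (\<phi>' j)" and form: "dirichlet_form \<Omega> ev \<phi>' G"
    using dirichlet_eigensystem_form[OF assms(1,5)] by blast
  interpret dirichlet_form \<Omega> ev \<phi>' G by (rule form)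
  have \<Omega>b: "\<Omega> \<in> sets borel" using \<Omega>(1) by auto
  have s1: "1 \<le> s" using assms(3) by simp
  obtain u1 where r: "borel_rep UNIV u u1" and u1: "sq_int u1" "\<And>x. x \<notin> closure \<Omega> \<Longrightarrow> u1 x = 0" "sq_int (ftg u1)"
    and fin: "(\<integral>\<^sup>+\<xi>. ennreal (norm \<xi> powr (2 * s) * (norm (ft u1 \<xi>))\<^sup>2) \<partial>lborel) \<noteq> \<infinity>"
    using tilde_sobolev_fourier[OF \<Omega>(3) s1 assms(6)] by blast
  obtain U where U: "h10 \<Omega> u1 U" by (rule h10_if_fourier[OF assms(2) u1])
  have ae: "AE x in lborel. u x = u1 x" using r by (simp add: borel_rep_def AE_lebesgue_on_iff)
  have [measurable]: "u1 \<in> borel_measurable borel" using u1(1) by (rule sq_int_measurable)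
  have um: "u \<in> borel_measurable lebesgue" using r by (simp add: borel_rep_def lebesgue_on_UNIV_eq)
  \<comment> \<open>A general continuous \<open>H\<close> covers the identity and the absolute value
    at once.\<close>
  have coef_eq: "L2_inner (lebesgue_on \<Omega>) (\<lambda>x. H (u x)) (\<phi> j) = coef (\<lambda>x. H (u1 x)) j"
    if H: "continuous_on UNIV H" for H :: "real \<Rightarrow> real" and j
  proof -
    have Hm: "H \<in> borel_measurable borel" by (rule borel_measurable_continuous_onI[OF H])
    have "borel_rep \<Omega> (\<lambda>x. H (u x)) (\<lambda>x. indicator \<Omega> x * H (u1 x))"
      unfolding borel_rep_def AE_lebesgue_on_iff[OF \<Omega>b]
    proof (intro conjI)
      show "(\<lambda>x. H (u x)) \<in> borel_measurable (lebesgue_on \<Omega>)"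
        by (rule measurable_restrict_space1[OF measurable_compose[OF um Hm]])
      have "(\<lambda>x. H (u1 x)) \<in> borel_measurable borel" by (rule measurable_compose[OF \<open>u1 \<in> _\<close> Hm])
      then show "(\<lambda>x. indicator \<Omega> x * H (u1 x)) \<in> borel_measurable borel" using \<Omega>b by measurable
    qed (use ae in \<open>auto elim!: eventually_mono\<close>)
    from borel_rep_integral(1)[OF \<Omega>b borel_rep_mult[OF this \<phi>']]
    have "L2_inner (lebesgue_on \<Omega>) (\<lambda>x. H (u x)) (\<phi> j) = (LINT x|lborel. indicator \<Omega> x * H (u1 x) * \<phi>' j x)"
      by (simp add: L2_inner_def)
    also have "\<dots> = coef (\<lambda>x. H (u1 x)) j"
      unfolding coef_def using \<phi>'[of j] by (intro Bochner_Integration.integral_cong) (auto simp: indicator_def borel_rep_def)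
    finally show ?thesis .
  qed
  have Q: "Q_DSp \<Omega> ev \<phi> s (\<lambda>x. H (u x)) = spectral s (\<lambda>x. H (u1 x))" if "continuous_on UNIV H" for H
    unfolding Q_DSp_def spectral_def coef_eq[OF that] ..
  have sc: "\<not> (AE x in lborel. \<bar>u1 x\<bar> + u1 x = 0)" "\<not> (AE x in lborel. \<bar>u1 x\<bar> - u1 x = 0)"
  proof -
    have "AE x in lebesgue_on \<Omega>. pos_part u x = 0" if "AE x in lborel. \<bar>u1 x\<bar> + u1 x = 0"
      unfolding AE_lebesgue_on_iff[OF \<Omega>b] using that ae by eventually_elim (simp add: pos_part_def)
    moreover have "AE x in lebesgue_on \<Omega>. neg_part u x = 0" if "AE x in lborel. \<bar>u1 x\<bar> - u1 x = 0"
      unfolding AE_lebesgue_on_iff[OF \<Omega>b] using that ae by eventually_elim (simp add: neg_part_def)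
    ultimately show "\<not> (AE x in lborel. \<bar>u1 x\<bar> + u1 x = 0)" "\<not> (AE x in lborel. \<bar>u1 x\<bar> - u1 x = 0)"
      using assms(7) by (auto simp: sign_changing_def)
  qed
  have "spectral s u1 < spectral s (\<lambda>x. \<bar>u1 x\<bar>)"
    using assms(3,4) by (intro spectral_abs_less[OF _ _ U sc fin]) auto
  moreover have "continuous_on UNIV (\<lambda>x::real. \<bar>x\<bar>)" by (intro continuous_intros)
  ultimately show ?thesis using Q[OF continuous_on_id] Q[of "\<lambda>x. \<bar>x\<bar>"] by simp
qed

end
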